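(* Let $\{\mathbf{S}_N\}_{N\ge1}$ be the vectors of sample inclusion indicators of a sequence of measurable Poisson sampling designs with first order inclusion probabilities $$\pi_{i,N}=\min\left\{c_N\frac{w(X_i)}{\sum_{j=1}^Nw(X_j)};1\right\},\quad i=1,\dots,N,$$ where $w:\mathcal{X}\to(0,\infty)$ and $c_N=c_N(X_1,\dots,X_N)>0$ is such that $\sum_{i=1}^N\pi_{i,N}=n_N$, with $n_N=n_N(X_1,\dots,X_N)\in[0,N]$ the expected sample size. Let $\mathcal{F}$ be a class of measurable functions $f:\mathcal{Y}\to\mathbb{R}$ and let $\{\mathbb{G}_N''\}_{N\ge1}$ be the corresponding sequence of Hájek empirical processes. Assume: (C1) $\mathcal{F}$ contains a function $f$ with $f\equiv C$ $P_y$-almost surely for some constant $C\neq0$; (B0) $n_N:\mathcal{X}^N\to[0,N]$ is measurable and $n_N/N\to\alpha$ in probability for some constant $\alpha\in(0,1)$; (B1) $w$ is measurable and $Ew(X_1)<\infty$; (B2* ) the class $\mathcal{F}/w_\theta:=\{(y,x)\mapsto f(y)/w_\theta(x):f\in\mathcal{F}\}$ is a $P_{y,x}$-Donsker class; (B3) $\sup\{|P_{y,x}(f/w_\theta)|:f\in\mathcal{F}\}<\infty$. Here $\theta>0$ is the unique constant with $E\min\{\theta w(X_1)/Ew(X_1);1\}=\alpha$ and $w_\theta(x):=\min\{w(x),Ew(X_1)/\theta\}$. Let $$\Sigma''(f,g):=E\left[w_\theta(X_1)\left(\frac{Ew(X_1)}{\theta}-w_\theta(X_1)\right)\frac{[f(Y_1)-P_yf][g(Y_1)-P_yg]}{w_\theta(X_1)^2}\right],\quad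 f,g\in\mathcal{F},$$ and let $\mathbb{G}''$ be the zero-mean Gaussian process indexed by $\mathcal{F}$ with covariance function $\Sigma''$ which is a Borel measurable and tight random element of $l^\infty(\mathcal{F})$ (under these assumptions such a process exists, and it is the weak limit of $\mathbb{G}_N''$ in $l^\infty(\mathcal{F})$). Then $$\sup_{h\in BL_1(l^\infty(\mathcal{F}))}\left|E_dh(\mathbb{G}_N'')-Eh(\mathbb{G}'')\right|\to0\quad\text{in outer probability}.$$
   Context: Setting. $\mathcal{Y},\mathcal{X}$ are separable Banach spaces. The underlying probability space is the product $\prod_{i=1}^\infty(\Omega_{y,x},\mathcal{A}_{y,x},P_{y,x})\times(\Omega_d,\mathcal{A}_d,P_d)\times\prod_{i=1}^\infty(\Omega_\varepsilon,\mathcal{A}_\varepsilon,P_\varepsilon)$ with product measure $P$; outer probabilities and expectations $P^*,E^*$ refer to it. The pairs $(Y_i,X_i)$, $i\ge1$, are the coordinate projections of the first factor: they are i.i.d. with values in $\mathcal{Y}\times\mathcal{X}$ and law $P_{y,x}$; $P_y$ is the law of $Y_1$. (The third factor carries an auxiliary i.i.d. Rademacher sequence.) Write $Qf:=\int f\,dQ$, $\mathbf{Y}_N=(Y_1,\dots,Y_N)$, $\mathbf{X}_N=(X_1,\dots,X_N)$; in particular $P_{y,x}(f/w_\theta)=E[f(Y_1)/w_\theta(X_1)]$. Poisson design. $D$ is a uniform-$[0,1]$ random variable depending only on the $\Omega_d$-coordinate. For each $N$ the inclusion probabilities $\pi_{i,N}$, $i\le N$, are functions of $\mathbf{X}_N$;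 put $\mathfrak{p}_N(\mathbf{s})=\prod_{i=1}^N\pi_{i,N}^{s_i}(1-\pi_{i,N})^{1-s_i}$ for $\mathbf{s}\in\{0,1\}^N$. With a fixed enumeration $\mathbf{s}^{(1)},\dots,\mathbf{s}^{(2^N)}$ of $\{0,1\}^N$, $\mathbf{S}_N=(S_{1,N},\dots,S_{N,N}):=\mathbf{s}^{(1)}$ if $D\le\mathfrak{p}_N(\mathbf{s}^{(1)})$ and $:=\mathbf{s}^{(k)}$ if $\sum_{j<k}\mathfrak{p}_N(\mathbf{s}^{(j)})<D\le\sum_{j\le k}\mathfrak{p}_N(\mathbf{s}^{(j)})$. Thus, given $\mathbf{X}_N$, the indicators are independent Bernoulli($\pi_{i,N}$) and conditionally independent of $\mathbf{Y}_N$. The design is measurable if each $\mathfrak{p}_N(\mathbf{s})$ is a measurable function of $\mathbf{X}_N$. $E_d$ denotes expectation over $D$ with all else fixed: for any function $g$, $E_dg(\mathbf{S}_N,\mathbf{Y}_N,\mathbf{X}_N)=\sum_{\mathbf{s}}g(\mathbf{s},\mathbf{Y}_N,\mathbf{X}_N)\mathfrak{p}_N(\mathbf{s})$. Hájek empirical process: $\mathbb{G}_N''f:=\sqrt N\left(\frac1{\widehat N}\sum_{i=1}^N\frac{S_{i,N}}{\pi_{i,N}}f(Y_i)-\frac1N\sum_{i=1}^Nf(Y_i)\right)$, $f\in\mathcal{F}$, with $\widehat N:=\sum_{i=1}^NS_{i,N}/\pi_{i,N}$ (when $\widehat N=0$ this is undefined; set it to $0$ by convention). $l^\infty(\mathcal{F})$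 is the space of bounded functions $z:\mathcal{F}\to\mathbb{R}$ with norm $\|z\|_{\mathcal{F}}=\sup_{f\in\mathcal{F}}|z(f)|$. $BL_1(l^\infty(\mathcal{F}))$ is the set of all $h:l^\infty(\mathcal{F})\to[0,1]$ with $|h(z_1)-h(z_2)|\le\|z_1-z_2\|_{\mathcal{F}}$ for all $z_1,z_2$. $T_N\to0$ in outer probability means $P^*\{|T_N|>\epsilon\}\to0$ for every $\epsilon>0$. A class $\mathcal{H}$ of measurable functions is $Q$-Donsker (usual sense) if $\sup_{f\in\mathcal{H}}|f(z)-Qf|<\infty$ for every $z$ and, for $Z_1,Z_2,\dots$ i.i.d. with law $Q$ (coordinate projections), the processes $f\mapsto N^{-1/2}\sum_{i=1}^N(f(Z_i)-Qf)$ converge weakly (in the sense $E^*h(\cdot)\to Eh(\cdot)$ for bounded continuous $h$) in $l^\infty(\mathcal{H})$ to a tight Borel measurable random element. *)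

theory Defs
  imports "HOL-Probability.Probability"
begin

section \<open>Random elements of the space of bounded functions\<close>

text \<open>
  The space of bounded real functions on an index set \<open>F\<close>, with the supremum distance, is the
  library's metric space of bounded functions.  Its elements are functions on the whole type that
  take the value \<open>undefined\<close> outside \<open>F\<close>; processes are therefore
  written with \<open>restrict\<close>.
\<close>

abbreviation linf :: "'f set \<Rightarrow> ('f \<Rightarrow> real) metric" where
  "linf F \<equiv> funspace F euclidean_metric"

definition linf_borel :: "'f set \<Rightarrow> ('f \<Rightarrow> real) measure" where
  "linf_borel F = sigma (mspace (linf F)) {U. openin (mtopology_of (linf F)) U}"

definition tight_borel_element :: "'a measure \<Rightarrow> 'f set \<Rightarrow> ('a \<Rightarrow> 'f \<Rightarrow> real) \<Rightarrow> bool" where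
  "tight_borel_element M F G \<longleftrightarrow>
     G \<in> measurable M (linf_borel F) \<and>
     (\<forall>\<epsilon>>0. \<exists>K. compactin (mtopology_of (linf F)) K \<and>
            measure M {\<omega> \<in> space M. G \<omega> \<in> K} \<ge> 1 - \<epsilon>)"

text \<open>
  \<open>h\<close> is only constrained on the elements of \<open>linf F\<close>; its values elsewhere are irrelevant.
\<close>

definition BL1 :: "'f set \<Rightarrow> (('f \<Rightarrow> real) \<Rightarrow> real) set" where
  "BL1 F = {h. (\<forall>z \<in> mspace (linf F). 0 \<le> h z \<and> h z \<le> 1) \<and>
               (\<forall>z1 \<in> mspace (linf F). \<forall>z2 \<in> mspace (linf F).
                  \<bar>h z1 - h z2\<bar> \<le> mdist (linf F) z1 z2)}"

section \<open>Outer expectation, outer probability, weak convergence, Donsker classes\<close>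

text \<open>
  Outer expectation of a bounded function.  For bounded \<open>T\<close> the infimum over integrable
  real majorants agrees with the one over extended real measurable majorants whose
  expectation exists.
\<close>

definition outer_expectation :: "'a measure \<Rightarrow> ('a \<Rightarrow> real) \<Rightarrow> real" where
  "outer_expectation M T =
     Inf {integral\<^sup>L M U | U. integrable M U \<and> (\<forall>\<omega> \<in> space M. T \<omega> \<le> U \<omega>)}"

definition tendsto_zero_outer_prob :: "'a measure \<Rightarrow> (nat \<Rightarrow> 'a \<Rightarrow> real) \<Rightarrow> bool" where
  "tendsto_zero_outer_prob M T \<longleftrightarrow>
     (\<forall>\<epsilon>>0. (\<lambda>N. outer_measure_of M {\<omega> \<in> space M. \<bar>T N \<omega>\<bar> > \<epsilon>}) \<longlonglongrightarrow> 0)"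

definition weakly_converges_linf ::
  "'a measure \<Rightarrow> 'f set \<Rightarrow> (nat \<Rightarrow> 'a \<Rightarrow> 'f \<Rightarrow> real) \<Rightarrow> 'b measure \<Rightarrow> ('b \<Rightarrow> 'f \<Rightarrow> real) \<Rightarrow> bool"
  where
  "weakly_converges_linf M F Z L G \<longleftrightarrow>
     (\<forall>h. continuous_map (mtopology_of (linf F)) euclideanreal h \<and>
          bounded (h ` mspace (linf F)) \<longrightarrow>
          (\<lambda>N. outer_expectation M (\<lambda>\<omega>. h (Z N \<omega>))) \<longlonglongrightarrow> (\<integral>\<omega>. h (G \<omega>) \<partial>L))"

definition empirical_process ::
  "'z measure \<Rightarrow> ('z \<Rightarrow> real) set \<Rightarrow> nat \<Rightarrow> (nat \<Rightarrow> 'z) \<Rightarrow> ('z \<Rightarrow> real) \<Rightarrow> real" where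
  "empirical_process Q H N z =
     restrict (\<lambda>f. (\<Sum>i<N. f (z i) - integral\<^sup>L Q f) / sqrt (real N)) H"

text \<open>
  The limit is represented by its law \<open>L\<close>, i.e. by the identity on the probability space
  carried by \<open>linf_borel H\<close>.
\<close>

definition Donsker :: "'z measure \<Rightarrow> ('z \<Rightarrow> real) set \<Rightarrow> bool" where
  "Donsker Q H \<longleftrightarrow>
     (\<forall>f\<in>H. integrable Q f) \<and>
     (\<forall>z \<in> space Q. bdd_above ((\<lambda>f. \<bar>f z - integral\<^sup>L Q f\<bar>) ` H)) \<and>
     (\<exists>L. prob_space L \<and> sets L = sets (linf_borel H) \<and>
          tight_borel_element L H (\<lambda>z. z) \<and>
          weakly_converges_linf (\<Pi>\<^sub>M i\<in>(UNIV :: nat set). Q) H (empirical_process Q H) L (\<lambda>z. z))"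

section \<open>Gaussian processes\<close>

text \<open>Point masses count as (degenerate) normal laws.\<close>

definition normal_rv :: "'a measure \<Rightarrow> ('a \<Rightarrow> real) \<Rightarrow> bool" where
  "normal_rv M X \<longleftrightarrow>
     X \<in> borel_measurable M \<and>
     ((\<exists>m. distr M borel X = return borel m) \<or>
      (\<exists>m. \<exists>\<sigma>>0. distributed M lborel X (normal_density m \<sigma>)))"

definition centered_gaussian_process ::
  "'a measure \<Rightarrow> 'f set \<Rightarrow> ('f \<Rightarrow> 'f \<Rightarrow> real) \<Rightarrow> ('a \<Rightarrow> 'f \<Rightarrow> real) \<Rightarrow> bool" where
  "centered_gaussian_process M F K G \<longleftrightarrow>
     (\<forall>A a. finite A \<and> A \<subseteq> F \<longrightarrow> normal_rv M (\<lambda>\<omega>. \<Sum>f\<in>A. a f * G \<omega> f)) \<and>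
     (\<forall>f\<in>F. (\<integral>\<omega>. G \<omega> f \<partial>M) = 0) \<and>
     (\<forall>f\<in>F. \<forall>g\<in>F. (\<integral>\<omega>. G \<omega> f * G \<omega> g \<partial>M) = K f g)"

section \<open>The sampling model\<close>

text \<open>
  Population units are numbered from 0, so that \<open>{..<N}\<close> is the population of size \<open>N\<close>.
  Functions of \<open>X\<^sub>1,\<dots>,X\<^sub>N\<close> are functions on \<open>{..<N} \<rightarrow>\<^sub>E UNIV\<close>.
\<close>

type_synonym ('y, 'x, 'd, 'e) omega = "(nat \<Rightarrow> 'y \<times> 'x) \<times> 'd \<times> (nat \<Rightarrow> 'e)"

definition model_space ::
  "('y \<times> 'x) measure \<Rightarrow> 'd measure \<Rightarrow> 'e measure \<Rightarrow> ('y, 'x, 'd, 'e) omega measure" where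
  "model_space Pyx Pd Pe =
     (\<Pi>\<^sub>M i\<in>(UNIV :: nat set). Pyx) \<Otimes>\<^sub>M (Pd \<Otimes>\<^sub>M (\<Pi>\<^sub>M i\<in>(UNIV :: nat set). Pe))"

definition Yvec :: "nat \<Rightarrow> ('y, 'x, 'd, 'e) omega \<Rightarrow> nat \<Rightarrow> 'y" where
  "Yvec N \<omega> = restrict (\<lambda>i. fst (fst \<omega> i)) {..<N}"

definition Xvec :: "nat \<Rightarrow> ('y, 'x, 'd, 'e) omega \<Rightarrow> nat \<Rightarrow> 'x" where
  "Xvec N \<omega> = restrict (\<lambda>i. snd (fst \<omega> i)) {..<N}"

definition incl_prob ::
  "('x \<Rightarrow> real) \<Rightarrow> (nat \<Rightarrow> (nat \<Rightarrow> 'x) \<Rightarrow> real) \<Rightarrow> nat \<Rightarrow> (nat \<Rightarrow> 'x) \<Rightarrow> nat \<Rightarrow> real" where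
  "incl_prob w c N x i = min (c N x * (w (x i) / (\<Sum>j<N. w (x j)))) 1"

definition poisson_prob ::
  "(nat \<Rightarrow> (nat \<Rightarrow> 'x) \<Rightarrow> nat \<Rightarrow> real) \<Rightarrow> nat \<Rightarrow> (nat \<Rightarrow> 'x) \<Rightarrow> (nat \<Rightarrow> nat) \<Rightarrow> real" where
  "poisson_prob \<pi> N x s = (\<Prod>i<N. \<pi> N x i ^ s i * (1 - \<pi> N x i) ^ (1 - s i))"

definition measurable_design ::
  "(nat \<Rightarrow> (nat \<Rightarrow> 'x::topological_space) \<Rightarrow> nat \<Rightarrow> real) \<Rightarrow> bool" where
  "measurable_design \<pi> \<longleftrightarrow>
     (\<forall>N\<ge>1. \<forall>s \<in> {..<N} \<rightarrow>\<^sub>E {0, 1}.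
        (\<lambda>x. poisson_prob \<pi> N x s) \<in> borel_measurable (\<Pi>\<^sub>M i\<in>{..<N}. borel))"

text \<open>
  \<open>enum N\<close> enumerates \<open>{0,1}\<^sup>N\<close>, with indices \<open>0, \<dots>, 2\<^sup>N - 1\<close>, and \<open>u\<close> is the value of the
  uniform random variable.
\<close>

definition sample_select ::
  "(nat \<Rightarrow> (nat \<Rightarrow> 'x) \<Rightarrow> nat \<Rightarrow> real) \<Rightarrow> (nat \<Rightarrow> nat \<Rightarrow> nat \<Rightarrow> nat) \<Rightarrow>
   nat \<Rightarrow> (nat \<Rightarrow> 'x) \<Rightarrow> real \<Rightarrow> nat \<Rightarrow> nat" where
  "sample_select \<pi> enum N x u =
     enum N (THE k. k < 2 ^ N \<and>
                    (k = 0 \<or> (\<Sum>j<k. poisson_prob \<pi> N x (enum N j)) < u) \<and>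
                    u \<le> (\<Sum>j\<le>k. poisson_prob \<pi> N x (enum N j)))"

definition Svec ::
  "(nat \<Rightarrow> (nat \<Rightarrow> 'x) \<Rightarrow> nat \<Rightarrow> real) \<Rightarrow> (nat \<Rightarrow> nat \<Rightarrow> nat \<Rightarrow> nat) \<Rightarrow> ('d \<Rightarrow> real) \<Rightarrow>
   nat \<Rightarrow> ('y, 'x, 'd, 'e) omega \<Rightarrow> nat \<Rightarrow> nat" where
  "Svec \<pi> enum D N \<omega> = sample_select \<pi> enum N (Xvec N \<omega>) (D (fst (snd \<omega>)))"

definition design_expectation ::
  "'d measure \<Rightarrow> (('y, 'x, 'd, 'e) omega \<Rightarrow> real) \<Rightarrow> ('y, 'x, 'd, 'e) omega \<Rightarrow> real" where
  "design_expectation Pd T \<omega> = (\<integral>d. T (fst \<omega>, d, snd (snd \<omega>)) \<partial>Pd)"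

definition hajek_stat ::
  "('y \<Rightarrow> real) set \<Rightarrow> nat \<Rightarrow> (nat \<Rightarrow> real) \<Rightarrow> (nat \<Rightarrow> nat) \<Rightarrow> (nat \<Rightarrow> 'y) \<Rightarrow> ('y \<Rightarrow> real) \<Rightarrow> real" where
  "hajek_stat F N p s y =
     (let Nhat = (\<Sum>i<N. real (s i) / p i) in
      restrict (\<lambda>f. if Nhat = 0 then 0
                    else sqrt (real N) * (1 / Nhat * (\<Sum>i<N. real (s i) / p i * f (y i))
                                          - 1 / real N * (\<Sum>i<N. f (y i)))) F)"

definition hajek_process ::
  "('y \<Rightarrow> real) set \<Rightarrow> (nat \<Rightarrow> (nat \<Rightarrow> 'x) \<Rightarrow> nat \<Rightarrow> real) \<Rightarrow> (nat \<Rightarrow> nat \<Rightarrow> nat \<Rightarrow> nat) \<Rightarrow>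
   ('d \<Rightarrow> real) \<Rightarrow> nat \<Rightarrow> ('y, 'x, 'd, 'e) omega \<Rightarrow> ('y \<Rightarrow> real) \<Rightarrow> real" where
  "hajek_process F \<pi> enum D N \<omega> =
     hajek_stat F N (\<pi> N (Xvec N \<omega>)) (Svec \<pi> enum D N \<omega>) (Yvec N \<omega>)"

section \<open>The design expectation as a finite sum\<close>

text \<open>
  Integrating out the uniform variable averages over the samples with weights
  \<open>poisson_prob\<close>, whichever enumeration is used.
\<close>

lemma sum_poisson_prob:
  "(\<Sum>s\<in>{..<N} \<rightarrow>\<^sub>E {0, 1}. poisson_prob \<pi> N x s) = 1"
proof -
  have "(\<Sum>s\<in>{..<N} \<rightarrow>\<^sub>E {0, 1::nat}. poisson_prob \<pi> N x s) =
        (\<Prod>i<N. \<Sum>b\<in>{0, 1}. \<pi> N x i ^ b * (1 - \<pi> N x i) ^ (1 - b))"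
    unfolding poisson_prob_def by (subst prod_sum_PiE) auto
  also have "\<dots> = 1" by simp
  finally show ?thesis .
qed

lemma expectation_sample_select:
  fixes g :: "(nat \<Rightarrow> nat) \<Rightarrow> real"
  assumes "prob_space Pd" and D: "D \<in> borel_measurable Pd" "distr Pd borel D = uniform_measure lborel {0..1}"
    and enum: "bij_betw (enum N) {..<2 ^ N} ({..<N} \<rightarrow>\<^sub>E {0, 1})"
    and \<pi>: "\<And>i. i < N \<Longrightarrow> 0 \<le> \<pi> N x i \<and> \<pi> N x i \<le> 1"
  shows "(\<integral>d. g (sample_select \<pi> enum N x (D d)) \<partial>Pd) =
         (\<Sum>s\<in>{..<N} \<rightarrow>\<^sub>E {0, 1}. g s * poisson_prob \<pi> N x s)"
proof -
  define p where "p k = poisson_prob \<pi> N x (enum N k)" for k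
  define C where "C k = (\<Sum>j<k. p j)" for k
  have p0: "p k \<ge> 0" for k
    unfolding p_def poisson_prob_def using \<pi> by (intro prod_nonneg) simp
  have mono: "C j \<le> C k" if "j \<le> k" for j k
    unfolding C_def using that p0 by (intro sum_mono2) auto
  have C0: "C 0 = 0" by (simp add: C_def)
  have C1: "C (2 ^ N) = 1"
    unfolding C_def p_def using sum.reindex_bij_betw[OF enum, of "poisson_prob \<pi> N x"] sum_poisson_prob[of \<pi> N x] by simp
  define Q where "Q u k \<longleftrightarrow> k < 2 ^ N \<and> (k = 0 \<or> C k < u) \<and> u \<le> C (Suc k)" for u k
  have sel: "sample_select \<pi> enum N x u = enum N (THE k. Q u k)" for u
    by (simp add: sample_select_def Q_def C_def p_def lessThan_Suc_atMost)
  have Quniq: "k = k'" if "Q u k" "Q u k'" for u k k'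
  proof (rule ccontr)
    assume "k \<noteq> k'"
    then consider "Suc k \<le> k'" | "Suc k' \<le> k" by linarith
    then show False using that mono[of "Suc k" k'] mono[of "Suc k'" k] by (cases; auto simp: Q_def)
  qed
  define I where "I k = {C k<..C (Suc k)}" for k
  have ind: "g (sample_select \<pi> enum N x u) =
      (\<Sum>k<2^N. g (enum N k) * indicator (I k) u) + g (enum N 0) * indicator {..0} u
        + g (sample_select \<pi> enum N x 2) * indicator {1<..} u" for u
  proof -
    consider "u \<le> 0" | "u > 1" | "0 < u" "u \<le> 1" by linarith
    then show ?thesis
    proof cases
      case 1
      have "Q u 0" using 1 mono[of 0 1] by (simp add: Q_def C0)
      then have "(THE k. Q u k) = 0" using Quniq by blast
      moreover have "indicator (I k) u = (0::real)" for k
        using 1 mono[of 0 k] C0 by (auto simp: I_def indicator_def)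
      ultimately show ?thesis using 1 by (simp add: sel)
    next
      case 2
      have no: "\<not> Q v k" if "v > 1" for v k
        using that mono[of "Suc k" "2^N"] C1 by (auto simp: Q_def)
      have "indicator (I k) u = (0::real)" if "k < 2^N" for k
        using 2 mono[of "Suc k" "2^N"] C1 that by (auto simp: I_def indicator_def)
      then show ?thesis using 2 no[of u] no[of 2] by (simp add: sel)
    next
      case 3
      define k where "k = (LEAST k. u \<le> C (Suc k))"
      have ex: "u \<le> C (Suc (2^N - 1))" using 3 C1 by simp
      have k1: "u \<le> C (Suc k)" unfolding k_def by (rule LeastI[of _ "2^N-1"]) (fact ex)
      have k2: "k \<le> 2^N - 1" unfolding k_def by (rule Least_le) (fact ex)
      have k3: "C k < u"
      proof (cases k)
        case (Suc m)
        then have "\<not> u \<le> C (Suc m)" using not_less_Least[of m "\<lambda>k. u \<le> C (Suc k)"] by (simp add: k_def)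
        then show ?thesis using Suc by simp
      qed (use 3 C0 in simp)
      have "(0::nat) < 2^N" by simp
      then have kN: "k < 2^N" using k2 by linarith
      have Qk: "Q u k" using k1 k3 kN by (simp add: Q_def)
      then have the: "(THE k. Q u k) = k" using Quniq by blast
      have "indicator (I j) u = (if j = k then 1 else 0::real)" if "j < 2^N" for j
        
      proof (cases "j = k")
        case False
        then have "\<not> Q u j" using Quniq[OF Qk] by blast
        then have "u \<notin> I j" using that unfolding Q_def I_def greaterThanAtMost_iff by blast
        then show ?thesis using False by simp
      next
        case True
        then show ?thesis using k1 k3 by (simp add: I_def)
      qed
      then have "(\<Sum>j<2^N. g (enum N j) * indicator (I j) u) = (\<Sum>j<2^N. if j = k then g (enum N j) else 0)"
        by (intro sum.cong) auto
      then show ?thesis using 3 kN by (simp add: sel the)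
    qed
  qed
  define a where "a = g (sample_select \<pi> enum N x 2)"
  note ind = ind[folded a_def]
  interpret Pd: prob_space Pd by fact
  let ?U = "uniform_measure lborel {0..1::real}"
  interpret U: prob_space ?U by (rule prob_space_uniform_measure) auto
  have setsU: "A \<in> sets ?U \<longleftrightarrow> A \<in> sets borel" for A by simp
  have mI: "I k \<in> sets borel" for k by (simp add: I_def)
  have uI: "measure ?U (I k) = p k" if "k < 2^N" for k
  proof -
    have "I k \<subseteq> {0..1}" using mono[of 0 k] mono[of "Suc k" "2^N"] C0 C1 that by (auto simp: I_def)
    then have "{0..1} \<inter> I k = {C k<..C (Suc k)}" by (auto simp: I_def)
    then show ?thesis using mono[of k "Suc k"] mI
      by (simp add: measure_uniform_measure measure_def emeasure_uniform_measure p0 divide_ennreal_def C_def)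
  qed
  have u1: "measure ?U {..0} = 0"
  proof -
    have "{0..1} \<inter> {..0} = {0::real}" by auto
    then show ?thesis by (simp add: measure_def emeasure_uniform_measure)
  qed
  have u2: "measure ?U {1<..} = 0"
  proof -
    have "{0..1} \<inter> {1<..} = ({}::real set)" by auto
    then show ?thesis by (simp add: measure_def emeasure_uniform_measure)
  qed
  have meas: "(\<lambda>u. g (sample_select \<pi> enum N x u)) \<in> borel_measurable borel"
    unfolding ind using mI by measurable
  have int: "integrable ?U (\<lambda>u. b * indicator A u)" if "A \<in> sets borel" for A and b :: real
    
    using that U.emeasure_finite[of A] unfolding top.not_eq_extremum infinity_ennreal_def
    by (intro integrable_mult_right integrable_real_indicator) simp_all
  have one: "(\<integral>u. b * indicator A u \<partial>?U) = b * measure ?U A" if "A \<in> sets borel" for A and b :: real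
    using that by (simp del: measure_uniform_measure)
  have "(\<integral>d. g (sample_select \<pi> enum N x (D d)) \<partial>Pd) = (\<integral>u. g (sample_select \<pi> enum N x u) \<partial>?U)"
    using meas D by (subst D(2)[symmetric], subst integral_distr) auto
  also have "\<dots> = (\<Sum>k<2^N. g (enum N k) * measure ?U (I k)) + g (enum N 0) * measure ?U {..0}
     + a * measure ?U {1<..}"
  proof -
    have "integrable ?U (\<lambda>u. \<Sum>k<2^N. g (enum N k) * indicator (I k) u)"
      by (intro Bochner_Integration.integrable_sum int mI)
    then show ?thesis
      unfolding ind using int[of "{..0}"] int[of "{1<..}"] one[of "{..0}"] one[of "{1<..}"]
      by (simp only: Bochner_Integration.integral_add Bochner_Integration.integrable_add
          Bochner_Integration.integral_sum int one mI borel_closed closed_atMost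
          borel_open open_greaterThan)
  qed
  also have "\<dots> = (\<Sum>k<2^N. g (enum N k) * p k)" using uI u1 u2 by simp
  also have "\<dots> = (\<Sum>s\<in>{..<N} \<rightarrow>\<^sub>E {0, 1}. g s * poisson_prob \<pi> N x s)"
    unfolding p_def using sum.reindex_bij_betw[OF enum, of "\<lambda>s. g s * poisson_prob \<pi> N x s"] by simp
  finally show ?thesis .
qed

section \<open>Moments of the weight and limiting covariance\<close>

definition mean_weight :: "('y \<times> 'x) measure \<Rightarrow> ('x \<Rightarrow> real) \<Rightarrow> real" where
  "mean_weight Pyx w = (\<integral>z. w (snd z) \<partial>Pyx)"

definition w_theta :: "('y \<times> 'x) measure \<Rightarrow> ('x \<Rightarrow> real) \<Rightarrow> real \<Rightarrow> 'x \<Rightarrow> real" where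
  "w_theta Pyx w \<theta> x = min (w x) (mean_weight Pyx w / \<theta>)"

definition weighted ::
  "('y \<times> 'x) measure \<Rightarrow> ('x \<Rightarrow> real) \<Rightarrow> real \<Rightarrow> ('y \<Rightarrow> real) \<Rightarrow> 'y \<times> 'x \<Rightarrow> real" where
  "weighted Pyx w \<theta> f = (\<lambda>(y, x). f y / w_theta Pyx w \<theta> x)"

definition Sigma_hajek ::
  "('y \<times> 'x) measure \<Rightarrow> ('x \<Rightarrow> real) \<Rightarrow> real \<Rightarrow> ('y \<Rightarrow> real) \<Rightarrow> ('y \<Rightarrow> real) \<Rightarrow> real" where
  "Sigma_hajek Pyx w \<theta> f g =
     (let Pf = (\<integral>z. f (fst z) \<partial>Pyx); Pg = (\<integral>z. g (fst z) \<partial>Pyx) in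
      \<integral>z. w_theta Pyx w \<theta> (snd z) * (mean_weight Pyx w / \<theta> - w_theta Pyx w \<theta> (snd z)) *
          ((f (fst z) - Pf) * (g (fst z) - Pg) / (w_theta Pyx w \<theta> (snd z))\<^sup>2) \<partial>Pyx)"

end

theory Submission
  imports Defs
begin

text \<open>
  Conditionally on the data, the Hajek process is a function of independent Bernoulli variables.
  The inclusion probabilities are asymptotically \<open>w\<^sub>\<theta>(X\<^sub>i) \<theta> / E w(X\<^sub>1)\<close>, because the equation that fixes
  the scale factor is an empirical version of the equation for \<open>\<theta>\<close>.  So finite-dimensional
  distributions converge by a conditional central limit theorem of Lindeberg type, uniformly over
  Lipschitz functionals, since these are approximated by trigonometric polynomials.

  Asymptotic equicontinuity is needed conditionally on the data.  The centred inclusion error of unit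
  \<open>i\<close> times \<open>w\<^sub>\<theta>(X\<^sub>i)\<close> is bounded, hence dominated in convex order by a multiple of a random sign, and
  the Donsker property bounds the signed sums over \<open>\<F>/w\<^sub>\<theta>\<close> in probability: sign patterns can be
  exchanged for index sets, and the Hoffmann-Joergensen inequality, applied with the data fixed, upgrades
  the tail bound to a mean bound.  The index set is discretized to finitely many functions, chosen so
  that the increments of the Donsker limit and of \<open>\<G>''\<close> are small.
\<close>

subsection \<open>Convergence in outer probability as a filter\<close>

text \<open>Two obstacles shape the proof. Suprema over \<open>F\<close> need not be measurable, so
  Fubini and the usual symmetrization by an independent copy are out of reach: events about the data
  are bounded in outer measure, while signs and inclusions are averaged by finite recursions at
  fixed data. Moreover the inverse inclusion probabilities are unbounded. Their limit is
  \<open>weight_cap / wt\<close>, so multiplication by \<open>wt\<close> makes the errors bounded,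
  and this is why the Donsker assumption concerns the functions divided by \<open>wt\<close>. The
  same division turns the constant function of (C1) into square integrability of
  1/\<open>wt\<close>, which controls the estimated population size in the denominator of the Hajek
  ratio. (B3) supplies boundedness of the means, which the Donsker property, being about centred
  functions, cannot see. The threshold 1/12 for Rademacher tail probabilities is dictated by the
  fourth moment inequality with constant 3; the factor 48 = 4 * 12 stems from it.\<close>

lemma outer_measure_of_Un_le:
  assumes "A \<subseteq> space M" "B \<subseteq> space M"
  shows "outer_measure_of M (A \<union> B) \<le> outer_measure_of M A + outer_measure_of M B"
proof -
  obtain E where E: "E \<in> sets M" "A \<subseteq> E" "outer_measure_of M A = emeasure M E"
    using outer_measure_of_attain[OF assms(1)] by blast
  obtain E' where E': "E' \<in> sets M" "B \<subseteq> E'" "outer_measure_of M B = emeasure M E'"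
    using outer_measure_of_attain[OF assms(2)] by blast
  have "outer_measure_of M (A \<union> B) \<le> outer_measure_of M (E \<union> E')"
    using E E' by (intro outer_measure_of_mono) auto
  also have "\<dots> = emeasure M (E \<union> E')" using E E' by simp
  also have "\<dots> \<le> emeasure M E + emeasure M E'" using E E' by (intro emeasure_subadditive)
  finally show ?thesis using E E' by simp
qed

lemma outer_measure_of_empty [simp]: "outer_measure_of M {} = 0"
  by simp

text \<open>Only this inequality holds in general: the preimage of a measurable hull of
  \<open>B\<close> covers the preimage of \<open>B\<close>, but a smaller measurable cover may
  exist. It serves for the projection of the model space onto the data and for relabelling
  coordinates.\<close>

lemma outer_measure_of_vimage_le:
  assumes T: "T \<in> measurable M M'" "distr M M' T = M'" and B: "B \<subseteq> space M'"
  shows "outer_measure_of M (T -` B \<inter> space M) \<le> outer_measure_of M' B"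
proof -
  obtain E where E: "E \<in> sets M'" "B \<subseteq> E" "outer_measure_of M' B = emeasure M' E"
    using outer_measure_of_attain[OF B] by blast
  have "outer_measure_of M (T -` B \<inter> space M) \<le> outer_measure_of M (T -` E \<inter> space M)"
    using E by (intro outer_measure_of_mono) auto
  also have "\<dots> = emeasure (distr M M' T) E" using E T(1) by (simp add: emeasure_distr measurable_sets)
  finally show ?thesis by (simp only: E(3) T(2))
qed

text \<open>A predicate on pairs (N, \<omega>) holds eventually when the outer measure of its
  failure set at stage N tends to 0; closure under conjunction is subadditivity. Convergence in
  outer probability is then ordinary convergence along this filter, so the limit calculus applies to
  nonmeasurable quantities.\<close>

definition outer_filter :: "'a measure \<Rightarrow> (nat \<times> 'a) filter" where
  "outer_filter M =
     Abs_filter (\<lambda>P. (\<lambda>N. outer_measure_of M {\<omega> \<in> space M. \<not> P (N, \<omega>)}) \<longlonglongrightarrow> 0)"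

lemma eventually_outer_filter:
  "eventually P (outer_filter M) \<longleftrightarrow> (\<lambda>N. outer_measure_of M {\<omega> \<in> space M. \<not> P (N, \<omega>)}) \<longlonglongrightarrow> 0"
  unfolding outer_filter_def
proof (rule eventually_Abs_filter, standard)
  show "(\<lambda>N. outer_measure_of M {\<omega> \<in> space M. \<not> True}) \<longlonglongrightarrow> 0" by simp
next
  fix P Q :: "nat \<times> 'a \<Rightarrow> bool"
  assume "(\<lambda>N. outer_measure_of M {\<omega> \<in> space M. \<not> P (N, \<omega>)}) \<longlonglongrightarrow> 0"
    "(\<lambda>N. outer_measure_of M {\<omega> \<in> space M. \<not> Q (N, \<omega>)}) \<longlonglongrightarrow> 0"
  then have lim: "(\<lambda>N. outer_measure_of M {\<omega> \<in> space M. \<not> P (N, \<omega>)} +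
      outer_measure_of M {\<omega> \<in> space M. \<not> Q (N, \<omega>)}) \<longlonglongrightarrow> 0"
    using tendsto_add by fastforce
  show "(\<lambda>N. outer_measure_of M {\<omega> \<in> space M. \<not> (P (N, \<omega>) \<and> Q (N, \<omega>))}) \<longlonglongrightarrow> 0"
  proof (rule tendsto_sandwich[OF _ _ tendsto_const lim])
    show "\<forall>\<^sub>F N in sequentially. outer_measure_of M {\<omega> \<in> space M. \<not> (P (N, \<omega>) \<and> Q (N, \<omega>))} \<le>
       outer_measure_of M {\<omega> \<in> space M. \<not> P (N, \<omega>)} + outer_measure_of M {\<omega> \<in> space M. \<not> Q (N, \<omega>)}"
      by (intro always_eventually allI order_trans[OF outer_measure_of_mono outer_measure_of_Un_le]) auto
  qed simp
next
  fix P Q :: "nat \<times> 'a \<Rightarrow> bool"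
  assume imp: "\<forall>x. P x \<longrightarrow> Q x" and lim: "(\<lambda>N. outer_measure_of M {\<omega> \<in> space M. \<not> P (N, \<omega>)}) \<longlonglongrightarrow> 0"
  show "(\<lambda>N. outer_measure_of M {\<omega> \<in> space M. \<not> Q (N, \<omega>)}) \<longlonglongrightarrow> 0"
    by (rule tendsto_sandwich[OF _ _ tendsto_const lim])
      (use imp in \<open>auto intro!: always_eventually outer_measure_of_mono\<close>)
qed

lemma eventually_outer_filterD:
  assumes "eventually P (outer_filter M)" "\<eta> > 0"
  shows "\<forall>\<^sub>F N in sequentially. outer_measure_of M {\<omega> \<in> space M. \<not> P (N, \<omega>)} \<le> ennreal \<eta>"
proof -
  have "\<forall>\<^sub>F N in sequentially. outer_measure_of M {\<omega> \<in> space M. \<not> P (N, \<omega>)} < ennreal \<eta>"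
    using assms unfolding eventually_outer_filter by (intro order_tendstoD) auto
  then show ?thesis by eventually_elim simp
qed

lemma eventually_outer_filterI:
  assumes "\<And>\<eta>. \<eta> > 0 \<Longrightarrow> \<forall>\<^sub>F N in sequentially. outer_measure_of M {\<omega> \<in> space M. \<not> P (N, \<omega>)} \<le> ennreal \<eta>"
  shows "eventually P (outer_filter M)"
  unfolding eventually_outer_filter
proof (rule order_tendstoI)
  fix a :: ennreal assume "0 < a"
  then obtain r where r: "r > 0" "ennreal r < a"
    by (metis ennreal_0 ennreal_less_zero_iff dense linorder_not_le ennreal_cases not_less_zero top_greatest order_less_le leD)
  show "\<forall>\<^sub>F N in sequentially. outer_measure_of M {\<omega> \<in> space M. \<not> P (N, \<omega>)} < a"
    using assms[OF r(1)] by eventually_elim (use r in simp)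
qed simp

lemma eventually_outer_filter_fst:
  assumes "\<forall>\<^sub>F N in sequentially. \<forall>\<omega> \<in> space M. P (N, \<omega>)"
  shows "eventually P (outer_filter M)"
proof (rule eventually_outer_filterI)
  fix \<eta> :: real assume "\<eta> > 0"
  show "\<forall>\<^sub>F N in sequentially. outer_measure_of M {\<omega> \<in> space M. \<not> P (N, \<omega>)} \<le> ennreal \<eta>"
    using assms
  proof eventually_elim
    case (elim N)
    then have "{\<omega> \<in> space M. \<not> P (N, \<omega>)} = {}" by auto
    then show ?case by (simp only: outer_measure_of_empty zero_le)
  qed
qed

lemma tendsto_outer_filter_fst:
  assumes "(f \<longlongrightarrow> l) sequentially"
  shows "((\<lambda>x. f (fst x)) \<longlongrightarrow> l) (outer_filter M)"
proof (rule topological_tendstoI)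
  fix S assume "open S" "l \<in> S"
  then have "\<forall>\<^sub>F N in sequentially. f N \<in> S" using assms by (rule topological_tendstoD[rotated])
  then show "\<forall>\<^sub>F x in outer_filter M. f (fst x) \<in> S"
    by (intro eventually_outer_filter_fst) (auto elim: eventually_mono)
qed

lemma tendsto_zero_outer_prob_iff:
  "(\<forall>\<epsilon>>0. (\<lambda>N. outer_measure_of M {\<omega> \<in> space M. \<bar>T N \<omega>\<bar> > \<epsilon>}) \<longlonglongrightarrow> 0) \<longleftrightarrow>
   ((\<lambda>x. T (fst x) (snd x)) \<longlongrightarrow> (0::real)) (outer_filter M)"
  (is "?L = ?R")
proof
  assume L: ?L
  show ?R
  proof (rule tendstoI)
    fix e :: real assume "e > 0"
    then have "\<forall>\<^sub>F x in outer_filter M. \<bar>T (fst x) (snd x)\<bar> \<le> e / 2"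
      using L[rule_format, of "e/2"] by (simp add: eventually_outer_filter not_le)
    then show "\<forall>\<^sub>F x in outer_filter M. dist (T (fst x) (snd x)) 0 < e"
      by eventually_elim (use \<open>e > 0\<close> in simp)
  qed
next
  assume R: ?R
  show ?L
  proof (intro allI impI)
    fix e :: real assume "e > 0"
    then have "\<forall>\<^sub>F x in outer_filter M. \<bar>T (fst x) (snd x)\<bar> \<le> e"
      using tendstoD[OF R \<open>e > 0\<close>] by (auto elim: eventually_mono)
    then show "(\<lambda>N. outer_measure_of M {\<omega> \<in> space M. \<bar>T N \<omega>\<bar> > e}) \<longlonglongrightarrow> 0"
      by (simp add: eventually_outer_filter not_le)
  qed
qed

subsection \<open>The weak law of large numbers\<close>

locale iid_sequence = Z: prob_space Q for Q :: "'z measure"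
begin

abbreviation M :: "(nat \<Rightarrow> 'z) measure" where
  "M \<equiv> \<Pi>\<^sub>M i\<in>UNIV. Q"

sublocale product_prob_space "\<lambda>_. Q" "UNIV :: nat set"
  by unfold_locales

lemma prob_space_M: "prob_space M"
  by unfold_locales

lemma space_M: "\<omega> \<in> space M \<longleftrightarrow> (\<forall>i. \<omega> i \<in> space Q)"
  by (auto simp: space_PiM PiE_def Pi_def extensional_def)

lemma distr_coord: "distr M Q (\<lambda>\<omega>. \<omega> i) = Q"
  using PiM_component[of i] by simp

lemma integrable_coord:
  fixes f :: "'z \<Rightarrow> real"
  assumes "integrable Q f"
  shows "integrable M (\<lambda>\<omega>. f (\<omega> i))"
proof -
  have "integrable (distr M Q (\<lambda>\<omega>. \<omega> i)) f" using assms by (simp only: distr_coord)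
  then show ?thesis
    by (subst (asm) integrable_distr_eq) (use assms in auto)
qed

lemma integral_coord:
  fixes f :: "'z \<Rightarrow> real"
  assumes "f \<in> borel_measurable Q"
  shows "(\<integral>\<omega>. f (\<omega> i) \<partial>M) = (\<integral>z. f z \<partial>Q)"
proof -
  have "(\<integral>z. f z \<partial>Q) = (\<integral>z. f z \<partial>distr M Q (\<lambda>\<omega>. \<omega> i))" by (simp only: distr_coord)
  also have "\<dots> = (\<integral>\<omega>. f (\<omega> i) \<partial>M)" by (rule integral_distr) (use assms in auto)
  finally show ?thesis by simp
qed

lemma eventually_markov:
  fixes V :: "nat \<Rightarrow> (nat \<Rightarrow> 'z) \<Rightarrow> real"
  assumes V: "\<And>N. integrable M (V N)" "\<And>N \<omega>. \<omega> \<in> space M \<Longrightarrow> V N \<omega> \<ge> 0"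
    and bd: "\<forall>\<^sub>F N in sequentially. (\<integral>\<omega>. V N \<omega> \<partial>M) \<le> \<delta>" and t: "t > 0"
  shows "\<forall>\<^sub>F N in sequentially. outer_measure_of M {\<omega> \<in> space M. V N \<omega> \<ge> t} \<le> ennreal (\<delta> / t)"
  using bd
proof eventually_elim
  case (elim N)
  interpret P: prob_space M by (rule prob_space_M)
  have [measurable]: "V N \<in> borel_measurable M" using V by auto
  have "measure M {\<omega> \<in> space M. V N \<omega> \<ge> t} \<le> (\<integral>\<omega>. V N \<omega> \<partial>M) / t"
    using V t by (intro integral_Markov_inequality_measure[where A="{}"]) auto
  also have "\<dots> \<le> \<delta> / t" using elim t by (intro divide_right_mono) auto
  finally show ?case by (simp add: P.emeasure_eq_measure ennreal_leI)
qed

text \<open>Covariances of different coordinates vanish by independence; each variance is at most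
  \<open>(2 * K)\<^sup>2\<close> because centring at most doubles a bound on the absolute
  value.\<close>

lemma indep_coord_square:
  fixes f :: "'z \<Rightarrow> real"
  assumes f: "f \<in> borel_measurable Q" "\<And>z. z \<in> space Q \<Longrightarrow> \<bar>f z\<bar> \<le> K"
  shows "(\<integral>\<omega>. ((\<Sum>i<N. f (\<omega> i) - (\<integral>z. f z \<partial>Q)))\<^sup>2 \<partial>M) \<le> real N * (2 * K)\<^sup>2"
proof -
  interpret P: prob_space M by (rule prob_space_M)
  define g where "g z = f z - (\<integral>z. f z \<partial>Q)" for z
  have If: "integrable Q f" using f by (intro Z.integrable_const_bound[of _ K]) auto
  have K: "K \<ge> 0" using f(2) Z.not_empty by force
  have "\<bar>\<integral>z. f z \<partial>Q\<bar> \<le> (\<integral>z. \<bar>f z\<bar> \<partial>Q)" by simp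
  also have "\<dots> \<le> K" using f If by (intro Z.integral_le_const) auto
  finally have gK: "\<bar>g z\<bar> \<le> 2 * K" if "z \<in> space Q" for z using f(2)[OF that] by (simp add: g_def)
  have [measurable]: "g \<in> borel_measurable Q" unfolding g_def using f by simp
  have mean: "(\<integral>\<omega>. g (\<omega> i) \<partial>M) = 0" for i
    by (subst integral_coord) (use If in \<open>auto simp: g_def[abs_def] Z.prob_space\<close>)
  have gg: "\<bar>g y * g z\<bar> \<le> (2*K) * (2*K)" if "y \<in> space Q" "z \<in> space Q" for y z
    unfolding abs_mult using gK that K by (intro mult_mono) auto
  have prodb: "integrable M (\<lambda>\<omega>. g (\<omega> i) * g (\<omega> j))" for i j
    using gg by (intro P.integrable_const_bound[of _ "(2*K) * (2*K)"] AE_I2) (auto simp only: space_M real_norm_def, measurable)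
  have indep: "(\<integral>\<omega>. g (\<omega> i) * g (\<omega> j) \<partial>M) = 0" if "i \<noteq> j" for i j
  proof -
    have "distr M (\<Pi>\<^sub>M i\<in>UNIV. Q) (\<lambda>\<omega>. \<lambda>i\<in>UNIV. \<omega> i) = (\<Pi>\<^sub>M i\<in>UNIV. distr M Q (\<lambda>\<omega>. \<omega> i))"
      by (simp add: distr_coord distr_id restrict_UNIV)
    moreover have "P.indep_vars (\<lambda>_. Q) (\<lambda>i \<omega>. \<omega> i) UNIV \<longleftrightarrow>
      distr M (\<Pi>\<^sub>M i\<in>UNIV. Q) (\<lambda>\<omega>. \<lambda>i\<in>UNIV. \<omega> i) = (\<Pi>\<^sub>M i\<in>UNIV. distr M Q (\<lambda>\<omega>. \<omega> i))"
      using P.indep_vars_iff_distr_eq_PiM[where I=UNIV and M'="\<lambda>_. Q" and X="\<lambda>i \<omega>. \<omega> i"] by auto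
    ultimately have "P.indep_vars (\<lambda>_. Q) (\<lambda>i \<omega>. \<omega> i) UNIV" by (rule iffD2[rotated])
    then have "P.indep_vars (\<lambda>_. borel) (\<lambda>i \<omega>. g (\<omega> i)) UNIV"
      by (rule P.indep_vars_compose2) auto
    then have "P.indep_vars (\<lambda>_. borel) (\<lambda>i \<omega>. g (\<omega> i)) {i, j}"
      by (rule P.indep_vars_subset) simp
    moreover have "integrable M (\<lambda>\<omega>. g (\<omega> i))" for i
      unfolding g_def using If by (intro integrable_coord) auto
    ultimately have "(\<integral>\<omega>. (\<Prod>k\<in>{i, j}. g (\<omega> k)) \<partial>M) = (\<Prod>k\<in>{i, j}. \<integral>\<omega>. g (\<omega> k) \<partial>M)"
      by (intro P.indep_vars_lebesgue_integral) auto
    then show ?thesis using that mean by simp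
  qed
  have "(\<integral>\<omega>. ((\<Sum>i<N. g (\<omega> i)))\<^sup>2 \<partial>M) = (\<integral>\<omega>. (\<Sum>i<N. \<Sum>j<N. g (\<omega> i) * g (\<omega> j)) \<partial>M)"
    by (simp add: power2_eq_square sum_product)
  also have "\<dots> = (\<Sum>i<N. \<Sum>j<N. (\<integral>\<omega>. g (\<omega> i) * g (\<omega> j) \<partial>M))"
    using prodb by (simp add: Bochner_Integration.integral_sum)
  also have "\<dots> = (\<Sum>i<N. \<integral>\<omega>. g (\<omega> i) * g (\<omega> i) \<partial>M)"
  proof (intro sum.cong refl)
    fix i assume "i \<in> {..<N}"
    then show "(\<Sum>j<N. (\<integral>\<omega>. g (\<omega> i) * g (\<omega> j) \<partial>M)) = (\<integral>\<omega>. g (\<omega> i) * g (\<omega> i) \<partial>M)"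
      using indep by (subst sum.remove[of _ i]) (auto intro!: sum.neutral)
  qed
  also have "\<dots> \<le> (\<Sum>i<N. (2 * K)\<^sup>2)"
  proof (intro sum_mono)
    fix i
    show "(\<integral>\<omega>. g (\<omega> i) * g (\<omega> i) \<partial>M) \<le> (2 * K)\<^sup>2"
    proof (rule P.integral_le_const[OF prodb], rule AE_I2)
      fix \<omega> assume "\<omega> \<in> space M"
      then have "\<bar>g (\<omega> i)\<bar> \<le> 2 * K" using gK by (simp add: space_M)
      then have "(g (\<omega> i))\<^sup>2 \<le> (2 * K)\<^sup>2" using K by (metis abs_ge_zero power2_abs power_mono)
      then show "g (\<omega> i) * g (\<omega> i) \<le> (2 * K)\<^sup>2" by (simp add: power2_eq_square)
    qed
  qed
  finally show ?thesis by (simp add: g_def)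
qed

text \<open>Chebyshev's inequality: the variance of the average is of order 1/N.\<close>

lemma wlln_bounded:
  fixes f :: "'z \<Rightarrow> real"
  assumes f: "f \<in> borel_measurable Q" "\<And>z. z \<in> space Q \<Longrightarrow> \<bar>f z\<bar> \<le> K" and \<epsilon>: "\<epsilon> > 0"
  shows "\<forall>\<^sub>F x in outer_filter M. \<bar>(\<Sum>i<fst x. f (snd x i)) / real (fst x) - (\<integral>z. f z \<partial>Q)\<bar> < \<epsilon>"
proof (rule eventually_outer_filterI)
  fix \<eta> :: real assume \<eta>: "\<eta> > 0"
  interpret P: prob_space M by (rule prob_space_M)
  define m where "m = (\<integral>z. f z \<partial>Q)"
  define V where "V N \<omega> = ((\<Sum>i<N. f (\<omega> i) - m))\<^sup>2 / (real N)\<^sup>2" for N and \<omega> :: "nat \<Rightarrow> 'z"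
  have K: "K \<ge> 0" using f(2) Z.not_empty by force
  have fi: "f (\<omega> i) \<in> {-K..K}" if "\<omega> \<in> space M" for \<omega> i
    using f(2)[of "\<omega> i"] that by (auto simp: space_M abs_le_iff)
  have IV: "integrable M (V N)" for N
  proof (rule P.integrable_const_bound[of _ "(real N * (K + \<bar>m\<bar>))\<^sup>2 / (real N)\<^sup>2"])
    show "AE \<omega> in M. norm (V N \<omega>) \<le> (real N * (K + \<bar>m\<bar>))\<^sup>2 / (real N)\<^sup>2"
    proof (rule AE_I2)
      fix \<omega> assume "\<omega> \<in> space M"
      then have "\<bar>\<Sum>i<N. f (\<omega> i) - m\<bar> \<le> (\<Sum>i<N. K + \<bar>m\<bar>)"
        using fi[of \<omega>] by (intro order_trans[OF sum_abs] sum_mono) (smt (verit) atLeastAtMost_iff)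
      then have "(\<Sum>i<N. f (\<omega> i) - m)\<^sup>2 \<le> (real N * (K + \<bar>m\<bar>))\<^sup>2"
        using K by (simp add: abs_le_square_iff[symmetric])
      then show "norm (V N \<omega>) \<le> (real N * (K + \<bar>m\<bar>))\<^sup>2 / (real N)\<^sup>2"
        by (simp add: V_def divide_right_mono)
    qed
    show "V N \<in> borel_measurable M" unfolding V_def using f by measurable
  qed
  have bd: "(\<integral>\<omega>. V N \<omega> \<partial>M) \<le> (2 * K)\<^sup>2 / real N" for N
  proof -
    have "(\<integral>\<omega>. V N \<omega> \<partial>M) = (\<integral>\<omega>. ((\<Sum>i<N. f (\<omega> i) - m))\<^sup>2 \<partial>M) / (real N)\<^sup>2"
      unfolding V_def by simp
    also have "\<dots> \<le> (real N * (2 * K)\<^sup>2) / (real N)\<^sup>2"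
      using indep_coord_square[OF f, of N] by (intro divide_right_mono) (auto simp: m_def)
    also have "\<dots> = (2 * K)\<^sup>2 / real N" by (cases "N = 0") (auto simp: power2_eq_square)
    finally show ?thesis .
  qed
  have "(\<lambda>N. (2 * K)\<^sup>2 / real N) \<longlonglongrightarrow> 0" by (rule lim_const_over_n)
  then have "\<forall>\<^sub>F N in sequentially. (2 * K)\<^sup>2 / real N < \<eta> * \<epsilon>\<^sup>2"
    using \<eta> \<epsilon> by (intro order_tendstoD) auto
  then have "\<forall>\<^sub>F N in sequentially. (\<integral>\<omega>. V N \<omega> \<partial>M) \<le> \<eta> * \<epsilon>\<^sup>2"
    by eventually_elim (use bd order_trans less_imp_le in blast)
  then have "\<forall>\<^sub>F N in sequentially. outer_measure_of M {\<omega> \<in> space M. V N \<omega> \<ge> \<epsilon>\<^sup>2} \<le> ennreal (\<eta> * \<epsilon>\<^sup>2 / \<epsilon>\<^sup>2)"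
    using IV \<epsilon> by (intro eventually_markov) (auto simp: V_def[abs_def])
  then show "\<forall>\<^sub>F N in sequentially. outer_measure_of M {\<omega> \<in> space M.
      \<not> \<bar>(\<Sum>i<fst (N, \<omega>). f (snd (N, \<omega>) i)) / real (fst (N, \<omega>)) - (\<integral>z. f z \<partial>Q)\<bar> < \<epsilon>} \<le> ennreal \<eta>"
    using eventually_gt_at_top[of 0]
  proof eventually_elim
    case (elim N)
    have "{\<omega> \<in> space M. \<not> \<bar>(\<Sum>i<N. f (\<omega> i)) / real N - m\<bar> < \<epsilon>} \<subseteq> {\<omega> \<in> space M. V N \<omega> \<ge> \<epsilon>\<^sup>2}"
    proof safe
      fix \<omega> assume *: "\<not> \<bar>(\<Sum>i<N. f (\<omega> i)) / real N - m\<bar> < \<epsilon>"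
      have "(\<Sum>i<N. f (\<omega> i)) / real N - m = (\<Sum>i<N. f (\<omega> i) - m) / real N"
        using elim by (simp add: sum_subtractf field_simps)
      then have "V N \<omega> = \<bar>(\<Sum>i<N. f (\<omega> i)) / real N - m\<bar>\<^sup>2"
        by (simp add: V_def power_divide)
      moreover have "\<epsilon>\<^sup>2 \<le> \<bar>(\<Sum>i<N. f (\<omega> i)) / real N - m\<bar>\<^sup>2"
        using * \<epsilon> by (intro power_mono) auto
      ultimately show "\<epsilon>\<^sup>2 \<le> V N \<omega>" by simp
    qed
    then have "outer_measure_of M {\<omega> \<in> space M. \<not> \<bar>(\<Sum>i<N. f (\<omega> i)) / real N - m\<bar> < \<epsilon>} \<le>
      outer_measure_of M {\<omega> \<in> space M. V N \<omega> \<ge> \<epsilon>\<^sup>2}" by (rule outer_measure_of_mono)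
    also have "\<dots> \<le> ennreal \<eta>" using elim \<epsilon> by simp
    finally show ?case by (simp add: m_def)
  qed
qed

lemma wlln_L1_small:
  fixes f :: "'z \<Rightarrow> real"
  assumes f: "integrable Q f" and \<epsilon>: "\<epsilon> > 0" "\<eta> > 0" and small: "(\<integral>z. \<bar>f z\<bar> \<partial>Q) \<le> \<eta> * \<epsilon>"
  shows "\<forall>\<^sub>F N in sequentially. outer_measure_of M
     {\<omega> \<in> space M. (\<Sum>i<N. \<bar>f (\<omega> i)\<bar>) / real N \<ge> \<epsilon>} \<le> ennreal \<eta>"
proof -
  define V where "V N \<omega> = (\<Sum>i<N. \<bar>f (\<omega> i)\<bar>) / real N" for N and \<omega> :: "nat \<Rightarrow> 'z"
  have fi: "integrable M (\<lambda>\<omega>. \<bar>f (\<omega> i)\<bar>)" for i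
    using f by (intro integrable_coord[of "\<lambda>z. \<bar>f z\<bar>"]) auto
  have "(\<integral>\<omega>. V N \<omega> \<partial>M) \<le> \<eta> * \<epsilon>" for N
  proof -
    have "(\<integral>\<omega>. V N \<omega> \<partial>M) = (\<Sum>i<N. \<integral>\<omega>. \<bar>f (\<omega> i)\<bar> \<partial>M) / real N"
      unfolding V_def using fi by (simp add: Bochner_Integration.integral_sum)
    also have "(\<Sum>i<N. \<integral>\<omega>. \<bar>f (\<omega> i)\<bar> \<partial>M) = (\<Sum>i<N. \<integral>z. \<bar>f z\<bar> \<partial>Q)"
      using f by (intro sum.cong integral_coord[of "\<lambda>z. \<bar>f z\<bar>"]) auto
    finally show ?thesis using small by (cases "N = 0") (use \<epsilon> in auto)
  qed
  then have "\<forall>\<^sub>F N in sequentially. outer_measure_of M {\<omega> \<in> space M. V N \<omega> \<ge> \<epsilon>} \<le> ennreal (\<eta> * \<epsilon> / \<epsilon>)"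
    using fi \<epsilon> by (intro eventually_markov) (auto simp: V_def sum_nonneg)
  then show ?thesis using \<epsilon> by (simp add: V_def)
qed

text \<open>Dominated convergence. The truncated tail mass is used for the law of large numbers and
  again, applied to a square, for the Lindeberg condition.\<close>

lemma truncation_L1:
  fixes f :: "'z \<Rightarrow> real"
  assumes f: "integrable Q f"
  shows "(\<lambda>K. \<integral>z. \<bar>f z\<bar> * indicator {z. \<bar>f z\<bar> > real K} z \<partial>Q) \<longlonglongrightarrow> 0"
proof -
  have "(\<lambda>K. \<integral>z. \<bar>f z\<bar> * indicator {z. \<bar>f z\<bar> > real K} z \<partial>Q) \<longlonglongrightarrow> (\<integral>z. 0 \<partial>Q)"
  proof (rule integral_dominated_convergence[where w="\<lambda>z. \<bar>f z\<bar>"])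
    show "AE z in Q. (\<lambda>K. \<bar>f z\<bar> * indicator {z. \<bar>f z\<bar> > real K} z) \<longlonglongrightarrow> 0"
    proof (rule AE_I2)
      fix z
      obtain n where n: "\<bar>f z\<bar> \<le> real n" using real_arch_simple by blast
      show "(\<lambda>K. \<bar>f z\<bar> * indicator {z. \<bar>f z\<bar> > real K} z) \<longlonglongrightarrow> 0"
        by (rule tendsto_eventually, rule eventually_sequentiallyI[of n]) (use n in \<open>auto simp: indicator_def\<close>)
    qed
    show "(\<lambda>z. \<bar>f z\<bar> * indicator {z. \<bar>f z\<bar> > real K} z) \<in> borel_measurable Q" for K
    proof -
      have [measurable]: "f \<in> borel_measurable Q" using f by auto
      have "(\<lambda>z. \<bar>f z\<bar> * (if \<bar>f z\<bar> > real K then 1 else 0)) \<in> borel_measurable Q" by measurable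
      then show ?thesis by (simp add: indicator_def of_bool_def)
    qed
  qed (use f in \<open>auto simp: indicator_def\<close>)
  then show ?thesis by simp
qed

text \<open>Truncation reduces the integrable case to the bounded one; the part with large values
  has small mean absolute value and is handled by Markov's inequality.\<close>

theorem wlln:
  fixes f :: "'z \<Rightarrow> real"
  assumes f: "integrable Q f"
  shows "((\<lambda>x. (\<Sum>i<fst x. f (snd x i)) / real (fst x)) \<longlongrightarrow> (\<integral>z. f z \<partial>Q)) (outer_filter M)"
proof (rule tendstoI)
  fix \<epsilon> :: real assume \<epsilon>: "\<epsilon> > 0"
  have [measurable]: "f \<in> borel_measurable Q" using f by auto
  show "\<forall>\<^sub>F x in outer_filter M. dist ((\<Sum>i<fst x. f (snd x i)) / real (fst x)) (\<integral>z. f z \<partial>Q) < \<epsilon>"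
  proof (rule eventually_outer_filterI)
    fix \<eta> :: real assume \<eta>: "\<eta> > 0"
    \<comment> \<open>The first bound limits the bias from dropping the large values; the second
      makes Markov's inequality give probability at most \<open>\<eta> / 2\<close> at level
      \<open>\<epsilon> / 4\<close>.\<close>
    define \<delta> where "\<delta> = min (\<epsilon> / 4) (\<eta> / 2 * (\<epsilon> / 4))"
    have \<delta>: "\<delta> > 0" "\<delta> \<le> \<epsilon> / 4" "\<delta> \<le> \<eta> / 2 * (\<epsilon> / 4)" using \<epsilon> \<eta> by (auto simp: \<delta>_def)
    have "\<forall>\<^sub>F K in sequentially. (\<integral>z. \<bar>f z\<bar> * indicator {z. \<bar>f z\<bar> > real K} z \<partial>Q) < \<delta>"
      using truncation_L1[OF f] \<delta> by (intro order_tendstoD) auto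
    then obtain K where K: "(\<integral>z. \<bar>f z\<bar> * indicator {z. \<bar>f z\<bar> > real K} z \<partial>Q) < \<delta>"
      by (auto dest: eventually_happens)
    define g where "g z = (if \<bar>f z\<bar> > real K then f z else 0)" for z
    define h where "h z = (if \<bar>f z\<bar> > real K then 0 else f z)" for z
    have fgh: "f z = g z + h z" for z by (simp add: g_def h_def)
    have [measurable]: "g \<in> borel_measurable Q" "h \<in> borel_measurable Q" unfolding g_def h_def by measurable
    have Ig: "integrable Q g" by (rule Bochner_Integration.integrable_bound[OF f]) (auto simp: g_def)
    have Ih: "integrable Q h" by (rule Bochner_Integration.integrable_bound[OF f]) (auto simp: h_def)
    have gabs: "\<bar>g z\<bar> = \<bar>f z\<bar> * indicator {z. \<bar>f z\<bar> > real K} z" for z by (simp add: g_def)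
    have gd: "(\<integral>z. \<bar>g z\<bar> \<partial>Q) \<le> \<delta>" using K by (simp add: gabs)
    have diff: "\<bar>(\<integral>z. f z \<partial>Q) - (\<integral>z. h z \<partial>Q)\<bar> \<le> \<epsilon> / 4"
    proof -
      have "(\<integral>z. f z \<partial>Q) - (\<integral>z. h z \<partial>Q) = (\<integral>z. g z \<partial>Q)" using Ig Ih by (simp add: fgh)
      then have "\<bar>(\<integral>z. f z \<partial>Q) - (\<integral>z. h z \<partial>Q)\<bar> \<le> (\<integral>z. \<bar>g z\<bar> \<partial>Q)" by simp
      then show ?thesis using gd \<delta> by simp
    qed
    have 1: "\<forall>\<^sub>F N in sequentially. outer_measure_of M
       {\<omega> \<in> space M. (\<Sum>i<N. \<bar>g (\<omega> i)\<bar>) / real N \<ge> \<epsilon> / 4} \<le> ennreal (\<eta> / 2)"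
      using Ig \<epsilon> \<eta> gd \<delta> by (intro wlln_L1_small) auto
    have "\<forall>\<^sub>F x in outer_filter M. \<bar>(\<Sum>i<fst x. h (snd x i)) / real (fst x) - (\<integral>z. h z \<partial>Q)\<bar> < \<epsilon> / 4"
      using \<epsilon> by (intro wlln_bounded[of _ "real K"]) (auto simp: h_def)
    then have 2: "\<forall>\<^sub>F N in sequentially. outer_measure_of M
       {\<omega> \<in> space M. \<not> \<bar>(\<Sum>i<N. h (\<omega> i)) / real N - (\<integral>z. h z \<partial>Q)\<bar> < \<epsilon> / 4} \<le> ennreal (\<eta> / 2)"
      using eventually_outer_filterD[of _ M "\<eta>/2"] \<eta> by fastforce
    from 1 2 show "\<forall>\<^sub>F N in sequentially. outer_measure_of M {\<omega> \<in> space M.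
      \<not> dist ((\<Sum>i<fst (N, \<omega>). f (snd (N, \<omega>) i)) / real (fst (N, \<omega>))) (\<integral>z. f z \<partial>Q) < \<epsilon>} \<le> ennreal \<eta>"
    proof eventually_elim
      case (elim N)
      let ?A = "{\<omega> \<in> space M. (\<Sum>i<N. \<bar>g (\<omega> i)\<bar>) / real N \<ge> \<epsilon> / 4}"
      let ?B = "{\<omega> \<in> space M. \<not> \<bar>(\<Sum>i<N. h (\<omega> i)) / real N - (\<integral>z. h z \<partial>Q)\<bar> < \<epsilon> / 4}"
      have sub: "{\<omega> \<in> space M. \<not> dist ((\<Sum>i<N. f (\<omega> i)) / real N) (\<integral>z. f z \<partial>Q) < \<epsilon>} \<subseteq> ?A \<union> ?B"
      proof safe
        fix \<omega> assume a: "\<not> dist ((\<Sum>i<N. f (\<omega> i)) / real N) (\<integral>z. f z \<partial>Q) < \<epsilon>"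
          and b: "\<bar>(\<Sum>i<N. h (\<omega> i)) / real N - (\<integral>z. h z \<partial>Q)\<bar> < \<epsilon> / 4"
        have "(\<Sum>i<N. f (\<omega> i)) / real N = (\<Sum>i<N. g (\<omega> i)) / real N + (\<Sum>i<N. h (\<omega> i)) / real N"
          by (simp add: fgh sum.distrib add_divide_distrib)
        moreover have "\<bar>(\<Sum>i<N. g (\<omega> i)) / real N\<bar> \<le> (\<Sum>i<N. \<bar>g (\<omega> i)\<bar>) / real N"
          by (simp add: divide_right_mono)
        ultimately show "\<epsilon> / 4 \<le> (\<Sum>i<N. \<bar>g (\<omega> i)\<bar>) / real N"
          using a b diff unfolding dist_real_def by linarith
      qed
      have "outer_measure_of M {\<omega> \<in> space M. \<not> dist ((\<Sum>i<N. f (\<omega> i)) / real N) (\<integral>z. f z \<partial>Q) < \<epsilon>}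
        \<le> outer_measure_of M (?A \<union> ?B)" by (rule outer_measure_of_mono[OF sub])
      also have "\<dots> \<le> outer_measure_of M ?A + outer_measure_of M ?B"
        by (intro outer_measure_of_Un_le) auto
      also have "\<dots> \<le> ennreal (\<eta> / 2) + ennreal (\<eta> / 2)" using elim by (intro add_mono) auto
      also have "\<dots> = ennreal \<eta>" using \<eta> by (simp flip: ennreal_plus)
      finally show ?case by simp
    qed
  qed
qed

end

subsection \<open>Expectations over independent two-point variables\<close>

text \<open>
  The coordinates below \<open>N\<close> are independent, the \<open>i\<close>-th one taking the value \<open>a i\<close> with
  probability \<open>p i\<close> and \<open>b i\<close> otherwise; the others are frozen at \<open>v\<close>.
\<close>

primrec two_pt :: "nat \<Rightarrow> (nat \<Rightarrow> real) \<Rightarrow> (nat \<Rightarrow> real) \<Rightarrow> (nat \<Rightarrow> real) \<Rightarrow>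
    ((nat \<Rightarrow> real) \<Rightarrow> 'b::real_vector) \<Rightarrow> (nat \<Rightarrow> real) \<Rightarrow> 'b" where
  "two_pt 0 p a b \<phi> v = \<phi> v"
| "two_pt (Suc N) p a b \<phi> v =
     p N *\<^sub>R two_pt N p a b \<phi> (v(N := a N)) + (1 - p N) *\<^sub>R two_pt N p a b \<phi> (v(N := b N))"

abbreviation rad :: "nat \<Rightarrow> ((nat \<Rightarrow> real) \<Rightarrow> 'b::real_vector) \<Rightarrow> (nat \<Rightarrow> real) \<Rightarrow> 'b" where
  "rad N \<equiv> two_pt N (\<lambda>_. 1/2) (\<lambda>_. 1) (\<lambda>_. -1)"

abbreviation bern :: "nat \<Rightarrow> (nat \<Rightarrow> real) \<Rightarrow> ((nat \<Rightarrow> real) \<Rightarrow> 'b::real_vector) \<Rightarrow> 'b" where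
  "bern N p \<phi> \<equiv> two_pt N p (\<lambda>_. 1) (\<lambda>_. 0) \<phi> (\<lambda>_. 0)"

lemma two_pt_cong:
  assumes "\<And>e. \<forall>i<N. e i = a i \<or> e i = b i \<Longrightarrow> \<forall>i\<ge>N. e i = v i \<Longrightarrow> \<phi> e = \<psi> e"
  shows "two_pt N p a b \<phi> v = two_pt N p a b \<psi> v"
  using assms
proof (induction N arbitrary: v)
  case 0
  then show ?case using 0[of v] by simp
next
  case (Suc N)
  have "two_pt N p a b \<phi> (v(N := c)) = two_pt N p a b \<psi> (v(N := c))" if "c = a N \<or> c = b N" for c
  proof (rule Suc.IH)
    fix e assume e: "\<forall>i<N. e i = a i \<or> e i = b i" "\<forall>i\<ge>N. e i = (v(N := c)) i"
    then have "e N = c" by simp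
    then show "\<phi> e = \<psi> e" using e that
      by (intro Suc.prems) (auto simp: less_Suc_eq)
  qed
  then show ?case by simp
qed

lemma two_pt_mono:
  fixes \<phi> \<psi> :: "(nat \<Rightarrow> real) \<Rightarrow> real"
  assumes "\<And>i. i < N \<Longrightarrow> 0 \<le> p i \<and> p i \<le> 1"
    and "\<And>e. \<forall>i<N. e i = a i \<or> e i = b i \<Longrightarrow> \<forall>i\<ge>N. e i = v i \<Longrightarrow> \<phi> e \<le> \<psi> e"
  shows "two_pt N p a b \<phi> v \<le> two_pt N p a b \<psi> v"
  using assms
proof (induction N arbitrary: v)
  case 0
  then show ?case using 0(2)[of v] by simp
next
  case (Suc N)
  have "two_pt N p a b \<phi> (v(N := c)) \<le> two_pt N p a b \<psi> (v(N := c))" if "c = a N \<or> c = b N" for c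
  proof (rule Suc.IH)
    fix e assume e: "\<forall>i<N. e i = a i \<or> e i = b i" "\<forall>i\<ge>N. e i = (v(N := c)) i"
    then have "e N = c" by simp
    then show "\<phi> e \<le> \<psi> e" using e that
      by (intro Suc.prems) (auto simp: less_Suc_eq)
  qed (use Suc.prems in auto)
  then show ?case using Suc.prems(1)[of N] by (auto intro!: add_mono mult_left_mono)
qed

lemma two_pt_const [simp]: "two_pt N p a b (\<lambda>_. c) v = c"
  by (induction N arbitrary: v) (auto simp flip: scaleR_add_left)

lemma two_pt_add: "two_pt N p a b (\<lambda>e. \<phi> e + \<psi> e) v = two_pt N p a b \<phi> v + two_pt N p a b \<psi> v"
  by (induction N arbitrary: v) (auto simp: algebra_simps)

lemma two_pt_cmult: "two_pt N p a b (\<lambda>e. c * \<phi> e) v = c * two_pt N p a b \<phi> v" for c :: "'b::real_algebra"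
  by (induction N arbitrary: v) (auto simp: algebra_simps)

lemma two_pt_linear:
  assumes "linear f"
  shows "two_pt N p a b (\<lambda>e. f (\<phi> e)) v = f (two_pt N p a b \<phi> v)"
  by (induction N arbitrary: v) (auto simp: linear_add[OF assms] linear_scale[OF assms])

text \<open>The value \<open>a i\<close> is coded by 1 and \<open>b i\<close> by 0, and the argument
  of \<phi> decodes. This turns the centred inclusion errors, two-point variables with varying
  values, into functions of the inclusion indicators.\<close>

lemma two_pt_affine:
  "two_pt N p a b \<phi> v =
     two_pt N p (\<lambda>_. 1) (\<lambda>_. 0) (\<lambda>s. \<phi> (\<lambda>i. if i < N then b i + (a i - b i) * s i else s i)) v"
proof (induction N arbitrary: v \<phi>)
  case (Suc N)
  \<comment> \<open>The coordinate at \<open>N\<close> may be frozen at its decoded value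
    \<open>d\<close>, or frozen at its code \<open>c\<close> and decoded inside \<phi>.\<close>
  have *: "two_pt N p (\<lambda>_. 1) (\<lambda>_. 0) (\<lambda>s. \<phi> (\<lambda>i. if i < N then b i + (a i - b i) * s i else s i)) (v(N := d))
    = two_pt N p (\<lambda>_. 1) (\<lambda>_. 0) (\<lambda>s. \<phi> (\<lambda>i. if i < Suc N then b i + (a i - b i) * s i else s i)) (v(N := c))"
    if "d = b N + (a N - b N) * c" for c d
  proof -
    have "two_pt N p (\<lambda>_. 1) (\<lambda>_. 0) (\<lambda>s. \<phi> (\<lambda>i. if i < N then b i + (a i - b i) * s i else s i)) (v(N := d))
      = two_pt N p (\<lambda>_. 1) (\<lambda>_. 0) (\<lambda>s. \<phi> (\<lambda>i. if i < N then b i + (a i - b i) * s i else (v(N := d)) i)) (v(N := c))"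
    proof -
      \<comment> \<open>Coordinates from \<open>M'\<close> on may be read off an explicit
        \<open>z\<close>, because the average over the first \<open>M\<close> coordinates never
        changes them.\<close>
      have shift: "two_pt M p (\<lambda>_. 1) (\<lambda>_. 0) (\<lambda>s. \<phi> (\<lambda>i. if i < M' then b i + (a i - b i) * s i else s i)) x
        = two_pt M p (\<lambda>_. 1) (\<lambda>_. 0) (\<lambda>s. \<phi> (\<lambda>i. if i < M' then b i + (a i - b i) * s i else z i)) y"
        if "M \<le> M'" "\<forall>i. M \<le> i \<and> i < M' \<longrightarrow> x i = y i" "\<forall>i\<ge>M'. x i = z i" for M M' x y z
        using that
      proof (induction M arbitrary: x y)
        case 0
        have "(\<lambda>i. if i < M' then b i + (a i - b i) * x i else x i) = (\<lambda>i. if i < M' then b i + (a i - b i) * y i else z i)"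
          using 0 by auto
        then show ?case by simp
      next
        case (Suc M)
        then show ?case by (auto intro!: arg_cong2[where f="(+)"] arg_cong2[where f=scaleR] Suc.IH)
      qed
      show ?thesis by (rule shift) auto
    qed
    also have "\<dots> = two_pt N p (\<lambda>_. 1) (\<lambda>_. 0) (\<lambda>s. \<phi> (\<lambda>i. if i < Suc N then b i + (a i - b i) * s i else s i)) (v(N := c))"
    proof (rule two_pt_cong)
      fix e :: "nat \<Rightarrow> real" assume "\<forall>i\<ge>N. e i = (v(N := c)) i"
      then have "(\<lambda>i. if i < N then b i + (a i - b i) * e i else (v(N := d)) i)
         = (\<lambda>i. if i < Suc N then b i + (a i - b i) * e i else e i)"
        using that by (auto simp: less_Suc_eq)
      then show "\<phi> (\<lambda>i. if i < N then b i + (a i - b i) * e i else (v(N := d)) i) =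
        \<phi> (\<lambda>i. if i < Suc N then b i + (a i - b i) * e i else e i)" by simp
    qed
    finally show ?thesis .
  qed
  show ?case
    unfolding two_pt.simps
    by (intro arg_cong2[where f="(+)"] arg_cong2[where f=scaleR] trans[OF Suc.IH *]) simp_all
qed simp

lemma two_pt_prod:
  fixes f :: "nat \<Rightarrow> real \<Rightarrow> 'b::{real_normed_algebra_1, comm_ring_1}"
  shows "two_pt N p a b (\<lambda>e. \<Prod>i<N. f i (e i)) v =
    (\<Prod>i<N. p i *\<^sub>R f i (a i) + (1 - p i) *\<^sub>R f i (b i))"
proof -
  have "two_pt N p a b (\<lambda>e. \<Prod>i<M. f i (e i)) v =
    (\<Prod>i<N. p i *\<^sub>R f i (a i) + (1 - p i) *\<^sub>R f i (b i)) * (\<Prod>i\<in>{N..<M}. f i (v i))" if "N \<le> M" for M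
    using that
  proof (induction N arbitrary: v)
    case 0
    then show ?case by (simp add: atLeast0LessThan)
  next
    case (Suc N)
    have 1: "{N..<M} = insert N {Suc N..<M}" using Suc.prems by auto
    have 2: "(\<Prod>i\<in>{Suc N..<M}. f i ((v(N := c)) i)) = (\<Prod>i\<in>{Suc N..<M}. f i (v i))" for c
      by (intro prod.cong) auto
    show ?case
      using Suc.prems by (simp add: Suc.IH 1 2 algebra_simps)
  qed
  from this[of N] show ?thesis by simp
qed

section \<open>Moments of sums of independent two-point variables\<close>

lemma two_pt_second_moment:
  fixes x :: "nat \<Rightarrow> real"
  assumes "\<And>i. i < N \<Longrightarrow> p i * a i + (1 - p i) * b i = 0"
  shows "two_pt N p a b (\<lambda>e. (\<Sum>i<N. x i * e i)\<^sup>2) v =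
    (\<Sum>i<N. (x i)\<^sup>2 * (p i * (a i)\<^sup>2 + (1 - p i) * (b i)\<^sup>2))"
proof -
  have "two_pt N p a b (\<lambda>e. (\<Sum>i<M. x i * e i)\<^sup>2) v =
    (\<Sum>i\<in>{N..<M}. x i * v i)\<^sup>2 + (\<Sum>i<N. (x i)\<^sup>2 * (p i * (a i)\<^sup>2 + (1 - p i) * (b i)\<^sup>2))" if "N \<le> M" for M
    using that assms
  proof (induction N arbitrary: v)
    case 0
    then show ?case by (simp add: atLeast0LessThan)
  next
    case (Suc N)
    define r where "r = (\<Sum>i\<in>{Suc N..<M}. x i * v i)"
    have 1: "{N..<M} = insert N {Suc N..<M}" using Suc.prems by auto
    have "(\<Sum>i\<in>{Suc N..<M}. x i * (v(N := c)) i) = r" for c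
      unfolding r_def by (intro sum.cong) auto
    then have 2: "(\<Sum>i\<in>{N..<M}. x i * (v(N := c)) i) = x N * c + r" for c
      unfolding 1 by simp
    have 3: "p N * a N + (1 - p N) * b N = 0" using Suc.prems by simp
    have "p N * (x N * a N + r)\<^sup>2 + (1 - p N) * (x N * b N + r)\<^sup>2
       = r\<^sup>2 + 2 * r * x N * (p N * a N + (1 - p N) * b N) + (x N)\<^sup>2 * (p N * (a N)\<^sup>2 + (1 - p N) * (b N)\<^sup>2)"
      by (simp add: power2_eq_square algebra_simps)
    then have sq: "p N * (x N * a N + r)\<^sup>2 + (1 - p N) * (x N * b N + r)\<^sup>2
       = r\<^sup>2 + (x N)\<^sup>2 * (p N * (a N)\<^sup>2 + (1 - p N) * (b N)\<^sup>2)" using 3 by simp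
    have "two_pt N p a b (\<lambda>e. (\<Sum>i<M. x i * e i)\<^sup>2) (v(N := c)) =
       (x N * c + r)\<^sup>2 + (\<Sum>i<N. (x i)\<^sup>2 * (p i * (a i)\<^sup>2 + (1 - p i) * (b i)\<^sup>2))" for c
      unfolding 2[symmetric] by (rule Suc.IH) (use Suc.prems in auto)
    moreover have "p * (A + S) + (1 - p) * (B + S) = (p * A + (1 - p) * B) + S" for p A B S :: real
      by (simp add: algebra_simps)
    ultimately show ?case unfolding two_pt.simps real_scaleR_def using sq by (simp add: r_def)
  qed
  from this[of N] show ?thesis by simp
qed

lemma rad_fourth_moment:
  fixes x :: "nat \<Rightarrow> real"
  shows "rad N (\<lambda>e. (\<Sum>i<N. x i * e i)^4) v \<le> 3 * ((\<Sum>i<N. (x i)\<^sup>2))\<^sup>2"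
proof -
  \<comment> \<open>Expanding (r + S)^4 with frozen part r leaves r^4, 6 r^2 E S^2 and E S^4, since
    odd powers average to 0; the bound 3 (E S^2)^2 for the last one is propagated.\<close>
  have "rad N (\<lambda>e. (\<Sum>i<M. x i * e i)^4) v \<le>
    (\<Sum>i\<in>{N..<M}. x i * v i)^4 + 6 * (\<Sum>i\<in>{N..<M}. x i * v i)\<^sup>2 * (\<Sum>i<N. (x i)\<^sup>2)
      + 3 * (\<Sum>i<N. (x i)\<^sup>2)\<^sup>2" if "N \<le> M" for M
    using that
  proof (induction N arbitrary: v)
    case 0
    then show ?case by (simp add: atLeast0LessThan)
  next
    case (Suc N)
    define r where "r = (\<Sum>i\<in>{Suc N..<M}. x i * v i)"
    define \<sigma> where "\<sigma> = (\<Sum>i<N. (x i)\<^sup>2)"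
    have 1: "{N..<M} = insert N {Suc N..<M}" using Suc.prems by auto
    have "(\<Sum>i\<in>{Suc N..<M}. x i * (v(N := c)) i) = r" for c
      unfolding r_def by (intro sum.cong) auto
    then have 2: "(\<Sum>i\<in>{N..<M}. x i * (v(N := c)) i) = x N * c + r" for c
      unfolding 1 by simp
    have "N \<le> M" using Suc.prems by simp
    then have IH: "rad N (\<lambda>e. (\<Sum>i<M. x i * e i)^4) (v(N := c)) \<le>
        (x N * c + r)^4 + 6 * (x N * c + r)\<^sup>2 * \<sigma> + 3 * \<sigma>\<^sup>2" for c
      unfolding 2[symmetric] \<sigma>_def by (rule Suc.IH)
    \<comment> \<open>Passing from \<open>\<sigma>\<close> to
      \<open>\<sigma> + (x N)\<^sup>2\<close> in the bound produces three copies of (x N)^4 where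
      the average contains only one; hence the surplus \<open>2 * (x N)^4\<close>.\<close>
    have "1/2 * ((x N * 1 + r)^4 + 6 * (x N * 1 + r)\<^sup>2 * \<sigma> + 3 * \<sigma>\<^sup>2) +
        1/2 * ((x N * (-1) + r)^4 + 6 * (x N * (-1) + r)\<^sup>2 * \<sigma> + 3 * \<sigma>\<^sup>2)
      = r^4 + 6 * r\<^sup>2 * (\<sigma> + (x N)\<^sup>2) + 3 * (\<sigma> + (x N)\<^sup>2)\<^sup>2 - 2 * (x N)^4"
      by (simp add: power2_eq_square power4_eq_xxxx algebra_simps)
    moreover have "(x N)^4 \<ge> 0" by simp
    ultimately have "1/2 * ((x N * 1 + r)^4 + 6 * (x N * 1 + r)\<^sup>2 * \<sigma> + 3 * \<sigma>\<^sup>2) +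
        1/2 * ((x N * (-1) + r)^4 + 6 * (x N * (-1) + r)\<^sup>2 * \<sigma> + 3 * \<sigma>\<^sup>2)
      \<le> r^4 + 6 * r\<^sup>2 * (\<sigma> + (x N)\<^sup>2) + 3 * (\<sigma> + (x N)\<^sup>2)\<^sup>2" by linarith
    moreover have "(\<Sum>i<Suc N. (x i)\<^sup>2) = \<sigma> + (x N)\<^sup>2" by (simp add: \<sigma>_def)
    ultimately show ?case
      using IH[of 1] IH[of "-1"] unfolding two_pt.simps r_def[symmetric] real_scaleR_def
      by (simp add: algebra_simps)
  qed
  from this[of N] show ?thesis by simp
qed

text \<open>Paley--Zygmund in reverse: the fourth moment turns a quantile bound into a variance bound.\<close>

lemma rad_quantile_variance:
  fixes x :: "nat \<Rightarrow> real"
  assumes "rad N (\<lambda>e. of_bool (\<bar>\<Sum>i<N. x i * e i\<bar> > t)) (\<lambda>_. 0) \<le> (1/12 :: real)"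
  shows "(\<Sum>i<N. (x i)\<^sup>2) \<le> 2 * t\<^sup>2"
proof (cases "(\<Sum>i<N. (x i)\<^sup>2) = 0")
  case False
  define \<sigma> where "\<sigma> = (\<Sum>i<N. (x i)\<^sup>2)"
  have pos: "\<sigma> > 0" using False unfolding \<sigma>_def by (smt (verit) sum_nonneg zero_le_power2)
  define R where "R e = (\<Sum>i<N. x i * e i)" for e :: "nat \<Rightarrow> real"
  define I :: "(nat \<Rightarrow> real) \<Rightarrow> real" where "I e = of_bool (\<bar>R e\<bar> > t)" for e
  have "\<sigma> = rad N (\<lambda>e. (R e)\<^sup>2) (\<lambda>_. 0)"
    unfolding R_def \<sigma>_def by (subst two_pt_second_moment) auto
  \<comment> \<open>AM-GM in the form R^2 \<le> R^4 / (12 \<sigma>) + 3 \<sigma>, used where |R|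
    exceeds \<open>t\<close>. After averaging, the fourth moment contributes \<sigma>/4 and the tail
    probability 1/12 another \<sigma>/4, which together can be absorbed.\<close>
  also have "\<dots> \<le> rad N (\<lambda>e. t\<^sup>2 + ((1 / (12 * \<sigma>)) * (R e)^4 + (3 * \<sigma>) * I e)) (\<lambda>_. 0)"
  proof (rule two_pt_mono)
    fix e :: "nat \<Rightarrow> real"
    show "(R e)\<^sup>2 \<le> t\<^sup>2 + ((1 / (12 * \<sigma>)) * (R e)^4 + (3 * \<sigma>) * I e)"
    proof (cases "\<bar>R e\<bar> > t")
      case True
      have "0 \<le> ((R e)\<^sup>2 - 6 * \<sigma>)\<^sup>2 / (12 * \<sigma>)" using pos by simp
      also have "\<dots> = (1 / (12 * \<sigma>)) * (R e)^4 + 3 * \<sigma> - (R e)\<^sup>2"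
        using pos by (simp add: field_simps power2_eq_square power4_eq_xxxx)
      finally have "0 \<le> (1 / (12 * \<sigma>)) * (R e)^4 + 3 * \<sigma> - (R e)\<^sup>2" .
      moreover have "t\<^sup>2 \<ge> 0" by simp
      ultimately have "(R e)\<^sup>2 \<le> t\<^sup>2 + ((1 / (12 * \<sigma>)) * (R e)^4 + 3 * \<sigma>)" by linarith
      then show ?thesis using True by (simp add: I_def)
    next
      case False
      then have "(R e)\<^sup>2 \<le> t\<^sup>2" by (simp add: abs_le_square_iff[symmetric])
      moreover have "0 \<le> (1 / (12 * \<sigma>)) * (R e)^4" using pos by simp
      ultimately have "(R e)\<^sup>2 \<le> t\<^sup>2 + (1 / (12 * \<sigma>)) * (R e)^4" by linarith
      then show ?thesis using False by (simp add: I_def)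
    qed
  qed simp
  also have "\<dots> = t\<^sup>2 + ((1 / (12 * \<sigma>)) * rad N (\<lambda>e. (R e)^4) (\<lambda>_. 0) + (3 * \<sigma>) * rad N I (\<lambda>_. 0))"
    by (simp only: two_pt_add two_pt_cmult two_pt_const)
  also have "\<dots> \<le> t\<^sup>2 + ((1 / (12 * \<sigma>)) * (3 * \<sigma>\<^sup>2) + (3 * \<sigma>) * (1/12))"
    using pos assms[folded R_def, folded I_def] rad_fourth_moment[of N x "\<lambda>_. 0", folded R_def \<sigma>_def]
    by (intro add_mono mult_left_mono order_refl) auto
  also have "\<dots> = t\<^sup>2 + \<sigma> / 2" using pos by (simp add: field_simps power2_eq_square)
  finally show ?thesis by (simp add: \<sigma>_def)
qed simp

subsection \<open>Rademacher averages of a seminorm\<close>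

text \<open>The intended instance maps a vector x to the supremum over \<open>F\<close> of |sum of
  x_i \<Delta>_f(i)| with the data fixed. Measurability in the data never enters at this
  level.\<close>

locale coord_seminorm =
  fixes q :: "(nat \<Rightarrow> real) \<Rightarrow> real"
  assumes triangle: "q (\<lambda>i. x i + y i) \<le> q x + q y"
    and homogeneous: "q (\<lambda>i. c * x i) = \<bar>c\<bar> * q x"
begin

lemma zero: "q (\<lambda>_. 0) = 0"
  using homogeneous[of 0 "\<lambda>_. 0"] by simp

lemma uminus: "q (\<lambda>i. - x i) = q x"
  using homogeneous[of "-1" x] by simp

lemma nonneg: "q x \<ge> 0"
  using triangle[of x "\<lambda>i. - x i"] uminus[of x] zero by simp

lemma midpoint: "2 * q (\<lambda>i. (x i + y i) / 2) \<le> q x + q y"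
  using triangle[of x y] homogeneous[of 2 "\<lambda>i. (x i + y i) / 2"] by (simp add: add_divide_distrib)

section \<open>Reflection of signs, Levy's maximal inequality and the Hoffmann-Joergensen
  bound\<close>

lemma rad_uminus: "rad N \<phi> (\<lambda>i. - v i) = rad N (\<lambda>e. \<phi> (\<lambda>i. - e i)) v"
proof (induction N arbitrary: v)
  case (Suc N)
  have "(\<lambda>i. - v i)(N := c) = (\<lambda>i. - (v(N := - c)) i)" for c by auto
  then have "rad N \<phi> ((\<lambda>i. - v i)(N := c)) = rad N (\<lambda>e. \<phi> (\<lambda>i. - e i)) (v(N := - c))" for c
    using Suc.IH[of "v(N := - c)"] by (simp del: fun_upd_apply)
  from this[of 1] this[of "-1"] show ?case by (simp del: fun_upd_apply)
qed simp

lemma rad_flip: "rad N \<phi> v = rad N (\<lambda>e. \<phi> (\<lambda>i. if i < N then - e i else e i)) v"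
proof -
  have "rad N \<phi> v = rad N (\<lambda>e. \<phi> (\<lambda>i. if i < N then - e i else v i)) w" for w
  proof (induction N arbitrary: v w)
    case (Suc N)
    have *: "rad N \<phi> (v(N := - c)) = rad N (\<lambda>e. \<phi> (\<lambda>i. if i < Suc N then - e i else v i)) (w(N := c))" for c
    proof -
      have "rad N \<phi> (v(N := - c)) = rad N (\<lambda>e. \<phi> (\<lambda>i. if i < N then - e i else (v(N := - c)) i)) (w(N := c))"
        by (rule Suc.IH)
      also have "\<dots> = rad N (\<lambda>e. \<phi> (\<lambda>i. if i < Suc N then - e i else v i)) (w(N := c))"
      proof (rule two_pt_cong)
        fix e :: "nat \<Rightarrow> real" assume "\<forall>i\<ge>N. e i = (w(N := c)) i"
        then have "e N = c" by simp
        then have "(\<lambda>i. if i < N then - e i else (v(N := - c)) i) = (\<lambda>i. if i < Suc N then - e i else v i)"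
          by (auto simp: less_Suc_eq)
        then show "\<phi> (\<lambda>i. if i < N then - e i else (v(N := - c)) i) = \<phi> (\<lambda>i. if i < Suc N then - e i else v i)"
          by simp
      qed
      finally show ?thesis .
    qed
    show ?case using *[of "-1"] *[of 1] by simp
  qed simp
  also have "\<dots> v = rad N (\<lambda>e. \<phi> (\<lambda>i. if i < N then - e i else e i)) v"
  proof (rule two_pt_cong)
    fix e assume "\<forall>i\<ge>N. e i = v i"
    then have "(\<lambda>i. if i < N then - e i else v i) = (\<lambda>i. if i < N then - e i else e i)" by auto
    then show "\<phi> (\<lambda>i. if i < N then - e i else v i) = \<phi> (\<lambda>i. if i < N then - e i else e i)" by simp
  qed
  finally show ?thesis .
qed

text \<open>The coefficient vector of the partial sum already known when signs are revealed from the
  top index down and those below \<open>N\<close> are still open.\<close>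

definition cut :: "nat \<Rightarrow> (nat \<Rightarrow> real) \<Rightarrow> nat \<Rightarrow> real" where
  "cut N v = (\<lambda>i. if i < N then 0 else v i)"

text \<open>The probability that some partial sum, revealing the signs from the top, exceeds \<open>t\<close>.\<close>

primrec hit :: "real \<Rightarrow> nat \<Rightarrow> (nat \<Rightarrow> real) \<Rightarrow> real" where
  "hit t 0 v = of_bool (q v > t)"
| "hit t (Suc N) v = (if q (cut (Suc N) v) > t then 1 else
     1/2 * hit t N (v(N := 1)) + (1 - 1/2) * hit t N (v(N := -1)))"

lemma hit_bounds: "0 \<le> hit t N v"
  by (induction N arbitrary: v) auto

lemma hit_eq_1: "q (cut N v) > t \<Longrightarrow> hit t N v = 1"
  by (cases N) (auto simp: cut_def)

text \<open>Levy's reflection: at the first crossing, a configuration and the one with the open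
  signs flipped average to the crossing partial sum, so by convexity at least one of the two exceeds
  \<open>t\<close>; both have the same law.\<close>

lemma levy: "hit t N v \<le> 2 * rad N (\<lambda>e. of_bool (q e > t)) v"
proof (induction N arbitrary: v)
  case (Suc N)
  show ?case
  proof (cases "q (cut (Suc N) v) > t")
    case True
    have "1 = rad (Suc N) (\<lambda>_. 1 :: real) v" by simp
    also have "\<dots> \<le> rad (Suc N) (\<lambda>e. of_bool (q e > t) + of_bool (q (\<lambda>i. if i < Suc N then - e i else e i) > t)) v"
    proof (rule two_pt_mono)
      fix e assume e: "\<forall>i\<ge>Suc N. e i = v i"
      have "(\<lambda>i. (e i + (if i < Suc N then - e i else e i)) / 2) = cut (Suc N) v"
        using e by (auto simp: cut_def)
      then have "2 * q (cut (Suc N) v) \<le> q e + q (\<lambda>i. if i < Suc N then - e i else e i)"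
        using midpoint[of e "\<lambda>i. if i < Suc N then - e i else e i"] by simp
      then have "q e > t \<or> q (\<lambda>i. if i < Suc N then - e i else e i) > t" using True by linarith
      then show "(1::real) \<le> of_bool (q e > t) + of_bool (q (\<lambda>i. if i < Suc N then - e i else e i) > t)"
        by auto
    qed auto
    also have "\<dots> = 2 * rad (Suc N) (\<lambda>e. of_bool (q e > t)) v"
      unfolding two_pt_add using rad_flip[of "Suc N" "\<lambda>e. of_bool (q e > t) :: real" v] by simp
    finally show ?thesis using True by simp
  next
    case False
    then show ?thesis using Suc.IH[of "v(N := 1)"] Suc.IH[of "v(N := -1)"] by (simp del: fun_upd_apply)
  qed
qed simp

text \<open>Jensen: a further independent symmetric coordinate cannot lower the mean of a seminorm.
  This compares the mean of a remaining sum with the mean over all coordinates.\<close>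

lemma rad_mean_mono: "rad N q (\<lambda>_. 0) \<le> rad (Suc N) q (\<lambda>_. 0)"
proof -
  let ?u = "(\<lambda>_. 0)(N := 1) :: nat \<Rightarrow> real"
  have "(\<lambda>_. 0)(N := -1) = (\<lambda>i. - ?u i)" by auto
  then have 1: "rad N q ((\<lambda>_. 0)(N := -1)) = rad N q ?u"
    using rad_uminus[of N q ?u] by (simp add: uminus)
  have "rad N q (\<lambda>_. 0) \<le> rad N q ?u"
  proof -
    have swap: "rad N (\<lambda>e. q (e(N := c))) w = rad N q (w(N := c))" for c w
    proof -
      have "rad M (\<lambda>e. q (e(N := c))) w = rad M q (w(N := c))" if "M \<le> N" for M
        using that
      proof (induction M arbitrary: w)
        case (Suc M)
        then have "N \<noteq> M" by simp
        then have "rad M (\<lambda>e. q (e(N := c))) (w(M := d)) = rad M q (w(N := c, M := d))" for d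
          using Suc.IH[of "w(M := d)"] Suc.prems by (simp add: fun_upd_twist[of N M] del: fun_upd_apply)
        then show ?case by (simp del: fun_upd_apply)
      qed simp
      then show ?thesis by simp
    qed
    have "2 * rad N q (\<lambda>_. 0) = 2 * rad N (\<lambda>e. q (e(N := 0))) (\<lambda>_. 0)"
      using swap[of 0 "\<lambda>_. 0"] by (simp add: fun_upd_idem)
    also have "\<dots> = rad N (\<lambda>e. 2 * q (e(N := 0))) (\<lambda>_. 0)" by (simp add: two_pt_cmult)
    also have "\<dots> \<le> rad N (\<lambda>e. q (e(N := 1)) + q (e(N := -1))) (\<lambda>_. 0)"
    proof (rule two_pt_mono)
      fix e :: "nat \<Rightarrow> real"
      have "(\<lambda>i. ((e(N := 1)) i + (e(N := -1)) i) / 2) = e(N := 0)" by auto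
      then show "2 * q (e(N := 0)) \<le> q (e(N := 1)) + q (e(N := -1))"
        using midpoint[of "e(N := 1)" "e(N := -1)"] by simp
    qed simp
    also have "\<dots> = 2 * rad N q ?u"
      unfolding two_pt_add swap using 1 by simp
    finally show ?thesis by simp
  qed
  then show ?thesis using 1 by simp
qed

text \<open>Induction along the revealed signs: as long as the partial sum has norm at most
  \<open>t\<close> nothing is paid beyond \<open>t\<close>, and at a crossing what is left costs at
  most the full mean. \<open>hit\<close> is the probability that a crossing occurs.\<close>

lemma rad_mean_le_hit:
  assumes "q (cut N v) \<le> t"
  shows "rad N q v \<le> t + hit t N v * rad N q (\<lambda>_. 0)"
  using assms
proof (induction N arbitrary: v)
  case 0
  then show ?case by (simp add: cut_def)
next
  case (Suc N)
  define M where "M = rad (Suc N) q (\<lambda>_. 0)"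
  let ?u = "(\<lambda>_. 0)(N := 1) :: nat \<Rightarrow> real"
  have MN: "rad N q (\<lambda>_. 0) \<le> M" using rad_mean_mono M_def by simp
  have "(\<lambda>_. 0)(N := -1) = (\<lambda>i. - ?u i)" by auto
  then have "rad N q ((\<lambda>_. 0)(N := -1)) = rad N q ?u"
    using rad_uminus[of N q ?u] by (simp add: uminus)
  then have Mu: "rad N q ((\<lambda>_. 0)(N := c)) = M" if "c = 1 \<or> c = -1" for c
    using that by (auto simp: M_def)
  have step: "rad N q (v(N := c)) \<le> t + hit t N (v(N := c)) * M" if c: "c = 1 \<or> c = -1" for c
  proof (cases "q (cut N (v(N := c))) \<le> t")
    case True
    have "rad N q (v(N := c)) \<le> t + hit t N (v(N := c)) * rad N q (\<lambda>_. 0)"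
      by (rule Suc.IH) fact
    also have "\<dots> \<le> t + hit t N (v(N := c)) * M"
      by (intro add_left_mono mult_left_mono MN hit_bounds)
    finally show ?thesis .
  next
    case False
    have swap: "rad L (\<lambda>e. q (\<lambda>i. if i < L' then e i else z i)) w = rad L (\<lambda>e. q e) y"
      if "L \<le> L'" "\<forall>i. i \<ge> L' \<longrightarrow> z i = y i" "\<forall>i. L \<le> i \<and> i < L' \<longrightarrow> w i = y i" for L L' w z y
      using that
    proof (induction L arbitrary: w y)
      case 0
      then have "(\<lambda>i. if i < L' then w i else z i) = y" by auto
      then show ?case by simp
    next
      case (Suc L)
      then have "rad L (\<lambda>e. q (\<lambda>i. if i < L' then e i else z i)) (w(L := d)) = rad L (\<lambda>e. q e) (y(L := d))" for d
        by (intro Suc.IH) auto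
      then show ?case by simp
    qed
    \<comment> \<open>The split is made before the crossing sign: the part from \<open>Suc N\<close>
      on still has norm at most \<open>t\<close>, and the crossing coordinate joins the remainder,
      whose mean is \<open>M\<close> by symmetry. Hence no bound on a single summand
      appears.\<close>
    have "rad N q (v(N := c)) \<le> rad N (\<lambda>e. q (cut (Suc N) v) + q (\<lambda>i. if i < Suc N then e i else 0)) (v(N := c))"
    proof (rule two_pt_mono)
      fix e assume e: "\<forall>i\<ge>N. e i = (v(N := c)) i"
      have "e = (\<lambda>i. cut (Suc N) v i + (if i < Suc N then e i else 0))"
        using e by (auto simp: cut_def fun_eq_iff)
      then show "q e \<le> q (cut (Suc N) v) + q (\<lambda>i. if i < Suc N then e i else 0)"
        using triangle[of "cut (Suc N) v" "\<lambda>i. if i < Suc N then e i else 0"] by simp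
    qed simp
    also have "\<dots> = q (cut (Suc N) v) + rad N q ((\<lambda>_. 0)(N := c))"
      unfolding two_pt_add two_pt_const
      by (subst swap[where y="(\<lambda>_. 0)(N := c)"]) auto
    also have "\<dots> \<le> t + M" using Suc.prems Mu[OF c] by simp
    finally show ?thesis using False hit_eq_1[of t N "v(N := c)"] by simp
  qed
  have "rad (Suc N) q v \<le> 1/2 * (t + hit t N (v(N := 1)) * M) + (1 - 1/2) * (t + hit t N (v(N := -1)) * M)"
    unfolding two_pt.simps real_scaleR_def by (intro add_mono mult_left_mono step) auto
  also have "\<dots> = t + hit t (Suc N) v * M" using Suc.prems by (simp add: field_simps)
  finally show ?case unfolding M_def .
qed

text \<open>
  Hoffmann-Joergensen: stopping at the first partial sum above \<open>t\<close>, the remaining sum contributes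
  at most the whole mean, so a small tail probability controls the mean.
\<close>

lemma rad_mean_le:
  assumes "rad N (\<lambda>e. of_bool (q e > t)) (\<lambda>_. 0) \<le> (1/4 :: real)" "t \<ge> 0"
  shows "rad N q (\<lambda>_. 0) \<le> 2 * t"
proof -
  let ?M = "rad N q (\<lambda>_. 0)"
  have "?M \<ge> rad N (\<lambda>_. 0) (\<lambda>_. 0)" by (rule two_pt_mono) (auto simp: nonneg)
  then have M0: "?M \<ge> 0" by simp
  have "cut N (\<lambda>_. 0) = (\<lambda>_. 0)" by (auto simp: cut_def)
  then have "q (cut N (\<lambda>_. 0)) \<le> t" using zero assms by simp
  then have "?M \<le> t + hit t N (\<lambda>_. 0) * ?M" by (rule rad_mean_le_hit)
  \<comment> \<open>Levy's factor 2 turns the tail 1/4 into 1/2, so half of the mean can be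
    absorbed.\<close>
  also have "hit t N (\<lambda>_. 0) \<le> 1/2" using levy[of t N "\<lambda>_. 0"] assms by simp
  finally have "?M \<le> t + 1/2 * ?M" using M0 by (simp add: mult_right_mono)
  then show ?thesis by simp
qed

text \<open>A centred variable with values in \<open>[-C, C]\<close> is dominated in convex order by \<open>C\<close> times a sign.\<close>

lemma two_pt_le_rad:
  assumes p: "\<And>i. i < N \<Longrightarrow> 0 \<le> p i \<and> p i \<le> 1"
    and centred: "\<And>i. i < N \<Longrightarrow> p i * a i + (1 - p i) * b i = 0"
    and bd: "\<And>i. i < N \<Longrightarrow> \<bar>a i\<bar> \<le> C \<and> \<bar>b i\<bar> \<le> C" and C: "C > 0"
  shows "two_pt N p a b q (\<lambda>_. 0) \<le> C * rad N q (\<lambda>_. 0)"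
proof -
  let ?R = "\<lambda>N. two_pt N (\<lambda>_. 1/2) (\<lambda>_. C) (\<lambda>_. - C) q"
  \<comment> \<open>An interior value \<open>x\<close> is the barycentre of \<open>C\<close> and
    \<open>- C\<close> with weights 1/2 + x/(2C) and 1/2 - x/(2C). This is convexity of the seminorm
    in one coordinate, averaged over the others.\<close>
  have cvx: "?R N (v(K := x)) \<le> (1/2 + x / (2 * C)) * ?R N (v(K := C)) + (1/2 - x / (2 * C)) * ?R N (v(K := - C))"
    if x: "\<bar>x\<bar> \<le> C" and "N \<le> K" for N K v x
  proof -
    have swap: "?R M (w(K := c)) = two_pt M (\<lambda>_. 1/2) (\<lambda>_. C) (\<lambda>_. - C) (\<lambda>e. q (e(K := c))) w" if "M \<le> K" for M w c
      using that by (induction M arbitrary: w) (auto simp: fun_upd_twist[of K])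
    define l where "l = 1/2 + x / (2 * C)"
    have l: "0 \<le> l" "l \<le> 1" "1/2 - x / (2 * C) = 1 - l" "x = l * C + (1 - l) * (- C)"
      using x C by (auto simp: l_def abs_le_iff field_simps)
    have "two_pt N (\<lambda>_. 1/2) (\<lambda>_. C) (\<lambda>_. - C) (\<lambda>e. q (e(K := x))) v \<le>
       two_pt N (\<lambda>_. 1/2) (\<lambda>_. C) (\<lambda>_. - C) (\<lambda>e. l * q (e(K := C)) + (1 - l) * q (e(K := - C))) v"
    proof (rule two_pt_mono)
      fix e :: "nat \<Rightarrow> real"
      have "e(K := x) = (\<lambda>i. l * (e(K := C)) i + (1 - l) * (e(K := - C)) i)"
        using l(4) by (auto simp: fun_eq_iff algebra_simps)
      then have "q (e(K := x)) \<le> q (\<lambda>i. l * (e(K := C)) i) + q (\<lambda>i. (1 - l) * (e(K := - C)) i)"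
        using triangle by metis
      then show "q (e(K := x)) \<le> l * q (e(K := C)) + (1 - l) * q (e(K := - C))"
        using l by (simp only: homogeneous abs_of_nonneg diff_ge_0_iff_ge)
    qed simp
    then show ?thesis
      unfolding two_pt_add two_pt_cmult by (simp only: swap[OF \<open>N \<le> K\<close>] l_def[symmetric] l(3))
  qed
  have "two_pt N p a b q v \<le> ?R N v" for v
    using p centred bd
  proof (induction N arbitrary: v)
    case (Suc N)
    have b: "\<bar>a N\<bar> \<le> C" "\<bar>b N\<bar> \<le> C" "0 \<le> p N" "p N \<le> 1" "p N * a N + (1 - p N) * b N = 0" using Suc.prems by auto
    have IH: "two_pt N p a b q w \<le> ?R N w" for w by (rule Suc.IH) (use Suc.prems in auto)
    let ?P = "?R N (v(N := C))" and ?Q = "?R N (v(N := - C))"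
    have "two_pt (Suc N) p a b q v \<le> p N * ?R N (v(N := a N)) + (1 - p N) * ?R N (v(N := b N))"
      unfolding two_pt.simps real_scaleR_def using b by (intro add_mono mult_left_mono IH) auto
    also have "\<dots> \<le> p N * ((1/2 + a N / (2 * C)) * ?P + (1/2 - a N / (2 * C)) * ?Q)
        + (1 - p N) * ((1/2 + b N / (2 * C)) * ?P + (1/2 - b N / (2 * C)) * ?Q)"
      using b by (intro add_mono mult_left_mono cvx) auto
    \<comment> \<open>The deviation from equal weights is proportional to the mean of the
      coordinate, which is 0.\<close>
    also have "\<dots> = 1/2 * ?P + 1/2 * ?Q + (p N * a N + (1 - p N) * b N) * ((?P - ?Q) / (2 * C))"
      using C by (simp add: field_simps)
    also have "\<dots> = ?R (Suc N) v" unfolding b(5) by simp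
    finally show ?case .
  qed simp
  also have "?R N (\<lambda>i. C * 0) = C * rad N q (\<lambda>_. 0)"
  proof -
    have "?R N (\<lambda>i. C * v i) = C * rad N q v" for v
    proof (induction N arbitrary: v)
      case 0
      then show ?case using homogeneous[of C v] C by simp
    next
      case (Suc N)
      have "(\<lambda>i. C * v i)(N := C * c) = (\<lambda>i. C * (v(N := c)) i)" for c by auto
      from this[of 1] this[of "-1"] show ?case
        using Suc.IH[of "v(N := 1)"] Suc.IH[of "v(N := -1)"] by (simp add: algebra_simps del: fun_upd_apply)
    qed
    from this[of "\<lambda>_. 0"] show ?thesis by simp
  qed
  finally show ?thesis by simp
qed

end

subsection \<open>The space of bounded functions\<close>

lemma linf_mspace:
  "z \<in> mspace (linf F) \<longleftrightarrow> z \<in> extensional F \<and> (\<exists>B. \<forall>f\<in>F. \<bar>z f\<bar> \<le> B)"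
  by (simp add: Metric_space.fspace_def[OF Met_TC.Metric_space_axioms]) (simp add: bounded_real)

lemma linf_dist_le:
  assumes "z \<in> mspace (linf F)" "z' \<in> mspace (linf F)" "\<And>f. f \<in> F \<Longrightarrow> \<bar>z f - z' f\<bar> \<le> a" "a \<ge> 0"
  shows "mdist (linf F) z z' \<le> a"
proof (cases "F = {}")
  case True
  then have "z = z'" using assms(1,2) by (auto simp: linf_mspace extensional_def)
  interpret L: Metric_space "mspace (linf F)" "mdist (linf F)" by (rule Metric_space_mspace_mdist)
  show ?thesis using L.mdist_zero[OF assms(1)] assms(4) unfolding \<open>z = z'\<close> by linarith
next
  case False
  have "\<forall>f\<in>F. mdist euclidean_metric (z f) (z' f) \<le> a" using assms(3) by (simp add: dist_real_def)
  then show ?thesis by (rule iffD2[OF funspace_mdist_le[OF assms(1,2) False]])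
qed

lemma linf_dist_ge:
  assumes "z \<in> mspace (linf F)" "z' \<in> mspace (linf F)" "f \<in> F"
  shows "\<bar>z f - z' f\<bar> \<le> mdist (linf F) z z'"
proof -
  have "F \<noteq> {}" using assms by auto
  then have "\<forall>f\<in>F. mdist euclidean_metric (z f) (z' f) \<le> mdist (linf F) z z'"
    by (rule iffD1[OF funspace_mdist_le[OF assms(1,2)] order_refl])
  then show ?thesis using assms(3) by (simp only: mdist_euclidean_metric dist_real_def)
qed

lemma linf_lipschitz_continuous:
  assumes "\<And>z z'. z \<in> mspace (linf F) \<Longrightarrow> z' \<in> mspace (linf F) \<Longrightarrow> \<bar>h z - h z'\<bar> \<le> C * mdist (linf F) z z'"
  shows "continuous_map (mtopology_of (linf F)) euclideanreal h"
proof -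
  have "Lipschitz_continuous_map (linf F) euclidean_metric h"
    using assms by (auto simp: Lipschitz_continuous_map_def dist_real_def simp del: mspace_funspace mdist_funspace)
  then have "continuous_map (mtopology_of (linf F)) (mtopology_of euclidean_metric) h"
    by (rule Lipschitz_continuous_imp_continuous_map)
  then show ?thesis by simp
qed

lemma space_linf_borel: "space (linf_borel F) = mspace (linf F)"
  by (simp add: linf_borel_def space_measure_of_conv)

lemma linf_continuous_measurable:
  assumes "continuous_map (mtopology_of (linf F)) euclideanreal h"
  shows "h \<in> borel_measurable (linf_borel F)"
proof (rule borel_measurableI)
  have sub: "{U. openin (mtopology_of (linf F)) U} \<subseteq> Pow (mspace (linf F))"
  proof
    fix U assume "U \<in> {U. openin (mtopology_of (linf F)) U}"
    then have "U \<subseteq> topspace (mtopology_of (linf F))" by (intro openin_subset) (simp only: mem_Collect_eq)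
    then show "U \<in> Pow (mspace (linf F))" by (simp only: Pow_iff topspace_mtopology_of)
  qed
  fix S :: "real set" assume "open S"
  then have "openin (mtopology_of (linf F)) {z \<in> topspace (mtopology_of (linf F)). h z \<in> S}"
    using assms unfolding continuous_map_def by auto
  then have "{z \<in> mspace (linf F). h z \<in> S} \<in> sets (linf_borel F)"
    unfolding linf_borel_def topspace_mtopology_of
    by (subst sets_measure_of[OF sub]) (rule sigma_sets.Basic, simp only: mem_Collect_eq)
  moreover have "h -` S \<inter> space (linf_borel F) = {z \<in> mspace (linf F). h z \<in> S}"
    by (auto simp: space_linf_borel)
  ultimately show "h -` S \<inter> space (linf_borel F) \<in> sets (linf_borel F)" by simp
qed

lemma compactin_linf_finite_net:
  assumes "compactin (mtopology_of (linf F)) K" "\<delta> > 0"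
  obtains W where "finite W" "W \<subseteq> mspace (linf F)" "\<And>z. z \<in> K \<Longrightarrow> \<exists>v\<in>W. \<forall>f\<in>F. \<bar>z f - v f\<bar> \<le> \<delta>"
proof -
  interpret L: Metric_space "mspace (linf F)" "mdist (linf F)" by (rule Metric_space_mspace_mdist)
  have K: "compactin L.mtopology K" using assms(1) by (simp add: mtopology_of_def)
  then have "L.mtotally_bounded K" by (rule L.compactin_imp_mtotally_bounded)
  then obtain W where W: "finite W" "W \<subseteq> K" "K \<subseteq> (\<Union>x\<in>W. L.mball x \<delta>)"
    using assms(2) unfolding L.mtotally_bounded_def by (elim allE[of _ \<delta>] impE exE conjE) (assumption | rule that)+
  have KM: "K \<subseteq> mspace (linf F)" using L.compactin_imp_mbounded[OF K] by (rule L.mbounded_subset_mspace)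
  show thesis
  proof (rule that[OF W(1)])
    show "W \<subseteq> mspace (linf F)" using W KM by blast
    fix z assume "z \<in> K"
    then obtain v where "v \<in> W" "z \<in> L.mball v \<delta>" using W(3) by blast
    then have v: "v \<in> mspace (linf F)" "z \<in> mspace (linf F)" "mdist (linf F) v z < \<delta>"
      by (simp_all add: L.in_mball del: mspace_funspace mdist_funspace)
    have "\<bar>z f - v f\<bar> \<le> \<delta>" if "f \<in> F" for f
      using linf_dist_ge[OF v(1,2) that] v(3) by linarith
    then show "\<exists>v\<in>W. \<forall>f\<in>F. \<bar>z f - v f\<bar> \<le> \<delta>" using \<open>v \<in> W\<close> by blast
  qed
qed

text \<open>Rounding values on a grid of mesh \<open>\<delta>\<close> gives each index a label.
  Finitely many bounded functions produce finitely many labels, and \<open>\<rho>\<close> sends an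
  index to a fixed index with the same label.\<close>

lemma finite_range_representatives:
  fixes W :: "('f \<Rightarrow> real) set"
  assumes "finite W" "\<And>v. v \<in> W \<Longrightarrow> \<exists>B. \<forall>f\<in>F. \<bar>v f\<bar> \<le> B" "\<delta> > 0"
  obtains \<rho> where "\<rho> ` F \<subseteq> F" "finite (\<rho> ` F)" "\<And>v f. v \<in> W \<Longrightarrow> f \<in> F \<Longrightarrow> \<bar>v f - v (\<rho> f)\<bar> \<le> \<delta>"
proof -
  define label where "label f = (\<lambda>v\<in>W. \<lfloor>v f / \<delta>\<rfloor>)" for f
  define B where "B v = (SOME B. \<forall>f\<in>F. \<bar>v f\<bar> \<le> B)" for v :: "'f \<Rightarrow> real"
  have B: "\<bar>v f\<bar> \<le> B v" if "v \<in> W" "f \<in> F" for v f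
    using someI_ex[OF assms(2)[OF that(1)]] that(2) unfolding B_def by blast
  have "label ` F \<subseteq> PiE W (\<lambda>v. {\<lfloor>- B v / \<delta>\<rfloor>..\<lfloor>B v / \<delta>\<rfloor>})"
  proof (rule image_subsetI, rule PiE_I)
    fix f v assume "f \<in> F" "v \<in> W"
    then have "- B v \<le> v f" "v f \<le> B v" using B[of v f] by auto
    then show "label f v \<in> {\<lfloor>- B v / \<delta>\<rfloor>..\<lfloor>B v / \<delta>\<rfloor>}"
      using \<open>v \<in> W\<close> assms(3) unfolding label_def restrict_apply' [OF \<open>v \<in> W\<close>] atLeastAtMost_iff
      by (intro conjI floor_mono divide_right_mono) auto
  qed (auto simp: label_def)
  then have fin: "finite (label ` F)" by (rule finite_subset) (intro finite_PiE assms(1) finite_atLeastAtMost_int)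
  define \<rho> where "\<rho> f = inv_into F label (label f)" for f
  show thesis
  proof (rule that)
    show "\<rho> ` F \<subseteq> F" unfolding \<rho>_def by (intro image_subsetI inv_into_into imageI)
    have "\<rho> ` F = inv_into F label ` (label ` F)" unfolding \<rho>_def by (simp only: image_image)
    then show "finite (\<rho> ` F)" using finite_imageI[OF fin] by (simp only:)
    fix v f assume v: "v \<in> W" and f: "f \<in> F"
    have "label (\<rho> f) = label f" unfolding \<rho>_def by (rule f_inv_into_f[OF imageI[OF f]])
    then have "label (\<rho> f) v = label f v" by (rule fun_cong)
    then have eq: "\<lfloor>v (\<rho> f) / \<delta>\<rfloor> = \<lfloor>v f / \<delta>\<rfloor>" unfolding label_def restrict_apply'[OF v] .
    have "\<bar>x - y\<bar> \<le> 1" if "\<lfloor>y\<rfloor> = \<lfloor>x\<rfloor>" for x y :: real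
      using floor_correct[of x] floor_correct[of y] unfolding that by linarith
    from this[OF eq] have "\<bar>(v f - v (\<rho> f)) / \<delta>\<bar> \<le> 1" unfolding diff_divide_distrib .
    then show "\<bar>v f - v (\<rho> f)\<bar> \<le> \<delta>" using assms(3) by (simp only: abs_divide abs_of_pos divide_le_eq_1_pos)
  qed
qed

subsection \<open>Tail bounds from weak convergence to a tight limit\<close>

text \<open>The supremum functional is Lipschitz, so a ramp between the levels \<open>a\<close> and
  \<open>b\<close> is an admissible test function. Its integral in the limit is at most the mass
  outside \<open>K\<close>, and a measurable majorant that nearly attains the outer expectation
  converts this into a bound for a possibly nonmeasurable event.\<close>

lemma weak_conv_sup_tail:
  fixes Z :: "nat \<Rightarrow> 'a \<Rightarrow> 'f \<Rightarrow> real" and u :: "'j \<Rightarrow> ('f \<Rightarrow> real) \<Rightarrow> real"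
  assumes M: "prob_space M" and L: "prob_space L" "sets L = sets (linf_borel F)"
    and weak: "weakly_converges_linf M F Z L (\<lambda>z. z)"
    and J: "J \<noteq> {}"
    and lip: "\<And>j z z'. j \<in> J \<Longrightarrow> z \<in> mspace (linf F) \<Longrightarrow> z' \<in> mspace (linf F) \<Longrightarrow>
        \<bar>u j z - u j z'\<bar> \<le> C * mdist (linf F) z z'"
    and bdd: "\<And>z. z \<in> mspace (linf F) \<Longrightarrow> bdd_above ((\<lambda>j. \<bar>u j z\<bar>) ` J)"
    and K: "measure L {z \<in> space L. z \<in> K} \<ge> 1 - \<eta>"
      "\<And>z j. z \<in> mspace (linf F) \<Longrightarrow> z \<in> K \<Longrightarrow> j \<in> J \<Longrightarrow> \<bar>u j z\<bar> \<le> a"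
    and Z: "\<And>N \<omega>. \<omega> \<in> space M \<Longrightarrow> Z N \<omega> \<in> mspace (linf F)"
    and ab: "a < b" and \<eta>: "\<eta> < \<eta>'"
  shows "\<forall>\<^sub>F N in sequentially. outer_measure_of M {\<omega> \<in> space M. \<exists>j\<in>J. \<bar>u j (Z N \<omega>)\<bar> \<ge> b} \<le> ennreal \<eta>'"
proof -
  interpret M: prob_space M by fact
  interpret L: prob_space L by fact
  define q where "q z = (SUP j\<in>J. \<bar>u j z\<bar>)" for z
  define h where "h z = min 1 (max 0 ((q z - a) / (b - a)))" for z
  have spL: "space L = mspace (linf F)" using sets_eq_imp_space_eq[OF L(2)] by (simp add: space_linf_borel)
  have qle: "q z \<le> q z' + C * mdist (linf F) z z'" if "z \<in> mspace (linf F)" "z' \<in> mspace (linf F)" for z z'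
    unfolding q_def
  proof (rule cSUP_least[OF J])
    fix j assume j: "j \<in> J"
    have "\<bar>u j z'\<bar> \<le> (SUP j\<in>J. \<bar>u j z'\<bar>)" by (rule cSUP_upper[OF j bdd[OF that(2)]])
    then show "\<bar>u j z\<bar> \<le> (SUP j\<in>J. \<bar>u j z'\<bar>) + C * mdist (linf F) z z'"
      using lip[OF j that] by linarith
  qed
  interpret Lm: Metric_space "mspace (linf F)" "mdist (linf F)" by (rule Metric_space_mspace_mdist)
  have qlip: "\<bar>q z - q z'\<bar> \<le> C * mdist (linf F) z z'" if "z \<in> mspace (linf F)" "z' \<in> mspace (linf F)" for z z'
    using qle[OF that] qle[OF that(2,1)] unfolding Lm.commute[of z' z] by linarith
  have hlip: "\<bar>h z - h z'\<bar> \<le> (C / (b - a)) * mdist (linf F) z z'" if "z \<in> mspace (linf F)" "z' \<in> mspace (linf F)" for z z'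
  proof -
    have "\<bar>h z - h z'\<bar> \<le> \<bar>(q z - a) / (b - a) - (q z' - a) / (b - a)\<bar>" by (simp add: h_def)
    also have "\<dots> = \<bar>q z - q z'\<bar> / (b - a)" using ab by (simp flip: diff_divide_distrib)
    also have "\<dots> \<le> C * mdist (linf F) z z' / (b - a)" using qlip[OF that] ab by (intro divide_right_mono) auto
    finally show ?thesis by simp
  qed
  have hc: "continuous_map (mtopology_of (linf F)) euclideanreal h" by (rule linf_lipschitz_continuous[OF hlip])
  have qc: "continuous_map (mtopology_of (linf F)) euclideanreal q" by (rule linf_lipschitz_continuous[OF qlip])
  have [measurable]: "h \<in> borel_measurable L" "q \<in> borel_measurable L"
    using linf_continuous_measurable[OF hc] linf_continuous_measurable[OF qc] L(2) by (simp_all cong: measurable_cong_sets)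
  have h01: "0 \<le> h z" "h z \<le> 1" for z by (auto simp: h_def)
  have "bounded (h ` mspace (linf F))" using h01 by (auto simp: bounded_real intro!: exI[of _ 1] simp del: mspace_funspace)
  then have lim: "(\<lambda>N. outer_expectation M (\<lambda>\<omega>. h (Z N \<omega>))) \<longlonglongrightarrow> (\<integral>\<omega>. h \<omega> \<partial>L)"
    using weak hc unfolding weakly_converges_linf_def by blast
  have "(\<integral>z. h z \<partial>L) \<le> (\<integral>z. 1 - indicator {z \<in> space L. q z \<le> a} z \<partial>L)"
  proof (rule integral_mono)
    show "integrable L h" using h01 by (intro L.integrable_const_bound[of _ 1]) auto
    show "integrable L (\<lambda>z. 1 - indicator {z \<in> space L. q z \<le> a} z :: real)"
      by (intro Bochner_Integration.integrable_diff integrable_real_indicator) (auto simp: L.emeasure_eq_measure)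
    fix z assume "z \<in> space L"
    then show "h z \<le> 1 - indicator {z \<in> space L. q z \<le> a} z"
      using ab h01[of z] by (auto simp: indicator_def h_def divide_nonpos_pos)
  qed
  also have "\<dots> = 1 - measure L {z \<in> space L. q z \<le> a}"
    by (subst Bochner_Integration.integral_diff)
      (auto simp: L.prob_space L.emeasure_eq_measure intro!: integrable_real_indicator)
  also have "\<dots> \<le> \<eta>"
  proof -
    have "measure L {z \<in> space L. z \<in> K} \<le> measure L {z \<in> space L. q z \<le> a}"
    proof (rule L.finite_measure_mono)
      show "{z \<in> space L. z \<in> K} \<subseteq> {z \<in> space L. q z \<le> a}"
        using K(2) by (auto simp: spL q_def intro!: cSUP_least[OF J] simp del: mspace_funspace)
    qed simp
    then show ?thesis using K(1) by linarith
  qed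
  also have "\<dots> < \<eta>'" by fact
  finally have "\<forall>\<^sub>F N in sequentially. outer_expectation M (\<lambda>\<omega>. h (Z N \<omega>)) < \<eta>'"
    using lim by (intro order_tendstoD)
  then show ?thesis
  proof eventually_elim
    case (elim N)
    \<comment> \<open>The infimum on the reals is meaningful here: the constant 1 is a majorant, and
      the integral of every majorant is nonnegative.\<close>
    let ?S = "{integral\<^sup>L M U | U. integrable M U \<and> (\<forall>\<omega> \<in> space M. h (Z N \<omega>) \<le> U \<omega>)}"
    have "integral\<^sup>L M (\<lambda>_. 1 :: real) \<in> ?S" using h01 by (intro CollectI exI[of _ "\<lambda>_. 1 :: real"]) auto
    then have "?S \<noteq> {}" by blast
    moreover have "bdd_below ?S"
    proof (rule bdd_belowI)
      fix x assume "x \<in> ?S"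
      then obtain U where "x = integral\<^sup>L M U" "\<forall>\<omega>\<in>space M. h (Z N \<omega>) \<le> U \<omega>" by blast
      then have "x = integral\<^sup>L M U" "\<And>\<omega>. \<omega> \<in> space M \<Longrightarrow> 0 \<le> U \<omega>"
        using order_trans[OF h01(1)] by blast+
      then show "0 \<le> x" by (auto intro: integral_nonneg)
    qed
    \<comment> \<open>An integrable majorant of the ramp with mean below \<open>\<eta>'\<close>; it
      is at least 1 wherever the ramp is saturated, so Markov's inequality applies to it.\<close>
    ultimately obtain U where U: "integrable M U" "\<And>\<omega>. \<omega> \<in> space M \<Longrightarrow> h (Z N \<omega>) \<le> U \<omega>" "integral\<^sup>L M U < \<eta>'"
      using elim cInf_less_iff[of ?S \<eta>'] unfolding outer_expectation_def by blast
    have [measurable]: "U \<in> borel_measurable M" using U by auto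
    have "{\<omega> \<in> space M. \<exists>j\<in>J. \<bar>u j (Z N \<omega>)\<bar> \<ge> b} \<subseteq> {\<omega> \<in> space M. U \<omega> \<ge> 1}"
    proof safe
      fix \<omega> j assume \<omega>: "\<omega> \<in> space M" and j: "j \<in> J" "b \<le> \<bar>u j (Z N \<omega>)\<bar>"
      have "\<bar>u j (Z N \<omega>)\<bar> \<le> q (Z N \<omega>)" unfolding q_def by (rule cSUP_upper[OF j(1) bdd[OF Z[OF \<omega>]]])
      then have "(q (Z N \<omega>) - a) / (b - a) \<ge> 1" using j ab by simp
      then show "1 \<le> U \<omega>" using U(2)[OF \<omega>] by (simp add: h_def)
    qed
    then have "outer_measure_of M {\<omega> \<in> space M. \<exists>j\<in>J. \<bar>u j (Z N \<omega>)\<bar> \<ge> b} \<le> outer_measure_of M {\<omega> \<in> space M. U \<omega> \<ge> 1}"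
      by (rule outer_measure_of_mono)
    also have "\<dots> = ennreal (measure M {\<omega> \<in> space M. U \<omega> \<ge> 1})"
      by (simp add: M.emeasure_eq_measure)
    also have "measure M {\<omega> \<in> space M. U \<omega> \<ge> 1} \<le> (\<integral>\<omega>. U \<omega> \<partial>M) / 1"
    proof (intro integral_Markov_inequality_measure[where A="{}"])
      show "AE \<omega> in M. 0 \<le> U \<omega>" using order_trans[OF h01(1) U(2)] by (intro AE_I2)
    qed (use U in auto)
    finally have "outer_measure_of M {\<omega> \<in> space M. \<exists>j\<in>J. \<bar>u j (Z N \<omega>)\<bar> \<ge> b} \<le> ennreal (\<integral>\<omega>. U \<omega> \<partial>M)"
      by (simp add: ennreal_leI)
    also have "\<dots> \<le> ennreal \<eta>'" using U(3) by (intro ennreal_leI) simp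
    finally show ?case .
  qed
qed

subsection \<open>Randomizing the signs of an empirical process\<close>

text \<open>A replacement for Fubini: only finitely many sign patterns contribute, each event is
  enlarged to a measurable hull, and the average of the hull indicators is a measurable function
  with mean at most \<open>\<eta>\<close>. Markov's inequality does the rest.\<close>

lemma outer_measure_rad_le:
  fixes B :: "(nat \<Rightarrow> real) \<Rightarrow> 'a set"
  assumes M: "prob_space M" and B: "\<And>e. B e \<subseteq> space M" and \<eta>: "\<eta> \<ge> 0" "t > 0"
    and small: "\<And>e. \<forall>i<N. e i = 1 \<or> e i = -1 \<Longrightarrow> outer_measure_of M (B e) \<le> ennreal \<eta>"
  shows "outer_measure_of M {\<omega> \<in> space M. rad N (\<lambda>e. of_bool (\<omega> \<in> B e)) (\<lambda>_. 0) \<ge> t} \<le> ennreal (\<eta> / t)"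
proof -
  interpret M: prob_space M by fact
  obtain C where C: "\<And>e. C e \<in> sets M" "\<And>e. B e \<subseteq> C e" "\<And>e. outer_measure_of M (B e) = emeasure M (C e)"
    using outer_measure_of_attain[OF B] by metis
  define u :: "'a \<Rightarrow> real" where "u \<omega> = rad N (\<lambda>e. of_bool (\<omega> \<in> C e)) (\<lambda>_. 0)" for \<omega>
  have *: "integrable M (\<lambda>\<omega>. rad K (\<lambda>e. of_bool (\<omega> \<in> C e)) v :: real) \<and>
     (\<integral>\<omega>. rad K (\<lambda>e. of_bool (\<omega> \<in> C e)) v \<partial>M) = rad K (\<lambda>e. measure M (C e)) v" for K v
  proof (induction K arbitrary: v)
    case 0
    have "(\<lambda>\<omega>. of_bool (\<omega> \<in> C v) :: real) = indicator (C v)" by (auto simp: indicator_def)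
    moreover have "integrable M (indicator (C v) :: _ \<Rightarrow> real)"
      using C(1)[of v] by (intro integrable_real_indicator) (auto simp: M.emeasure_eq_measure)
    ultimately have "integrable M (\<lambda>\<omega>. of_bool (\<omega> \<in> C v) :: real)"
      "(\<integral>\<omega>. of_bool (\<omega> \<in> C v) \<partial>M) = measure M (C v)" using C(1)[of v] by (simp_all only:) simp
    then show ?case by simp
  next
    case (Suc K)
    then show ?case by (simp del: fun_upd_apply)
  qed
  have [measurable]: "u \<in> borel_measurable M" using * unfolding u_def by blast
  have "{\<omega> \<in> space M. rad N (\<lambda>e. of_bool (\<omega> \<in> B e)) (\<lambda>_. 0) \<ge> t} \<subseteq> {\<omega> \<in> space M. u \<omega> \<ge> t}"
  proof safe
    fix \<omega> assume "t \<le> rad N (\<lambda>e. of_bool (\<omega> \<in> B e)) (\<lambda>_. 0 :: real)"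
    also have "\<dots> \<le> u \<omega>" unfolding u_def by (rule two_pt_mono) (use C(2) in auto)
    finally show "t \<le> u \<omega>" .
  qed
  then have "outer_measure_of M {\<omega> \<in> space M. rad N (\<lambda>e. of_bool (\<omega> \<in> B e)) (\<lambda>_. 0) \<ge> t} \<le>
     outer_measure_of M {\<omega> \<in> space M. u \<omega> \<ge> t}" by (rule outer_measure_of_mono)
  also have "\<dots> = ennreal (measure M {\<omega> \<in> space M. u \<omega> \<ge> t})" by (simp add: M.emeasure_eq_measure)
  also have "\<dots> \<le> ennreal (\<eta> / t)"
  proof (rule ennreal_leI)
    have "rad N (\<lambda>e. 0) (\<lambda>_. 0 :: real) \<le> u \<omega>" for \<omega> unfolding u_def by (rule two_pt_mono) auto
    then have u0: "0 \<le> u \<omega>" for \<omega> by simp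
    have "measure M {\<omega> \<in> space M. u \<omega> \<ge> t} \<le> (\<integral>\<omega>. u \<omega> \<partial>M) / t"
      using * u0 \<eta> unfolding u_def by (intro integral_Markov_inequality_measure[where A="{}"]) auto
    also have "(\<integral>\<omega>. u \<omega> \<partial>M) = rad N (\<lambda>e. measure M (C e)) (\<lambda>_. 0)" using * unfolding u_def by simp
    also have "\<dots> \<le> rad N (\<lambda>e. \<eta>) (\<lambda>_. 0)"
    proof (rule two_pt_mono)
      fix e :: "nat \<Rightarrow> real" assume "\<forall>i<N. e i = 1 \<or> e i = - 1"
      then have "ennreal (measure M (C e)) \<le> ennreal \<eta>"
        using small[of e] C(3)[of e] by (simp add: M.emeasure_eq_measure)
      then show "measure M (C e) \<le> \<eta>" using \<eta> by simp
    qed simp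
    finally show "measure M {\<omega> \<in> space M. u \<omega> \<ge> t} \<le> \<eta> / t" using \<eta> by (simp add: divide_right_mono)
  qed
  finally show ?thesis .
qed

context iid_sequence
begin

text \<open>An injective relabelling of the coordinates preserves the product law.\<close>

lemma outer_reindex_le:
  assumes "inj j" "B \<subseteq> space M"
  shows "outer_measure_of M {\<omega> \<in> space M. (\<lambda>i. \<omega> (j i)) \<in> B} \<le> outer_measure_of M B"
proof -
  have "distr M M (\<lambda>\<omega>. \<lambda>n\<in>UNIV. \<omega> (j n)) = M"
    by (rule distr_PiM_reindex) (use assms Z.prob_space_axioms in auto)
  then have d: "distr M M (\<lambda>\<omega> i. \<omega> (j i)) = M" by (simp add: restrict_UNIV)
  have m: "(\<lambda>\<omega> i. \<omega> (j i)) \<in> measurable M M"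
    by (rule measurable_PiM_single') (auto simp: space_PiM)
  have "{\<omega> \<in> space M. (\<lambda>i. \<omega> (j i)) \<in> B} = (\<lambda>\<omega> i. \<omega> (j i)) -` B \<inter> space M" by auto
  then show ?thesis using outer_measure_of_vimage_le[OF m d assms(2)] by simp
qed

text \<open>Exchangeability, in the one-sided sense available for outer measures: the sum over
  \<open>I\<close> behaves like the sum over the first \<open>card I\<close> coordinates.\<close>

lemma subset_tail:
  fixes \<Delta> :: "'j \<Rightarrow> 'z \<Rightarrow> real"
  assumes tail: "outer_measure_of M {\<omega> \<in> space M. \<exists>f\<in>J. \<bar>\<Sum>i<card I. \<Delta> f (\<omega> i)\<bar> > t} \<le> ennreal \<eta>"
    and I: "finite I"
  shows "outer_measure_of M {\<omega> \<in> space M. \<exists>f\<in>J. \<bar>\<Sum>i\<in>I. \<Delta> f (\<omega> i)\<bar> > t} \<le> ennreal \<eta>"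
proof -
  obtain k where k: "bij_betw k {..<card I} I"
    using ex_bij_betw_nat_finite[OF I] unfolding atLeast0LessThan by blast
  obtain m where m: "\<forall>i\<in>I. i < m" using iffD1[OF finite_nat_set_iff_bounded I] by blast
  \<comment> \<open>The enumeration of \<open>I\<close> is extended to an injection on all indices
    by shifting the remaining arguments beyond every element of \<open>I\<close>.\<close>
  define j where "j i = (if i < card I then k i else m + i)" for i
  have jI: "j i \<in> I" if "i < card I" for i using k that by (auto simp: j_def bij_betw_def)
  have "inj j"
  proof (rule injI)
    fix x y assume xy: "j x = j y"
    have low: "j z < m \<longleftrightarrow> z < card I" for z
      using jI[of z] m by (cases "z < card I") (auto simp: j_def)
    have k': "inj_on k {..<card I}" using k by (simp add: bij_betw_def)
    show "x = y"
    proof (cases "x < card I")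
      case True
      then have "y < card I" using low[of x] low[of y] xy by simp
      then show ?thesis using True xy k' by (simp add: j_def inj_on_def)
    next
      case False
      then have "\<not> y < card I" using low[of x] low[of y] xy by simp
      then show ?thesis using False xy by (simp add: j_def)
    qed
  qed
  have "(\<Sum>i\<in>I. \<Delta> f (\<omega> i)) = (\<Sum>i<card I. \<Delta> f (\<omega> (j i)))" for f \<omega>
    using sum.reindex_bij_betw[OF k, of "\<lambda>i. \<Delta> f (\<omega> i)"] by (simp add: j_def)
  then have "{\<omega> \<in> space M. \<exists>f\<in>J. \<bar>\<Sum>i\<in>I. \<Delta> f (\<omega> i)\<bar> > t} =
     {\<omega> \<in> space M. (\<lambda>i. \<omega> (j i)) \<in> {\<omega> \<in> space M. \<exists>f\<in>J. \<bar>\<Sum>i<card I. \<Delta> f (\<omega> i)\<bar> > t}}"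
    by (auto simp: space_M)
  also have "outer_measure_of M \<dots> \<le> outer_measure_of M {\<omega> \<in> space M. \<exists>f\<in>J. \<bar>\<Sum>i<card I. \<Delta> f (\<omega> i)\<bar> > t}"
    by (rule outer_reindex_le[OF \<open>inj j\<close>]) auto
  finally show ?thesis using tail by simp
qed

text \<open>
  Few indices are harmless: they are the difference of two large index sets.  Measurability plays
  no role, so the envelope need not be controlled at all.
\<close>

lemma subset_tail_uniform:
  fixes \<Delta> :: "'j \<Rightarrow> 'z \<Rightarrow> real"
  assumes tail: "\<And>n. n \<ge> N0 \<Longrightarrow>
      outer_measure_of M {\<omega> \<in> space M. \<exists>f\<in>J. \<bar>\<Sum>i<n. \<Delta> f (\<omega> i)\<bar> > t * sqrt (real n)} \<le> ennreal \<eta>"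
    and I: "finite I" "card I \<le> N" and N: "2 * N0 \<le> N" and t: "t \<ge> 0" "\<eta> \<ge> 0"
  shows "outer_measure_of M {\<omega> \<in> space M. \<exists>f\<in>J. \<bar>\<Sum>i\<in>I. \<Delta> f (\<omega> i)\<bar> > 2 * t * sqrt (real N)} \<le> ennreal (2 * \<eta>)"
proof -
  have large: "outer_measure_of M {\<omega> \<in> space M. \<exists>f\<in>J. \<bar>\<Sum>i\<in>I. \<Delta> f (\<omega> i)\<bar> > t * sqrt (real N)} \<le> ennreal \<eta>"
    if "finite I" "card I \<le> N" "card I \<ge> N0" for I
  proof -
    have "t * sqrt (real (card I)) \<le> t * sqrt (real N)" using that t by (intro mult_left_mono) auto
    then have "{\<omega> \<in> space M. \<exists>f\<in>J. \<bar>\<Sum>i\<in>I. \<Delta> f (\<omega> i)\<bar> > t * sqrt (real N)} \<subseteq>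
      {\<omega> \<in> space M. \<exists>f\<in>J. \<bar>\<Sum>i\<in>I. \<Delta> f (\<omega> i)\<bar> > t * sqrt (real (card I))}" by force
    then have "outer_measure_of M {\<omega> \<in> space M. \<exists>f\<in>J. \<bar>\<Sum>i\<in>I. \<Delta> f (\<omega> i)\<bar> > t * sqrt (real N)} \<le>
      outer_measure_of M {\<omega> \<in> space M. \<exists>f\<in>J. \<bar>\<Sum>i\<in>I. \<Delta> f (\<omega> i)\<bar> > t * sqrt (real (card I))}"
      by (rule outer_measure_of_mono)
    also have "\<dots> \<le> ennreal \<eta>" by (rule subset_tail[OF tail[OF that(3)] that(1)])
    finally show ?thesis .
  qed
  define R where "R = t * sqrt (real N)"
  have R: "R \<ge> 0" using t by (simp add: R_def)
  show ?thesis
  proof (cases "card I \<ge> N0")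
    case True
    have "{\<omega> \<in> space M. \<exists>f\<in>J. \<bar>\<Sum>i\<in>I. \<Delta> f (\<omega> i)\<bar> > 2 * t * sqrt (real N)} \<subseteq>
       {\<omega> \<in> space M. \<exists>f\<in>J. \<bar>\<Sum>i\<in>I. \<Delta> f (\<omega> i)\<bar> > t * sqrt (real N)}"
    proof safe
      fix \<omega> f assume a: "f \<in> J" "2 * t * sqrt (real N) < \<bar>\<Sum>i\<in>I. \<Delta> f (\<omega> i)\<bar>"
      have "2 * t * sqrt (real N) = 2 * R" by (simp add: R_def)
      then have "t * sqrt (real N) < \<bar>\<Sum>i\<in>I. \<Delta> f (\<omega> i)\<bar>" using a(2) R unfolding R_def by linarith
      then show "\<exists>f\<in>J. t * sqrt (real N) < \<bar>\<Sum>i\<in>I. \<Delta> f (\<omega> i)\<bar>" using a(1) by blast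
    qed
    then have "outer_measure_of M {\<omega> \<in> space M. \<exists>f\<in>J. \<bar>\<Sum>i\<in>I. \<Delta> f (\<omega> i)\<bar> > 2 * t * sqrt (real N)} \<le>
       outer_measure_of M {\<omega> \<in> space M. \<exists>f\<in>J. \<bar>\<Sum>i\<in>I. \<Delta> f (\<omega> i)\<bar> > t * sqrt (real N)}"
      by (rule outer_measure_of_mono)
    also have "\<dots> \<le> ennreal \<eta>" by (rule large[OF I True])
    also have "\<dots> \<le> ennreal (2 * \<eta>)" using t by (intro ennreal_leI) auto
    finally show ?thesis .
  next
    case False
    obtain m where m: "\<forall>i\<in>I. i < m" using iffD1[OF finite_nat_set_iff_bounded I(1)] by blast
    \<comment> \<open>\<open>N0\<close> fresh indices beyond \<open>I\<close>. Since
      \<open>card I < N0\<close>, the union has at least \<open>N0\<close> and fewer than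
      \<open>2 * N0 \<le> N\<close> elements, so both index sets are large and their two bounds
      \<open>R\<close> add up.\<close>
    define K where "K = {m..<m + N0}"
    have K: "finite K" "card K = N0" "I \<inter> K = {}" using m by (auto simp: K_def)
    have IK: "card (I \<union> K) = card I + N0" using card_Un_disjoint[OF I(1) K(1) K(3)] K(2) by simp
    let ?A = "{\<omega> \<in> space M. \<exists>f\<in>J. \<bar>\<Sum>i\<in>I \<union> K. \<Delta> f (\<omega> i)\<bar> > R}"
    let ?B = "{\<omega> \<in> space M. \<exists>f\<in>J. \<bar>\<Sum>i\<in>K. \<Delta> f (\<omega> i)\<bar> > R}"
    have "{\<omega> \<in> space M. \<exists>f\<in>J. \<bar>\<Sum>i\<in>I. \<Delta> f (\<omega> i)\<bar> > 2 * t * sqrt (real N)} \<subseteq> ?A \<union> ?B"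
    proof safe
      fix \<omega> f assume a: "f \<in> J" "2 * t * sqrt (real N) < \<bar>\<Sum>i\<in>I. \<Delta> f (\<omega> i)\<bar>"
        and b: "\<not> (\<exists>f\<in>J. R < \<bar>\<Sum>i\<in>K. \<Delta> f (\<omega> i)\<bar>)"
      have "(\<Sum>i\<in>I \<union> K. \<Delta> f (\<omega> i)) = (\<Sum>i\<in>I. \<Delta> f (\<omega> i)) + (\<Sum>i\<in>K. \<Delta> f (\<omega> i))"
        by (rule sum.union_disjoint[OF I(1) K(1) K(3)])
      moreover have "2 * R < \<bar>\<Sum>i\<in>I. \<Delta> f (\<omega> i)\<bar>" using a by (simp add: R_def)
      moreover have "\<bar>\<Sum>i\<in>K. \<Delta> f (\<omega> i)\<bar> \<le> R" using a(1) b by (auto simp: not_less)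
      ultimately show "\<exists>f\<in>J. R < \<bar>\<Sum>i\<in>I \<union> K. \<Delta> f (\<omega> i)\<bar>" using a(1) by (intro bexI[of _ f]) auto
    qed
    then have "outer_measure_of M {\<omega> \<in> space M. \<exists>f\<in>J. \<bar>\<Sum>i\<in>I. \<Delta> f (\<omega> i)\<bar> > 2 * t * sqrt (real N)} \<le>
       outer_measure_of M (?A \<union> ?B)" by (rule outer_measure_of_mono)
    also have "\<dots> \<le> outer_measure_of M ?A + outer_measure_of M ?B" by (rule outer_measure_of_Un_le) auto
    also have "\<dots> \<le> ennreal \<eta> + ennreal \<eta>"
    proof (intro add_mono)
      show "outer_measure_of M ?A \<le> ennreal \<eta>"
        unfolding R_def using False N K IK I by (intro large) auto
      show "outer_measure_of M ?B \<le> ennreal \<eta>"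
        unfolding R_def using False N K IK I by (intro large) auto
    qed
    also have "\<dots> = ennreal (2 * \<eta>)" using t by (simp flip: ennreal_plus)
    finally show ?thesis .
  qed
qed

text \<open>Positive and negative signs split the signed sum into a difference of two sums over
  index sets; both the level and the probability double.\<close>

lemma sign_tail:
  fixes \<Delta> :: "'j \<Rightarrow> 'z \<Rightarrow> real"
  assumes tail: "\<And>n. n \<ge> N0 \<Longrightarrow>
      outer_measure_of M {\<omega> \<in> space M. \<exists>f\<in>J. \<bar>\<Sum>i<n. \<Delta> f (\<omega> i)\<bar> > t * sqrt (real n)} \<le> ennreal \<eta>"
    and N: "2 * N0 \<le> N" and t: "t \<ge> 0" "\<eta> \<ge> 0" and e: "\<forall>i<N. e i = 1 \<or> e i = -1"
  shows "outer_measure_of M {\<omega> \<in> space M. \<exists>f\<in>J. \<bar>\<Sum>i<N. e i * \<Delta> f (\<omega> i)\<bar> > 4 * t * sqrt (real N)} \<le> ennreal (4 * \<eta>)"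
proof -
  define I where "I = {i. i < N \<and> e i = 1}"
  define K where "K = {i. i < N \<and> e i \<noteq> 1}"
  have fin: "finite I" "finite K" by (auto simp: I_def K_def)
  have sub: "I \<subseteq> {..<N}" "K \<subseteq> {..<N}" by (auto simp: I_def K_def)
  have card: "card I \<le> N" "card K \<le> N"
    using card_mono[OF _ sub(1)] card_mono[OF _ sub(2)] by auto
  have split: "(\<Sum>i<N. e i * \<Delta> f (\<omega> i)) = (\<Sum>i\<in>I. \<Delta> f (\<omega> i)) - (\<Sum>i\<in>K. \<Delta> f (\<omega> i))" for f \<omega>
  proof -
    have un: "{..<N} = I \<union> K" and dis: "I \<inter> K = {}" by (auto simp: I_def K_def)
    have "(\<Sum>i<N. e i * \<Delta> f (\<omega> i)) = (\<Sum>i\<in>I. e i * \<Delta> f (\<omega> i)) + (\<Sum>i\<in>K. e i * \<Delta> f (\<omega> i))"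
      unfolding un by (rule sum.union_disjoint[OF fin dis])
    also have "(\<Sum>i\<in>I. e i * \<Delta> f (\<omega> i)) = (\<Sum>i\<in>I. \<Delta> f (\<omega> i))" by (rule sum.cong) (auto simp: I_def)
    also have "(\<Sum>i\<in>K. e i * \<Delta> f (\<omega> i)) = (\<Sum>i\<in>K. - \<Delta> f (\<omega> i))"
      by (rule sum.cong) (use e in \<open>auto simp: K_def\<close>)
    finally show ?thesis by (simp add: sum_negf)
  qed
  define R where "R = 2 * t * sqrt (real N)"
  let ?A = "{\<omega> \<in> space M. \<exists>f\<in>J. \<bar>\<Sum>i\<in>I. \<Delta> f (\<omega> i)\<bar> > R}"
  let ?B = "{\<omega> \<in> space M. \<exists>f\<in>J. \<bar>\<Sum>i\<in>K. \<Delta> f (\<omega> i)\<bar> > R}"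
  have "{\<omega> \<in> space M. \<exists>f\<in>J. \<bar>\<Sum>i<N. e i * \<Delta> f (\<omega> i)\<bar> > 4 * t * sqrt (real N)} \<subseteq> ?A \<union> ?B"
  proof safe
    fix \<omega> f assume a: "f \<in> J" "4 * t * sqrt (real N) < \<bar>\<Sum>i<N. e i * \<Delta> f (\<omega> i)\<bar>"
      and b: "\<not> (\<exists>f\<in>J. R < \<bar>\<Sum>i\<in>K. \<Delta> f (\<omega> i)\<bar>)"
    have "2 * R < \<bar>(\<Sum>i\<in>I. \<Delta> f (\<omega> i)) - (\<Sum>i\<in>K. \<Delta> f (\<omega> i))\<bar>" using a by (simp add: R_def split)
    moreover have "\<bar>\<Sum>i\<in>K. \<Delta> f (\<omega> i)\<bar> \<le> R" using a(1) b by (auto simp: not_less)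
    ultimately show "\<exists>f\<in>J. R < \<bar>\<Sum>i\<in>I. \<Delta> f (\<omega> i)\<bar>" using a(1) by (intro bexI[of _ f]) auto
  qed
  then have "outer_measure_of M {\<omega> \<in> space M. \<exists>f\<in>J. \<bar>\<Sum>i<N. e i * \<Delta> f (\<omega> i)\<bar> > 4 * t * sqrt (real N)} \<le>
     outer_measure_of M (?A \<union> ?B)" by (rule outer_measure_of_mono)
  also have "\<dots> \<le> outer_measure_of M ?A + outer_measure_of M ?B" by (rule outer_measure_of_Un_le) auto
  also have "\<dots> \<le> ennreal (2 * \<eta>) + ennreal (2 * \<eta>)"
    unfolding R_def
    by (rule add_mono[OF subset_tail_uniform[OF tail fin(1) card(1) N t] subset_tail_uniform[OF tail fin(2) card(2) N t]])
  also have "\<dots> = ennreal (4 * \<eta>)" using t by (simp flip: ennreal_plus)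
  finally show ?thesis .
qed

text \<open>Markov's inequality at level 1/12 turns \<open>4 * \<eta>\<close> into
  \<open>48 * \<eta>\<close>. The level 1/12 suits \<open>rad_quantile_variance\<close> and lies
  below the 1/4 of \<open>rad_mean_le\<close>, so one event serves both.\<close>

lemma rad_tail:
  fixes \<Delta> :: "'j \<Rightarrow> 'z \<Rightarrow> real"
  assumes tail: "\<And>n. n \<ge> N0 \<Longrightarrow>
      outer_measure_of M {\<omega> \<in> space M. \<exists>f\<in>J. \<bar>\<Sum>i<n. \<Delta> f (\<omega> i)\<bar> > t * sqrt (real n)} \<le> ennreal \<eta>"
    and N: "2 * N0 \<le> N" and t: "t \<ge> 0" "\<eta> \<ge> 0"
  shows "outer_measure_of M {\<omega> \<in> space M.
      rad N (\<lambda>e. of_bool (\<exists>f\<in>J. \<bar>\<Sum>i<N. e i * \<Delta> f (\<omega> i)\<bar> > 4 * t * sqrt (real N))) (\<lambda>_. 0) \<ge> (1/12 :: real)}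
    \<le> ennreal (48 * \<eta>)"
proof -
  define B where "B e = {\<omega> \<in> space M. \<exists>f\<in>J. \<bar>\<Sum>i<N. e i * \<Delta> f (\<omega> i)\<bar> > 4 * t * sqrt (real N)}" for e
  have "outer_measure_of M {\<omega> \<in> space M. rad N (\<lambda>e. of_bool (\<omega> \<in> B e)) (\<lambda>_. 0) \<ge> (1/12 :: real)} \<le> ennreal (4 * \<eta> / (1/12))"
  proof (rule outer_measure_rad_le[OF prob_space_M])
    show "outer_measure_of M (B e) \<le> ennreal (4 * \<eta>)" if "\<forall>i<N. e i = 1 \<or> e i = - 1" for e
      unfolding B_def by (rule sign_tail[OF tail N t that])
  qed (use t in \<open>auto simp: B_def\<close>)
  moreover have "{\<omega> \<in> space M. rad N (\<lambda>e. of_bool (\<omega> \<in> B e)) (\<lambda>_. 0) \<ge> (1/12 :: real)} =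
    {\<omega> \<in> space M. rad N (\<lambda>e. of_bool (\<exists>f\<in>J. \<bar>\<Sum>i<N. e i * \<Delta> f (\<omega> i)\<bar> > 4 * t * sqrt (real N))) (\<lambda>_. 0) \<ge> (1/12 :: real)}"
    by (intro Collect_cong conj_cong refl arg_cong2[where f="(\<le>)"] two_pt_cong) (simp add: B_def)
  ultimately show ?thesis by simp
qed

end

subsection \<open>A trigonometric partition of unity\<close>

text \<open>Binomial expansion of the 2m-th power of cos(x/2); all frequencies lie between -m and
  m.\<close>

lemma cos_sq_power_cis:
  "complex_of_real (((1 + cos x) / 2) ^ m) =
     (\<Sum>r\<le>2 * m. of_nat ((2 * m) choose r) * cis (x * (real r - real m))) / 4 ^ m"
proof -
  have "complex_of_real ((1 + cos x) / 2) = (cis (x / 2) + cis (- (x / 2)))\<^sup>2 / 4"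
  proof -
    have "cis (x / 2) + cis (- (x / 2)) = complex_of_real (2 * cos (x / 2))"
      by (simp add: complex_eq_iff)
    moreover have "(1 + cos x) / 2 = (cos (x / 2))\<^sup>2" using cos_double_cos[of "x/2"] by simp
    ultimately show ?thesis by (simp add: power_mult_distrib)
  qed
  then have "complex_of_real (((1 + cos x) / 2) ^ m) = (cis (x / 2) + cis (- (x / 2))) ^ (2 * m) / 4 ^ m"
    unfolding of_real_power by (simp only: power_mult power_divide)
  also have "(cis (x / 2) + cis (- (x / 2))) ^ (2 * m) =
     (\<Sum>r\<le>2 * m. of_nat ((2 * m) choose r) * cis (x / 2) ^ r * cis (- (x / 2)) ^ (2 * m - r))"
    by (rule binomial_ring)
  also have "\<dots> = (\<Sum>r\<le>2 * m. of_nat ((2 * m) choose r) * cis (x * (real r - real m)))"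
  proof (intro sum.cong refl)
    fix r assume "r \<in> {..2 * m}"
    then have "real r * (x / 2) + real (2 * m - r) * (- (x / 2)) = x * (real r - real m)"
      by (simp add: of_nat_diff field_simps)
    then have "cis (x / 2) ^ r * cis (- (x / 2)) ^ (2 * m - r) = cis (x * (real r - real m))"
      unfolding Complex.DeMoivre cis_mult by (simp only:)
    then show "of_nat ((2 * m) choose r) * cis (x / 2) ^ r * cis (- (x / 2)) ^ (2 * m - r) =
      of_nat ((2 * m) choose r) * cis (x * (real r - real m))" by (simp add: mult.assoc)
  qed
  finally show ?thesis .
qed

lemma sum_roots_of_unity:
  fixes k :: int
  assumes "J > 0" "\<bar>k\<bar> < int J" "k \<noteq> 0"
  shows "(\<Sum>j<J. cis (2 * pi * real j / real J * real_of_int k)) = 0"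
proof -
  define z where "z = cis (2 * pi * real_of_int k / real J)"
  have pow: "cis (2 * pi * real j / real J * real_of_int k) = z ^ j" for j
    unfolding z_def Complex.DeMoivre by (simp add: field_simps)
  have zJ: "z ^ J = 1"
  proof -
    have "real J * (2 * pi * real_of_int k / real J) = 2 * pi * real_of_int k" using assms by simp
    then show ?thesis unfolding z_def Complex.DeMoivre by (simp only: cis_multiple_2pi Ints_of_int)
  qed
  have z1: "z \<noteq> 1"
  proof
    assume "z = 1"
    then have "cos (2 * pi * real_of_int k / real J) = 1" by (simp add: z_def complex_eq_iff)
    then obtain n :: int where "2 * pi * real_of_int k / real J = real_of_int n * 2 * pi"
      using cos_one_2pi_int by auto
    then have "real_of_int k = real_of_int n * real J" using assms by (simp add: field_simps)
    then have "real_of_int k = real_of_int (n * int J)" by simp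
    then have "int J dvd k" unfolding of_int_eq_iff by simp
    then show False using dvd_imp_le_int[OF assms(3) \<open>int J dvd k\<close>] assms(2) by linarith
  qed
  show ?thesis unfolding pow using geometric_sum[OF z1, of J] zJ by simp
qed

text \<open>Averaging over \<open>J > m\<close> equally spaced nodes annihilates every nonzero
  frequency of size at most \<open>m\<close>, so only the constant coefficient survives and the sum
  does not depend on \<open>x\<close>.\<close>

lemma sum_cos_sq_power:
  assumes "J > m"
  shows "(\<Sum>j<J. ((1 + cos (x - (2 * pi * real j / real J - pi))) / 2) ^ m) =
     real J * real ((2 * m) choose m) / 4 ^ m"
proof -
  have J: "J > 0" using assms by simp
  define y where "y = x + pi"
  have "complex_of_real (\<Sum>j<J. ((1 + cos (x - (2 * pi * real j / real J - pi))) / 2) ^ m) =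
    (\<Sum>j<J. \<Sum>r\<le>2 * m. of_nat ((2 * m) choose r) * cis ((x - (2 * pi * real j / real J - pi)) * (real r - real m))) / 4 ^ m"
    unfolding of_real_sum cos_sq_power_cis by (simp add: sum_divide_distrib)
  also have "(\<Sum>j<J. \<Sum>r\<le>2 * m. of_nat ((2 * m) choose r) * cis ((x - (2 * pi * real j / real J - pi)) * (real r - real m))) =
    (\<Sum>r\<le>2 * m. of_nat ((2 * m) choose r) * cis (y * (real r - real m)) *
       (\<Sum>j<J. cis (2 * pi * real j / real J * real_of_int (int m - int r))))"
  proof -
    have "cis ((x - (2 * pi * real j / real J - pi)) * (real r - real m)) =
      cis (y * (real r - real m)) * cis (2 * pi * real j / real J * real_of_int (int m - int r))" for j r
    proof -
      define t where "t = 2 * pi * real j / real J"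
      have "(x - (t - pi)) * (real r - real m) = y * (real r - real m) + t * real_of_int (int m - int r)"
        by (simp add: y_def algebra_simps)
      then show ?thesis unfolding t_def[symmetric] cis_mult by (simp only:)
    qed
    then show ?thesis
      unfolding sum_distrib_left by (subst sum.swap) (simp only: mult.assoc)
  qed
  also have "\<dots> = (\<Sum>r\<le>2 * m. if r = m then of_nat ((2 * m) choose m) * of_nat J else 0)"
  proof (intro sum.cong refl)
    fix r assume r: "r \<in> {..2 * m}"
    show "of_nat ((2 * m) choose r) * cis (y * (real r - real m)) *
       (\<Sum>j<J. cis (2 * pi * real j / real J * real_of_int (int m - int r))) =
       (if r = m then of_nat ((2 * m) choose m) * of_nat J else 0)"
    proof (cases "r = m")
      case False
      have "(\<Sum>j<J. cis (2 * pi * real j / real J * real_of_int (int m - int r))) = 0"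
        using r False assms by (intro sum_roots_of_unity J) auto
      then show ?thesis using False by simp
    qed simp
  qed
  also have "\<dots> = of_nat ((2 * m) choose m) * of_nat J" by simp
  finally have "complex_of_real (\<Sum>j<J. ((1 + cos (x - (2 * pi * real j / real J - pi))) / 2) ^ m) =
     complex_of_real (real J * real ((2 * m) choose m) / 4 ^ m)" by simp
  then show ?thesis by (simp only: of_real_eq_iff)
qed

lemma central_binomial_ratio:
  "real ((2 * Suc m) choose Suc m) / 4 ^ Suc m = (1 - 1 / (2 * real m + 2)) * (real ((2 * m) choose m) / 4 ^ m)"
proof -
  have 1: "real ((2 * k) choose k) = fact (2 * k) / (fact k * fact k)" for k
    by (subst binomial_fact) (auto simp: mult_2)
  show ?thesis unfolding 1
    by (simp add: divide_simps) (simp add: algebra_simps)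
qed

text \<open>Since sin(z/2)^2 = 1 - (1 + cos z)/2, the sum is a difference of two consecutive powers,
  and the ratio of central binomial coefficients gives the factor 1/(2m + 2). The power
  \<open>Suc m\<close> is the source of \<open>J > Suc m\<close>.\<close>

lemma sum_cos_sq_power_sin:
  assumes "J > Suc m"
  shows "(\<Sum>j<J. ((1 + cos (x - (2 * pi * real j / real J - pi))) / 2) ^ m *
        (sin ((x - (2 * pi * real j / real J - pi)) / 2))\<^sup>2) =
     real J * real ((2 * m) choose m) / 4 ^ m / (2 * real m + 2)"
proof -
  have half: "(sin (z / 2))\<^sup>2 = 1 - (1 + cos z) / 2" for z :: real
    using cos_double_sin[of "z/2"] by (simp add: field_simps)
  have *: "((1 + cos z) / 2) ^ m * (sin (z / 2))\<^sup>2 = ((1 + cos z) / 2) ^ m - ((1 + cos z) / 2) ^ Suc m" for z :: real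
    unfolding half by (simp add: algebra_simps)
  show ?thesis
    unfolding * sum_subtractf using assms
    by (subst (1 2) sum_cos_sq_power) (simp_all only: central_binomial_ratio mult.assoc[symmetric] times_divide_eq_right[symmetric], simp_all add: algebra_simps)
qed

text \<open>The de la Vallee Poussin kernel, translated to \<open>m + 2\<close> equally spaced nodes
  in [-pi, pi) and normalized to sum to 1. With \<open>m + 2\<close> nodes the summation formulas
  for the powers \<open>m\<close> and \<open>Suc m\<close> are both exact.\<close>

definition trig_kernel :: "nat \<Rightarrow> nat \<Rightarrow> real \<Rightarrow> real" where
  "trig_kernel m j x = ((1 + cos (x - (2 * pi * real j / real (m + 2) - pi))) / 2) ^ m /
     (real (m + 2) * real ((2 * m) choose m) / 4 ^ m)"

lemma trig_kernel_nonneg: "trig_kernel m j x \<ge> 0"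
proof -
  have "1 + cos z \<ge> 0" for z :: real using cos_ge_minus_one[of z] by linarith
  then show ?thesis unfolding trig_kernel_def by (intro divide_nonneg_nonneg zero_le_power) auto
qed

lemma trig_kernel_sum: "(\<Sum>j<m + 2. trig_kernel m j x) = 1"
proof -
  have "real (m + 2) * real ((2 * m) choose m) / 4 ^ m \<noteq> 0" by simp
  then show ?thesis
    unfolding trig_kernel_def sum_divide_distrib[symmetric]
    by (subst sum_cos_sq_power) auto
qed

text \<open>Chebyshev's inequality with the squared sine of half the distance in place of the
  squared distance.\<close>

lemma trig_kernel_concentration:
  assumes "\<delta> > 0" "\<epsilon> > 0"
  obtains m where "\<And>x. \<bar>x\<bar> \<le> 1 \<Longrightarrow>
    (\<Sum>j<m + 2. trig_kernel m j x * of_bool (\<bar>x - (2 * pi * real j / real (m + 2) - pi)\<bar> > \<delta>)) \<le> \<epsilon>"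
proof -
  \<comment> \<open>For |x| \<le> 1 and a node in [-pi, pi), half the distance is at most (pi + 1)/2
    < pi, so the sine vanishes only at distance 0 and periodicity causes no second peak; compactness
    gives the lower bound \<open>s\<close>.\<close>
  obtain s where s: "s > 0" "\<And>y. \<delta> / 2 \<le> y \<Longrightarrow> y \<le> (pi + 1) / 2 \<Longrightarrow> s \<le> (sin y)\<^sup>2"
  proof (cases "{\<delta> / 2..(pi + 1) / 2} = {}")
    case True
    then show ?thesis using that[of 1] by auto
  next
    case False
    have "continuous_on {\<delta> / 2..(pi + 1) / 2} (\<lambda>y. (sin y)\<^sup>2)" by (intro continuous_intros)
    then obtain y0 where y0: "y0 \<in> {\<delta> / 2..(pi + 1) / 2}" "\<And>y. y \<in> {\<delta> / 2..(pi + 1) / 2} \<Longrightarrow> (sin y0)\<^sup>2 \<le> (sin y)\<^sup>2"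
      using continuous_attains_inf[OF compact_Icc False] by blast
    have "sin y0 > 0" using y0(1) assms pi_gt3 by (intro sin_gt_zero) auto
    then show ?thesis using y0 by (intro that[of "(sin y0)\<^sup>2"]) auto
  qed
  obtain m :: nat where m: "real m \<ge> 1 / (s * \<epsilon>)" using real_arch_simple by blast
  then have m: "1 / (2 * real m + 2) \<le> s * \<epsilon>"
  proof -
    have "1 \<le> s * \<epsilon> * real m" using m s assms by (simp add: field_simps)
    also have "\<dots> \<le> s * \<epsilon> * (2 * real m + 2)" using s assms by (intro mult_left_mono) auto
    finally show ?thesis by (simp add: field_simps)
  qed
  show thesis
  proof (rule that)
    fix x :: real assume x: "\<bar>x\<bar> \<le> 1"
    let ?c = "\<lambda>j. 2 * pi * real j / real (m + 2) - pi"
    have "s * (\<Sum>j<m + 2. trig_kernel m j x * of_bool (\<bar>x - ?c j\<bar> > \<delta>)) \<le>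
       (\<Sum>j<m + 2. trig_kernel m j x * (sin ((x - ?c j) / 2))\<^sup>2)"
      unfolding sum_distrib_left
    proof (intro sum_mono)
      fix j assume j: "j \<in> {..<m + 2}"
      show "s * (trig_kernel m j x * of_bool (\<bar>x - ?c j\<bar> > \<delta>)) \<le> trig_kernel m j x * (sin ((x - ?c j) / 2))\<^sup>2"
      proof (cases "\<bar>x - ?c j\<bar> > \<delta>")
        case True
        have "0 \<le> real j / real (m + 2)" "real j / real (m + 2) \<le> 1" using j by (auto simp: field_simps)
        then have "0 \<le> 2 * pi * (real j / real (m + 2))" "2 * pi * (real j / real (m + 2)) \<le> 2 * pi * 1"
          by (intro mult_nonneg_nonneg mult_left_mono; simp)+
        moreover have "?c j = 2 * pi * (real j / real (m + 2)) - pi" by simp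
        ultimately have "\<bar>x - ?c j\<bar> \<le> pi + 1" using x by (simp only: abs_le_iff) linarith
        then have "s \<le> (sin (\<bar>x - ?c j\<bar> / 2))\<^sup>2" using True by (intro s) auto
        also have "\<dots> = (sin ((x - ?c j) / 2))\<^sup>2"
          by (cases "x - ?c j \<ge> 0") (simp_all add: abs_if minus_divide_left[symmetric] del: minus_diff_eq)
        finally have "s * trig_kernel m j x \<le> (sin ((x - ?c j) / 2))\<^sup>2 * trig_kernel m j x"
          by (rule mult_right_mono) (rule trig_kernel_nonneg)
        then show ?thesis using True by (simp add: mult.commute)
      qed (simp add: trig_kernel_nonneg)
    qed
    also have "\<dots> = 1 / (2 * real m + 2)"
    proof -
      define C where "C = real (m + 2) * real ((2 * m) choose m) / 4 ^ m"
      have suc: "Suc m < m + 2" by simp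
      have "C \<noteq> 0" by (simp add: C_def)
      then have "C / (2 * real m + 2) / C = 1 / (2 * real m + 2)" by simp
      then show ?thesis
        unfolding trig_kernel_def times_divide_eq_left sum_divide_distrib[symmetric]
          sum_cos_sq_power_sin[OF suc] C_def[symmetric] .
    qed
    also have "\<dots> \<le> s * \<epsilon>" by (rule m)
    finally show "(\<Sum>j<m + 2. trig_kernel m j x * of_bool (\<bar>x - ?c j\<bar> > \<delta>)) \<le> \<epsilon>"
      using s(1) by (simp only: mult_le_cancel_left_pos)
  qed
qed

subsection \<open>Trigonometric polynomials in finitely many coordinates\<close>

text \<open>A cosine with free phase covers sines and constants, so combinations of characters are
  treated without leaving the reals. Expectations of these generators are exactly what the limit
  theorems deliver.\<close>

inductive trig_poly :: "'f set \<Rightarrow> (('f \<Rightarrow> real) \<Rightarrow> real) \<Rightarrow> bool" for A where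
  cos: "trig_poly A (\<lambda>u. a * cos ((\<Sum>f\<in>A. t f * u f) + b))"
| add: "trig_poly A \<phi> \<Longrightarrow> trig_poly A \<psi> \<Longrightarrow> trig_poly A (\<lambda>u. \<phi> u + \<psi> u)"

lemma trig_poly_const: "trig_poly A (\<lambda>_. c)"
  using trig_poly.cos[of A c "\<lambda>_. 0" 0] by simp

text \<open>Product-to-sum formula: cos X cos Y is half of cos(X - Y) + cos(X + Y).\<close>

lemma trig_poly_mult:
  assumes "trig_poly A \<phi>" "trig_poly A \<psi>"
  shows "trig_poly A (\<lambda>u. \<phi> u * \<psi> u)"
  using assms
proof (induction rule: trig_poly.induct)
  case (cos a t b)
  from cos show ?case
  proof (induction rule: trig_poly.induct)
    case (cos a' t' b')
    have "(\<lambda>u. a * cos ((\<Sum>f\<in>A. t f * u f) + b) * (a' * cos ((\<Sum>f\<in>A. t' f * u f) + b'))) =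
      (\<lambda>u. a * a' / 2 * cos ((\<Sum>f\<in>A. (t f - t' f) * u f) + (b - b')) +
           a * a' / 2 * cos ((\<Sum>f\<in>A. (t f + t' f) * u f) + (b + b')))"
    proof
      fix u
      define X where "X = (\<Sum>f\<in>A. t f * u f) + b"
      define Y where "Y = (\<Sum>f\<in>A. t' f * u f) + b'"
      have 1: "(\<Sum>f\<in>A. (t f - t' f) * u f) + (b - b') = X - Y"
        "(\<Sum>f\<in>A. (t f + t' f) * u f) + (b + b') = X + Y"
        by (simp_all add: X_def Y_def algebra_simps sum.distrib sum_subtractf)
      have "a * cos X * (a' * cos Y) = a * a' / 2 * cos (X - Y) + a * a' / 2 * cos (X + Y)"
        by (simp add: cos_add cos_diff algebra_simps)
      then show "a * cos ((\<Sum>f\<in>A. t f * u f) + b) * (a' * cos ((\<Sum>f\<in>A. t' f * u f) + b')) =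
         a * a' / 2 * cos ((\<Sum>f\<in>A. (t f - t' f) * u f) + (b - b')) +
           a * a' / 2 * cos ((\<Sum>f\<in>A. (t f + t' f) * u f) + (b + b'))"
        unfolding 1 X_def[symmetric] Y_def[symmetric] .
    qed
    then show ?case by (simp only:) (intro trig_poly.intros)
  next
    case (add \<phi> \<psi>)
    then show ?case by (simp only: distrib_left) (intro trig_poly.intros)
  qed
next
  case (add \<phi> \<psi>')
  have "trig_poly A (\<lambda>u. \<phi> u * \<psi> u + \<psi>' u * \<psi> u)"
    using add by (intro trig_poly.add) auto
  then show ?case by (simp only: distrib_right)
qed

lemma trig_poly_power: "trig_poly A \<phi> \<Longrightarrow> trig_poly A (\<lambda>u. \<phi> u ^ n)"
  by (induction n) (auto intro: trig_poly_const trig_poly_mult)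

lemma trig_poly_prod:
  "(\<And>i. i \<in> I \<Longrightarrow> trig_poly A (\<phi> i)) \<Longrightarrow> trig_poly A (\<lambda>u. \<Prod>i\<in>I. \<phi> i u)"
  by (induction I rule: infinite_finite_induct) (auto intro: trig_poly_const trig_poly_mult)

lemma trig_poly_trig_kernel:
  assumes "finite A" "f \<in> A"
  shows "trig_poly A (\<lambda>u. trig_kernel m j (u f / R))"
proof -
  define x where "x = 2 * pi * real j / real (m + 2) - pi"
  define D where "D = real (m + 2) * real ((2 * m) choose m) / 4 ^ m"
  define C where "C = inverse D"
  have "(\<Sum>g\<in>A. (if g = f then 1 / R else 0) * u g) = u f / R" for u :: "'a \<Rightarrow> real"
    using assms by (simp add: if_distrib[of "\<lambda>z. z * _"] cong: if_cong)
  then have "trig_poly A (\<lambda>u. 1/2 * cos (u f / R + - x))"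
    using trig_poly.cos[of A "1/2" "\<lambda>g. if g = f then 1 / R else 0" "- x"] by simp
  then have "trig_poly A (\<lambda>u. C * (1/2 + 1/2 * cos (u f / R + - x)) ^ m)"
    by (rule trig_poly_mult[OF trig_poly_const trig_poly_power[OF trig_poly.add[OF trig_poly_const]]])
  moreover have "(\<lambda>u. C * (1/2 + 1/2 * cos (u f / R + - x)) ^ m) = (\<lambda>u. trig_kernel m j (u f / R))"
  proof
    fix u :: "'a \<Rightarrow> real"
    have "1/2 + 1/2 * cos (u f / R + - x) = (1 + cos (u f / R - x)) / 2" by (simp add: add_divide_distrib)
    moreover have "C * z = z / D" for z by (simp add: C_def divide_inverse mult.commute)
    ultimately show "C * (1/2 + 1/2 * cos (u f / R + - x)) ^ m = trig_kernel m j (u f / R)"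
      unfolding trig_kernel_def x_def[symmetric] D_def[symmetric] by (simp only:)
  qed
  ultimately show ?thesis by simp
qed

subsection \<open>Convergence of expectations of Lipschitz functions\<close>

text \<open>Lipschitz for the maximal distance over the coordinates in \<open>A\<close>, with
  \<open>d\<close> as any bound of that distance; the case \<open>d = 0\<close> shows that only
  those coordinates matter.\<close>

definition lip_coord :: "'f set \<Rightarrow> (('f \<Rightarrow> real) \<Rightarrow> real) \<Rightarrow> bool" where
  "lip_coord A k \<longleftrightarrow> (\<forall>u. 0 \<le> k u \<and> k u \<le> 1) \<and>
     (\<forall>u v d. 0 \<le> d \<and> (\<forall>f\<in>A. \<bar>u f - v f\<bar> \<le> d) \<longrightarrow> \<bar>k u - k v\<bar> \<le> d)"

text \<open>A positive normalized linear functional on all functions, measurable or not; the design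
  mean at fixed data and its images under maps are of this kind.\<close>

locale expectation_functional =
  fixes E :: "('u \<Rightarrow> real) \<Rightarrow> real"
  assumes add: "E (\<lambda>u. \<phi> u + \<psi> u) = E \<phi> + E \<psi>"
    and scale: "E (\<lambda>u. c * \<phi> u) = c * E \<phi>"
    and mono: "(\<And>u. \<phi> u \<le> \<psi> u) \<Longrightarrow> E \<phi> \<le> E \<psi>"
    and one: "E (\<lambda>_. 1) = 1"
begin

lemma const: "E (\<lambda>_. c) = c"
  using scale[of c "\<lambda>_. 1"] one by simp

lemma sum: "E (\<lambda>u. \<Sum>j\<in>J. \<phi> j u) = (\<Sum>j\<in>J. E (\<phi> j))"
  by (induction J rule: infinite_finite_induct) (auto simp: add const)

lemma uminus: "E (\<lambda>u. - \<phi> u) = - E \<phi>"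
  using scale[of "-1" \<phi>] by simp

lemma diff: "E (\<lambda>u. \<phi> u - \<psi> u) = E \<phi> - E \<psi>"
  using add[of \<phi> "\<lambda>u. - \<psi> u"] uminus[of \<psi>] by simp

lemma abs_diff_le:
  assumes "\<And>u. \<bar>\<phi> u - \<psi> u\<bar> \<le> \<xi> u"
  shows "\<bar>E \<phi> - E \<psi>\<bar> \<le> E \<xi>"
proof -
  have "E (\<lambda>u. \<phi> u - \<psi> u) \<le> E \<xi>" "E (\<lambda>u. - \<xi> u) \<le> E (\<lambda>u. \<phi> u - \<psi> u)"
    using assms by (auto intro!: mono simp: abs_le_iff) (smt (verit) assms)
  then show ?thesis by (simp add: diff uminus)
qed

end

text \<open>The values of \<open>k\<close> at grid points are averaged with a partition of unity
  made of products of trigonometric kernels. \<open>I\<close>, \<open>q\<close> and \<open>c\<close>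
  are chosen before \<open>k\<close>, which makes all later limits uniform over \<open>k\<close>.
  Coordinates outside [-R, R], where periodicity spoils the kernel, are paid for by the second
  moment term.\<close>

lemma lip_coord_kernel_approx:
  assumes A: "finite A" and \<epsilon>: "\<epsilon> > 0" and R: "R > 0"
  obtains I :: "('f \<Rightarrow> nat) set" and q :: "('f \<Rightarrow> nat) \<Rightarrow> ('f \<Rightarrow> real) \<Rightarrow> real" and c where
    "finite I" "\<And>j. j \<in> I \<Longrightarrow> trig_poly A (q j)"
    "\<And>k u. lip_coord A k \<Longrightarrow> \<bar>k u - (\<Sum>j\<in>I. k (c j) * q j u)\<bar> \<le> \<epsilon> + (\<Sum>f\<in>A. (u f)\<^sup>2) / R\<^sup>2"
proof -
  \<comment> \<open>Half of \<epsilon> goes to nearby nodes, the other half to the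
    \<open>card A\<close> one-dimensional concentration errors.\<close>
  define \<epsilon>1 where "\<epsilon>1 = \<epsilon> / (2 * (1 + real (card A)))"
  have \<epsilon>1: "\<epsilon>1 > 0" "\<epsilon> / 2 + real (card A) * \<epsilon>1 \<le> \<epsilon>" using \<epsilon> by (auto simp: \<epsilon>1_def field_simps)
  define \<delta> where "\<delta> = \<epsilon> / (2 * R)"
  have \<delta>: "\<delta> > 0" using \<epsilon> R by (simp add: \<delta>_def)
  obtain m where m: "\<And>x. \<bar>x\<bar> \<le> 1 \<Longrightarrow>
    (\<Sum>j<m + 2. trig_kernel m j x * of_bool (\<bar>x - (2 * pi * real j / real (m + 2) - pi)\<bar> > \<delta>)) \<le> \<epsilon>1"
    using trig_kernel_concentration[OF \<delta> \<epsilon>1(1)] by blast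
  define x where "x j = 2 * pi * real j / real (m + 2) - pi" for j
  define I where "I = (A \<rightarrow>\<^sub>E {..<m + 2})"
  define q where "q j u = (\<Prod>f\<in>A. trig_kernel m (j f) (u f / R))" for j :: "'f \<Rightarrow> nat" and u
  define c where "c j = (\<lambda>f. R * x (j f))" for j :: "'f \<Rightarrow> nat"
  have q0: "q j u \<ge> 0" for j u unfolding q_def by (intro prod_nonneg trig_kernel_nonneg)
  have q1: "(\<Sum>j\<in>I. q j u) = 1" for u
  proof -
    have "(\<Sum>j\<in>I. q j u) = (\<Prod>f\<in>A. \<Sum>i<m + 2. trig_kernel m i (u f / R))"
      unfolding q_def I_def using A by (subst prod_sum_PiE) auto
    then show ?thesis unfolding trig_kernel_sum by simp
  qed
  \<comment> \<open>Product structure: the kernels of the other coordinates sum to 1, which leaves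
    the one-dimensional kernel.\<close>
  have marginal: "(\<Sum>j\<in>I. q j u * of_bool (P (j f))) = (\<Sum>i<m + 2. trig_kernel m i (u f / R) * of_bool (P i))"
    if f: "f \<in> A" for f u P
  proof -
    define r where "r g i = trig_kernel m i (u g / R) * (if g = f then of_bool (P i) else 1)" for g i
    have "q j u * of_bool (P (j f)) = (\<Prod>g\<in>A. r g (j g))" for j
      unfolding q_def r_def prod.distrib using A f by simp
    then have "(\<Sum>j\<in>I. q j u * of_bool (P (j f))) = (\<Prod>g\<in>A. \<Sum>i<m + 2. r g i)"
      unfolding I_def using A by (subst prod_sum_PiE) auto
    also have "\<dots> = (\<Sum>i<m + 2. r f i) * (\<Prod>g\<in>A - {f}. \<Sum>i<m + 2. r g i)"
      using A f by (rule prod.remove)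
    also have "(\<Prod>g\<in>A - {f}. \<Sum>i<m + 2. r g i) = (\<Prod>g\<in>A - {f}. 1)"
    proof (intro prod.cong refl)
      fix g assume "g \<in> A - {f}"
      then have "r g i = trig_kernel m i (u g / R)" for i by (simp add: r_def)
      then show "(\<Sum>i<m + 2. r g i) = 1" by (simp only: trig_kernel_sum)
    qed
    finally show ?thesis by (simp add: r_def)
  qed
  show thesis
  proof (rule that[of I q c])
    show "finite I" unfolding I_def using A by (intro finite_PiE) auto
    show "trig_poly A (q j)" for j
      unfolding q_def[abs_def] using A by (intro trig_poly_prod trig_poly_trig_kernel)
    fix k u assume k: "lip_coord A k"
    have k01: "0 \<le> k v" "k v \<le> 1" for v using k unfolding lip_coord_def by auto
    \<comment> \<open>Either the node is within R \<delta> = \<epsilon>/2 of \<open>u\<close> in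
      every coordinate of \<open>A\<close>, or some indicator on the right is 1 and covers the whole
      range of \<open>k\<close>.\<close>
    have pt: "\<bar>k u - k (c j)\<bar> \<le> \<epsilon> / 2 + (\<Sum>f\<in>A. of_bool (\<bar>u f / R - x (j f)\<bar> > \<delta>))" for j
    proof (cases "\<forall>f\<in>A. \<bar>u f / R - x (j f)\<bar> \<le> \<delta>")
      case True
      have "\<bar>u f - c j f\<bar> \<le> \<epsilon> / 2" if "f \<in> A" for f
      proof -
        have "\<bar>u f - c j f\<bar> = R * \<bar>u f / R - x (j f)\<bar>"
        proof -
          have "u f - c j f = R * (u f / R - x (j f))" using R by (simp add: c_def right_diff_distrib)
          then show ?thesis using R by (simp only: abs_mult abs_of_pos)
        qed
        also have "\<dots> \<le> R * \<delta>" using True that R by (intro mult_left_mono) auto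
        finally show ?thesis using R by (simp add: \<delta>_def)
      qed
      then have "\<bar>k u - k (c j)\<bar> \<le> \<epsilon> / 2"
        using conjunct2[OF k[unfolded lip_coord_def], rule_format, of "\<epsilon> / 2" u "c j"] \<epsilon> by simp
      moreover have "0 \<le> (\<Sum>f\<in>A. of_bool (\<bar>u f / R - x (j f)\<bar> > \<delta>) :: real)" by (intro sum_nonneg) auto
      ultimately show ?thesis by linarith
    next
      case False
      then obtain f where f: "f \<in> A" "\<bar>u f / R - x (j f)\<bar> > \<delta>" by auto
      have "(1::real) = of_bool (\<bar>u f / R - x (j f)\<bar> > \<delta>)" using f by simp
      also have "\<dots> \<le> (\<Sum>f\<in>A. of_bool (\<bar>u f / R - x (j f)\<bar> > \<delta>))"
        using A f(1) by (intro member_le_sum) auto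
      finally show ?thesis using k01[of u] k01[of "c j"] \<epsilon> by (simp add: abs_le_iff)
    qed
    have "k u - (\<Sum>j\<in>I. k (c j) * q j u) = (\<Sum>j\<in>I. q j u * (k u - k (c j)))"
    proof -
      have "(\<Sum>j\<in>I. q j u * (k u - k (c j))) = (\<Sum>j\<in>I. q j u) * k u - (\<Sum>j\<in>I. k (c j) * q j u)"
        unfolding right_diff_distrib sum_subtractf sum_distrib_right by (simp only: mult.commute)
      then show ?thesis by (simp add: q1)
    qed
    then have "\<bar>k u - (\<Sum>j\<in>I. k (c j) * q j u)\<bar> \<le> (\<Sum>j\<in>I. q j u * \<bar>k u - k (c j)\<bar>)"
      using q0 by (simp add: order_trans[OF sum_abs] abs_mult)
    also have "\<dots> \<le> (\<Sum>j\<in>I. q j u * (\<epsilon> / 2 + (\<Sum>f\<in>A. of_bool (\<bar>u f / R - x (j f)\<bar> > \<delta>))))"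
      by (intro sum_mono mult_left_mono pt q0)
    also have "\<dots> = \<epsilon> / 2 + (\<Sum>f\<in>A. \<Sum>j\<in>I. q j u * of_bool (\<bar>u f / R - x (j f)\<bar> > \<delta>))"
    proof -
      have "(\<Sum>j\<in>I. q j u * (\<epsilon> / 2)) = \<epsilon> / 2" by (simp only: sum_distrib_right[symmetric] q1 mult_1_left)
      then show ?thesis
        unfolding distrib_left sum.distrib sum_distrib_left by (subst (2) sum.swap) (simp only:)
    qed
    also have "\<dots> \<le> \<epsilon> / 2 + (\<Sum>f\<in>A. \<epsilon>1 + (u f)\<^sup>2 / R\<^sup>2)"
    proof (intro add_left_mono sum_mono)
      fix f assume f: "f \<in> A"
      have e: "(\<Sum>j\<in>I. q j u * of_bool (\<bar>u f / R - x (j f)\<bar> > \<delta>)) =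
        (\<Sum>i<m + 2. trig_kernel m i (u f / R) * of_bool (\<bar>u f / R - x i\<bar> > \<delta>))"
        by (rule marginal[OF f])
      show "(\<Sum>j\<in>I. q j u * of_bool (\<bar>u f / R - x (j f)\<bar> > \<delta>)) \<le> \<epsilon>1 + (u f)\<^sup>2 / R\<^sup>2"
      proof (cases "\<bar>u f / R\<bar> \<le> 1")
        case True
        have "(u f)\<^sup>2 / R\<^sup>2 \<ge> 0" by simp
        then show ?thesis unfolding e using m[OF True] unfolding x_def by linarith
      next
        case False
        have "(\<Sum>i<m + 2. trig_kernel m i (u f / R) * of_bool (\<bar>u f / R - x i\<bar> > \<delta>)) \<le>
          (\<Sum>i<m + 2. trig_kernel m i (u f / R) * 1)"
          by (intro sum_mono mult_left_mono trig_kernel_nonneg) auto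
        also have "\<dots> = 1" by (simp only: mult_1_right trig_kernel_sum)
        also have "1 \<le> \<bar>u f / R\<bar>\<^sup>2" using False by (intro one_le_power) auto
        also have "\<dots> = (u f)\<^sup>2 / R\<^sup>2" by (simp add: power_divide)
        finally show ?thesis unfolding e using \<epsilon>1 by linarith
      qed
    qed
    also have "\<dots> \<le> \<epsilon> + (\<Sum>f\<in>A. (u f)\<^sup>2) / R\<^sup>2"
      using \<epsilon>1(2) by (simp add: sum.distrib sum_divide_distrib)
    finally show "\<bar>k u - (\<Sum>j\<in>I. k (c j) * q j u)\<bar> \<le> \<epsilon> + (\<Sum>f\<in>A. (u f)\<^sup>2) / R\<^sup>2" .
  qed
qed

text \<open>Only the finitely many trigonometric polynomials of
  \<open>lip_coord_kernel_approx\<close> have to converge. Their coefficients \<open>k (c j)\<close>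
  lie in [0, 1], so the bound holds for all \<open>k\<close> at once; second moments control the
  approximation error on both sides.\<close>

theorem lip_coord_convergence:
  fixes E :: "'x \<Rightarrow> (('f \<Rightarrow> real) \<Rightarrow> real) \<Rightarrow> real" and W :: "'w \<Rightarrow> 'f \<Rightarrow> real"
  assumes A: "finite A" and E: "\<And>x. expectation_functional (E x)" and Q: "prob_space Q"
    and W: "\<And>f. f \<in> A \<Longrightarrow> (\<lambda>s. W s f) \<in> borel_measurable Q"
      "\<And>f. f \<in> A \<Longrightarrow> integrable Q (\<lambda>s. (W s f)\<^sup>2)"
    and moment: "\<And>f. f \<in> A \<Longrightarrow> \<exists>B. \<forall>\<^sub>F x in Fl. E x (\<lambda>u. (u f)\<^sup>2) \<le> B"
    and char: "\<And>t b. ((\<lambda>x. E x (\<lambda>u. cos ((\<Sum>f\<in>A. t f * u f) + b))) \<longlongrightarrow>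
        (\<integral>s. cos ((\<Sum>f\<in>A. t f * W s f) + b) \<partial>Q)) Fl"
    and \<epsilon>: "\<epsilon> > 0"
  shows "\<forall>\<^sub>F x in Fl. \<forall>k. lip_coord A k \<and> (\<lambda>s. k (W s)) \<in> borel_measurable Q \<longrightarrow>
     \<bar>E x k - (\<integral>s. k (W s) \<partial>Q)\<bar> \<le> \<epsilon>"
proof -
  interpret Q: prob_space Q by fact
  have trig: "integrable Q (\<lambda>s. \<phi> (W s)) \<and> ((\<lambda>x. E x \<phi>) \<longlongrightarrow> (\<integral>s. \<phi> (W s) \<partial>Q)) Fl" if "trig_poly A \<phi>" for \<phi>
    using that
  proof (induction rule: trig_poly.induct)
    case (cos a t b)
    have [measurable]: "(\<lambda>s. \<Sum>f\<in>A. t f * W s f) \<in> borel_measurable Q"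
      using W by (intro borel_measurable_sum borel_measurable_times) auto
    have "integrable Q (\<lambda>s. a * cos ((\<Sum>f\<in>A. t f * W s f) + b))"
      by (intro integrable_mult_right Q.integrable_const_bound[of _ 1]) auto
    moreover have "E x (\<lambda>u. a * cos ((\<Sum>f\<in>A. t f * u f) + b)) = a * E x (\<lambda>u. cos ((\<Sum>f\<in>A. t f * u f) + b))" for x
      by (rule expectation_functional.scale[OF E])
    ultimately show ?case using char[of t b] by (auto intro!: tendsto_mult)
  next
    case (add \<phi> \<psi>)
    then show ?case using expectation_functional.add[OF E] by (auto intro!: tendsto_add)
  qed
  define B where "B f = (SOME B. \<forall>\<^sub>F x in Fl. E x (\<lambda>u. (u f)\<^sup>2) \<le> B)" for f
  have B: "\<forall>\<^sub>F x in Fl. E x (\<lambda>u. (u f)\<^sup>2) \<le> B f" if "f \<in> A" for f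
    unfolding B_def by (rule someI_ex[OF moment[OF that]])
  \<comment> \<open>Dominates the sums of second moments of the functionals and of the limit, so one
    radius \<open>R\<close> serves both.\<close>
  define B' where "B' = (\<Sum>f\<in>A. \<bar>B f\<bar> + (\<integral>s. (W s f)\<^sup>2 \<partial>Q))"
  have B'0: "B' \<ge> 0" unfolding B'_def by (intro sum_nonneg add_nonneg_nonneg) auto
  define R where "R = sqrt (8 * (B' + 1) / \<epsilon>)"
  have R: "R > 0" "R\<^sup>2 = 8 * (B' + 1) / \<epsilon>" using \<epsilon> B'0 by (auto simp: R_def)
  have BR: "B' / R\<^sup>2 \<le> \<epsilon> / 8" unfolding R(2) using \<epsilon> B'0 by (simp add: field_simps)
  obtain I :: "('f \<Rightarrow> nat) set" and q c where Iq: "finite I" "\<And>j. j \<in> I \<Longrightarrow> trig_poly A (q j)"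
    "\<And>k u. lip_coord A k \<Longrightarrow> \<bar>k u - (\<Sum>j\<in>I. k (c j) * q j u)\<bar> \<le> \<epsilon> / 8 + (\<Sum>f\<in>A. (u f)\<^sup>2) / R\<^sup>2"
  proof -
    have "\<epsilon> / 8 > 0" using \<epsilon> by simp
    from lip_coord_kernel_approx[OF A this R(1)] that show thesis by blast
  qed
  have "((\<lambda>x. \<Sum>j\<in>I. \<bar>E x (q j) - (\<integral>s. q j (W s) \<partial>Q)\<bar>) \<longlongrightarrow> (\<Sum>j\<in>I. \<bar>(\<integral>s. q j (W s) \<partial>Q) - (\<integral>s. q j (W s) \<partial>Q)\<bar>)) Fl"
    using trig Iq(2) by (intro tendsto_intros) blast
  then have "((\<lambda>x. \<Sum>j\<in>I. \<bar>E x (q j) - (\<integral>s. q j (W s) \<partial>Q)\<bar>) \<longlongrightarrow> 0) Fl" by simp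
  then have small: "\<forall>\<^sub>F x in Fl. (\<Sum>j\<in>I. \<bar>E x (q j) - (\<integral>s. q j (W s) \<partial>Q)\<bar>) < \<epsilon> / 2"
    using \<epsilon> by (intro order_tendstoD) auto
  have "\<forall>\<^sub>F x in Fl. \<forall>f\<in>A. E x (\<lambda>u. (u f)\<^sup>2) \<le> B f" using A B by (intro eventually_ball_finite) auto
  with small show ?thesis
  proof eventually_elim
    case (elim x)
    interpret Ex: expectation_functional "E x" by (rule E)
    show ?case
    proof (intro allI impI, elim conjE)
      fix k assume k: "lip_coord A k" and km: "(\<lambda>s. k (W s)) \<in> borel_measurable Q"
      have k01: "0 \<le> k v" "k v \<le> 1" for v using k unfolding lip_coord_def by auto
      define g where "g u = (\<Sum>j\<in>I. k (c j) * q j u)" for u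
      have kg: "\<bar>k u - g u\<bar> \<le> \<epsilon> / 8 + (\<Sum>f\<in>A. (u f)\<^sup>2) / R\<^sup>2" for u
        using Iq(3)[OF k, of u] by (simp add: g_def)
      have 1: "\<bar>E x k - E x g\<bar> \<le> \<epsilon> / 8 + \<epsilon> / 8"
      proof -
        have "\<bar>E x k - E x g\<bar> \<le> E x (\<lambda>u. \<epsilon> / 8 + inverse (R\<^sup>2) * (\<Sum>f\<in>A. (u f)\<^sup>2))"
        proof (rule Ex.abs_diff_le)
          show "\<bar>k u - g u\<bar> \<le> \<epsilon> / 8 + inverse (R\<^sup>2) * (\<Sum>f\<in>A. (u f)\<^sup>2)" for u
            using kg[of u] unfolding divide_inverse[of _ "R\<^sup>2"] mult.commute[of _ "inverse (R\<^sup>2)"] .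
        qed
        also have "\<dots> = \<epsilon> / 8 + inverse (R\<^sup>2) * (\<Sum>f\<in>A. E x (\<lambda>u. (u f)\<^sup>2))"
          by (simp only: Ex.add Ex.scale Ex.const Ex.sum)
        also have "\<dots> = \<epsilon> / 8 + (\<Sum>f\<in>A. E x (\<lambda>u. (u f)\<^sup>2)) / R\<^sup>2"
          unfolding divide_inverse[of _ "R\<^sup>2"] mult.commute[of _ "inverse (R\<^sup>2)"] ..
        also have "(\<Sum>f\<in>A. E x (\<lambda>u. (u f)\<^sup>2)) \<le> B'"
          unfolding B'_def
        proof (intro sum_mono)
          fix f assume "f \<in> A"
          then have "E x (\<lambda>u. (u f)\<^sup>2) \<le> B f" using elim(2) by blast
          moreover have "0 \<le> (\<integral>s. (W s f)\<^sup>2 \<partial>Q)" by simp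
          ultimately show "E x (\<lambda>u. (u f)\<^sup>2) \<le> \<bar>B f\<bar> + (\<integral>s. (W s f)\<^sup>2 \<partial>Q)" by linarith
        qed
        then have "(\<Sum>f\<in>A. E x (\<lambda>u. (u f)\<^sup>2)) / R\<^sup>2 \<le> B' / R\<^sup>2" by (intro divide_right_mono) auto
        finally show ?thesis using BR by linarith
      qed
      have Ig: "integrable Q (\<lambda>s. g (W s))" unfolding g_def using trig Iq(2) by auto
      have Ik: "integrable Q (\<lambda>s. k (W s))" using km k01 by (intro Q.integrable_const_bound[of _ 1]) auto
      have 2: "\<bar>(\<integral>s. k (W s) \<partial>Q) - (\<integral>s. g (W s) \<partial>Q)\<bar> \<le> \<epsilon> / 8 + \<epsilon> / 8"
      proof -
        have "\<bar>(\<integral>s. k (W s) \<partial>Q) - (\<integral>s. g (W s) \<partial>Q)\<bar> = \<bar>\<integral>s. k (W s) - g (W s) \<partial>Q\<bar>" using Ig Ik by simp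
        also have "\<dots> \<le> (\<integral>s. \<bar>k (W s) - g (W s)\<bar> \<partial>Q)" by simp
        also have "\<dots> \<le> (\<integral>s. \<epsilon> / 8 + (\<Sum>f\<in>A. (W s f)\<^sup>2) / R\<^sup>2 \<partial>Q)"
          using Ig Ik W kg by (intro integral_mono) auto
        also have "\<dots> = \<epsilon> / 8 + (\<Sum>f\<in>A. \<integral>s. (W s f)\<^sup>2 \<partial>Q) / R\<^sup>2"
          using W by (simp add: Q.prob_space)
        also have "(\<Sum>f\<in>A. \<integral>s. (W s f)\<^sup>2 \<partial>Q) \<le> B'" unfolding B'_def by (intro sum_mono) auto
        then have "(\<Sum>f\<in>A. \<integral>s. (W s f)\<^sup>2 \<partial>Q) / R\<^sup>2 \<le> B' / R\<^sup>2" by (intro divide_right_mono) auto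
        finally show ?thesis using BR by linarith
      qed
      have 3: "\<bar>E x g - (\<integral>s. g (W s) \<partial>Q)\<bar> \<le> \<epsilon> / 2"
      proof -
        have "E x g - (\<integral>s. g (W s) \<partial>Q) = (\<Sum>j\<in>I. k (c j) * (E x (q j) - (\<integral>s. q j (W s) \<partial>Q)))"
          unfolding g_def[abs_def] using trig Iq(2)
          by (simp add: Ex.sum Ex.scale right_diff_distrib sum_subtractf)
        also have "\<bar>\<dots>\<bar> \<le> (\<Sum>j\<in>I. \<bar>k (c j) * (E x (q j) - (\<integral>s. q j (W s) \<partial>Q))\<bar>)" by (rule sum_abs)
        also have "\<dots> \<le> (\<Sum>j\<in>I. \<bar>E x (q j) - (\<integral>s. q j (W s) \<partial>Q)\<bar>)"
          using k01 by (intro sum_mono) (auto simp: abs_mult intro!: mult_left_le_one_le)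
        finally show ?thesis using elim(1) by linarith
      qed
      show "\<bar>E x k - (\<integral>s. k (W s) \<partial>Q)\<bar> \<le> \<epsilon>" using 1 2 3 by linarith
    qed
  qed
qed

subsection \<open>Centred normal variables\<close>

text \<open>A point mass with mean 0 sits at 0 and fits the formula with variance 0. Otherwise
  standardization leads to the characteristic function of the standard normal law, and the phase
  \<open>b\<close> is a rotation by \<open>cis b\<close> before taking real parts.\<close>

lemma normal_rv_moments:
  assumes M: "prob_space M" and X: "normal_rv M X" and mean: "(\<integral>\<omega>. X \<omega> \<partial>M) = 0"
  shows "integrable M (\<lambda>\<omega>. (X \<omega>)\<^sup>2)"
    and "(\<integral>\<omega>. cos (X \<omega> + b) \<partial>M) = exp (- (\<integral>\<omega>. (X \<omega>)\<^sup>2 \<partial>M) / 2) * cos b"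
proof -
  interpret prob_space M by fact
  have [measurable]: "X \<in> borel_measurable M" using X by (simp add: normal_rv_def)
  have "integrable M (\<lambda>\<omega>. (X \<omega>)\<^sup>2) \<and> (\<integral>\<omega>. cos (X \<omega> + b) \<partial>M) = exp (- (\<integral>\<omega>. (X \<omega>)\<^sup>2 \<partial>M) / 2) * cos b"
  proof (cases "\<exists>m. distr M borel X = return borel m")
    case True
    then obtain m where m: "distr M borel X = return borel m" by blast
    have I: "(\<integral>\<omega>. f (X \<omega>) \<partial>M) = f m" if "f \<in> borel_measurable borel" for f :: "real \<Rightarrow> real"
    proof -
      have "(\<integral>\<omega>. f (X \<omega>) \<partial>M) = (\<integral>x. f x \<partial>distr M borel X)" using that by (simp add: integral_distr)
      then show ?thesis using that by (simp add: m integral_return)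
    qed
    have m0: "m = 0" using I[of "\<lambda>x. x"] mean by simp
    have "AE \<omega> in M. X \<omega> = 0"
    proof -
      have "AE x in return borel m. x = 0" by (subst AE_return) (auto simp: m0)
      then have "AE x in distr M borel X. x = 0" by (simp only: m)
      then show ?thesis by (subst (asm) AE_distr_iff) auto
    qed
    then have ae: "AE \<omega> in M. (X \<omega>)\<^sup>2 = 0" by eventually_elim simp
    have "integrable M (\<lambda>\<omega>. (X \<omega>)\<^sup>2) \<longleftrightarrow> integrable M (\<lambda>\<omega>. 0 :: real)"
      using ae by (intro integrable_cong_AE) auto
    moreover have "(\<integral>\<omega>. cos (X \<omega> + b) \<partial>M) = cos b" using I[of "\<lambda>x. cos (x + b)"] m0 by simp
    moreover have "(\<integral>\<omega>. (X \<omega>)\<^sup>2 \<partial>M) = 0" using I[of "\<lambda>x. x\<^sup>2"] m0 by simp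
    ultimately show ?thesis by simp
  next
    case False
    then obtain m \<sigma> where d: "\<sigma> > 0" "distributed M lborel X (normal_density m \<sigma>)"
      using X unfolding normal_rv_def by blast
    have m0: "m = 0" using normal_distributed_expectation[OF d(1) d(2)] mean by simp
    have sq: "(\<integral>\<omega>. (X \<omega>)\<^sup>2 \<partial>M) = \<sigma>\<^sup>2" using normal_distributed_variance[OF d] mean by simp
    have intsq: "integrable M (\<lambda>\<omega>. (X \<omega>)\<^sup>2)"
    proof -
      have "integrable lborel (\<lambda>x. normal_density m \<sigma> x * x\<^sup>2)"
        using integrable_normal_moment[OF d(1), of m 2] m0 by simp
      then show ?thesis
        by (subst distributed_integrable[OF d(2), symmetric]) (auto simp: normal_density_nonneg)
    qed
    define Z where "Z \<omega> = X \<omega> / \<sigma>" for \<omega>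
    have [measurable]: "Z \<in> borel_measurable M" unfolding Z_def by measurable
    have "distributed M lborel Z std_normal_density"
      using normal_standard_normal_convert[OF d(1), of X m] d(2) m0 by (simp add: Z_def[abs_def])
    then have dZ: "distr M borel Z = std_normal_distribution"
      by (simp add: distributed_def cong: distr_cong)
    have XZ: "X \<omega> = \<sigma> * Z \<omega>" for \<omega> using d(1) by (simp add: Z_def)
    have ch: "(CLINT \<omega>|M. iexp (X \<omega>)) = exp (- (\<sigma>\<^sup>2) / 2)"
    proof -
      have "(CLINT \<omega>|M. iexp (X \<omega>)) = (CLINT \<omega>|M. iexp (\<sigma> * Z \<omega>))" by (simp add: XZ)
      also have "\<dots> = (CLINT x|distr M borel Z. iexp (\<sigma> * x))" by (subst integral_distr) auto
      also have "\<dots> = char std_normal_distribution \<sigma>" by (simp add: dZ char_def)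
      finally show ?thesis by (simp add: char_std_normal_distribution exp_of_real)
    qed
    have int: "complex_integrable M (\<lambda>\<omega>. iexp (X \<omega>))"
      by (intro integrable_const_bound[of _ 1]) auto
    have "(\<integral>\<omega>. cos (X \<omega> + b) \<partial>M) = (\<integral>\<omega>. Re (cis b * iexp (X \<omega>)) \<partial>M)"
      by (intro Bochner_Integration.integral_cong refl) (simp add: cis_conv_exp[symmetric] cis_mult add.commute)
    also have "\<dots> = Re (CLINT \<omega>|M. cis b * iexp (X \<omega>))"
      using int by (intro integral_Re integrable_mult_right)
    also have "\<dots> = Re (cis b * exp (- (\<sigma>\<^sup>2) / 2))" using ch by simp
    also have "\<dots> = exp (- (\<sigma>\<^sup>2) / 2) * cos b"
      by (simp add: mult.commute)
    finally show ?thesis using intsq sq by simp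
  qed
  then show "integrable M (\<lambda>\<omega>. (X \<omega>)\<^sup>2)"
    "(\<integral>\<omega>. cos (X \<omega> + b) \<partial>M) = exp (- (\<integral>\<omega>. (X \<omega>)\<^sup>2 \<partial>M) / 2) * cos b" by auto
qed

subsection \<open>A central limit theorem for Poisson sampling of fixed values\<close>

text \<open>The smaller of the quadratic and the cubic remainder; the truncation at 1 allows a
  Lindeberg argument with second moments only.\<close>

lemma iexp_second_order:
  "cmod (iexp x - (1 + \<i> * x - x\<^sup>2 / 2)) \<le> x\<^sup>2 * min 1 \<bar>x\<bar>"
proof -
  have s: "(\<Sum>k\<le>2. (\<i> * complex_of_real x) ^ k / fact k) = 1 + \<i> * x - x\<^sup>2 / 2"
    by (simp add: numeral_2_eq_2 power2_eq_square algebra_simps)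
  have 1: "cmod (iexp x - (1 + \<i> * x - x\<^sup>2 / 2)) \<le> \<bar>x\<bar> ^ 3 / 6"
    using iexp_approx1[of x 2] unfolding s by (simp add: numeral_3_eq_3 fact_numeral)
  have 2: "cmod (iexp x - (1 + \<i> * x - x\<^sup>2 / 2)) \<le> x\<^sup>2"
    using iexp_approx2[of x 2] unfolding s by (simp add: fact_numeral)
  have "\<bar>x\<bar> ^ 3 = x\<^sup>2 * \<bar>x\<bar>" by (simp add: power3_eq_cube power2_eq_square)
  moreover have "0 \<le> x\<^sup>2 * \<bar>x\<bar>" by simp
  ultimately have "\<bar>x\<bar> ^ 3 / 6 \<le> x\<^sup>2 * \<bar>x\<bar>" by linarith
  then show ?thesis using 1 2 by (auto simp: min_def)
qed

lemma exp_minus_first_order: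
  fixes y :: real
  assumes "y \<ge> 0"
  shows "\<bar>exp (- y) - (1 - y)\<bar> \<le> y * min 1 y"
proof -
  have a: "1 - y \<le> exp (- y)" using exp_ge_add_one_self[of "- y"] by simp
  have b: "exp (- y) \<le> 1" using assms by simp
  have c: "exp (- y) \<le> 1 / (1 + y)"
  proof -
    have "1 + y \<le> exp y" by (rule exp_ge_add_one_self)
    then show ?thesis using assms by (simp add: exp_minus inverse_eq_divide frac_le)
  qed
  have "1 / (1 + y) \<le> 1 - y + y * y"
  proof -
    have "(1 - y + y * y) * (1 + y) = 1 + y * y * y" by (simp add: algebra_simps)
    then have "1 \<le> (1 - y + y * y) * (1 + y)" using assms by simp
    then show ?thesis using assms by (simp add: divide_le_eq)
  qed
  then have "exp (- y) - (1 - y) \<le> y * y" using c by linarith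
  then show ?thesis using a b by (auto simp: min_def)
qed

text \<open>The two-point variable (s/p - 1) z has mean 0 and variance (1/p - 1) z^2, so its
  characteristic function and the normal one agree to second order; \<open>D\<close> bounds both of
  its values.\<close>

lemma bern_char_factor:
  fixes z p D :: real
  assumes p: "0 < p" "p \<le> 1" and D: "\<bar>z\<bar> / p \<le> D"
  shows "cmod (p *\<^sub>R iexp ((1 / p - 1) * z) + (1 - p) *\<^sub>R iexp (- z) - exp (- ((1 / p - 1) * z\<^sup>2) / 2))
    \<le> 2 * (D\<^sup>2 * min 1 D)"
proof -
  define a where "a = (1 / p - 1) * z"
  define b where "b = - z"
  define v where "v = (1 / p - 1) * z\<^sup>2"
  have D0: "D \<ge> 0" using D p by (meson abs_ge_zero divide_nonneg_pos order_trans)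
  have zD: "\<bar>z\<bar> \<le> D"
  proof -
    have "\<bar>z\<bar> \<le> \<bar>z\<bar> / p" using p by (simp add: le_divide_eq mult_left_le)
    then show ?thesis using D by linarith
  qed
  have aD: "\<bar>a\<bar> \<le> D"
  proof -
    have "1 / p - 1 \<ge> 0" using p by simp
    then have "\<bar>a\<bar> = (1 / p - 1) * \<bar>z\<bar>" by (simp only: a_def abs_mult abs_of_nonneg)
    then have "\<bar>a\<bar> = \<bar>z\<bar> / p - \<bar>z\<bar>" by (simp add: left_diff_distrib)
    then show ?thesis using D by linarith
  qed
  have mean: "p * a + (1 - p) * b = 0" using p by (simp add: a_def b_def field_simps)
  have var: "p * a\<^sup>2 + (1 - p) * b\<^sup>2 = v"
    using p by (simp add: a_def b_def v_def power2_eq_square field_simps)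
  have mono: "x\<^sup>2 * min 1 \<bar>x\<bar> \<le> D\<^sup>2 * min 1 D" if "\<bar>x\<bar> \<le> D" for x
  proof -
    have "x\<^sup>2 \<le> D\<^sup>2" using that by (simp add: abs_le_square_iff[symmetric])
    then show ?thesis using that D0 by (intro mult_mono) auto
  qed
  have a2: "a\<^sup>2 \<le> D\<^sup>2" "b\<^sup>2 \<le> D\<^sup>2" using aD zD D0 by (simp_all add: abs_le_square_iff[symmetric] b_def)
  have v: "0 \<le> v" "v \<le> D\<^sup>2"
  proof -
    show "0 \<le> v" unfolding var[symmetric] using p by simp
    have "v \<le> p * D\<^sup>2 + (1 - p) * D\<^sup>2"
      unfolding var[symmetric] using a2 p by (intro add_mono mult_left_mono) auto
    then show "v \<le> D\<^sup>2" by (simp add: algebra_simps)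
  qed
  have 1: "cmod (p *\<^sub>R iexp a + (1 - p) *\<^sub>R iexp b - (1 - v / 2)) \<le> D\<^sup>2 * min 1 D"
  proof -
    have "complex_of_real p * (1 + \<i> * a - a\<^sup>2 / 2) + complex_of_real (1 - p) * (1 + \<i> * b - b\<^sup>2 / 2) =
       1 + \<i> * complex_of_real (p * a + (1 - p) * b) - complex_of_real (p * a\<^sup>2 + (1 - p) * b\<^sup>2) / 2"
      by (simp add: field_simps)
    also have "\<dots> = 1 - v / 2" unfolding mean var by simp
    finally have "p *\<^sub>R iexp a + (1 - p) *\<^sub>R iexp b - (1 - v / 2) =
      p *\<^sub>R (iexp a - (1 + \<i> * a - a\<^sup>2 / 2)) + (1 - p) *\<^sub>R (iexp b - (1 + \<i> * b - b\<^sup>2 / 2))"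
      by (simp only: scaleR_conv_of_real right_diff_distrib) (simp only: algebra_simps)
    also have "cmod \<dots> \<le> p * cmod (iexp a - (1 + \<i> * a - a\<^sup>2 / 2)) + (1 - p) * cmod (iexp b - (1 + \<i> * b - b\<^sup>2 / 2))"
      using p by (intro order_trans[OF norm_triangle_ineq]) simp
    also have "\<dots> \<le> p * (D\<^sup>2 * min 1 D) + (1 - p) * (D\<^sup>2 * min 1 D)"
      using p aD zD
      by (intro add_mono mult_left_mono order_trans[OF iexp_second_order mono]) (auto simp: b_def)
    finally show ?thesis by (simp add: algebra_simps)
  qed
  have 2: "cmod ((1 - v / 2) - exp (- v / 2)) \<le> D\<^sup>2 * min 1 D"
  proof -
    have "complex_of_real (1 - v / 2) - exp (- v / 2) = complex_of_real ((1 - v / 2) - exp (- v / 2))"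
      by (simp add: exp_of_real)
    then have "cmod ((1 - v / 2) - exp (- v / 2)) = \<bar>exp (- (v / 2)) - (1 - v / 2)\<bar>"
      by (simp only: norm_of_real) (simp add: abs_minus_commute)
    also have "\<dots> \<le> (v / 2) * min 1 (v / 2)" using v by (intro exp_minus_first_order) auto
    also have "\<dots> \<le> D\<^sup>2 * min 1 D"
    proof (intro mult_mono)
      show "v / 2 \<le> D\<^sup>2" using v by simp
      have "min 1 (v / 2) \<le> min 1 (D\<^sup>2)" using v by auto
      also have "\<dots> \<le> min 1 D"
      proof (cases "D \<le> 1")
        case True
        then have "D * D \<le> D * 1" using D0 by (intro mult_left_mono) auto
        then show ?thesis by (auto simp: power2_eq_square)
      qed auto
      finally show "min 1 (v / 2) \<le> min 1 D" .
    qed (use v D0 in auto)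
    finally show ?thesis .
  qed
  have "cmod (p *\<^sub>R iexp a + (1 - p) *\<^sub>R iexp b - exp (- v / 2)) \<le>
    cmod (p *\<^sub>R iexp a + (1 - p) *\<^sub>R iexp b - (1 - v / 2)) + cmod ((1 - v / 2) - exp (- v / 2))"
    using dist_triangle[of "p *\<^sub>R iexp a + (1 - p) *\<^sub>R iexp b" "complex_of_real (exp (- v / 2))" "1 - complex_of_real v / 2"]
    unfolding dist_norm by simp
  then have "cmod (p *\<^sub>R iexp a + (1 - p) *\<^sub>R iexp b - exp (- v / 2)) \<le> 2 * (D\<^sup>2 * min 1 D)" using 1 2 by linarith
  then show ?thesis unfolding a_def b_def v_def .
qed

text \<open>Lindeberg's comparison: all factors have modulus at most 1, so the difference of the
  products is at most the sum of the differences. The bound is explicit and holds at fixed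
  data.\<close>

lemma bern_clt:
  fixes z p D :: "nat \<Rightarrow> real"
  assumes p: "\<And>i. i < N \<Longrightarrow> 0 < p i \<and> p i \<le> 1" and D: "\<And>i. i < N \<Longrightarrow> \<bar>z i\<bar> / p i \<le> D i"
  shows "\<bar>bern N p (\<lambda>s. cos ((\<Sum>i<N. (s i / p i - 1) * z i) + b))
      - exp (- (\<Sum>i<N. (1 / p i - 1) * (z i)\<^sup>2) / 2) * cos b\<bar> \<le> 2 * (\<Sum>i<N. (D i)\<^sup>2 * min 1 (D i))"
proof -
  define X where "X s = (\<Sum>i<N. (s i / p i - 1) * z i)" for s :: "nat \<Rightarrow> real"
  define \<phi> where "\<phi> i = p i *\<^sub>R iexp ((1 / p i - 1) * z i) + (1 - p i) *\<^sub>R iexp (- z i)" for i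
  define \<psi> where "\<psi> i = exp (- ((1 / p i - 1) * (z i)\<^sup>2) / 2)" for i
  have prod: "iexp (X s) = (\<Prod>i<N. iexp ((s i / p i - 1) * z i))" for s
    by (simp add: X_def exp_sum sum_distrib_left)
  have E: "bern N p (\<lambda>s. iexp (X s)) = (\<Prod>i<N. \<phi> i)"
    unfolding prod by (subst two_pt_prod) (simp add: \<phi>_def)
  have "exp (- (\<Sum>i<N. (1 / p i - 1) * (z i)\<^sup>2) / 2) = (\<Prod>i<N. \<psi> i)"
    by (simp add: \<psi>_def exp_sum[symmetric] sum_negf sum_divide_distrib)
  then have P: "complex_of_real (exp (- (\<Sum>i<N. (1 / p i - 1) * (z i)\<^sup>2) / 2)) = (\<Prod>i<N. complex_of_real (\<psi> i))"
    by simp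
  have "cmod ((\<Prod>i<N. \<phi> i) - (\<Prod>i<N. complex_of_real (\<psi> i))) \<le> (\<Sum>i<N. cmod (\<phi> i - complex_of_real (\<psi> i)))"
  proof (rule norm_prod_diff)
    fix i assume i: "i \<in> {..<N}"
    have "cmod (\<phi> i) \<le> p i * 1 + (1 - p i) * 1"
      unfolding \<phi>_def using p[of i] i by (intro order_trans[OF norm_triangle_ineq]) simp
    then show "cmod (\<phi> i) \<le> 1" by simp
    have "0 \<le> (1 / p i - 1) * (z i)\<^sup>2" using p[of i] i by simp
    then show "cmod (complex_of_real (\<psi> i)) \<le> 1" by (simp add: \<psi>_def)
  qed
  also have "\<dots> \<le> (\<Sum>i<N. 2 * ((D i)\<^sup>2 * min 1 (D i)))"
  proof (intro sum_mono)
    fix i assume i: "i \<in> {..<N}"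
    show "cmod (\<phi> i - complex_of_real (\<psi> i)) \<le> 2 * ((D i)\<^sup>2 * min 1 (D i))"
      using bern_char_factor[of "p i" "z i" "D i"] p[of i] D[of i] i
      unfolding \<phi>_def \<psi>_def by (simp add: exp_of_real)
  qed
  finally have bound: "cmod (bern N p (\<lambda>s. iexp (X s)) - exp (- (\<Sum>i<N. (1 / p i - 1) * (z i)\<^sup>2) / 2)) \<le>
    2 * (\<Sum>i<N. (D i)\<^sup>2 * min 1 (D i))"
    unfolding E P[symmetric] by (simp add: exp_of_real sum_distrib_left)
  define c where "c = exp (- (\<Sum>i<N. (1 / p i - 1) * (z i)\<^sup>2) / 2)"
  define T where "T = bern N p (\<lambda>s. iexp (X s))"
  have bound': "cmod (T - complex_of_real c) \<le> 2 * (\<Sum>i<N. (D i)\<^sup>2 * min 1 (D i))"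
    using bound unfolding T_def c_def .
  have "bern N p (\<lambda>s. cos (X s + b)) = bern N p (\<lambda>s. Re (cis b * iexp (X s)))"
    by (intro two_pt_cong) (simp add: cis_conv_exp[symmetric] cis_mult add.commute)
  also have "\<dots> = Re (bern N p (\<lambda>s. cis b * iexp (X s)))"
    by (rule two_pt_linear) (simp add: linear_iff)
  also have "\<dots> = Re (cis b * T)" unfolding T_def by (simp only: two_pt_cmult)
  finally have "bern N p (\<lambda>s. cos (X s + b)) - c * cos b = Re (cis b * (T - complex_of_real c))"
    by (simp add: right_diff_distrib mult.commute)
  also have "\<bar>\<dots>\<bar> \<le> cmod (cis b * (T - complex_of_real c))" by (rule abs_Re_le_cmod)
  also have "\<dots> = cmod (T - complex_of_real c)" by (simp only: norm_mult norm_cis mult_1_left)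
  also note bound'
  finally show ?thesis unfolding X_def c_def .
qed

subsection \<open>The design expectation as an expectation over independent inclusions\<close>

text \<open>Splitting off the last coordinate of the sample reproduces the recursion of
  \<open>two_pt\<close>. A sample is \<open>undefined\<close> from \<open>N\<close> on, hence the
  conditional that pads it with zeros.\<close>

lemma sum_poisson_prob_bern:
  fixes g :: "(nat \<Rightarrow> nat) \<Rightarrow> real"
  assumes g: "\<And>s. s \<in> {..<N} \<rightarrow>\<^sub>E {0, 1} \<Longrightarrow> g s = \<phi> (\<lambda>i. if i < N then real (s i) else 0)"
  shows "(\<Sum>s\<in>{..<N} \<rightarrow>\<^sub>E {0, 1}. g s * poisson_prob \<pi> N x s) = bern N (\<pi> N x) \<phi>"
proof -
  define w where "w M s = (\<Prod>i<M. \<pi> N x i ^ s i * (1 - \<pi> N x i) ^ (1 - s i))" for M and s :: "nat \<Rightarrow> nat"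
  \<comment> \<open>Padding with arbitrary frozen values \<open>v\<close> in place of zeros is what
    the induction needs.\<close>
  have *: "(\<Sum>s\<in>{..<M} \<rightarrow>\<^sub>E {0, 1::nat}. \<phi> (\<lambda>i. if i < M then real (s i) else v i) * w M s) =
      two_pt M (\<pi> N x) (\<lambda>_. 1) (\<lambda>_. 0) \<phi> v" for M v
  proof (induction M arbitrary: v)
    case 0
    then show ?case by (simp add: w_def)
  next
    case (Suc M)
    let ?S = "{..<M} \<rightarrow>\<^sub>E {0, 1::nat}"
    have inj: "inj_on (\<lambda>(y, g). g(M := y)) ({0, 1::nat} \<times> ?S)"
      by (rule inj_combinator) auto
    have "{..<Suc M} \<rightarrow>\<^sub>E {0, 1::nat} = (\<lambda>(y, g). g(M := y)) ` ({0, 1} \<times> ?S)"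
      using PiE_insert_eq[of M "{..<M}" "\<lambda>_. {0, 1::nat}"] by (simp add: lessThan_Suc)
    then have "(\<Sum>s\<in>{..<Suc M} \<rightarrow>\<^sub>E {0, 1::nat}. \<phi> (\<lambda>i. if i < Suc M then real (s i) else v i) * w (Suc M) s) =
      (\<Sum>(y, s)\<in>{0, 1} \<times> ?S. \<phi> (\<lambda>i. if i < Suc M then real ((s(M := y)) i) else v i) * w (Suc M) (s(M := y)))"
      using sum.reindex[OF inj, of "\<lambda>s. \<phi> (\<lambda>i. if i < Suc M then real (s i) else v i) * w (Suc M) s"]
      by (simp only: o_def case_prod_beta')
    also have "\<dots> = (\<Sum>y\<in>{0, 1}. \<Sum>s\<in>?S. \<phi> (\<lambda>i. if i < Suc M then real ((s(M := y)) i) else v i) * w (Suc M) (s(M := y)))"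
      by (rule sum.cartesian_product[symmetric])
    also have "\<dots> = (\<Sum>y\<in>{0, 1}. (\<pi> N x M ^ y * (1 - \<pi> N x M) ^ (1 - y)) *
       (\<Sum>s\<in>?S. \<phi> (\<lambda>i. if i < M then real (s i) else (v(M := real y)) i) * w M s))"
    proof (intro sum.cong refl)
      fix y :: nat
      have a: "(\<lambda>i. if i < Suc M then real ((s(M := y)) i) else v i) = (\<lambda>i. if i < M then real (s i) else (v(M := real y)) i)" for s
        by (auto simp: fun_eq_iff less_Suc_eq)
      have b: "w (Suc M) (s(M := y)) = (\<pi> N x M ^ y * (1 - \<pi> N x M) ^ (1 - y)) * w M s" for s
      proof -
        have "(\<Prod>i<M. \<pi> N x i ^ (s(M := y)) i * (1 - \<pi> N x i) ^ (1 - (s(M := y)) i)) = w M s"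
          unfolding w_def by (intro prod.cong) auto
        then show ?thesis by (simp add: w_def mult.commute)
      qed
      show "(\<Sum>s\<in>?S. \<phi> (\<lambda>i. if i < Suc M then real ((s(M := y)) i) else v i) * w (Suc M) (s(M := y))) =
         (\<pi> N x M ^ y * (1 - \<pi> N x M) ^ (1 - y)) * (\<Sum>s\<in>?S. \<phi> (\<lambda>i. if i < M then real (s i) else (v(M := real y)) i) * w M s)"
        unfolding a b sum_distrib_left by (intro sum.cong refl) (simp only: mult.left_commute)
    qed
    also have "\<dots> = two_pt (Suc M) (\<pi> N x) (\<lambda>_. 1) (\<lambda>_. 0) \<phi> v"
      unfolding Suc.IH by (simp del: fun_upd_apply)
    finally show ?case .
  qed
  have "(\<Sum>s\<in>{..<N} \<rightarrow>\<^sub>E {0, 1}. g s * poisson_prob \<pi> N x s) =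
    (\<Sum>s\<in>{..<N} \<rightarrow>\<^sub>E {0, 1::nat}. \<phi> (\<lambda>i. if i < N then real (s i) else (\<lambda>_. 0) i) * w N s)"
    by (intro sum.cong refl arg_cong2[where f="(*)"]) (simp_all only: g w_def poisson_prob_def)
  then show ?thesis unfolding * .
qed

subsection \<open>The population model\<close>

lemma order_tendstoI_real:
  fixes f :: "'a \<Rightarrow> real"
  assumes "\<And>\<delta>. \<delta> > 0 \<Longrightarrow> \<forall>\<^sub>F x in Fl. f x < l + \<delta>" "\<And>\<delta>. \<delta> > 0 \<Longrightarrow> \<forall>\<^sub>F x in Fl. l - \<delta> < f x"
  shows "(f \<longlongrightarrow> l) Fl"
proof (rule tendstoI)
  fix e :: real assume "e > 0"
  from assms(1)[OF this] assms(2)[OF this] show "\<forall>\<^sub>F x in Fl. dist (f x) l < e"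
    by eventually_elim (simp add: dist_real_def abs_less_iff)
qed

text \<open>Only the data factor of the probability space appears. Sampling is represented later by
  the finite average \<open>design_mean\<close>, and the convergence of the expected sampling
  fraction is expressed along the filter on data sequences.\<close>

locale poisson_model =
  fixes Pyx :: "('y::{banach, second_countable_topology} \<times> 'x::{banach, second_countable_topology}) measure"
    and w :: "'x \<Rightarrow> real" and n c :: "nat \<Rightarrow> (nat \<Rightarrow> 'x) \<Rightarrow> real" and F :: "('y \<Rightarrow> real) set" and \<alpha> \<theta> :: real
  assumes Pyx: "prob_space Pyx" "sets Pyx = sets borel"
    and w_pos: "\<And>x. w x > 0"
    and c_pos: "\<And>N x. N \<ge> 1 \<Longrightarrow> x \<in> {..<N} \<rightarrow>\<^sub>E UNIV \<Longrightarrow> c N x > 0"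
    and sum_incl_prob: "\<And>N x. N \<ge> 1 \<Longrightarrow> x \<in> {..<N} \<rightarrow>\<^sub>E UNIV \<Longrightarrow> (\<Sum>i<N. incl_prob w c N x i) = n N x"
    and F_measurable: "F \<subseteq> borel_measurable borel"
    and C1: "\<exists>f\<in>F. \<exists>C. C \<noteq> 0 \<and> (AE y in distr Pyx borel fst. f y = C)"
    and \<alpha>: "0 < \<alpha>" "\<alpha> < 1"
    and n_conv: "((\<lambda>x. n (fst x) (\<lambda>i\<in>{..<fst x}. snd (snd x i)) / real (fst x)) \<longlongrightarrow> \<alpha>) (outer_filter (\<Pi>\<^sub>M i\<in>(UNIV :: nat set). Pyx))"
    and B1: "w \<in> borel_measurable borel" "integrable Pyx (\<lambda>z. w (snd z))"
    and \<theta>: "\<theta> > 0" "(\<integral>z. min (\<theta> * w (snd z) / mean_weight Pyx w) 1 \<partial>Pyx) = \<alpha>"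
    and B2: "Donsker Pyx (weighted Pyx w \<theta> ` F)"
    and B3: "bdd_above ((\<lambda>f. \<bar>integral\<^sup>L Pyx (weighted Pyx w \<theta> f)\<bar>) ` F)"
begin

sublocale iid_sequence Pyx
  using Pyx(1) by (simp add: iid_sequence_def)

abbreviation Fl :: "(nat \<times> (nat \<Rightarrow> 'y \<times> 'x)) filter" where "Fl \<equiv> outer_filter M"

abbreviation wt :: "'x \<Rightarrow> real" where "wt \<equiv> w_theta Pyx w \<theta>"

text \<open>The truncation level of \<open>wt\<close>; the inclusion probability of a unit with
  covariate \<open>x\<close> is asymptotically \<open>wt x / weight_cap\<close>.\<close>

definition weight_cap :: real where "weight_cap = mean_weight Pyx w / \<theta>"

definition weighted_mean :: "('y \<Rightarrow> real) \<Rightarrow> real" where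
  "weighted_mean f = integral\<^sup>L Pyx (weighted Pyx w \<theta> f)"

definition centred_weighted :: "('y \<Rightarrow> real) \<Rightarrow> 'y \<times> 'x \<Rightarrow> real" where
  "centred_weighted f z = weighted Pyx w \<theta> f z - weighted_mean f"

definition incl :: "nat \<Rightarrow> (nat \<Rightarrow> 'y \<times> 'x) \<Rightarrow> nat \<Rightarrow> real" where
  "incl N \<omega> = incl_prob w c N (\<lambda>i\<in>{..<N}. snd (\<omega> i))"

text \<open>All inclusion probabilities of a stage are governed by this one number, the empirical
  counterpart of \<open>1 / weight_cap\<close>.\<close>

definition scale_factor :: "nat \<Rightarrow> (nat \<Rightarrow> 'y \<times> 'x) \<Rightarrow> real" where
  "scale_factor N \<omega> = c N (\<lambda>i\<in>{..<N}. snd (\<omega> i)) / (\<Sum>j<N. w (snd (\<omega> j)))"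

lemma space_Pyx [simp]: "space Pyx = UNIV"
  using sets_eq_imp_space_eq[OF Pyx(2)] by simp

lemma Pyx_measurable:
  fixes f :: "'y \<Rightarrow> real" and g :: "'x \<Rightarrow> real"
  shows "f \<in> borel_measurable (borel :: 'y measure) \<Longrightarrow> (\<lambda>z. f (fst z)) \<in> borel_measurable Pyx"
    and "g \<in> borel_measurable (borel :: 'x measure) \<Longrightarrow> (\<lambda>z. g (snd z)) \<in> borel_measurable Pyx"
proof -
  have "sets Pyx = sets (borel \<Otimes>\<^sub>M borel)"
    using Pyx(2) arg_cong[OF borel_prod, of sets, symmetric] by (rule trans)
  then have eq: "borel_measurable Pyx = (borel_measurable (borel \<Otimes>\<^sub>M borel) :: ('y \<times> 'x \<Rightarrow> real) set)"
    by (rule measurable_cong_sets) (rule refl)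
  show "(\<lambda>z. f (fst z)) \<in> borel_measurable Pyx" if "f \<in> borel_measurable (borel :: 'y measure)"
    unfolding eq by (rule measurable_compose[OF measurable_fst that])
  show "(\<lambda>z. g (snd z)) \<in> borel_measurable Pyx" if "g \<in> borel_measurable (borel :: 'x measure)"
    unfolding eq by (rule measurable_compose[OF measurable_snd that])
qed

lemma w_measurable [measurable]: "(\<lambda>z. w (snd z)) \<in> borel_measurable Pyx"
  using B1(1) by (rule Pyx_measurable)

lemma mean_weight_pos: "mean_weight Pyx w > 0"
proof -
  have "(\<integral>z. w (snd z) \<partial>Pyx) \<noteq> 0"
  proof
    assume "(\<integral>z. w (snd z) \<partial>Pyx) = 0"
    then have "AE z in Pyx. w (snd z) = 0"
      using B1(2) w_pos by (subst (asm) integral_nonneg_eq_0_iff_AE) (auto intro: less_imp_le)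
    then have "AE z in Pyx. False" by eventually_elim (use w_pos in \<open>metis less_irrefl\<close>)
    then show False by simp
  qed
  moreover have "(\<integral>z. w (snd z) \<partial>Pyx) \<ge> 0" by (intro integral_nonneg_AE AE_I2 less_imp_le[OF w_pos])
  ultimately show ?thesis by (simp add: mean_weight_def)
qed

lemma weight_cap_pos: "weight_cap > 0"
  using mean_weight_pos \<theta>(1) by (simp add: weight_cap_def)

lemma wt_eq: "wt x = min (w x) weight_cap"
  by (simp add: w_theta_def weight_cap_def)

lemma wt_bounds: "0 < wt x" "wt x \<le> weight_cap"
  using w_pos[of x] weight_cap_pos by (auto simp: wt_eq)

lemma wt_measurable [measurable]: "(\<lambda>z. wt (snd z)) \<in> borel_measurable Pyx"
  unfolding wt_eq by measurable

lemma wt_scaled: "wt x / weight_cap = min (w x / weight_cap) 1"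
  using weight_cap_pos by (simp add: wt_eq min_def divide_le_eq)

lemma F_comp_measurable: "f \<in> F \<Longrightarrow> (\<lambda>z. f (fst z)) \<in> borel_measurable Pyx"
  using F_measurable by (intro Pyx_measurable) auto

lemma weighted_eq: "weighted Pyx w \<theta> f z = f (fst z) / wt (snd z)"
  by (simp add: weighted_def case_prod_beta)

lemma weighted_mult: "wt (snd z) * weighted Pyx w \<theta> f z = f (fst z)"
  using wt_bounds(1)[of "snd z"] by (simp add: weighted_eq)

lemma weighted_measurable: "f \<in> F \<Longrightarrow> weighted Pyx w \<theta> f \<in> borel_measurable Pyx"
  using F_comp_measurable[of f] by (simp add: weighted_eq[abs_def])

lemma centred_weighted_measurable: "f \<in> F \<Longrightarrow> centred_weighted f \<in> borel_measurable Pyx"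
  using weighted_measurable[of f] by (simp add: centred_weighted_def[abs_def])

subsection \<open>Convergence of the inclusion probabilities\<close>

lemma incl_eq: "i < N \<Longrightarrow> incl N \<omega> i = min (scale_factor N \<omega> * w (snd (\<omega> i))) 1"
proof -
  assume "i < N"
  moreover have "(\<Sum>j<N. w ((\<lambda>i\<in>{..<N}. snd (\<omega> i)) j)) = (\<Sum>j<N. w (snd (\<omega> j)))"
    by (intro sum.cong) auto
  ultimately show ?thesis by (simp add: incl_def incl_prob_def scale_factor_def)
qed

lemma scale_factor_pos: "N \<ge> 1 \<Longrightarrow> scale_factor N \<omega> > 0"
proof -
  assume N: "N \<ge> 1"
  then have "c N (\<lambda>i\<in>{..<N}. snd (\<omega> i)) > 0" by (intro c_pos) auto
  moreover have "(\<Sum>j<N. w (snd (\<omega> j))) > 0" using N w_pos by (intro sum_pos) (auto simp: lessThan_empty_iff)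
  ultimately show ?thesis by (simp add: scale_factor_def)
qed

lemma incl_bounds: "i < N \<Longrightarrow> 0 < incl N \<omega> i" "i < N \<Longrightarrow> incl N \<omega> i \<le> 1"
  using scale_factor_pos[of N \<omega>] w_pos[of "snd (\<omega> i)"] by (auto simp: incl_eq)

lemma sum_incl: "N \<ge> 1 \<Longrightarrow> (\<Sum>i<N. min (scale_factor N \<omega> * w (snd (\<omega> i))) 1) = n N (\<lambda>i\<in>{..<N}. snd (\<omega> i))"
proof -
  assume N: "N \<ge> 1"
  have "(\<Sum>i<N. min (scale_factor N \<omega> * w (snd (\<omega> i))) 1) = (\<Sum>i<N. incl N \<omega> i)"
    by (intro sum.cong) (auto simp: incl_eq)
  also have "\<dots> = n N (\<lambda>i\<in>{..<N}. snd (\<omega> i))"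
    unfolding incl_def by (rule sum_incl_prob[OF N]) auto
  finally show ?thesis .
qed

text \<open>\<open>1 / weight_cap\<close> solves \<open>capped_mean t = \<alpha>\<close>; the scale
  factor solves the empirical version, with the expected sampling fraction in place of
  \<alpha>.\<close>

definition capped_mean :: "real \<Rightarrow> real" where "capped_mean t = (\<integral>z. min (t * w (snd z)) 1 \<partial>Pyx)"

lemma capped_mean_integrable: "t \<ge> 0 \<Longrightarrow> integrable Pyx (\<lambda>z. min (t * w (snd z)) 1)"
  using w_pos by (intro Z.integrable_const_bound[of _ 1]) (auto simp: min_def less_imp_le)

lemma capped_mean_weight_cap: "capped_mean (1 / weight_cap) = \<alpha>"
  using \<theta>(2) by (simp add: capped_mean_def weight_cap_def mult.commute)

text \<open>Because \<open>w\<close> is positive, equality of the means would force both truncated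
  variables to be 1 almost surely, and then both means would be 1.\<close>

lemma capped_mean_strict:
  assumes "0 \<le> s" "s < t" "capped_mean s < 1 \<or> capped_mean t < 1"
  shows "capped_mean s < capped_mean t"
proof -
  have le: "min (s * w (snd z)) 1 \<le> min (t * w (snd z)) 1" for z :: "'y \<times> 'x"
    using assms(2) w_pos[of "snd z"] by (intro min.mono mult_right_mono) auto
  have t0: "t \<ge> 0" using assms by simp
  have mono: "capped_mean s \<le> capped_mean t"
    unfolding capped_mean_def using le by (intro integral_mono capped_mean_integrable assms t0)
  have "capped_mean s \<noteq> capped_mean t"
  proof
    assume "capped_mean s = capped_mean t"
    then have "(\<integral>z. min (t * w (snd z)) 1 - min (s * w (snd z)) 1 \<partial>Pyx) = 0"
      unfolding capped_mean_def using capped_mean_integrable[OF assms(1)] capped_mean_integrable[OF t0] by simp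
    then have "AE z in Pyx. min (t * w (snd z)) 1 - min (s * w (snd z)) 1 = 0"
      using le capped_mean_integrable[OF assms(1)] capped_mean_integrable[OF t0]
      by (subst (asm) integral_nonneg_eq_0_iff_AE) auto
    then have ae: "AE z in Pyx. min (s * w (snd z)) 1 = 1 \<and> min (t * w (snd z)) 1 = 1"
    proof eventually_elim
      case (elim z)
      have "s * w (snd z) < t * w (snd z)" using assms(2) w_pos[of "snd z"] by simp
      then show ?case using elim by (auto simp: min_def split: if_splits)
    qed
    have "capped_mean s = (\<integral>z. 1 \<partial>Pyx)" unfolding capped_mean_def using ae by (intro integral_cong_AE) auto
    moreover have "capped_mean t = (\<integral>z. 1 \<partial>Pyx)" unfolding capped_mean_def using ae by (intro integral_cong_AE) auto
    ultimately show False using assms(3) Z.prob_space by simp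
  qed
  then show ?thesis using mono by simp
qed

lemma eventually_ge_Fl: "\<forall>\<^sub>F x in Fl. fst x \<ge> N0"
  by (rule eventually_outer_filter_fst) (use eventually_ge_at_top[of N0] in simp)

lemma capped_mean_empirical:
  assumes "t \<ge> 0"
  shows "((\<lambda>x. (\<Sum>i<fst x. min (t * w (snd (snd x i))) 1) / real (fst x)) \<longlongrightarrow> capped_mean t) Fl"
  unfolding capped_mean_def using wlln[OF capped_mean_integrable[OF assms]] .

text \<open>The empirical equation is monotone in the scale, so the law of large numbers is needed
  only at the two points at distance \<delta> from \<open>1 / weight_cap\<close>; a uniform law over
  scales is avoided.\<close>

theorem scale_factor_conv: "((\<lambda>x. scale_factor (fst x) (snd x)) \<longlongrightarrow> 1 / weight_cap) Fl"
proof (rule order_tendstoI_real)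
  have k: "1 / weight_cap > 0" using weight_cap_pos by simp
  fix \<delta> :: real assume \<delta>: "\<delta> > 0"
  have n_eq: "(\<Sum>i<fst x. min (scale_factor (fst x) (snd x) * w (snd (snd x i))) 1) / real (fst x) =
     n (fst x) (\<lambda>i\<in>{..<fst x}. snd (snd x i)) / real (fst x)" if "fst x \<ge> 1" for x
    using sum_incl[OF that] by simp
  have mono: "(\<Sum>i<N. min (s * w (snd (\<omega> i))) 1) / real N \<le> (\<Sum>i<N. min (t * w (snd (\<omega> i))) 1) / real N"
    if "s \<le> t" for s t N and \<omega> :: "nat \<Rightarrow> 'y \<times> 'x"
    using that w_pos by (intro divide_right_mono sum_mono min.mono mult_right_mono) (auto intro: less_imp_le)
  show "\<forall>\<^sub>F x in Fl. scale_factor (fst x) (snd x) < 1 / weight_cap + \<delta>"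
  proof -
    have gt: "\<alpha> < capped_mean (1 / weight_cap + \<delta>)"
      using capped_mean_strict[of "1 / weight_cap" "1 / weight_cap + \<delta>"] capped_mean_weight_cap \<alpha> k \<delta> by simp
    define m where "m = (\<alpha> + capped_mean (1 / weight_cap + \<delta>)) / 2"
    have m: "\<alpha> < m" "m < capped_mean (1 / weight_cap + \<delta>)" using gt by (auto simp: m_def)
    have "\<forall>\<^sub>F x in Fl. m < (\<Sum>i<fst x. min ((1 / weight_cap + \<delta>) * w (snd (snd x i))) 1) / real (fst x)"
      using order_tendstoD(1)[OF capped_mean_empirical m(2)] k \<delta> by simp
    moreover have "\<forall>\<^sub>F x in Fl. n (fst x) (\<lambda>i\<in>{..<fst x}. snd (snd x i)) / real (fst x) < m"
      using order_tendstoD(2)[OF n_conv m(1)] .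
    ultimately show ?thesis using eventually_ge_Fl[of 1]
    proof eventually_elim
      case (elim x)
      show ?case
      proof (rule ccontr)
        assume "\<not> ?thesis"
        then have "1 / weight_cap + \<delta> \<le> scale_factor (fst x) (snd x)" by simp
        from mono[OF this, of "snd x" "fst x"] show False using elim n_eq[OF elim(3)] by linarith
      qed
    qed
  qed
  show "\<forall>\<^sub>F x in Fl. 1 / weight_cap - \<delta> < scale_factor (fst x) (snd x)"
  \<comment> \<open>Strict monotonicity is available for nonnegative arguments; if the lower point
    is not positive, positivity of the scale factor suffices.\<close>
  proof (cases "1 / weight_cap - \<delta> > 0")
    case False
    show ?thesis using eventually_ge_Fl[of 1]
    proof eventually_elim
      case (elim x)
      show ?case using scale_factor_pos[OF elim, of "snd x"] False by linarith
    qed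
  next
    case True
    have lt: "capped_mean (1 / weight_cap - \<delta>) < \<alpha>"
      using capped_mean_strict[of "1 / weight_cap - \<delta>" "1 / weight_cap"] capped_mean_weight_cap \<alpha> True \<delta> by simp
    define m where "m = (\<alpha> + capped_mean (1 / weight_cap - \<delta>)) / 2"
    have m: "m < \<alpha>" "capped_mean (1 / weight_cap - \<delta>) < m" using lt by (auto simp: m_def)
    have "\<forall>\<^sub>F x in Fl. (\<Sum>i<fst x. min ((1 / weight_cap - \<delta>) * w (snd (snd x i))) 1) / real (fst x) < m"
      using order_tendstoD(2)[OF capped_mean_empirical m(2)] True by simp
    moreover have "\<forall>\<^sub>F x in Fl. m < n (fst x) (\<lambda>i\<in>{..<fst x}. snd (snd x i)) / real (fst x)"
      using order_tendstoD(1)[OF n_conv m(1)] .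
    ultimately show ?thesis using eventually_ge_Fl[of 1]
    proof eventually_elim
      case (elim x)
      show ?case
      proof (rule ccontr)
        assume "\<not> ?thesis"
        then have "scale_factor (fst x) (snd x) \<le> 1 / weight_cap - \<delta>" by simp
        from mono[OF this, of "snd x" "fst x"] show False using elim n_eq[OF elim(3)] by linarith
      qed
    qed
  qed
qed

text \<open>The factor 2 comes from the scale being at least half of its limit. This bound makes
  \<open>wt\<close> times an inclusion error bounded by a constant.\<close>

lemma incl_lower:
  assumes "scale_factor N \<omega> \<ge> 1 / (2 * weight_cap)" "i < N"
  shows "1 / incl N \<omega> i \<le> 2 * weight_cap / wt (snd (\<omega> i))"
proof -
  have "wt (snd (\<omega> i)) / (2 * weight_cap) = min (w (snd (\<omega> i)) / weight_cap) 1 / 2"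
    using wt_scaled[of "snd (\<omega> i)"] by simp
  also have "\<dots> \<le> min (scale_factor N \<omega> * w (snd (\<omega> i))) 1"
  proof -
    have "1 / (2 * weight_cap) * w (snd (\<omega> i)) \<le> scale_factor N \<omega> * w (snd (\<omega> i))"
      using assms(1) w_pos by (intro mult_right_mono) (auto intro: less_imp_le)
    then show ?thesis by (auto simp: min_def)
  qed
  also have "\<dots> = incl N \<omega> i" using incl_eq[OF assms(2)] by simp
  finally have "wt (snd (\<omega> i)) / (2 * weight_cap) \<le> incl N \<omega> i" .
  then have "1 / incl N \<omega> i \<le> 1 / (wt (snd (\<omega> i)) / (2 * weight_cap))"
    using wt_bounds[of "snd (\<omega> i)"] weight_cap_pos by (intro frac_le) auto
  then show ?thesis by simp
qed

text \<open>Truncation at 1 does not increase relative errors: min(r v, 1) lies between min(v, 1)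
  and r min(v, 1). The relative form matters because it passes to the unbounded inverse
  probabilities.\<close>

lemma min_ratio:
  fixes u a b :: real
  assumes "u > 0" "a > 0" "b > 0"
  shows "\<bar>min (a * u) 1 - min (b * u) 1\<bar> \<le> \<bar>a / b - 1\<bar> * min (b * u) 1"
proof -
  have scale: "a * u = (a / b) * (b * u)" using assms by simp
  define v where "v = b * u"
  define r where "r = a / b"
  have v: "v > 0" and r: "r > 0" using assms by (auto simp: v_def r_def)
  have "\<bar>min (r * v) 1 - min v 1\<bar> \<le> \<bar>r - 1\<bar> * min v 1"
  proof (cases "r \<ge> 1")
    case True
    have "min v 1 \<le> min (r * v) 1" using True v by (intro min.mono) auto
    moreover have "v \<le> r * v" using True v by simp
    then have "min (r * v) 1 \<le> r * min v 1" using True by (auto simp: min_def)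
    ultimately show ?thesis using True by (simp add: left_diff_distrib)
  next
    case False
    have "min (r * v) 1 \<le> min v 1" using False v by (intro min.mono) (auto simp: mult_le_cancel_right1)
    moreover have "r * min v 1 \<le> min (r * v) 1" using False v r by (auto simp: min_def mult_le_one mult_left_le)
    ultimately show ?thesis using False by (simp add: left_diff_distrib)
  qed
  then show ?thesis unfolding scale v_def[symmetric] r_def[symmetric] .
qed

lemma incl_inverse_diff:
  assumes "scale_factor N \<omega> \<ge> 1 / (2 * weight_cap)" "i < N"
  shows "\<bar>1 / incl N \<omega> i - weight_cap / wt (snd (\<omega> i))\<bar> \<le> \<bar>scale_factor N \<omega> * weight_cap - 1\<bar> * (2 * weight_cap / wt (snd (\<omega> i)))"
proof -
  define p where "p = incl N \<omega> i"
  define t where "t = wt (snd (\<omega> i)) / weight_cap"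
  have N: "N \<ge> 1" using assms by simp
  have p: "p > 0" using incl_bounds(1)[OF assms(2)] by (simp add: p_def)
  have t: "t > 0" using wt_bounds weight_cap_pos by (simp add: t_def)
  have "\<bar>p - t\<bar> \<le> \<bar>scale_factor N \<omega> / (1 / weight_cap) - 1\<bar> * t"
    using min_ratio[OF w_pos[of "snd (\<omega> i)"] scale_factor_pos[OF N, of \<omega>], of "1 / weight_cap"] weight_cap_pos
    by (simp add: p_def t_def incl_eq[OF assms(2)] wt_scaled)
  then have d: "\<bar>p - t\<bar> \<le> \<bar>scale_factor N \<omega> * weight_cap - 1\<bar> * t" by simp
  have "\<bar>1 / p - 1 / t\<bar> = \<bar>p - t\<bar> / (p * t)"
    using p t by (simp add: abs_minus_commute diff_frac_eq abs_mult)
  also have "\<dots> \<le> (\<bar>scale_factor N \<omega> * weight_cap - 1\<bar> * t) / (p * t)" using d p t by (intro divide_right_mono) auto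
  also have "\<dots> = \<bar>scale_factor N \<omega> * weight_cap - 1\<bar> * (1 / p)" using t by simp
  also have "\<dots> \<le> \<bar>scale_factor N \<omega> * weight_cap - 1\<bar> * (2 * weight_cap / wt (snd (\<omega> i)))"
    using incl_lower[OF assms] by (intro mult_left_mono) (auto simp: p_def)
  finally show ?thesis by (simp add: p_def t_def)
qed

lemma eventually_scale_factor: "\<forall>\<^sub>F x in Fl. scale_factor (fst x) (snd x) \<ge> 1 / (2 * weight_cap)"
proof -
  have "1 / (2 * weight_cap) < 1 / weight_cap" using weight_cap_pos by (simp add: field_simps)
  from order_tendstoD(1)[OF scale_factor_conv this] show ?thesis by (auto elim: eventually_mono)
qed

subsection \<open>Consequences of the Donsker property\<close>

lemma centred_weighted_bounded: "\<exists>B. \<forall>f\<in>F. \<bar>centred_weighted f z\<bar> \<le> B"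
proof -
  have "bdd_above ((\<lambda>f. \<bar>f z - integral\<^sup>L Pyx f\<bar>) ` weighted Pyx w \<theta> ` F)"
  proof -
    have "\<forall>z\<in>space Pyx. bdd_above ((\<lambda>f. \<bar>f z - integral\<^sup>L Pyx f\<bar>) ` weighted Pyx w \<theta> ` F)"
      using B2 unfolding Donsker_def by (rule conjunct1[OF conjunct2])
    then show ?thesis by (rule bspec) (simp only: space_Pyx UNIV_I)
  qed
  then obtain B where "\<forall>x\<in>(\<lambda>f. \<bar>f z - integral\<^sup>L Pyx f\<bar>) ` weighted Pyx w \<theta> ` F. x \<le> B"
    unfolding bdd_above_def by blast
  then show ?thesis by (intro exI[of _ B]) (simp add: centred_weighted_def weighted_mean_def)
qed

lemma weighted_mean_bounded: "\<exists>B. \<forall>f\<in>F. \<bar>weighted_mean f\<bar> \<le> B"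
  using B3 unfolding bdd_above_def weighted_mean_def by blast

lemma empirical_weighted:
  "f \<in> F \<Longrightarrow> empirical_process Pyx (weighted Pyx w \<theta> ` F) N \<omega> (weighted Pyx w \<theta> f) = (\<Sum>i<N. centred_weighted f (\<omega> i)) / sqrt (real N)"
  by (simp add: empirical_process_def centred_weighted_def weighted_mean_def)

lemma empirical_mspace: "empirical_process Pyx (weighted Pyx w \<theta> ` F) N \<omega> \<in> mspace (linf (weighted Pyx w \<theta> ` F))"
proof -
  define B where "B z = (SOME B. \<forall>f\<in>F. \<bar>centred_weighted f z\<bar> \<le> B)" for z
  have B: "\<forall>f\<in>F. \<bar>centred_weighted f z\<bar> \<le> B z" for z unfolding B_def by (rule someI_ex[OF centred_weighted_bounded])
  have "\<bar>(\<Sum>i<N. centred_weighted f (\<omega> i)) / sqrt (real N)\<bar> \<le> (\<Sum>i<N. B (\<omega> i)) / sqrt (real N)" if "f \<in> F" for f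
  proof -
    have "\<bar>\<Sum>i<N. centred_weighted f (\<omega> i)\<bar> \<le> (\<Sum>i<N. B (\<omega> i))"
      using B that by (intro order_trans[OF sum_abs] sum_mono) auto
    then show ?thesis by (simp add: divide_right_mono)
  qed
  then show ?thesis
    unfolding linf_mspace by (intro conjI exI[of _ "(\<Sum>i<N. B (\<omega> i)) / sqrt (real N)"])
      (auto simp: empirical_weighted, simp add: empirical_process_def)
qed

text \<open>
  A finite set of bounded functions on \<open>F\<close> decides which finite discretizations \<open>\<rho>\<close> of the
  index set are fine enough; this replaces total boundedness in a semimetric.
\<close>

lemma donsker_osc_tail:
  assumes \<epsilon>: "\<epsilon> > 0" and \<eta>: "\<eta> > 0"
  obtains W where "finite W" "\<And>v. v \<in> W \<Longrightarrow> \<exists>B. \<forall>f\<in>F. \<bar>v f\<bar> \<le> B"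
    "\<And>\<rho>. \<rho> ` F \<subseteq> F \<Longrightarrow> (\<And>v f. v \<in> W \<Longrightarrow> f \<in> F \<Longrightarrow> \<bar>v f - v (\<rho> f)\<bar> \<le> \<epsilon> / 4) \<Longrightarrow>
      \<forall>\<^sub>F N in sequentially. outer_measure_of M {\<omega> \<in> space M. \<exists>f\<in>F. \<bar>\<Sum>i<N. centred_weighted f (\<omega> i) - centred_weighted (\<rho> f) (\<omega> i)\<bar> > \<epsilon> * sqrt (real N)} \<le> ennreal \<eta>"
proof -
  let ?wf = "weighted Pyx w \<theta>"
  let ?H = "?wf ` F"
  obtain L where L: "prob_space L" "sets L = sets (linf_borel ?H)" "tight_borel_element L ?H (\<lambda>z. z)"
    "weakly_converges_linf M ?H (empirical_process Pyx ?H) L (\<lambda>z. z)"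
    using B2 unfolding Donsker_def by blast
  have "\<eta> / 2 > 0" using \<eta> by simp
  then obtain K where K: "compactin (mtopology_of (linf ?H)) K" "measure L {z \<in> space L. z \<in> K} \<ge> 1 - \<eta> / 2"
    using L(3) unfolding tight_borel_element_def by blast
  have "\<epsilon> / 8 > 0" using \<epsilon> by simp
  obtain V where V: "finite V" "V \<subseteq> mspace (linf ?H)" "\<And>z. z \<in> K \<Longrightarrow> \<exists>v\<in>V. \<forall>f\<in>?H. \<bar>z f - v f\<bar> \<le> \<epsilon> / 8"
    by (rule compactin_linf_finite_net[OF K(1) \<open>\<epsilon> / 8 > 0\<close>]) (rule that)
  define W where "W = (\<lambda>v f. v (?wf f)) ` V"
  show thesis
  proof (rule that)
    show "finite W" using V(1) by (simp add: W_def)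
    show "\<exists>B. \<forall>f\<in>F. \<bar>v f\<bar> \<le> B" if vW: "v \<in> W" for v
    proof -
      obtain v' where v': "v' \<in> V" "v = (\<lambda>f. v' (?wf f))" using vW unfolding W_def by blast
      have "v' \<in> mspace (linf ?H)" by (rule subsetD[OF V(2) v'(1)])
      then obtain B where "\<forall>f\<in>?H. \<bar>v' f\<bar> \<le> B" unfolding linf_mspace by blast
      then show ?thesis by (intro exI[of _ B]) (simp add: v'(2))
    qed
    fix \<rho> assume \<rho>: "\<rho> ` F \<subseteq> F" "\<And>v f. v \<in> W \<Longrightarrow> f \<in> F \<Longrightarrow> \<bar>v f - v (\<rho> f)\<bar> \<le> \<epsilon> / 4"
    have \<rho>F: "\<rho> f \<in> F" if "f \<in> F" for f using \<rho>(1) that by blast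
    \<comment> \<open>On \<open>K\<close> such an increment is at most \<epsilon>/8 + \<epsilon>/4 +
      \<epsilon>/8 = \<epsilon>/2: two distances to the net and the increment of a net function. As
      a difference of two evaluations it has Lipschitz constant 2.\<close>
    define u where "u f z = z (?wf f) - z (?wf (\<rho> f))" for f and z :: "('y \<times> 'x \<Rightarrow> real) \<Rightarrow> real"
    have FN: "F \<noteq> {}" using C1 by blast
    have "\<forall>\<^sub>F N in sequentially. outer_measure_of M {\<omega> \<in> space M. \<exists>f\<in>F. \<bar>u f (empirical_process Pyx ?H N \<omega>)\<bar> \<ge> \<epsilon>} \<le> ennreal \<eta>"
    proof (rule weak_conv_sup_tail[OF prob_space_M L(1,2,4) FN, where C=2 and K=K and \<eta>="\<eta> / 2" and a="\<epsilon> / 2"])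
      fix f z z' assume f: "f \<in> F" and z: "z \<in> mspace (linf ?H)" "z' \<in> mspace (linf ?H)"
      have "\<bar>z (?wf f) - z' (?wf f)\<bar> \<le> mdist (linf ?H) z z'"
        by (rule linf_dist_ge[OF z imageI[OF f]])
      moreover have "\<bar>z (?wf (\<rho> f)) - z' (?wf (\<rho> f))\<bar> \<le> mdist (linf ?H) z z'"
        by (rule linf_dist_ge[OF z imageI[OF \<rho>F[OF f]]])
      ultimately show "\<bar>u f z - u f z'\<bar> \<le> 2 * mdist (linf ?H) z z'" unfolding u_def by linarith
    next
      fix z assume "z \<in> mspace (linf ?H)"
      then obtain B where B: "\<forall>f\<in>?H. \<bar>z f\<bar> \<le> B" unfolding linf_mspace by blast
      show "bdd_above ((\<lambda>f. \<bar>u f z\<bar>) ` F)"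
      proof (rule bdd_aboveI2[of _ _ "B + B"])
        fix f assume f: "f \<in> F"
        have "\<bar>z (?wf f)\<bar> \<le> B" "\<bar>z (?wf (\<rho> f))\<bar> \<le> B"
          using bspec[OF B imageI[OF f]] bspec[OF B imageI[OF \<rho>F[OF f]]] .
        then show "\<bar>u f z\<bar> \<le> B + B" unfolding u_def by linarith
      qed
    next
      fix z f assume z: "z \<in> K" and f: "f \<in> F"
      obtain v where v: "v \<in> V" "\<forall>f\<in>?H. \<bar>z f - v f\<bar> \<le> \<epsilon> / 8" using V(3)[OF z] by blast
      have "\<bar>v (?wf f) - v (?wf (\<rho> f))\<bar> \<le> \<epsilon> / 4"
        using \<rho>(2)[OF _ f, of "\<lambda>f. v (?wf f)"] v(1) unfolding W_def by blast
      moreover have "\<bar>z (?wf f) - v (?wf f)\<bar> \<le> \<epsilon> / 8" by (rule bspec[OF v(2) imageI[OF f]])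
      moreover have "\<bar>z (?wf (\<rho> f)) - v (?wf (\<rho> f))\<bar> \<le> \<epsilon> / 8" by (rule bspec[OF v(2) imageI[OF \<rho>F[OF f]]])
      ultimately show "\<bar>u f z\<bar> \<le> \<epsilon> / 2" unfolding u_def by linarith
    next
      show "empirical_process Pyx ?H N \<omega> \<in> mspace (linf ?H)" for N \<omega> by (rule empirical_mspace)
    qed (use \<epsilon> \<eta> K(2) in auto)
    then show "\<forall>\<^sub>F N in sequentially. outer_measure_of M {\<omega> \<in> space M. \<exists>f\<in>F. \<bar>\<Sum>i<N. centred_weighted f (\<omega> i) - centred_weighted (\<rho> f) (\<omega> i)\<bar> > \<epsilon> * sqrt (real N)} \<le> ennreal \<eta>"
      using eventually_gt_at_top[of 0]
    proof eventually_elim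
      case (elim N)
      have eq: "u f (empirical_process Pyx ?H N \<omega>) = (\<Sum>i<N. centred_weighted f (\<omega> i) - centred_weighted (\<rho> f) (\<omega> i)) / sqrt (real N)" if "f \<in> F" for f \<omega>
        unfolding u_def empirical_weighted[OF that] empirical_weighted[OF \<rho>F[OF that]] by (simp add: sum_subtractf diff_divide_distrib)
      have "{\<omega> \<in> space M. \<exists>f\<in>F. \<bar>\<Sum>i<N. centred_weighted f (\<omega> i) - centred_weighted (\<rho> f) (\<omega> i)\<bar> > \<epsilon> * sqrt (real N)} \<subseteq>
        {\<omega> \<in> space M. \<exists>f\<in>F. \<bar>u f (empirical_process Pyx ?H N \<omega>)\<bar> \<ge> \<epsilon>}"
      proof safe
        fix \<omega> f assume f: "f \<in> F" "\<epsilon> * sqrt (real N) < \<bar>\<Sum>i<N. centred_weighted f (\<omega> i) - centred_weighted (\<rho> f) (\<omega> i)\<bar>"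
        then have "\<epsilon> \<le> \<bar>\<Sum>i<N. centred_weighted f (\<omega> i) - centred_weighted (\<rho> f) (\<omega> i)\<bar> / sqrt (real N)"
          using elim(2) by (simp add: le_divide_eq)
        then have "\<epsilon> \<le> \<bar>u f (empirical_process Pyx ?H N \<omega>)\<bar>" unfolding eq[OF f(1)] by simp
        then show "\<exists>f\<in>F. \<epsilon> \<le> \<bar>u f (empirical_process Pyx ?H N \<omega>)\<bar>" using f(1) by (rule bexI)
      qed
      then show ?case by (rule order_trans[OF outer_measure_of_mono elim(1)])
    qed
  qed
qed

text \<open>Tightness gives stochastic boundedness of one coordinate: on the compact set the value
  at \<open>f\<close> is within 1 of one of finitely many numbers.\<close>

lemma donsker_single_tail:
  assumes f: "f \<in> F" and \<eta>: "\<eta> > 0"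
  obtains K where "K > 0"
    "\<forall>\<^sub>F N in sequentially. outer_measure_of M {\<omega> \<in> space M. \<bar>\<Sum>i<N. centred_weighted f (\<omega> i)\<bar> > K * sqrt (real N)} \<le> ennreal \<eta>"
proof -
  let ?wf = "weighted Pyx w \<theta>"
  let ?H = "?wf ` F"
  obtain L where L: "prob_space L" "sets L = sets (linf_borel ?H)" "tight_borel_element L ?H (\<lambda>z. z)"
    "weakly_converges_linf M ?H (empirical_process Pyx ?H) L (\<lambda>z. z)"
    using B2 unfolding Donsker_def by blast
  have "\<eta> / 2 > 0" using \<eta> by simp
  then obtain K where K: "compactin (mtopology_of (linf ?H)) K" "measure L {z \<in> space L. z \<in> K} \<ge> 1 - \<eta> / 2"
    using L(3) unfolding tight_borel_element_def by blast
  obtain V where V: "finite V" "V \<subseteq> mspace (linf ?H)" "\<And>z. z \<in> K \<Longrightarrow> \<exists>v\<in>V. \<forall>f\<in>?H. \<bar>z f - v f\<bar> \<le> 1"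
    by (rule compactin_linf_finite_net[OF K(1) zero_less_one]) (rule that)
  define a where "a = (\<Sum>v\<in>V. \<bar>v (?wf f)\<bar>) + 1"
  have a0: "a > 0" unfolding a_def by (intro add_nonneg_pos sum_nonneg) auto
  have "\<forall>\<^sub>F N in sequentially. outer_measure_of M {\<omega> \<in> space M. \<exists>f\<in>{f}. \<bar>empirical_process Pyx ?H N \<omega> (?wf f)\<bar> \<ge> a + 1} \<le> ennreal \<eta>"
  proof (rule weak_conv_sup_tail[OF prob_space_M L(1,2,4), where C=1 and K=K and \<eta>="\<eta> / 2" and a=a])
    fix f' z z' assume f': "f' \<in> {f}" and z: "z \<in> mspace (linf ?H)" "z' \<in> mspace (linf ?H)"
    have "f' \<in> F" using f' f by simp
    then show "\<bar>z (?wf f') - z' (?wf f')\<bar> \<le> 1 * mdist (linf ?H) z z'"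
      using linf_dist_ge[OF z imageI] by (simp del: mspace_funspace mdist_funspace)
  next
    fix z f' assume z: "z \<in> K" and f': "f' \<in> {f}"
    have f': "f' = f" using f' by simp
    obtain v where v: "v \<in> V" "\<forall>f\<in>?H. \<bar>z f - v f\<bar> \<le> 1" using V(3)[OF z] by blast
    have "\<bar>v (?wf f)\<bar> \<le> (\<Sum>v\<in>V. \<bar>v (?wf f)\<bar>)" using V(1) v(1) by (intro member_le_sum) auto
    then show "\<bar>z (?wf f')\<bar> \<le> a" using bspec[OF v(2) imageI[OF f]] unfolding a_def f' by linarith
  next
    show "empirical_process Pyx ?H N \<omega> \<in> mspace (linf ?H)" for N \<omega> by (rule empirical_mspace)
  qed (use \<eta> K(2) in auto)
  then have "\<forall>\<^sub>F N in sequentially. outer_measure_of M {\<omega> \<in> space M. \<bar>\<Sum>i<N. centred_weighted f (\<omega> i)\<bar> > (a + 1) * sqrt (real N)} \<le> ennreal \<eta>"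
    using eventually_gt_at_top[of 0]
  proof eventually_elim
    case (elim N)
    have "{\<omega> \<in> space M. \<bar>\<Sum>i<N. centred_weighted f (\<omega> i)\<bar> > (a + 1) * sqrt (real N)} \<subseteq>
      {\<omega> \<in> space M. \<exists>f\<in>{f}. \<bar>empirical_process Pyx ?H N \<omega> (?wf f)\<bar> \<ge> a + 1}"
    proof safe
      fix \<omega> assume "(a + 1) * sqrt (real N) < \<bar>\<Sum>i<N. centred_weighted f (\<omega> i)\<bar>"
      then have "a + 1 \<le> \<bar>\<Sum>i<N. centred_weighted f (\<omega> i)\<bar> / sqrt (real N)" using elim(2) by (simp add: le_divide_eq)
      then show "\<exists>f\<in>{f}. a + 1 \<le> \<bar>empirical_process Pyx ?H N \<omega> (?wf f)\<bar>"
        unfolding bex_simps empirical_weighted[OF f] by (simp add: empirical_weighted[OF f])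
    qed
    then show ?case by (rule order_trans[OF outer_measure_of_mono elim(1)])
  qed
  then show thesis using a0 by (intro that[of "a + 1"]) auto
qed

text \<open>The converse central limit theorem: stochastic boundedness forces a finite second moment.\<close>

lemma centred_weighted_square_integrable:
  assumes f: "f \<in> F"
  shows "integrable Pyx (\<lambda>z. (centred_weighted f z)\<^sup>2)"
proof -
  have [measurable]: "centred_weighted f \<in> borel_measurable Pyx" using centred_weighted_measurable[OF f] .
  \<comment> \<open>1/192 = (1/4)/48: \<open>rad_tail\<close> multiplies by 48 and leaves a bad
    event of outer probability at most 1/4.\<close>
  obtain K where K: "K > 0"
    "\<forall>\<^sub>F N in sequentially. outer_measure_of M {\<omega> \<in> space M. \<bar>\<Sum>i<N. centred_weighted f (\<omega> i)\<bar> > K * sqrt (real N)} \<le> ennreal (1/192)"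
    by (rule donsker_single_tail[OF f, of "1/192"]) simp
  then obtain N0 where N0: "\<And>n. n \<ge> N0 \<Longrightarrow>
      outer_measure_of M {\<omega> \<in> space M. \<exists>f\<in>{f}. \<bar>\<Sum>i<n. centred_weighted f (\<omega> i)\<bar> > K * sqrt (real n)} \<le> ennreal (1/192)"
    unfolding eventually_sequentially by auto
  define G where "G N \<omega> \<longleftrightarrow> rad N (\<lambda>e. of_bool (\<exists>f\<in>{f}. \<bar>\<Sum>i<N. e i * centred_weighted f (\<omega> i)\<bar> > 4 * K * sqrt (real N))) (\<lambda>_. 0) < (1/12 :: real)"
    for N and \<omega> :: "nat \<Rightarrow> 'y \<times> 'x"
  have bad: "outer_measure_of M {\<omega> \<in> space M. \<not> G N \<omega>} \<le> ennreal (1/4)" if "N \<ge> 2 * N0" for N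
    using rad_tail[OF N0 that] K(1) by (simp add: G_def not_less)
  have good: "(\<Sum>i<N. (centred_weighted f (\<omega> i))\<^sup>2) \<le> 32 * K\<^sup>2 * real N" if "G N \<omega>" for N \<omega>
  proof -
    have "(\<Sum>i<N. (centred_weighted f (\<omega> i))\<^sup>2) \<le> 2 * (4 * K * sqrt (real N))\<^sup>2"
      using that by (intro rad_quantile_variance) (simp add: G_def mult.commute)
    then show ?thesis by (simp add: power_mult_distrib)
  qed
  \<comment> \<open>The bound on the sum of squares and the law of large numbers for the truncated
    square each fail with outer probability at most 1/4, so some data sequence satisfies both;
    evaluating there bounds the truncated mean independently of \<open>m\<close>.\<close>
  have trunc: "(\<integral>z. min ((centred_weighted f z)\<^sup>2) (real m) \<partial>Pyx) \<le> 32 * K\<^sup>2 + 1" for m :: nat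
  proof -
    have int: "integrable Pyx (\<lambda>z. min ((centred_weighted f z)\<^sup>2) (real m))"
      by (intro Z.integrable_const_bound[of _ "real m"]) auto
    define E where "E = (\<integral>z. min ((centred_weighted f z)\<^sup>2) (real m) \<partial>Pyx)"
    have "\<forall>\<^sub>F x in Fl. E - 1 < (\<Sum>i<fst x. min ((centred_weighted f (snd x i))\<^sup>2) (real m)) / real (fst x)"
      using wlln[OF int] unfolding E_def by (intro order_tendstoD(1)) auto
    then have "\<forall>\<^sub>F N in sequentially. outer_measure_of M
       {\<omega> \<in> space M. \<not> (E - 1 < (\<Sum>i<N. min ((centred_weighted f (\<omega> i))\<^sup>2) (real m)) / real N)} \<le> ennreal (1/4)"
      using eventually_outer_filterD[of _ M "1/4"] by fastforce
    moreover have "\<forall>\<^sub>F N in sequentially. N \<ge> max 1 (2 * N0)" by (rule eventually_ge_at_top)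
    ultimately have "\<forall>\<^sub>F N in sequentially. N \<ge> max 1 (2 * N0) \<and> outer_measure_of M
       {\<omega> \<in> space M. \<not> (E - 1 < (\<Sum>i<N. min ((centred_weighted f (\<omega> i))\<^sup>2) (real m)) / real N)} \<le> ennreal (1/4)"
      by eventually_elim simp
    then obtain N where N: "N \<ge> max 1 (2 * N0)" "outer_measure_of M
       {\<omega> \<in> space M. \<not> (E - 1 < (\<Sum>i<N. min ((centred_weighted f (\<omega> i))\<^sup>2) (real m)) / real N)} \<le> ennreal (1/4)"
      by (auto dest: eventually_happens)
    let ?A = "{\<omega> \<in> space M. \<not> G N \<omega>}"
    let ?B = "{\<omega> \<in> space M. \<not> (E - 1 < (\<Sum>i<N. min ((centred_weighted f (\<omega> i))\<^sup>2) (real m)) / real N)}"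
    have "outer_measure_of M (?A \<union> ?B) \<le> outer_measure_of M ?A + outer_measure_of M ?B"
      by (rule outer_measure_of_Un_le) auto
    also have "\<dots> \<le> ennreal (1/4) + ennreal (1/4)" using bad[of N] N by (intro add_mono) auto
    also have "\<dots> = ennreal (1/2)" by (simp flip: ennreal_plus)
    also have "\<dots> < ennreal 1" by (subst ennreal_less_iff) auto
    finally have "?A \<union> ?B \<noteq> space M" using prob_space.emeasure_space_1[OF prob_space_M] by auto
    then obtain \<omega> where \<omega>: "G N \<omega>" "E - 1 < (\<Sum>i<N. min ((centred_weighted f (\<omega> i))\<^sup>2) (real m)) / real N" by blast
    have "(\<Sum>i<N. min ((centred_weighted f (\<omega> i))\<^sup>2) (real m)) \<le> (\<Sum>i<N. (centred_weighted f (\<omega> i))\<^sup>2)" by (intro sum_mono) auto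
    also have "\<dots> \<le> 32 * K\<^sup>2 * real N" by (rule good[OF \<omega>(1)])
    finally have "(\<Sum>i<N. min ((centred_weighted f (\<omega> i))\<^sup>2) (real m)) / real N \<le> 32 * K\<^sup>2"
      using N(1) by (simp add: divide_le_eq)
    then show ?thesis using \<omega>(2) unfolding E_def by linarith
  qed
  have "(\<integral>\<^sup>+z. ennreal ((centred_weighted f z)\<^sup>2) \<partial>Pyx) = (\<integral>\<^sup>+z. (SUP m. ennreal (min ((centred_weighted f z)\<^sup>2) (real m))) \<partial>Pyx)"
  proof (intro nn_integral_cong)
    fix z
    obtain k :: nat where k: "(centred_weighted f z)\<^sup>2 \<le> real k" using real_arch_simple by blast
    show "ennreal ((centred_weighted f z)\<^sup>2) = (SUP m. ennreal (min ((centred_weighted f z)\<^sup>2) (real m)))"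
    proof (rule antisym)
      have "ennreal ((centred_weighted f z)\<^sup>2) = ennreal (min ((centred_weighted f z)\<^sup>2) (real k))" using k by simp
      also have "\<dots> \<le> (SUP m. ennreal (min ((centred_weighted f z)\<^sup>2) (real m)))" by (rule SUP_upper) simp
      finally show "ennreal ((centred_weighted f z)\<^sup>2) \<le> (SUP m. ennreal (min ((centred_weighted f z)\<^sup>2) (real m)))" .
    qed (auto intro!: SUP_least ennreal_leI)
  qed
  also have "\<dots> = (SUP m. \<integral>\<^sup>+z. ennreal (min ((centred_weighted f z)\<^sup>2) (real m)) \<partial>Pyx)"
    by (intro nn_integral_monotone_convergence_SUP) (auto simp: incseq_def le_fun_def intro!: ennreal_leI)
  also have "\<dots> \<le> ennreal (32 * K\<^sup>2 + 1)"
  proof (rule SUP_least)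
    fix m :: nat
    have int: "integrable Pyx (\<lambda>z. min ((centred_weighted f z)\<^sup>2) (real m))"
      by (intro Z.integrable_const_bound[of _ "real m"]) auto
    have "(\<integral>\<^sup>+z. ennreal (min ((centred_weighted f z)\<^sup>2) (real m)) \<partial>Pyx) = ennreal (\<integral>z. min ((centred_weighted f z)\<^sup>2) (real m) \<partial>Pyx)"
      using int by (intro nn_integral_eq_integral) auto
    also have "\<dots> \<le> ennreal (32 * K\<^sup>2 + 1)" by (intro ennreal_leI trunc)
    finally show "(\<integral>\<^sup>+z. ennreal (min ((centred_weighted f z)\<^sup>2) (real m)) \<partial>Pyx) \<le> ennreal (32 * K\<^sup>2 + 1)" .
  qed
  finally show ?thesis by (intro integrableI_bounded) (auto simp: less_top[symmetric] top_unique)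
qed

end

subsection \<open>Moments of the weighted inclusion errors\<close>

lemma bern_variance:
  assumes "\<And>i. i < N \<Longrightarrow> 0 < p i \<and> p i \<le> 1"
  shows "bern N p (\<lambda>s. (\<Sum>i<N. (s i / p i - 1) * x i)\<^sup>2) = (\<Sum>i<N. (1 / p i - 1) * (x i)\<^sup>2)"
proof -
  have "two_pt N p (\<lambda>i. 1 / p i - 1) (\<lambda>_. -1) (\<lambda>e. (\<Sum>i<N. x i * e i)\<^sup>2) (\<lambda>_. 0) =
    (\<Sum>i<N. (x i)\<^sup>2 * (p i * (1 / p i - 1)\<^sup>2 + (1 - p i) * (-1)\<^sup>2))"
    using assms by (intro two_pt_second_moment) (force simp: field_simps)
  also have "\<dots> = (\<Sum>i<N. (1 / p i - 1) * (x i)\<^sup>2)"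
    using assms by (intro sum.cong refl) (force simp: field_simps power2_eq_square)
  finally have 1: "two_pt N p (\<lambda>i. 1 / p i - 1) (\<lambda>_. -1) (\<lambda>e. (\<Sum>i<N. x i * e i)\<^sup>2) (\<lambda>_. 0) =
    (\<Sum>i<N. (1 / p i - 1) * (x i)\<^sup>2)" .
  have "(\<Sum>i<N. (s i / p i - 1) * x i) = (\<Sum>i<N. x i * (if i < N then - 1 + (1 / p i - 1 - - 1) * s i else s i))" for s
    by (intro sum.cong refl) (simp add: mult.commute)
  then show ?thesis unfolding two_pt_affine[of N p "\<lambda>i. 1 / p i - 1"] 1[symmetric] by (simp only:)
qed

text \<open>Both values of the centred variable (s/p - 1) x are at most |x|/p in absolute value, so
  convex domination by a sign applies.\<close>

lemma (in coord_seminorm) bern_le_rad: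
  assumes p: "\<And>i. i < N \<Longrightarrow> 0 < p i \<and> p i \<le> 1" and x: "\<And>i. i < N \<Longrightarrow> \<bar>x i\<bar> / p i \<le> C" and C: "C > 0"
  shows "bern N p (\<lambda>s. q (\<lambda>i. if i < N then (s i / p i - 1) * x i else 0)) \<le> C * rad N q (\<lambda>_. 0)"
proof -
  have bd: "\<bar>(1 / p i - 1) * x i\<bar> \<le> C \<and> \<bar>- x i\<bar> \<le> C" if i: "i < N" for i
  proof -
    have pi: "0 < p i" "p i \<le> 1" using p[OF i] by auto
    have "1 / p i - 1 \<ge> 0" using pi by simp
    then have "\<bar>(1 / p i - 1) * x i\<bar> = (1 / p i - 1) * \<bar>x i\<bar>" by (simp only: abs_mult abs_of_nonneg)
    then have 1: "\<bar>(1 / p i - 1) * x i\<bar> = \<bar>x i\<bar> / p i - \<bar>x i\<bar>" by (simp add: left_diff_distrib)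
    have "\<bar>x i\<bar> \<le> \<bar>x i\<bar> / p i" using pi by (simp add: le_divide_eq mult_left_le)
    then show ?thesis using x[OF i] 1 by simp
  qed
  have "two_pt N p (\<lambda>i. (1 / p i - 1) * x i) (\<lambda>i. - x i) q (\<lambda>_. 0) \<le> C * rad N q (\<lambda>_. 0)"
  proof (rule two_pt_le_rad[OF _ _ bd C])
    show "0 \<le> p i \<and> p i \<le> 1" if "i < N" for i using p[OF that] by auto
    show "p i * ((1 / p i - 1) * x i) + (1 - p i) * - x i = 0" if "i < N" for i
    proof -
      have "p i * (1 / p i - 1) = 1 - p i" using p[OF that] by (simp add: right_diff_distrib)
      then show ?thesis by (simp flip: mult.assoc)
    qed
  qed
  also have "two_pt N p (\<lambda>i. (1 / p i - 1) * x i) (\<lambda>i. - x i) q (\<lambda>_. 0) =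
     bern N p (\<lambda>s. q (\<lambda>i. if i < N then (s i / p i - 1) * x i else 0))"
    unfolding two_pt_affine[of N p "\<lambda>i. (1 / p i - 1) * x i"]
  proof (rule two_pt_cong)
    fix s :: "nat \<Rightarrow> real" assume "\<forall>i\<ge>N. s i = 0"
    then have "(\<lambda>i. if i < N then - x i + ((1 / p i - 1) * x i - - x i) * s i else s i) =
      (\<lambda>i. if i < N then (s i / p i - 1) * x i else 0)"
      by (auto simp: fun_eq_iff algebra_simps)
    then show "q (\<lambda>i. if i < N then - x i + ((1 / p i - 1) * x i - - x i) * s i else s i) =
      q (\<lambda>i. if i < N then (s i / p i - 1) * x i else 0)" by (simp only:)
  qed
  finally show ?thesis .
qed

lemma abs_le_1_plus_sq: "\<bar>z::real\<bar> \<le> 1 + z\<^sup>2"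
proof -
  have "0 \<le> (\<bar>z\<bar> - 1)\<^sup>2" by simp
  then have "2 * \<bar>z\<bar> \<le> 1 + z\<^sup>2" by (simp add: power2_diff)
  moreover have "0 \<le> \<bar>z\<bar>" by simp
  ultimately show ?thesis by linarith
qed

context poisson_model
begin

section \<open>Scaled inclusion errors and the Hajek identity\<close>

abbreviation design_mean :: "nat \<Rightarrow> (nat \<Rightarrow> 'y \<times> 'x) \<Rightarrow> ((nat \<Rightarrow> real) \<Rightarrow> real) \<Rightarrow> real" where
  "design_mean N \<omega> \<equiv> bern N (incl N \<omega>)"

text \<open>The error of the Horvitz-Thompson estimator of the population mean of
  \<open>\<psi>\<close>, multiplied by the square root of N.\<close>

definition incl_error :: "nat \<Rightarrow> (nat \<Rightarrow> 'y \<times> 'x) \<Rightarrow> ('y \<times> 'x \<Rightarrow> real) \<Rightarrow> (nat \<Rightarrow> real) \<Rightarrow> real" where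
  "incl_error N \<omega> \<psi> s = (\<Sum>i<N. (s i / incl N \<omega> i - 1) * \<psi> (\<omega> i)) / sqrt (real N)"

definition incl_error_var :: "nat \<Rightarrow> (nat \<Rightarrow> 'y \<times> 'x) \<Rightarrow> ('y \<times> 'x \<Rightarrow> real) \<Rightarrow> real" where
  "incl_error_var N \<omega> \<psi> = (\<Sum>i<N. (1 / incl N \<omega> i - 1) * (\<psi> (\<omega> i))\<^sup>2) / real N"

definition hajek :: "nat \<Rightarrow> (nat \<Rightarrow> 'y \<times> 'x) \<Rightarrow> (nat \<Rightarrow> real) \<Rightarrow> ('y \<Rightarrow> real) \<Rightarrow> real" where
  "hajek N \<omega> s f = (if (\<Sum>i<N. s i / incl N \<omega> i) = 0 then 0
     else sqrt (real N) * (1 / (\<Sum>i<N. s i / incl N \<omega> i) * (\<Sum>i<N. s i / incl N \<omega> i * f (fst (\<omega> i)))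
        - 1 / real N * (\<Sum>i<N. f (fst (\<omega> i)))))"

definition sample_mean :: "nat \<Rightarrow> (nat \<Rightarrow> 'y \<times> 'x) \<Rightarrow> ('y \<times> 'x \<Rightarrow> real) \<Rightarrow> real" where
  "sample_mean N \<omega> \<psi> = (\<Sum>i<N. \<psi> (\<omega> i)) / real N"

lemma design_mean_functional: "expectation_functional (design_mean N \<omega>)"
proof
  show "design_mean N \<omega> \<phi> \<le> design_mean N \<omega> \<psi>" if "\<And>u. \<phi> u \<le> \<psi> u" for \<phi> \<psi>
    using that incl_bounds[of _ N \<omega>] by (intro two_pt_mono) (auto intro: less_imp_le)
qed (simp_all add: two_pt_add two_pt_cmult)

lemma incl_error_second: "design_mean N \<omega> (\<lambda>s. (incl_error N \<omega> \<psi> s)\<^sup>2) = incl_error_var N \<omega> \<psi>"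
proof -
  interpret design_mean: expectation_functional "design_mean N \<omega>" by (rule design_mean_functional)
  have "(incl_error N \<omega> \<psi> s)\<^sup>2 = inverse (real N) * (\<Sum>i<N. (s i / incl N \<omega> i - 1) * \<psi> (\<omega> i))\<^sup>2" for s
  proof -
    have "(incl_error N \<omega> \<psi> s)\<^sup>2 = (\<Sum>i<N. (s i / incl N \<omega> i - 1) * \<psi> (\<omega> i))\<^sup>2 / real N"
      by (simp add: incl_error_def power_divide)
    then show ?thesis by (simp only: divide_inverse[of _ "real N"] mult.commute[of "inverse (real N)"])
  qed
  then have "design_mean N \<omega> (\<lambda>s. (incl_error N \<omega> \<psi> s)\<^sup>2) = inverse (real N) * design_mean N \<omega> (\<lambda>s. (\<Sum>i<N. (s i / incl N \<omega> i - 1) * \<psi> (\<omega> i))\<^sup>2)"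
    by (simp only: design_mean.scale)
  also have "design_mean N \<omega> (\<lambda>s. (\<Sum>i<N. (s i / incl N \<omega> i - 1) * \<psi> (\<omega> i))\<^sup>2) = (\<Sum>i<N. (1 / incl N \<omega> i - 1) * (\<psi> (\<omega> i))\<^sup>2)"
    by (rule bern_variance) (use incl_bounds in blast)
  finally show ?thesis by (simp add: incl_error_var_def divide_inverse mult.commute)
qed

lemma incl_error_abs: "design_mean N \<omega> (\<lambda>s. \<bar>incl_error N \<omega> \<psi> s\<bar>) \<le> 1 + incl_error_var N \<omega> \<psi>"
proof -
  interpret design_mean: expectation_functional "design_mean N \<omega>" by (rule design_mean_functional)
  have "design_mean N \<omega> (\<lambda>s. \<bar>incl_error N \<omega> \<psi> s\<bar>) \<le> design_mean N \<omega> (\<lambda>s. 1 + (incl_error N \<omega> \<psi> s)\<^sup>2)"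
    by (intro design_mean.mono abs_le_1_plus_sq)
  also have "\<dots> = 1 + incl_error_var N \<omega> \<psi>" by (simp only: design_mean.add design_mean.one incl_error_second)
  finally show ?thesis .
qed

lemma incl_error_one: "N \<ge> 1 \<Longrightarrow> (\<Sum>i<N. s i / incl N \<omega> i) = real N + sqrt (real N) * incl_error N \<omega> (\<lambda>_. 1) s"
  by (simp add: incl_error_def sum_subtractf)

text \<open>The Hajek process is invariant under subtracting a constant from \<open>f\<close>, so
  \<open>k\<close> is free. With \<open>k\<close> the mean of \<open>f\<close> the sample mean tends
  to 0 and the second term becomes negligible; \<open>k = 0\<close> serves for comparing two
  functions.\<close>

lemma hajek_identity:
  assumes N: "N \<ge> 1" and nz: "(\<Sum>i<N. s i / incl N \<omega> i) \<noteq> 0"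
  shows "hajek N \<omega> s f = real N / (\<Sum>i<N. s i / incl N \<omega> i) *
    (incl_error N \<omega> (\<lambda>z. f (fst z) - k) s - sample_mean N \<omega> (\<lambda>z. f (fst z) - k) * incl_error N \<omega> (\<lambda>_. 1) s)"
proof -
  define S1 where "S1 = (\<Sum>i<N. s i / incl N \<omega> i)"
  define S where "S = (\<Sum>i<N. s i / incl N \<omega> i * f (fst (\<omega> i)))"
  define B where "B = (\<Sum>i<N. f (fst (\<omega> i)))"
  define r where "r = sqrt (real N)"
  have r: "r > 0" "r * r = real N" using N by (auto simp: r_def)
  have "(\<Sum>i<N. (s i / incl N \<omega> i - 1) * (f (fst (\<omega> i)) - k)) = S - B - k * S1 + k * real N"
    by (simp add: S_def B_def S1_def left_diff_distrib right_diff_distrib diff_divide_distrib sum_subtractf sum_distrib_left mult.commute)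
  then have 1: "incl_error N \<omega> (\<lambda>z. f (fst z) - k) s = (S - B - k * S1 + k * real N) / r" by (simp add: incl_error_def r_def)
  have 2: "incl_error N \<omega> (\<lambda>_. 1) s = (S1 - real N) / r"
    by (simp add: incl_error_def S1_def r_def sum_subtractf)
  have 3: "sample_mean N \<omega> (\<lambda>z. f (fst z) - k) = B / real N - k"
    using N by (simp add: sample_mean_def B_def sum_subtractf diff_divide_distrib)
  have "hajek N \<omega> s f = r * (1 / S1 * S - 1 / real N * B)"
    using nz by (simp add: hajek_def S1_def S_def B_def r_def)
  also have "\<dots> = r * r / S1 * ((S - B - k * S1 + k * (r * r)) / r - (B / (r * r) - k) * ((S1 - r * r) / r))"
    using nz r(1) unfolding S1_def[symmetric] r(2)[symmetric] by (simp add: field_simps)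
  finally show ?thesis unfolding 1 2 3 S1_def[symmetric] r(2)[symmetric] .
qed

subsection \<open>Limits of the conditional moments\<close>

text \<open>Square integrability of \<psi>/\<open>wt\<close> is what the Donsker class provides.
  Since inverse inclusion probabilities are of order 1/\<open>wt\<close>, it also yields the
  Lindeberg condition for the inclusion errors of \<psi>.\<close>

definition sq_int :: "('y \<times> 'x \<Rightarrow> real) \<Rightarrow> bool" where
  "sq_int \<psi> \<longleftrightarrow> \<psi> \<in> borel_measurable Pyx \<and> integrable Pyx (\<lambda>z. (\<psi> z / wt (snd z))\<^sup>2)"

lemma sq_int_add:
  assumes "sq_int \<phi>" "sq_int \<psi>"
  shows "sq_int (\<lambda>z. \<phi> z + \<psi> z)"
proof -
  have [measurable]: "\<phi> \<in> borel_measurable Pyx" "\<psi> \<in> borel_measurable Pyx" using assms by (auto simp: sq_int_def)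
  have "integrable Pyx (\<lambda>z. 2 * ((\<phi> z / wt (snd z))\<^sup>2 + (\<psi> z / wt (snd z))\<^sup>2))"
    using assms by (auto simp: sq_int_def)
  then have "integrable Pyx (\<lambda>z. ((\<phi> z + \<psi> z) / wt (snd z))\<^sup>2)"
  proof (rule Bochner_Integration.integrable_bound)
    show "AE z in Pyx. norm (((\<phi> z + \<psi> z) / wt (snd z))\<^sup>2) \<le> norm (2 * ((\<phi> z / wt (snd z))\<^sup>2 + (\<psi> z / wt (snd z))\<^sup>2))"
    proof (rule AE_I2)
      fix z
      have "(a + b)\<^sup>2 \<le> 2 * (a\<^sup>2 + b\<^sup>2)" for a b :: real
        using zero_le_power2[of "a - b"] by (simp add: power2_sum power2_diff)
      from this[of "\<phi> z / wt (snd z)" "\<psi> z / wt (snd z)"]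
      show "norm (((\<phi> z + \<psi> z) / wt (snd z))\<^sup>2) \<le> norm (2 * ((\<phi> z / wt (snd z))\<^sup>2 + (\<psi> z / wt (snd z))\<^sup>2))"
        by (simp add: add_divide_distrib)
    qed
  qed measurable
  then show ?thesis by (simp add: sq_int_def)
qed

lemma sq_int_scale: "sq_int \<phi> \<Longrightarrow> sq_int (\<lambda>z. k * \<phi> z)"
proof -
  assume \<phi>: "sq_int \<phi>"
  then have [measurable]: "\<phi> \<in> borel_measurable Pyx" by (auto simp: sq_int_def)
  have e: "(k * \<phi> z / wt (snd z))\<^sup>2 = k\<^sup>2 * (\<phi> z / wt (snd z))\<^sup>2" for z
    by (simp add: power_mult_distrib power_divide)
  show ?thesis unfolding sq_int_def e using \<phi> by (auto simp: sq_int_def)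
qed

lemma sq_int_sum: "finite A \<Longrightarrow> (\<And>f. f \<in> A \<Longrightarrow> sq_int (\<phi> f)) \<Longrightarrow> sq_int (\<lambda>z. \<Sum>f\<in>A. \<phi> f z)"
proof (induction A rule: finite_induct)
  case empty
  then show ?case by (simp add: sq_int_def)
next
  case (insert f A)
  then show ?case by (simp add: sq_int_add)
qed

lemma sq_int_F: "f \<in> F \<Longrightarrow> sq_int (\<lambda>z. f (fst z))"
proof -
  assume f: "f \<in> F"
  have [measurable]: "centred_weighted f \<in> borel_measurable Pyx" by (rule centred_weighted_measurable[OF f])
  have "integrable Pyx (\<lambda>z. 2 * ((centred_weighted f z)\<^sup>2 + (weighted_mean f)\<^sup>2))"
    using centred_weighted_square_integrable[OF f] by auto
  then have "integrable Pyx (\<lambda>z. (centred_weighted f z + weighted_mean f)\<^sup>2)"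
  proof (rule Bochner_Integration.integrable_bound)
    have "(a + b)\<^sup>2 \<le> 2 * (a\<^sup>2 + b\<^sup>2)" for a b :: real
      using zero_le_power2[of "a - b"] by (simp add: power2_sum power2_diff)
    then show "AE z in Pyx. norm ((centred_weighted f z + weighted_mean f)\<^sup>2) \<le> norm (2 * ((centred_weighted f z)\<^sup>2 + (weighted_mean f)\<^sup>2))" by simp
  qed measurable
  then show "sq_int (\<lambda>z. f (fst z))"
    using F_comp_measurable[OF f] by (simp add: sq_int_def centred_weighted_def weighted_eq)
qed

text \<open>The almost surely constant member of \<open>F\<close> is divided by \<open>wt\<close>
  like all others, so 1/\<open>wt\<close> is square integrable. This brings the estimated population
  size, through the inclusion error of the constant 1, under control.\<close>

lemma sq_int_one: "sq_int (\<lambda>_. 1)"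
proof -
  obtain f C where f: "f \<in> F" "C \<noteq> 0" "AE y in distr Pyx borel fst. f y = C" using C1 by blast
  have fm: "f \<in> borel_measurable borel" using f F_measurable by auto
  have fst: "fst \<in> measurable Pyx borel"
  proof -
    have "sets Pyx = sets (borel \<Otimes>\<^sub>M borel)"
      using Pyx(2) arg_cong[OF borel_prod, of sets, symmetric] by (rule trans)
    then have "measurable Pyx (borel :: 'y measure) = measurable (borel \<Otimes>\<^sub>M borel) borel"
      by (rule measurable_cong_sets) (rule refl)
    then show ?thesis by simp
  qed
  have ae: "AE z in Pyx. f (fst z) = C"
    using f(3) fm fst by (subst (asm) AE_distr_iff) (auto intro: measurable_sets)
  have sf: "sq_int (\<lambda>z. f (fst z))" by (rule sq_int_F[OF f(1)])
  have "integrable Pyx (\<lambda>z. (f (fst z) / wt (snd z))\<^sup>2) \<longleftrightarrow> integrable Pyx (\<lambda>z. (C / wt (snd z))\<^sup>2)"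
    using ae F_comp_measurable[OF f(1)] by (intro integrable_cong_AE) auto
  then have "integrable Pyx (\<lambda>z. (C / wt (snd z))\<^sup>2)" using sf by (simp add: sq_int_def)
  then have "sq_int (\<lambda>_. C)" by (simp add: sq_int_def)
  from sq_int_scale[OF this, of "1 / C"] show ?thesis using f(2) by simp
qed

lemma sq_int_centred: "f \<in> F \<Longrightarrow> sq_int (\<lambda>z. f (fst z) - k)"
  using sq_int_add[OF sq_int_F sq_int_scale[OF sq_int_one, of "- k"]] by simp

lemma sq_int_integrable:
  assumes "sq_int \<psi>"
  shows "integrable Pyx (\<lambda>z. (\<psi> z)\<^sup>2 / wt (snd z))" "integrable Pyx (\<lambda>z. (\<psi> z)\<^sup>2)" "integrable Pyx \<psi>"
    "integrable Pyx (\<lambda>z. (weight_cap / wt (snd z) - 1) * (\<psi> z)\<^sup>2)"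
proof -
  have [measurable]: "\<psi> \<in> borel_measurable Pyx" using assms by (auto simp: sq_int_def)
  have I: "integrable Pyx (\<lambda>z. (\<psi> z / wt (snd z))\<^sup>2)" using assms by (simp add: sq_int_def)
  define g where "g z = \<psi> z / wt (snd z)" for z
  have g: "\<psi> z = wt (snd z) * g z" for z using wt_bounds(1)[of "snd z"] by (simp add: g_def)
  have gm [measurable]: "g \<in> borel_measurable Pyx" unfolding g_def by measurable
  have Ig: "integrable Pyx (\<lambda>z. weight_cap * (g z)\<^sup>2)" using I by (simp add: g_def)
  have e1: "(\<psi> z)\<^sup>2 / wt (snd z) = wt (snd z) * (g z)\<^sup>2" for z
    using wt_bounds(1)[of "snd z"] by (simp add: g power2_eq_square)
  have b1: "wt (snd z) * (g z)\<^sup>2 \<le> weight_cap * (g z)\<^sup>2" for z using wt_bounds(2)[of "snd z"] by (intro mult_right_mono) auto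
  show i1: "integrable Pyx (\<lambda>z. (\<psi> z)\<^sup>2 / wt (snd z))"
    unfolding e1
  proof (rule Bochner_Integration.integrable_bound[OF Ig])
    show "AE z in Pyx. norm (wt (snd z) * (g z)\<^sup>2) \<le> norm (weight_cap * (g z)\<^sup>2)"
      using b1 wt_bounds(1) weight_cap_pos by (intro AE_I2) (simp add: abs_mult less_imp_le)
  qed measurable
  have e2: "(\<psi> z)\<^sup>2 = wt (snd z) * ((\<psi> z)\<^sup>2 / wt (snd z))" for z using wt_bounds(1)[of "snd z"] by simp
  show i2: "integrable Pyx (\<lambda>z. (\<psi> z)\<^sup>2)"
  proof (rule Bochner_Integration.integrable_bound[OF integrable_mult_right[OF i1, of weight_cap]])
    have "(\<psi> z)\<^sup>2 \<le> weight_cap * ((\<psi> z)\<^sup>2 / wt (snd z))" for z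
    proof -
      have "wt (snd z) * ((\<psi> z)\<^sup>2 / wt (snd z)) \<le> weight_cap * ((\<psi> z)\<^sup>2 / wt (snd z))"
        using wt_bounds[of "snd z"] by (intro mult_right_mono) auto
      then show ?thesis using e2[of z] by linarith
    qed
    then show "AE z in Pyx. norm ((\<psi> z)\<^sup>2) \<le> norm (weight_cap * ((\<psi> z)\<^sup>2 / wt (snd z)))"
      by (intro AE_I2) (simp only: real_norm_def abs_power2, rule order_trans[OF _ abs_ge_self])
  qed measurable
  have "integrable Pyx (\<lambda>z. 1 + (\<psi> z)\<^sup>2)" using i2 by simp
  then show "integrable Pyx \<psi>"
  proof (rule Bochner_Integration.integrable_bound)
    show "AE z in Pyx. norm (\<psi> z) \<le> norm (1 + (\<psi> z)\<^sup>2)" using abs_le_1_plus_sq by (intro AE_I2) simp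
  qed measurable
  have e3: "(weight_cap / wt (snd z) - 1) * (\<psi> z)\<^sup>2 = weight_cap * ((\<psi> z)\<^sup>2 / wt (snd z)) - (\<psi> z)\<^sup>2" for z
    by (simp add: left_diff_distrib)
  show "integrable Pyx (\<lambda>z. (weight_cap / wt (snd z) - 1) * (\<psi> z)\<^sup>2)" unfolding e3 using i1 i2 by (intro Bochner_Integration.integrable_diff integrable_mult_right)
qed

text \<open>Replacing 1/\<open>incl\<close> by \<open>weight_cap / wt\<close> costs at most a
  multiple of the relative error of the scale factor times a convergent average; the law of large
  numbers handles the rest.\<close>

lemma incl_error_var_conv:
  assumes "sq_int \<psi>"
  shows "((\<lambda>x. incl_error_var (fst x) (snd x) \<psi>) \<longlongrightarrow> (\<integral>z. (weight_cap / wt (snd z) - 1) * (\<psi> z)\<^sup>2 \<partial>Pyx)) Fl"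
proof -
  define A where "A x = (\<Sum>i<fst x. (weight_cap / wt (snd (snd x i)) - 1) * (\<psi> (snd x i))\<^sup>2) / real (fst x)" for x :: "nat \<times> (nat \<Rightarrow> 'y \<times> 'x)"
  define B where "B x = (\<Sum>i<fst x. (\<psi> (snd x i))\<^sup>2 / wt (snd (snd x i))) / real (fst x)" for x :: "nat \<times> (nat \<Rightarrow> 'y \<times> 'x)"
  have A: "(A \<longlongrightarrow> (\<integral>z. (weight_cap / wt (snd z) - 1) * (\<psi> z)\<^sup>2 \<partial>Pyx)) Fl"
    using wlln[OF sq_int_integrable(4)[OF assms]] unfolding A_def .
  have B: "(B \<longlongrightarrow> (\<integral>z. (\<psi> z)\<^sup>2 / wt (snd z) \<partial>Pyx)) Fl"
    using wlln[OF sq_int_integrable(1)[OF assms]] unfolding B_def .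
  have "((\<lambda>x. \<bar>scale_factor (fst x) (snd x) * weight_cap - 1\<bar> * (2 * weight_cap) * B x) \<longlongrightarrow> \<bar>1 / weight_cap * weight_cap - 1\<bar> * (2 * weight_cap) * (\<integral>z. (\<psi> z)\<^sup>2 / wt (snd z) \<partial>Pyx)) Fl"
    by (intro tendsto_intros scale_factor_conv B)
  then have z: "((\<lambda>x. \<bar>scale_factor (fst x) (snd x) * weight_cap - 1\<bar> * (2 * weight_cap) * B x) \<longlongrightarrow> 0) Fl" using weight_cap_pos by simp
  have "((\<lambda>x. incl_error_var (fst x) (snd x) \<psi> - A x) \<longlongrightarrow> 0) Fl"
  proof (rule Lim_null_comparison[OF _ z])
    show "\<forall>\<^sub>F x in Fl. norm (incl_error_var (fst x) (snd x) \<psi> - A x) \<le> \<bar>scale_factor (fst x) (snd x) * weight_cap - 1\<bar> * (2 * weight_cap) * B x"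
      using eventually_scale_factor
    proof eventually_elim
      case (elim x)
      obtain N \<omega> where x: "x = (N, \<omega>)" by (cases x)
      define K where "K = \<bar>scale_factor N \<omega> * weight_cap - 1\<bar>"
      define X where "X i = (1 / incl N \<omega> i - weight_cap / wt (snd (\<omega> i))) * (\<psi> (\<omega> i))\<^sup>2" for i
      define Y where "Y i = (\<psi> (\<omega> i))\<^sup>2 / wt (snd (\<omega> i))" for i
      have diff: "incl_error_var N \<omega> \<psi> - A x = (\<Sum>i<N. X i) / real N"
        unfolding incl_error_var_def A_def x fst_conv snd_conv diff_divide_distrib[symmetric] sum_subtractf[symmetric] X_def
        by (intro arg_cong2[where f="(/)"] sum.cong refl) (simp add: left_diff_distrib)
      have "\<bar>X i\<bar> \<le> K * (2 * weight_cap) * Y i" if i: "i \<in> {..<N}" for i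
      proof -
        have "\<bar>1 / incl N \<omega> i - weight_cap / wt (snd (\<omega> i))\<bar> \<le> K * (2 * weight_cap / wt (snd (\<omega> i)))"
          unfolding K_def using elim i by (intro incl_inverse_diff) (auto simp: x)
        then have "\<bar>X i\<bar> \<le> K * (2 * weight_cap / wt (snd (\<omega> i))) * (\<psi> (\<omega> i))\<^sup>2"
          unfolding X_def abs_mult abs_power2 by (rule mult_right_mono) simp
        then show ?thesis by (simp add: Y_def)
      qed
      then have "(\<Sum>i<N. \<bar>X i\<bar>) \<le> (\<Sum>i<N. K * (2 * weight_cap) * Y i)" by (rule sum_mono)
      then have "\<bar>\<Sum>i<N. X i\<bar> \<le> K * (2 * weight_cap) * (\<Sum>i<N. Y i)"
        unfolding sum_distrib_left using order_trans[OF sum_abs] by blast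
      then have "\<bar>(\<Sum>i<N. X i) / real N\<bar> \<le> K * (2 * weight_cap) * (\<Sum>i<N. Y i) / real N"
        unfolding abs_divide abs_of_nat by (rule divide_right_mono) simp
      then show ?case
        unfolding x fst_conv snd_conv diff[unfolded x] B_def Y_def K_def by (simp only: real_norm_def times_divide_eq_right)
    qed
  qed
  from tendsto_add[OF this A] show ?thesis by simp
qed

text \<open>The remainder of \<open>bern_clt\<close> with \<open>D\<close> taken from
  \<open>incl_lower\<close>. Large values of (\<psi>/\<open>wt\<close>)^2 have a small average by
  integrability; for the others the factor \<open>min\<close> is of order 1/sqrt N.\<close>

lemma lindeberg_conv:
  assumes "sq_int \<psi>"
  shows "((\<lambda>x. \<Sum>i<fst x. (2 * weight_cap * \<bar>\<psi> (snd x i) / wt (snd (snd x i))\<bar> / sqrt (real (fst x)))\<^sup>2 *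
      min 1 (2 * weight_cap * \<bar>\<psi> (snd x i) / wt (snd (snd x i))\<bar> / sqrt (real (fst x)))) \<longlongrightarrow> 0) Fl" (is "(?S \<longlongrightarrow> 0) Fl")
proof (rule order_tendstoI_real)
  define g where "g z = \<psi> z / wt (snd z)" for z
  have [measurable]: "\<psi> \<in> borel_measurable Pyx" using assms by (auto simp: sq_int_def)
  have [measurable]: "g \<in> borel_measurable Pyx" unfolding g_def by measurable
  have Ig: "integrable Pyx (\<lambda>z. (g z)\<^sup>2)" using assms by (simp add: sq_int_def g_def)
  fix \<delta> :: real assume \<delta>: "\<delta> > 0"
  have S0: "0 \<le> ?S x" for x using weight_cap_pos by (intro sum_nonneg mult_nonneg_nonneg) auto
  show "\<forall>\<^sub>F x in Fl. 0 - \<delta> < ?S x"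
  proof (intro always_eventually allI)
    fix x show "0 - \<delta> < ?S x" using S0[of x] \<delta> by linarith
  qed
  define c where "c = (2 * weight_cap)\<^sup>2"
  have c: "c > 0" using weight_cap_pos by (simp add: c_def)
  define E2 where "E2 = (\<integral>z. (g z)\<^sup>2 \<partial>Pyx) + 1"
  have E2: "E2 > 0" unfolding E2_def by (intro add_nonneg_pos integral_nonneg_AE) auto
  have "(\<lambda>K. \<integral>z. \<bar>(g z)\<^sup>2\<bar> * indicator {z. \<bar>(g z)\<^sup>2\<bar> > real K} z \<partial>Pyx) \<longlonglongrightarrow> 0"
    by (rule truncation_L1[OF Ig])
  then have "\<forall>\<^sub>F K in sequentially. (\<integral>z. \<bar>(g z)\<^sup>2\<bar> * indicator {z. \<bar>(g z)\<^sup>2\<bar> > real K} z \<partial>Pyx) < \<delta> / (2 * c)"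
    using \<delta> c by (intro order_tendstoD(2)) auto
  then obtain K :: nat where K: "(\<integral>z. \<bar>(g z)\<^sup>2\<bar> * indicator {z. \<bar>(g z)\<^sup>2\<bar> > real K} z \<partial>Pyx) < \<delta> / (2 * c)"
    by (auto dest: eventually_happens)
  define h where "h z = (if (g z)\<^sup>2 > real K then (g z)\<^sup>2 else 0)" for z
  have hm [measurable]: "h \<in> borel_measurable Pyx" unfolding h_def by measurable
  have Ih: "integrable Pyx h" by (rule Bochner_Integration.integrable_bound[OF Ig]) (auto simp: h_def)
  have "(\<integral>z. h z \<partial>Pyx) = (\<integral>z. \<bar>(g z)\<^sup>2\<bar> * indicator {z. \<bar>(g z)\<^sup>2\<bar> > real K} z \<partial>Pyx)"
    by (intro Bochner_Integration.integral_cong refl) (simp add: h_def)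
  then have Eh: "(\<integral>z. h z \<partial>Pyx) < \<delta> / (2 * c)" using K by simp
  have 1: "\<forall>\<^sub>F x in Fl. (\<Sum>i<fst x. h (snd x i)) / real (fst x) < \<delta> / (2 * c)"
    using order_tendstoD(2)[OF wlln[OF Ih] Eh] .
  have 2: "\<forall>\<^sub>F x in Fl. (\<Sum>i<fst x. (g (snd x i))\<^sup>2) / real (fst x) < E2"
    using wlln[OF Ig] unfolding E2_def by (intro order_tendstoD(2)) auto
  have "((\<lambda>N. 2 * weight_cap * sqrt (real K) / sqrt (real N)) \<longlongrightarrow> 0) sequentially"
    by (intro real_tendsto_divide_at_top[OF tendsto_const] filterlim_compose[OF sqrt_at_top filterlim_real_sequentially])
  then have "((\<lambda>x. 2 * weight_cap * sqrt (real K) / sqrt (real (fst x))) \<longlongrightarrow> 0) Fl" by (rule tendsto_outer_filter_fst)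
  then have 3: "\<forall>\<^sub>F x in Fl. 2 * weight_cap * sqrt (real K) / sqrt (real (fst x)) < \<delta> / (2 * c * E2)"
    using \<delta> c E2 by (intro order_tendstoD(2)) auto
  show "\<forall>\<^sub>F x in Fl. ?S x < 0 + \<delta>"
    using 1 2 3 eventually_ge_Fl[of 1]
  proof eventually_elim
    case (elim x)
    obtain N \<omega> where x: "x = (N, \<omega>)" by (cases x)
    have N: "real N > 0" using elim by (simp add: x)
    define r where "r = 2 * weight_cap * sqrt (real K) / sqrt (real N)"
    have r0: "r \<ge> 0" using weight_cap_pos by (simp add: r_def)
    have summand: "(2 * weight_cap * \<bar>g (\<omega> i)\<bar> / sqrt (real N))\<^sup>2 * min 1 (2 * weight_cap * \<bar>g (\<omega> i)\<bar> / sqrt (real N)) \<le>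
        c * (h (\<omega> i) / real N) + c * r * ((g (\<omega> i))\<^sup>2 / real N)" for i
    proof -
      have sq: "(2 * weight_cap * \<bar>g (\<omega> i)\<bar> / sqrt (real N))\<^sup>2 = c * ((g (\<omega> i))\<^sup>2 / real N)"
        using N by (simp add: c_def power_mult_distrib power_divide)
      have nn: "0 \<le> c * ((g (\<omega> i))\<^sup>2 / real N)" using c by simp
      show ?thesis
      proof (cases "(g (\<omega> i))\<^sup>2 > real K")
        case True
        have "c * ((g (\<omega> i))\<^sup>2 / real N) * min 1 (2 * weight_cap * \<bar>g (\<omega> i)\<bar> / sqrt (real N)) \<le> c * ((g (\<omega> i))\<^sup>2 / real N) * 1"
          using nn by (intro mult_left_mono) auto
        moreover have "0 \<le> c * r * ((g (\<omega> i))\<^sup>2 / real N)" using c r0 by simp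
        ultimately show ?thesis using True unfolding sq by (simp add: h_def)
      next
        case False
        then have "\<bar>g (\<omega> i)\<bar> \<le> sqrt (real K)" by (simp add: real_le_rsqrt)
        then have "2 * weight_cap * \<bar>g (\<omega> i)\<bar> / sqrt (real N) \<le> r"
          unfolding r_def using weight_cap_pos by (intro divide_right_mono mult_left_mono) auto
        then have "c * ((g (\<omega> i))\<^sup>2 / real N) * min 1 (2 * weight_cap * \<bar>g (\<omega> i)\<bar> / sqrt (real N)) \<le> c * ((g (\<omega> i))\<^sup>2 / real N) * r"
          using nn by (intro mult_left_mono) auto
        then show ?thesis using False unfolding sq by (simp add: h_def algebra_simps)
      qed
    qed
    have "?S x \<le> (\<Sum>i<N. c * (h (\<omega> i) / real N) + c * r * ((g (\<omega> i))\<^sup>2 / real N))"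
      unfolding x fst_conv snd_conv g_def[symmetric] by (intro sum_mono summand)
    also have "\<dots> = c * ((\<Sum>i<N. h (\<omega> i)) / real N) + c * r * ((\<Sum>i<N. (g (\<omega> i))\<^sup>2) / real N)"
      by (simp only: sum.distrib sum_distrib_left[symmetric] sum_divide_distrib[symmetric])
    finally have total: "?S x \<le> c * ((\<Sum>i<N. h (\<omega> i)) / real N) + c * r * ((\<Sum>i<N. (g (\<omega> i))\<^sup>2) / real N)" .
    have "c * ((\<Sum>i<N. h (\<omega> i)) / real N) < c * (\<delta> / (2 * c))"
      using elim(1) c by (intro mult_strict_left_mono) (auto simp: x)
    moreover have "c * (\<delta> / (2 * c)) = \<delta> / 2" using c by simp
    moreover have "c * r * ((\<Sum>i<N. (g (\<omega> i))\<^sup>2) / real N) \<le> c * r * E2"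
      using elim(2) c r0 by (intro mult_left_mono) (auto simp: x)
    moreover have "c * r * E2 \<le> c * (\<delta> / (2 * c * E2)) * E2"
      using elim(3) c E2 by (intro mult_right_mono mult_left_mono) (auto simp: x r_def)
    moreover have "c * (\<delta> / (2 * c * E2)) * E2 = \<delta> / 2" using c E2 by (simp add: field_simps)
    ultimately show ?case using total by linarith
  qed
qed

text \<open>The distance to the normal expression with the design variance vanishes by the Lindeberg
  bound, and the design variance itself converges.\<close>

theorem incl_error_clt:
  assumes "sq_int \<psi>"
  shows "((\<lambda>x. design_mean (fst x) (snd x) (\<lambda>s. cos (incl_error (fst x) (snd x) \<psi> s + b))) \<longlongrightarrow>
     exp (- (\<integral>z. (weight_cap / wt (snd z) - 1) * (\<psi> z)\<^sup>2 \<partial>Pyx) / 2) * cos b) Fl"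
proof -
  define V where "V = (\<integral>z. (weight_cap / wt (snd z) - 1) * (\<psi> z)\<^sup>2 \<partial>Pyx)"
  define S where "S x = (\<Sum>i<fst x. (2 * weight_cap * \<bar>\<psi> (snd x i) / wt (snd (snd x i))\<bar> / sqrt (real (fst x)))\<^sup>2 *
      min 1 (2 * weight_cap * \<bar>\<psi> (snd x i) / wt (snd (snd x i))\<bar> / sqrt (real (fst x))))" for x
  have S: "((\<lambda>x. 2 * S x) \<longlongrightarrow> 0) Fl" using tendsto_mult_right_zero[OF lindeberg_conv[OF assms]] unfolding S_def .
  have lim: "((\<lambda>x. exp (- incl_error_var (fst x) (snd x) \<psi> / 2) * cos b) \<longlongrightarrow> exp (- V / 2) * cos b) Fl"
    using incl_error_var_conv[OF assms] unfolding V_def by (intro tendsto_intros) auto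
  have "((\<lambda>x. design_mean (fst x) (snd x) (\<lambda>s. cos (incl_error (fst x) (snd x) \<psi> s + b)) - exp (- incl_error_var (fst x) (snd x) \<psi> / 2) * cos b) \<longlongrightarrow> 0) Fl"
  proof (rule Lim_null_comparison[OF _ S])
    show "\<forall>\<^sub>F x in Fl. norm (design_mean (fst x) (snd x) (\<lambda>s. cos (incl_error (fst x) (snd x) \<psi> s + b)) - exp (- incl_error_var (fst x) (snd x) \<psi> / 2) * cos b) \<le> 2 * S x"
      using eventually_scale_factor eventually_ge_Fl[of 1]
    proof eventually_elim
      case (elim x)
      obtain N \<omega> where x: "x = (N, \<omega>)" by (cases x)
      define z where "z i = \<psi> (\<omega> i) / sqrt (real N)" for i
      define D where "D i = 2 * weight_cap * \<bar>\<psi> (\<omega> i) / wt (snd (\<omega> i))\<bar> / sqrt (real N)" for i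
      have D: "\<bar>z i\<bar> / incl N \<omega> i \<le> D i" if "i < N" for i
      proof -
        have "\<bar>z i\<bar> * (1 / incl N \<omega> i) \<le> \<bar>z i\<bar> * (2 * weight_cap / wt (snd (\<omega> i)))"
          using elim(1) that by (intro mult_left_mono incl_lower) (auto simp: x)
        also have "\<dots> = D i" using wt_bounds(1)[of "snd (\<omega> i)"] by (simp add: z_def D_def abs_divide mult_ac)
        finally show ?thesis by simp
      qed
      have t: "incl_error N \<omega> \<psi> s = (\<Sum>i<N. (s i / incl N \<omega> i - 1) * z i)" for s
        by (simp add: incl_error_def z_def sum_divide_distrib)
      have v: "incl_error_var N \<omega> \<psi> = (\<Sum>i<N. (1 / incl N \<omega> i - 1) * (z i)\<^sup>2)"
        by (simp add: incl_error_var_def z_def sum_divide_distrib power_divide)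
      have "\<bar>design_mean N \<omega> (\<lambda>s. cos ((\<Sum>i<N. (s i / incl N \<omega> i - 1) * z i) + b))
        - exp (- (\<Sum>i<N. (1 / incl N \<omega> i - 1) * (z i)\<^sup>2) / 2) * cos b\<bar> \<le> 2 * (\<Sum>i<N. (D i)\<^sup>2 * min 1 (D i))"
        using D incl_bounds by (intro bern_clt) auto
      then show ?case unfolding x fst_conv snd_conv t v S_def D_def real_norm_def .
    qed
  qed
  from tendsto_add[OF this lim] show ?thesis unfolding V_def by simp
qed

end

context poisson_model
begin

subsection \<open>Oscillation of the Hajek process over a discretization\<close>

lemma F_bounded: "\<exists>B. \<forall>f\<in>F. \<bar>f (fst (z :: 'y \<times> 'x))\<bar> \<le> B"
proof -
  obtain B1 B2 where B: "\<forall>f\<in>F. \<bar>centred_weighted f z\<bar> \<le> B1" "\<forall>f\<in>F. \<bar>weighted_mean f\<bar> \<le> B2"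
    using centred_weighted_bounded weighted_mean_bounded by blast
  have "\<bar>f (fst z)\<bar> \<le> weight_cap * (B1 + B2)" if "f \<in> F" for f
  proof -
    have "\<bar>centred_weighted f z + weighted_mean f\<bar> \<le> B1 + B2" using bspec[OF B(1) that] bspec[OF B(2) that] by linarith
    then have "wt (snd z) * \<bar>centred_weighted f z + weighted_mean f\<bar> \<le> weight_cap * (B1 + B2)"
      using wt_bounds[of "snd z"] by (intro mult_mono) auto
    moreover have "f (fst z) = wt (snd z) * (centred_weighted f z + weighted_mean f)"
      using weighted_mult[of z f] by (simp add: centred_weighted_def)
    ultimately show ?thesis using wt_bounds(1)[of "snd z"] by (simp add: abs_mult)
  qed
  then show ?thesis by blast
qed

lemma hajek_bounded: "\<exists>B. \<forall>f\<in>F. \<bar>hajek N \<omega> s f\<bar> \<le> B"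
proof -
  define b where "b i = (SOME B. \<forall>f\<in>F. \<bar>f (fst (\<omega> i))\<bar> \<le> B)" for i
  have b: "\<forall>f\<in>F. \<bar>f (fst (\<omega> i))\<bar> \<le> b i" for i unfolding b_def by (rule someI_ex[OF F_bounded])
  define S1 where "S1 = (\<Sum>i<N. s i / incl N \<omega> i)"
  define B where "B = sqrt (real N) * (\<bar>1 / S1\<bar> * (\<Sum>i<N. \<bar>s i / incl N \<omega> i\<bar> * b i) + \<bar>1 / real N\<bar> * (\<Sum>i<N. b i))"
  have "\<bar>hajek N \<omega> s f\<bar> \<le> B" if f: "f \<in> F" for f
  proof -
    have bf: "\<bar>f (fst (\<omega> i))\<bar> \<le> b i" for i using b f by blast
    then have b0: "0 \<le> b i" for i using abs_ge_zero order_trans by blast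
    have B0: "0 \<le> B" unfolding B_def by (intro mult_nonneg_nonneg add_nonneg_nonneg sum_nonneg b0) auto
    have 1: "\<bar>\<Sum>i<N. s i / incl N \<omega> i * f (fst (\<omega> i))\<bar> \<le> (\<Sum>i<N. \<bar>s i / incl N \<omega> i\<bar> * b i)"
      by (rule order_trans[OF sum_abs], rule sum_mono) (simp only: abs_mult, intro mult_left_mono bf abs_ge_zero)
    have 2: "\<bar>\<Sum>i<N. f (fst (\<omega> i))\<bar> \<le> (\<Sum>i<N. b i)"
      by (rule order_trans[OF sum_abs], rule sum_mono) (rule bf)
    have "\<bar>1 / S1 * (\<Sum>i<N. s i / incl N \<omega> i * f (fst (\<omega> i))) - 1 / real N * (\<Sum>i<N. f (fst (\<omega> i)))\<bar> \<le>
      \<bar>1 / S1\<bar> * (\<Sum>i<N. \<bar>s i / incl N \<omega> i\<bar> * b i) + \<bar>1 / real N\<bar> * (\<Sum>i<N. b i)"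
      by (rule order_trans[OF abs_triangle_ineq4])
        (simp only: abs_mult, intro add_mono mult_left_mono 1 2 abs_ge_zero)
    then have "sqrt (real N) * \<bar>1 / S1 * (\<Sum>i<N. s i / incl N \<omega> i * f (fst (\<omega> i))) - 1 / real N * (\<Sum>i<N. f (fst (\<omega> i)))\<bar> \<le> B"
      unfolding B_def by (intro mult_left_mono) auto
    then show ?thesis using B0 unfolding hajek_def S1_def[symmetric] by (simp add: abs_mult)
  qed
  then show ?thesis by blast
qed

lemma hajek_mspace:
  assumes "\<rho> ` F \<subseteq> F"
  shows "restrict (\<lambda>f. hajek N \<omega> s (\<rho> f)) F \<in> mspace (linf F)"
proof -
  obtain B where B: "\<forall>f\<in>F. \<bar>hajek N \<omega> s f\<bar> \<le> B" using hajek_bounded by blast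
  have "\<forall>f\<in>F. \<bar>restrict (\<lambda>f. hajek N \<omega> s (\<rho> f)) F f\<bar> \<le> B" using B assms by auto
  then show ?thesis unfolding linf_mspace by (intro conjI exI[of _ B]) auto
qed

lemma incl_error_var_one_le:
  assumes "scale_factor N \<omega> \<ge> 1 / (2 * weight_cap)" "(\<Sum>i<N. 1 / wt (snd (\<omega> i))) / real N \<le> D"
  shows "incl_error_var N \<omega> (\<lambda>_. 1) \<le> 2 * weight_cap * D"
proof -
  have "(\<Sum>i<N. (1 / incl N \<omega> i - 1) * 1\<^sup>2) \<le> (\<Sum>i<N. 2 * weight_cap * (1 / wt (snd (\<omega> i))))"
    using incl_lower[OF assms(1)] by (intro sum_mono) (simp add: diff_le_eq add_increasing2)
  then have "incl_error_var N \<omega> (\<lambda>_. 1) \<le> (\<Sum>i<N. 2 * weight_cap * (1 / wt (snd (\<omega> i)))) / real N"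
    unfolding incl_error_var_def by (rule divide_right_mono) simp
  also have "\<dots> = 2 * weight_cap * ((\<Sum>i<N. 1 / wt (snd (\<omega> i))) / real N)" by (simp add: sum_distrib_left)
  also have "\<dots> \<le> 2 * weight_cap * D" using assms(2) weight_cap_pos by (intro mult_left_mono) auto
  finally show ?thesis .
qed

lemma incl_error_var_wt_le:
  assumes "scale_factor N \<omega> \<ge> 1 / (2 * weight_cap)" "N \<ge> 1"
  shows "incl_error_var N \<omega> (\<lambda>z. wt (snd z)) \<le> 2 * weight_cap\<^sup>2"
proof -
  have "(1 / incl N \<omega> i - 1) * (wt (snd (\<omega> i)))\<^sup>2 \<le> 2 * weight_cap\<^sup>2" if "i < N" for i
  proof -
    have w: "0 < wt (snd (\<omega> i))" "wt (snd (\<omega> i)) \<le> weight_cap" by (rule wt_bounds)+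
    have "(1 / incl N \<omega> i - 1) * (wt (snd (\<omega> i)))\<^sup>2 \<le> (2 * weight_cap / wt (snd (\<omega> i))) * (wt (snd (\<omega> i)))\<^sup>2"
      using incl_lower[OF assms(1) that] by (intro mult_right_mono) auto
    also have "\<dots> = 2 * weight_cap * wt (snd (\<omega> i))" using w by (simp add: power2_eq_square)
    also have "\<dots> \<le> 2 * weight_cap * weight_cap" using w weight_cap_pos by (intro mult_left_mono) auto
    finally show ?thesis by (simp add: power2_eq_square)
  qed
  then have "(\<Sum>i<N. (1 / incl N \<omega> i - 1) * (wt (snd (\<omega> i)))\<^sup>2) \<le> (\<Sum>i<N. 2 * weight_cap\<^sup>2)" by (intro sum_mono) auto
  then show ?thesis unfolding incl_error_var_def using assms(2) by (simp add: divide_le_eq mult.commute)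
qed

text \<open>The data are fixed and the bound has four sources.
  \<open>8 * weight_cap * D / real N\<close> is Chebyshev's inequality for an estimated population
  size below N/2; \<open>16 * weight_cap * \<epsilon>\<close> stems from the increments of the
  centred weighted functions, by convex domination; the term with
  \<open>\<delta> * (1 + 2 * weight_cap\<^sup>2)\<close> from the increments of their means; the
  last one from the change of the sample means times the error of the estimated size.\<close>

lemma hajek_osc_bound:
  assumes N: "N \<ge> 1" and a: "scale_factor N \<omega> \<ge> 1 / (2 * weight_cap)" and \<rho>: "\<rho> ` F \<subseteq> F" and \<delta>: "\<delta> \<ge> 0" and \<epsilon>: "\<epsilon> > 0"
    and weighted_mean: "\<And>f. f \<in> F \<Longrightarrow> \<bar>weighted_mean f - weighted_mean (\<rho> f)\<bar> \<le> \<delta>"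
    and event: "rad N (\<lambda>e. of_bool (\<exists>f\<in>F. \<bar>\<Sum>i<N. e i * (centred_weighted f (\<omega> i) - centred_weighted (\<rho> f) (\<omega> i))\<bar> > 4 * \<epsilon> * sqrt (real N))) (\<lambda>_. 0) < (1/12 :: real)"
    and D: "(\<Sum>i<N. 1 / wt (snd (\<omega> i))) / real N \<le> D"
    and h: "h \<in> BL1 F"
  shows "\<bar>design_mean N \<omega> (\<lambda>s. h (restrict (\<lambda>f. hajek N \<omega> s f) F)) - design_mean N \<omega> (\<lambda>s. h (restrict (\<lambda>f. hajek N \<omega> s (\<rho> f)) F))\<bar>
    \<le> 8 * weight_cap * D / real N + 2 * (16 * weight_cap * \<epsilon> + \<delta> * (1 + 2 * weight_cap\<^sup>2) + weight_cap * (6 * \<epsilon> + \<delta>) * (1 + 2 * weight_cap * D))"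
proof -
  interpret design_mean: expectation_functional "design_mean N \<omega>" by (rule design_mean_functional)
  define \<Delta> where "\<Delta> f i = centred_weighted f (\<omega> i) - centred_weighted (\<rho> f) (\<omega> i)" for f i
  define t where "t = 4 * \<epsilon> * sqrt (real N)"
  have t: "t \<ge> 0" using \<epsilon> by (simp add: t_def)
  have FN: "F \<noteq> {}" using C1 by blast
  have \<rho>F: "\<rho> f \<in> F" if "f \<in> F" for f using \<rho> that by blast
  define b where "b i = (SOME B. \<forall>f\<in>F. \<bar>centred_weighted f (\<omega> i)\<bar> \<le> B)" for i
  have b: "\<forall>f\<in>F. \<bar>centred_weighted f (\<omega> i)\<bar> \<le> b i" for i unfolding b_def by (rule someI_ex[OF centred_weighted_bounded])
  have \<Delta>b: "\<bar>\<Delta> f i\<bar> \<le> 2 * b i" if "f \<in> F" for f i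
    using bspec[OF b that] bspec[OF b \<rho>F[OF that]] unfolding \<Delta>_def by (smt (verit))
  define q where "q e = (SUP f\<in>F. \<bar>\<Sum>i<N. e i * \<Delta> f i\<bar>)" for e :: "nat \<Rightarrow> real"
  have bdd: "bdd_above ((\<lambda>f. \<bar>\<Sum>i<N. e i * \<Delta> f i\<bar>) ` F)" for e :: "nat \<Rightarrow> real"
  proof (rule bdd_aboveI2)
    fix f assume f: "f \<in> F"
    show "\<bar>\<Sum>i<N. e i * \<Delta> f i\<bar> \<le> (\<Sum>i<N. \<bar>e i\<bar> * (2 * b i))"
      by (rule order_trans[OF sum_abs], rule sum_mono) (simp only: abs_mult, intro mult_left_mono \<Delta>b f abs_ge_zero)
  qed
  have q_upper: "\<bar>\<Sum>i<N. e i * \<Delta> f i\<bar> \<le> q e" if "f \<in> F" for f e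
    unfolding q_def by (rule cSUP_upper[OF that bdd])
  have q_least: "q e \<le> B" if "\<And>f. f \<in> F \<Longrightarrow> \<bar>\<Sum>i<N. e i * \<Delta> f i\<bar> \<le> B" for e B
    unfolding q_def by (rule cSUP_least[OF FN that])
  have q0: "q e \<ge> 0" for e
  proof -
    obtain f where "f \<in> F" using FN by blast
    from q_upper[OF this, of e] show ?thesis using abs_ge_zero order_trans by blast
  qed
  have scale_le: "q (\<lambda>i. k * e i) \<le> \<bar>k\<bar> * q e" for k e
  proof (rule q_least)
    fix f assume f: "f \<in> F"
    have "(\<Sum>i<N. k * e i * \<Delta> f i) = k * (\<Sum>i<N. e i * \<Delta> f i)" by (simp add: sum_distrib_left mult.assoc)
    then show "\<bar>\<Sum>i<N. k * e i * \<Delta> f i\<bar> \<le> \<bar>k\<bar> * q e"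
      by (simp only: abs_mult) (intro mult_left_mono q_upper f abs_ge_zero)
  qed
  interpret q: coord_seminorm q
  proof
    fix x y :: "nat \<Rightarrow> real"
    show "q (\<lambda>i. x i + y i) \<le> q x + q y"
    proof (rule q_least)
      fix f assume f: "f \<in> F"
      have "(\<Sum>i<N. (x i + y i) * \<Delta> f i) = (\<Sum>i<N. x i * \<Delta> f i) + (\<Sum>i<N. y i * \<Delta> f i)"
        by (simp add: distrib_right sum.distrib)
      then show "\<bar>\<Sum>i<N. (x i + y i) * \<Delta> f i\<bar> \<le> q x + q y"
        using q_upper[OF f, of x] q_upper[OF f, of y] by linarith
    qed
  next
    fix k :: real and x :: "nat \<Rightarrow> real"
    show "q (\<lambda>i. k * x i) = \<bar>k\<bar> * q x"
    proof (cases "k = 0")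
      case True
      then show ?thesis using scale_le[of 0 x] q0[of "\<lambda>i. 0 * x i"] by simp
    next
      case False
      \<comment> \<open>The reverse inequality is \<open>scale_le\<close> for the inverse
        factor.\<close>
      have "q (\<lambda>i. (1 / k) * (k * x i)) \<le> \<bar>1 / k\<bar> * q (\<lambda>i. k * x i)" by (rule scale_le)
      moreover have "(\<lambda>i. (1 / k) * (k * x i)) = x" using False by auto
      ultimately have "q x \<le> q (\<lambda>i. k * x i) / \<bar>k\<bar>" by simp
      then have "\<bar>k\<bar> * q x \<le> q (\<lambda>i. k * x i)" using False by (simp add: le_divide_eq mult.commute)
      then show ?thesis using scale_le[of k x] by linarith
    qed
  qed
  have evt: "rad N (\<lambda>e. of_bool (\<exists>f\<in>F. \<bar>\<Sum>i<N. e i * \<Delta> f i\<bar> > t)) (\<lambda>_. 0) < (1/12 :: real)"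
    using event unfolding \<Delta>_def t_def .
  have mean: "rad N q (\<lambda>_. 0) \<le> 2 * t"
  proof (rule q.rad_mean_le[OF _ t])
    have "rad N (\<lambda>e. of_bool (q e > t)) (\<lambda>_. 0) \<le> rad N (\<lambda>e. of_bool (\<exists>f\<in>F. \<bar>\<Sum>i<N. e i * \<Delta> f i\<bar> > t) :: real) (\<lambda>_. 0)"
    proof (rule two_pt_mono)
      fix e :: "nat \<Rightarrow> real"
      have "q e > t \<Longrightarrow> \<exists>f\<in>F. \<bar>\<Sum>i<N. e i * \<Delta> f i\<bar> > t"
        using q_least[of e t] by (meson not_le)
      then show "of_bool (q e > t) \<le> (of_bool (\<exists>f\<in>F. \<bar>\<Sum>i<N. e i * \<Delta> f i\<bar> > t) :: real)" by auto
    qed simp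
    then show "rad N (\<lambda>e. of_bool (q e > t)) (\<lambda>_. 0) \<le> (1/4 :: real)" using evt by linarith
  qed
  \<comment> \<open>The same event, read for a single function, bounds its sum of squares by 2
    t^2.\<close>
  have sq: "(\<Sum>i<N. (\<Delta> f i)\<^sup>2) \<le> 32 * \<epsilon>\<^sup>2 * real N" if f: "f \<in> F" for f
  proof -
    have "rad N (\<lambda>e. of_bool (\<bar>\<Sum>i<N. \<Delta> f i * e i\<bar> > t)) (\<lambda>_. 0) \<le> rad N (\<lambda>e. of_bool (\<exists>f\<in>F. \<bar>\<Sum>i<N. e i * \<Delta> f i\<bar> > t) :: real) (\<lambda>_. 0)"
      by (rule two_pt_mono) (use f in \<open>auto simp: mult.commute\<close>)
    then have "(\<Sum>i<N. (\<Delta> f i)\<^sup>2) \<le> 2 * t\<^sup>2" using evt by (intro rad_quantile_variance) linarith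
    then show ?thesis by (simp add: t_def power_mult_distrib)
  qed
  define \<xi> where "\<xi> s = (\<lambda>i. if i < N then (s i / incl N \<omega> i - 1) * wt (snd (\<omega> i)) else 0)" for s :: "nat \<Rightarrow> real"
  have E\<xi>: "design_mean N \<omega> (\<lambda>s. q (\<xi> s)) \<le> 2 * weight_cap * (2 * t)"
  proof -
    have "design_mean N \<omega> (\<lambda>s. q (\<xi> s)) \<le> 2 * weight_cap * rad N q (\<lambda>_. 0)"
      unfolding \<xi>_def
    proof (rule q.bern_le_rad)
      fix i assume i: "i < N"
      show "0 < incl N \<omega> i \<and> incl N \<omega> i \<le> 1" using incl_bounds[OF i] by blast
      have w: "0 < wt (snd (\<omega> i))" by (rule wt_bounds)
      have "wt (snd (\<omega> i)) * (1 / incl N \<omega> i) \<le> wt (snd (\<omega> i)) * (2 * weight_cap / wt (snd (\<omega> i)))"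
        using w by (intro mult_left_mono incl_lower a i) auto
      then show "\<bar>wt (snd (\<omega> i))\<bar> / incl N \<omega> i \<le> 2 * weight_cap" using w by simp
    qed (use weight_cap_pos in simp)
    also have "\<dots> \<le> 2 * weight_cap * (2 * t)" using mean weight_cap_pos by (intro mult_left_mono) auto
    finally show ?thesis .
  qed
  \<comment> \<open>Multiplying back by \<open>wt\<close> splits an increment into its centred part
    and the increment of the means, which is deterministic and at most \<delta>.\<close>
  have fdiff: "f (fst (\<omega> i)) - \<rho> f (fst (\<omega> i)) = wt (snd (\<omega> i)) * (\<Delta> f i + (weighted_mean f - weighted_mean (\<rho> f)))" for f i
    using weighted_mult[of "\<omega> i" f] weighted_mult[of "\<omega> i" "\<rho> f"]
    by (simp add: \<Delta>_def centred_weighted_def right_diff_distrib)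
  define r where "r = sqrt (real N)"
  have r: "r > 0" "r * r = real N" using N by (auto simp: r_def)
  define t1 where "t1 s = incl_error N \<omega> (\<lambda>_. 1) s" for s
  define tw where "tw s = incl_error N \<omega> (\<lambda>z. wt (snd z)) s" for s
  have tdiff: "\<bar>incl_error N \<omega> (\<lambda>z. f (fst z)) s - incl_error N \<omega> (\<lambda>z. \<rho> f (fst z)) s\<bar> \<le> q (\<xi> s) / r + \<delta> * \<bar>tw s\<bar>" if f: "f \<in> F" for f s
  proof -
    have "(s i / incl N \<omega> i - 1) * f (fst (\<omega> i)) - (s i / incl N \<omega> i - 1) * \<rho> f (fst (\<omega> i)) =
       \<xi> s i * \<Delta> f i + (weighted_mean f - weighted_mean (\<rho> f)) * ((s i / incl N \<omega> i - 1) * wt (snd (\<omega> i)))" if "i < N" for i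
    proof -
      have alg: "a * (u * (d + m)) = a * u * d + m * (a * u)" for a u d m :: real by (simp add: algebra_simps)
      show ?thesis unfolding right_diff_distrib[symmetric] fdiff \<xi>_def if_P[OF that] by (rule alg)
    qed
    then have "(\<Sum>i<N. (s i / incl N \<omega> i - 1) * f (fst (\<omega> i))) - (\<Sum>i<N. (s i / incl N \<omega> i - 1) * \<rho> f (fst (\<omega> i))) =
       (\<Sum>i<N. \<xi> s i * \<Delta> f i) + (weighted_mean f - weighted_mean (\<rho> f)) * (\<Sum>i<N. (s i / incl N \<omega> i - 1) * wt (snd (\<omega> i)))"
      unfolding sum_subtractf[symmetric] sum_distrib_left sum.distrib[symmetric] by (intro sum.cong refl) auto
    then have "incl_error N \<omega> (\<lambda>z. f (fst z)) s - incl_error N \<omega> (\<lambda>z. \<rho> f (fst z)) s =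
       (\<Sum>i<N. \<xi> s i * \<Delta> f i) / r + (weighted_mean f - weighted_mean (\<rho> f)) * tw s"
      unfolding incl_error_def tw_def r_def[symmetric] diff_divide_distrib[symmetric] by (simp add: add_divide_distrib)
    moreover have "\<bar>(\<Sum>i<N. \<xi> s i * \<Delta> f i) / r\<bar> \<le> q (\<xi> s) / r"
      using q_upper[OF f, of "\<xi> s"] r by (simp add: abs_divide divide_right_mono)
    moreover have "\<bar>(weighted_mean f - weighted_mean (\<rho> f)) * tw s\<bar> \<le> \<delta> * \<bar>tw s\<bar>"
      unfolding abs_mult by (intro mult_right_mono weighted_mean f) auto
    ultimately show ?thesis by linarith
  qed
  have cdiff: "\<bar>sample_mean N \<omega> (\<lambda>z. f (fst z)) - sample_mean N \<omega> (\<lambda>z. \<rho> f (fst z))\<bar> \<le> weight_cap * (6 * \<epsilon> + \<delta>)" if f: "f \<in> F" for f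
  proof -
    \<comment> \<open>AM-GM turns the bound on the mean square into one on the mean absolute value:
      (32/12) \<epsilon> \<le> 3 \<epsilon> from the squares, plus another 3 \<epsilon>.\<close>
    have pt: "\<bar>f (fst (\<omega> i)) - \<rho> f (fst (\<omega> i))\<bar> \<le> weight_cap * ((\<Delta> f i)\<^sup>2 / (12 * \<epsilon>) + (3 * \<epsilon> + \<delta>))" for i
    proof -
      have "0 \<le> (\<bar>\<Delta> f i\<bar> - 6 * \<epsilon>)\<^sup>2 / (12 * \<epsilon>)" using \<epsilon> by simp
      also have "\<dots> = (\<Delta> f i)\<^sup>2 / (12 * \<epsilon>) + 3 * \<epsilon> - \<bar>\<Delta> f i\<bar>"
        using \<epsilon> by (simp add: power2_diff field_simps power2_eq_square)
      finally have "\<bar>\<Delta> f i + (weighted_mean f - weighted_mean (\<rho> f))\<bar> \<le> (\<Delta> f i)\<^sup>2 / (12 * \<epsilon>) + (3 * \<epsilon> + \<delta>)"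
        using weighted_mean[OF f] by linarith
      then show ?thesis
        unfolding fdiff abs_mult using wt_bounds[of "snd (\<omega> i)"] by (intro mult_mono) auto
    qed
    have "\<bar>(\<Sum>i<N. f (fst (\<omega> i))) - (\<Sum>i<N. \<rho> f (fst (\<omega> i)))\<bar> \<le> (\<Sum>i<N. weight_cap * ((\<Delta> f i)\<^sup>2 / (12 * \<epsilon>) + (3 * \<epsilon> + \<delta>)))"
      unfolding sum_subtractf[symmetric] by (rule order_trans[OF sum_abs], rule sum_mono) (rule pt)
    moreover have "(\<Sum>i<N. weight_cap * ((\<Delta> f i)\<^sup>2 / (12 * \<epsilon>) + (3 * \<epsilon> + \<delta>))) = weight_cap * ((\<Sum>i<N. (\<Delta> f i)\<^sup>2) / (12 * \<epsilon>) + real N * (3 * \<epsilon> + \<delta>))"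
      by (simp add: sum_distrib_left[symmetric] sum.distrib sum_divide_distrib)
    moreover have "(\<Sum>i<N. (\<Delta> f i)\<^sup>2) / (12 * \<epsilon>) \<le> 32 * \<epsilon>\<^sup>2 * real N / (12 * \<epsilon>)"
      using sq[OF f] \<epsilon> by (intro divide_right_mono) auto
    then have "weight_cap * ((\<Sum>i<N. (\<Delta> f i)\<^sup>2) / (12 * \<epsilon>) + real N * (3 * \<epsilon> + \<delta>)) \<le> weight_cap * (3 * \<epsilon> * real N + real N * (3 * \<epsilon> + \<delta>))"
    proof (intro mult_left_mono add_right_mono)
      assume le: "(\<Sum>i<N. (\<Delta> f i)\<^sup>2) / (12 * \<epsilon>) \<le> 32 * \<epsilon>\<^sup>2 * real N / (12 * \<epsilon>)"
      have "32 * \<epsilon>\<^sup>2 * real N / (12 * \<epsilon>) = 32 / 12 * (\<epsilon> * real N)" using \<epsilon> by (simp add: power2_eq_square)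
      moreover have "0 \<le> \<epsilon> * real N" using \<epsilon> by simp
      ultimately show "(\<Sum>i<N. (\<Delta> f i)\<^sup>2) / (12 * \<epsilon>) \<le> 3 * \<epsilon> * real N" using le by linarith
    qed (use weight_cap_pos in simp)
    moreover have "weight_cap * (3 * \<epsilon> * real N + real N * (3 * \<epsilon> + \<delta>)) = weight_cap * (6 * \<epsilon> + \<delta>) * real N" by (simp add: algebra_simps)
    ultimately have "\<bar>(\<Sum>i<N. f (fst (\<omega> i))) - (\<Sum>i<N. \<rho> f (fst (\<omega> i)))\<bar> \<le> weight_cap * (6 * \<epsilon> + \<delta>) * real N" by linarith
    then show ?thesis
      unfolding sample_mean_def diff_divide_distrib[symmetric] using N by (simp add: abs_divide divide_le_eq)
  qed
  define X where "X s = 2 * (1 / r * q (\<xi> s) + (\<delta> * \<bar>tw s\<bar> + weight_cap * (6 * \<epsilon> + \<delta>) * \<bar>t1 s\<bar>))" for s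
  have X0: "X s \<ge> 0" for s unfolding X_def using q0 r \<delta> \<epsilon> weight_cap_pos by (intro mult_nonneg_nonneg add_nonneg_nonneg) auto
  have pt: "\<bar>h (restrict (\<lambda>f. hajek N \<omega> s f) F) - h (restrict (\<lambda>f. hajek N \<omega> s (\<rho> f)) F)\<bar> \<le> 4 / real N * (t1 s)\<^sup>2 + X s" for s
  proof -
    let ?z = "restrict (\<lambda>f. hajek N \<omega> s f) F" and ?z' = "restrict (\<lambda>f. hajek N \<omega> s (\<rho> f)) F"
    have m: "?z \<in> mspace (linf F)" "?z' \<in> mspace (linf F)" using hajek_mspace[of "\<lambda>f. f"] hajek_mspace[OF \<rho>] by auto
    have h01: "\<forall>z\<in>mspace (linf F). 0 \<le> h z \<and> h z \<le> 1" using h unfolding BL1_def by blast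
    define S1 where "S1 = (\<Sum>i<N. s i / incl N \<omega> i)"
    have S1: "S1 = real N + r * t1 s" unfolding S1_def t1_def r_def by (rule incl_error_one[OF N])
    show ?thesis
    \<comment> \<open>If the estimated size is below N/2, the trivial bound 1 is charged to the
      square of \<open>t1\<close>; this includes the case where the process is 0 by
      convention.\<close>
    proof (cases "S1 \<ge> real N / 2")
      case True
      then have S1p: "S1 > 0" using N by linarith
      have \<nu>: "0 \<le> real N / S1" "real N / S1 \<le> 2" using True S1p by (auto simp: divide_le_eq)
      have "\<bar>?z f - ?z' f\<bar> \<le> X s" if f: "f \<in> F" for f
      proof -
        have nz: "(\<Sum>i<N. s i / incl N \<omega> i) \<noteq> 0" using S1p by (simp add: S1_def)
        have id: "hajek N \<omega> s g = real N / S1 * (incl_error N \<omega> (\<lambda>z. g (fst z)) s - sample_mean N \<omega> (\<lambda>z. g (fst z)) * t1 s)" for g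
          using hajek_identity[OF N nz, of g 0] by (simp add: S1_def t1_def)
        define d where "d = incl_error N \<omega> (\<lambda>z. f (fst z)) s - incl_error N \<omega> (\<lambda>z. \<rho> f (fst z)) s"
        define m where "m = sample_mean N \<omega> (\<lambda>z. f (fst z)) - sample_mean N \<omega> (\<lambda>z. \<rho> f (fst z))"
        have "?z f - ?z' f = real N / S1 * (d - m * t1 s)"
          using f by (simp add: id d_def m_def algebra_simps)
        then have "\<bar>?z f - ?z' f\<bar> = real N / S1 * \<bar>d - m * t1 s\<bar>" using \<nu>(1) by (simp only: abs_mult abs_of_nonneg)
        also have "\<dots> \<le> 2 * \<bar>d - m * t1 s\<bar>" using \<nu>(2) by (intro mult_right_mono) auto
        also have "\<bar>d - m * t1 s\<bar> \<le> \<bar>d\<bar> + \<bar>m\<bar> * \<bar>t1 s\<bar>" using abs_triangle_ineq4[of d "m * t1 s"] by (simp add: abs_mult)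
        also have "\<bar>d\<bar> + \<bar>m\<bar> * \<bar>t1 s\<bar> \<le> (q (\<xi> s) / r + \<delta> * \<bar>tw s\<bar>) + weight_cap * (6 * \<epsilon> + \<delta>) * \<bar>t1 s\<bar>"
          using tdiff[OF f, of s] cdiff[OF f] unfolding d_def m_def by (intro add_mono mult_right_mono) auto
        finally show ?thesis unfolding X_def by simp
      qed
      then have "mdist (linf F) ?z ?z' \<le> X s" by (rule linf_dist_le[OF m _ X0])
      moreover have "\<bar>h ?z - h ?z'\<bar> \<le> mdist (linf F) ?z ?z'" using h m unfolding BL1_def by blast
      moreover have "0 \<le> 4 / real N * (t1 s)\<^sup>2" by simp
      ultimately show ?thesis by linarith
    next
      case False
      then have "r * t1 s < - (real N / 2)" using S1 by linarith
      then have "real N / 2 \<le> \<bar>r * t1 s\<bar>" by linarith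
      then have "(real N / 2)\<^sup>2 \<le> (r * t1 s)\<^sup>2" using N by (simp add: abs_le_square_iff[symmetric])
      then have "real N * real N / 4 \<le> real N * (t1 s)\<^sup>2"
        using r(2) by (simp add: power2_eq_square mult_ac) (metis mult.assoc mult.left_commute r(2))
      then have "1 \<le> 4 / real N * (t1 s)\<^sup>2" using N by (simp add: field_simps)
      moreover have "\<bar>h ?z - h ?z'\<bar> \<le> 1" using bspec[OF h01 m(1)] bspec[OF h01 m(2)] by linarith
      ultimately show ?thesis using X0[of s] by linarith
    qed
  qed
  have "\<bar>design_mean N \<omega> (\<lambda>s. h (restrict (\<lambda>f. hajek N \<omega> s f) F)) - design_mean N \<omega> (\<lambda>s. h (restrict (\<lambda>f. hajek N \<omega> s (\<rho> f)) F))\<bar>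
     \<le> design_mean N \<omega> (\<lambda>s. 4 / real N * (t1 s)\<^sup>2 + X s)" by (rule design_mean.abs_diff_le[OF pt])
  also have "\<dots> = 4 / real N * incl_error_var N \<omega> (\<lambda>_. 1) + 2 * (1 / r * design_mean N \<omega> (\<lambda>s. q (\<xi> s)) +
      (\<delta> * design_mean N \<omega> (\<lambda>s. \<bar>tw s\<bar>) + weight_cap * (6 * \<epsilon> + \<delta>) * design_mean N \<omega> (\<lambda>s. \<bar>t1 s\<bar>)))"
    unfolding X_def design_mean.add design_mean.scale t1_def incl_error_second ..
  also have "\<dots> \<le> 4 / real N * (2 * weight_cap * D) + 2 * (1 / r * (2 * weight_cap * (2 * t)) +
      (\<delta> * (1 + 2 * weight_cap\<^sup>2) + weight_cap * (6 * \<epsilon> + \<delta>) * (1 + 2 * weight_cap * D)))"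
  proof (intro add_mono mult_left_mono)
    show "incl_error_var N \<omega> (\<lambda>_. 1) \<le> 2 * weight_cap * D" by (rule incl_error_var_one_le[OF a D])
    show "design_mean N \<omega> (\<lambda>s. q (\<xi> s)) \<le> 2 * weight_cap * (2 * t)" by (rule E\<xi>)
    show "design_mean N \<omega> (\<lambda>s. \<bar>tw s\<bar>) \<le> 1 + 2 * weight_cap\<^sup>2"
      using incl_error_abs[of N \<omega> "\<lambda>z. wt (snd z)"] incl_error_var_wt_le[OF a N] unfolding tw_def by linarith
    show "design_mean N \<omega> (\<lambda>s. \<bar>t1 s\<bar>) \<le> 1 + 2 * weight_cap * D"
      using incl_error_abs[of N \<omega> "\<lambda>_. 1"] incl_error_var_one_le[OF a D] unfolding t1_def by linarith
  qed (use r \<delta> \<epsilon> weight_cap_pos in auto)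
  also have "1 / r * (2 * weight_cap * (2 * t)) = 16 * weight_cap * \<epsilon>"
    using r by (simp add: t_def r_def[symmetric])
  also have "4 / real N * (2 * weight_cap * D) = 8 * weight_cap * D / real N" by simp
  finally show ?thesis by (simp only: add.assoc)
qed

subsection \<open>Finite-dimensional convergence\<close>

definition centred_val :: "('y \<Rightarrow> real) \<Rightarrow> 'y \<times> 'x \<Rightarrow> real" where
  "centred_val f = (\<lambda>z. f (fst z) - (\<integral>z. f (fst z) \<partial>Pyx))"

lemma sq_int_centred_val: "f \<in> F \<Longrightarrow> sq_int (centred_val f)"
  unfolding centred_val_def by (rule sq_int_centred)

lemma sample_mean_centred_val: "f \<in> F \<Longrightarrow> ((\<lambda>x. sample_mean (fst x) (snd x) (centred_val f)) \<longlongrightarrow> 0) Fl"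
proof -
  assume f: "f \<in> F"
  have I: "integrable Pyx (\<lambda>z. f (fst z))" by (rule sq_int_integrable(3)[OF sq_int_F[OF f]])
  have "((\<lambda>x. sample_mean (fst x) (snd x) (centred_val f)) \<longlongrightarrow> (\<integral>z. centred_val f z \<partial>Pyx)) Fl"
    unfolding sample_mean_def by (rule wlln[OF sq_int_integrable(3)[OF sq_int_centred_val[OF f]]])
  moreover have "(\<integral>z. centred_val f z \<partial>Pyx) = 0"
    unfolding centred_val_def using I Z.prob_space by simp
  ultimately show ?thesis by simp
qed

text \<open>After centring, N over the estimated size tends to 1 and the sample mean to 0, so only
  the Horvitz-Thompson error remains. Truncation at 1 tames the rare samples with a small estimated
  size.\<close>

lemma hajek_linearization:
  assumes f: "f \<in> F"
  shows "((\<lambda>x. design_mean (fst x) (snd x) (\<lambda>s. min 1 \<bar>hajek (fst x) (snd x) s f - incl_error (fst x) (snd x) (centred_val f) s\<bar>)) \<longlongrightarrow> 0) Fl"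
proof -
  define V1 where "V1 = (\<integral>z. (weight_cap / wt (snd z) - 1) * 1\<^sup>2 \<partial>Pyx)"
  define Vf where "Vf = (\<integral>z. (weight_cap / wt (snd z) - 1) * (centred_val f z)\<^sup>2 \<partial>Pyx)"
  \<comment> \<open>N^(-1/4) balances two cases: for |t1| \<le> N^(1/4) the ratio differs from 1 by
    at most 2 N^(-1/4), and by Chebyshev's inequality the complement costs the variance of
    \<open>t1\<close> divided by sqrt N.\<close>
  define r where "r N = 1 / sqrt (sqrt (real N))" for N :: nat
  define v1 where "v1 x = incl_error_var (fst x) (snd x) (\<lambda>_. 1)" for x
  define vf where "vf x = incl_error_var (fst x) (snd x) (centred_val f)" for x
  define m where "m x = sample_mean (fst x) (snd x) (centred_val f)" for x
  define B where "B x = 1 / sqrt (real (fst x)) * v1 x + (2 * r (fst x) * (1 + vf x) + 2 * \<bar>m x\<bar> * (1 + v1 x))" for x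
  have c1: "(v1 \<longlongrightarrow> V1) Fl" unfolding v1_def V1_def by (rule incl_error_var_conv[OF sq_int_one])
  have cf: "(vf \<longlongrightarrow> Vf) Fl" unfolding vf_def Vf_def by (rule incl_error_var_conv[OF sq_int_centred_val[OF f]])
  have cm: "(m \<longlongrightarrow> 0) Fl" unfolding m_def by (rule sample_mean_centred_val[OF f])
  have sq: "filterlim (\<lambda>N. sqrt (real N)) at_top sequentially"
    by (rule filterlim_compose[OF sqrt_at_top filterlim_real_sequentially])
  have l1: "((\<lambda>x. 1 / sqrt (real (fst x))) \<longlongrightarrow> 0) Fl"
    by (rule tendsto_outer_filter_fst, rule real_tendsto_divide_at_top[OF tendsto_const sq])
  have rs: "(r \<longlongrightarrow> 0) sequentially"
    unfolding r_def by (rule real_tendsto_divide_at_top[OF tendsto_const filterlim_compose[OF sqrt_at_top sq]])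
  have l2: "((\<lambda>x. r (fst x)) \<longlongrightarrow> 0) Fl" by (rule tendsto_outer_filter_fst[OF rs])
  have "(B \<longlongrightarrow> 0 * V1 + (2 * 0 * (1 + Vf) + 2 * \<bar>0\<bar> * (1 + V1))) Fl"
    unfolding B_def by (intro tendsto_intros l1 l2 c1 cf cm)
  then have B: "(B \<longlongrightarrow> 0) Fl" by simp
  \<comment> \<open>Keeps the estimated size at least N/2 in the first of the two cases.\<close>
  have r2: "\<forall>\<^sub>F x in Fl. r (fst x) \<le> 1 / 2"
    using order_tendstoD(2)[OF l2, of "1/2"] by (auto elim: eventually_mono)
  show ?thesis
  proof (rule Lim_null_comparison[OF _ B])
    show "\<forall>\<^sub>F x in Fl. norm (design_mean (fst x) (snd x) (\<lambda>s. min 1 \<bar>hajek (fst x) (snd x) s f - incl_error (fst x) (snd x) (centred_val f) s\<bar>)) \<le> B x"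
      using eventually_ge_Fl[of 1] r2
    proof eventually_elim
      case (elim x)
      obtain N \<omega> where x: "x = (N, \<omega>)" by (cases x)
      interpret design_mean: expectation_functional "design_mean N \<omega>" by (rule design_mean_functional)
      have N: "N \<ge> 1" and r12: "r N \<le> 1 / 2" using elim by (auto simp: x)
      define R where "R = sqrt (real N)"
      have R: "R > 0" "R * R = real N" using N by (auto simp: R_def)
      have rR: "r N > 0" "r N * r N = 1 / R" using R by (auto simp: r_def R_def)
      define t1 where "t1 s = incl_error N \<omega> (\<lambda>_. 1) s" for s
      define tf where "tf s = incl_error N \<omega> (centred_val f) s" for s
      define mm where "mm = sample_mean N \<omega> (centred_val f)"
      have pt: "min 1 \<bar>hajek N \<omega> s f - tf s\<bar> \<le> 1 / R * (t1 s)\<^sup>2 + (2 * r N * (1 + (tf s)\<^sup>2) + 2 * \<bar>mm\<bar> * (1 + (t1 s)\<^sup>2))" for s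
      proof (cases "\<bar>t1 s\<bar> \<le> r N * R")
        case True
        define S1 where "S1 = (\<Sum>i<N. s i / incl N \<omega> i)"
        have S1: "S1 = R * R + R * t1 s" unfolding S1_def t1_def R(2) unfolding R_def by (rule incl_error_one[OF N])
        have bd: "\<bar>R * t1 s\<bar> \<le> r N * (R * R)"
        proof -
          have "R * \<bar>t1 s\<bar> \<le> R * (r N * R)" using True R by (intro mult_left_mono) auto
          moreover have "\<bar>R * t1 s\<bar> = R * \<bar>t1 s\<bar>" using R(1) by (simp add: abs_mult)
          moreover have "R * (r N * R) = r N * (R * R)" by simp
          ultimately show ?thesis by linarith
        qed
        have half: "r N * (R * R) \<le> 1 / 2 * (R * R)" using r12 R by (intro mult_right_mono) auto
        have S1h: "S1 \<ge> R * R / 2" using S1 bd half by linarith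
        have RR: "R * R > 0" using R(1) by simp
        have S1p: "S1 > 0" using S1h RR by linarith
        have \<nu>2: "\<bar>real N / S1\<bar> \<le> 2" using S1h S1p R(2)[symmetric] by (simp add: abs_divide divide_le_eq)
        have "real N / S1 - 1 = - (R * t1 s) / S1" using S1p S1 R(2) by (simp add: field_simps)
        then have "\<bar>real N / S1 - 1\<bar> = \<bar>R * t1 s\<bar> / S1" using S1p by (simp add: abs_divide)
        also have "\<dots> \<le> r N * (R * R) / (R * R / 2)" using bd S1h RR S1p rR by (intro frac_le) auto
        also have "\<dots> = 2 * r N" using R(1) by simp
        finally have \<nu>1: "\<bar>real N / S1 - 1\<bar> \<le> 2 * r N" .
        have nz: "(\<Sum>i<N. s i / incl N \<omega> i) \<noteq> 0" using S1p by (simp add: S1_def)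
        have "hajek N \<omega> s f = real N / S1 * (tf s - mm * t1 s)"
          using hajek_identity[OF N nz, of f "\<integral>z. f (fst z) \<partial>Pyx"] unfolding S1_def tf_def mm_def t1_def centred_val_def .
        then have "hajek N \<omega> s f - tf s = (real N / S1 - 1) * tf s - real N / S1 * (mm * t1 s)"
          by (simp add: algebra_simps)
        then have "\<bar>hajek N \<omega> s f - tf s\<bar> \<le> \<bar>real N / S1 - 1\<bar> * \<bar>tf s\<bar> + \<bar>real N / S1\<bar> * (\<bar>mm\<bar> * \<bar>t1 s\<bar>)"
          using abs_triangle_ineq4[of "(real N / S1 - 1) * tf s" "real N / S1 * (mm * t1 s)"] by (simp only: abs_mult)
        also have "\<dots> \<le> 2 * r N * (1 + (tf s)\<^sup>2) + 2 * (\<bar>mm\<bar> * (1 + (t1 s)\<^sup>2))"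
          using \<nu>1 \<nu>2 abs_le_1_plus_sq[of "tf s"] abs_le_1_plus_sq[of "t1 s"] rR(1)
          by (intro add_mono mult_mono mult_left_mono) auto
        finally have "\<bar>hajek N \<omega> s f - tf s\<bar> \<le> 2 * r N * (1 + (tf s)\<^sup>2) + 2 * \<bar>mm\<bar> * (1 + (t1 s)\<^sup>2)" by simp
        moreover have "0 \<le> 1 / R * (t1 s)\<^sup>2" using R by simp
        ultimately show ?thesis by linarith
      next
        case False
        then have "r N * R \<le> \<bar>t1 s\<bar>" by simp
        then have "(r N * R)\<^sup>2 \<le> (t1 s)\<^sup>2" using rR R by (simp add: abs_le_square_iff[symmetric])
        moreover have "(r N * R)\<^sup>2 = R"
        proof -
          have "(r N * R)\<^sup>2 = (r N * r N) * (R * R)" by (simp add: power2_eq_square mult_ac)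
          then show ?thesis unfolding rR(2) using R(1) by simp
        qed
        ultimately have "1 \<le> 1 / R * (t1 s)\<^sup>2" using R by (simp add: field_simps)
        moreover have "0 \<le> 2 * r N * (1 + (tf s)\<^sup>2)" using rR by (intro mult_nonneg_nonneg) auto
        moreover have "0 \<le> 2 * \<bar>mm\<bar> * (1 + (t1 s)\<^sup>2)" by (intro mult_nonneg_nonneg) auto
        ultimately show ?thesis by linarith
      qed
      have "design_mean N \<omega> (\<lambda>s. min 1 \<bar>hajek N \<omega> s f - tf s\<bar>) \<le>
        design_mean N \<omega> (\<lambda>s. 1 / R * (t1 s)\<^sup>2 + (2 * r N * (1 + (tf s)\<^sup>2) + 2 * \<bar>mm\<bar> * (1 + (t1 s)\<^sup>2)))"
        by (rule design_mean.mono[OF pt])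
      also have "\<dots> = 1 / R * incl_error_var N \<omega> (\<lambda>_. 1) + (2 * r N * (1 + incl_error_var N \<omega> (centred_val f)) + 2 * \<bar>mm\<bar> * (1 + incl_error_var N \<omega> (\<lambda>_. 1)))"
        unfolding design_mean.add design_mean.scale design_mean.one t1_def tf_def incl_error_second ..
      also have "\<dots> = B x" unfolding B_def v1_def vf_def m_def x mm_def R_def by simp
      finally have le: "design_mean N \<omega> (\<lambda>s. min 1 \<bar>hajek N \<omega> s f - tf s\<bar>) \<le> B x" .
      have "design_mean N \<omega> (\<lambda>_. 0) \<le> design_mean N \<omega> (\<lambda>s. min 1 \<bar>hajek N \<omega> s f - tf s\<bar>)" by (rule design_mean.mono) simp
      then have "0 \<le> design_mean N \<omega> (\<lambda>s. min 1 \<bar>hajek N \<omega> s f - tf s\<bar>)" unfolding design_mean.const .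
      then show ?case using le unfolding x fst_conv snd_conv tf_def by simp
    qed
  qed
qed

text \<open>If the sum is at least 1, the range of \<open>k\<close> suffices; otherwise no
  truncation is active and the sum bounds the maximal distance.\<close>

lemma lip_coord_diff:
  assumes A: "finite A" and k: "lip_coord A k"
  shows "\<bar>k u - k v\<bar> \<le> (\<Sum>f\<in>A. min 1 \<bar>u f - v f\<bar>)"
proof -
  define d where "d = (\<Sum>f\<in>A. min 1 \<bar>u f - v f\<bar>)"
  have le: "min 1 \<bar>u f - v f\<bar> \<le> d" if "f \<in> A" for f
    unfolding d_def using A that by (intro member_le_sum) auto
  have d0: "d \<ge> 0" unfolding d_def by (intro sum_nonneg) auto
  have k01: "0 \<le> k w" "k w \<le> 1" for w using k unfolding lip_coord_def by auto
  have "\<bar>k u - k v\<bar> \<le> d"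
  proof (cases "d \<ge> 1")
    case True
    then show ?thesis using k01[of u] k01[of v] by linarith
  next
    case False
    have "\<forall>f\<in>A. \<bar>u f - v f\<bar> \<le> d"
    proof
      fix f assume "f \<in> A"
      from le[OF this] False show "\<bar>u f - v f\<bar> \<le> d" by (simp add: min_def split: if_splits)
    qed
    then show ?thesis using k d0 unfolding lip_coord_def by blast
  qed
  then show ?thesis unfolding d_def .
qed

text \<open>Linear combinations of coordinates are inclusion errors of linear combinations of
  functions, so the one-dimensional theorem yields all the cosine limits (Cramer-Wold).
  Linearization then passes to the Hajek process at a cost that does not depend on
  \<open>k\<close>.\<close>

theorem hajek_finite_dim:
  fixes W :: "'w \<Rightarrow> ('y \<Rightarrow> real) \<Rightarrow> real"
  assumes A: "finite A" "A \<subseteq> F" and Q: "prob_space Q"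
    and W: "\<And>f. f \<in> A \<Longrightarrow> (\<lambda>s. W s f) \<in> borel_measurable Q" "\<And>f. f \<in> A \<Longrightarrow> integrable Q (\<lambda>s. (W s f)\<^sup>2)"
    and char: "\<And>t b. (\<integral>s. cos ((\<Sum>f\<in>A. t f * W s f) + b) \<partial>Q) =
       exp (- (\<integral>z. (weight_cap / wt (snd z) - 1) * (\<Sum>f\<in>A. t f * centred_val f z)\<^sup>2 \<partial>Pyx) / 2) * cos b"
    and \<epsilon>: "\<epsilon> > 0"
  shows "\<forall>\<^sub>F x in Fl. \<forall>k. lip_coord A k \<and> (\<lambda>s. k (W s)) \<in> borel_measurable Q \<longrightarrow>
     \<bar>design_mean (fst x) (snd x) (\<lambda>s. k (hajek (fst x) (snd x) s)) - (\<integral>s. k (W s) \<partial>Q)\<bar> \<le> \<epsilon>"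
proof -
  define E where "E x \<phi> = design_mean (fst x) (snd x) (\<lambda>s. \<phi> (\<lambda>f. incl_error (fst x) (snd x) (centred_val f) s))"
    for x and \<phi> :: "(('y \<Rightarrow> real) \<Rightarrow> real) \<Rightarrow> real"
  have EF: "expectation_functional (E x)" for x
  proof -
    interpret design_mean: expectation_functional "design_mean (fst x) (snd x)" by (rule design_mean_functional)
    show ?thesis unfolding E_def by standard (simp_all only: design_mean.add design_mean.scale design_mean.one, rule design_mean.mono, simp)
  qed
  have lin: "\<forall>\<^sub>F x in Fl. \<forall>k. lip_coord A k \<and> (\<lambda>s. k (W s)) \<in> borel_measurable Q \<longrightarrow> \<bar>E x k - (\<integral>s. k (W s) \<partial>Q)\<bar> \<le> \<epsilon> / 2"
  proof (rule lip_coord_convergence[OF A(1) EF Q W])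
    fix f assume "f \<in> A"
    then have f: "f \<in> F" using A by blast
    have "\<forall>\<^sub>F x in Fl. incl_error_var (fst x) (snd x) (centred_val f) < (\<integral>z. (weight_cap / wt (snd z) - 1) * (centred_val f z)\<^sup>2 \<partial>Pyx) + 1"
      by (rule order_tendstoD(2)[OF incl_error_var_conv[OF sq_int_centred_val[OF f]]]) simp
    then show "\<exists>B. \<forall>\<^sub>F x in Fl. E x (\<lambda>u. (u f)\<^sup>2) \<le> B"
      unfolding E_def incl_error_second by (intro exI) (erule eventually_mono, erule less_imp_le)
  next
    fix t b
    have sq: "sq_int (\<lambda>z. \<Sum>f\<in>A. t f * centred_val f z)"
      using A by (intro sq_int_sum sq_int_scale sq_int_centred_val) auto
    have comb: "(\<Sum>f\<in>A. t f * incl_error N \<omega> (centred_val f) s) = incl_error N \<omega> (\<lambda>z. \<Sum>f\<in>A. t f * centred_val f z) s" for N \<omega> s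
    proof -
      have "(\<Sum>i<N. (s i / incl N \<omega> i - 1) * (\<Sum>f\<in>A. t f * centred_val f (\<omega> i))) =
        (\<Sum>f\<in>A. t f * (\<Sum>i<N. (s i / incl N \<omega> i - 1) * centred_val f (\<omega> i)))"
        unfolding sum_distrib_left by (subst sum.swap) (simp only: mult.left_commute)
      then show ?thesis unfolding incl_error_def by (simp only: sum_divide_distrib[symmetric] times_divide_eq_right)
    qed
    show "((\<lambda>x. E x (\<lambda>u. cos ((\<Sum>f\<in>A. t f * u f) + b))) \<longlongrightarrow> (\<integral>s. cos ((\<Sum>f\<in>A. t f * W s f) + b) \<partial>Q)) Fl"
      unfolding E_def comb char by (rule incl_error_clt[OF sq])
  qed (use \<epsilon> in auto)
  have "((\<lambda>x. \<Sum>f\<in>A. design_mean (fst x) (snd x) (\<lambda>s. min 1 \<bar>hajek (fst x) (snd x) s f - incl_error (fst x) (snd x) (centred_val f) s\<bar>)) \<longlongrightarrow> (\<Sum>f\<in>A. 0)) Fl"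
    using A by (intro tendsto_sum hajek_linearization) auto
  then have "\<forall>\<^sub>F x in Fl. (\<Sum>f\<in>A. design_mean (fst x) (snd x) (\<lambda>s. min 1 \<bar>hajek (fst x) (snd x) s f - incl_error (fst x) (snd x) (centred_val f) s\<bar>)) < \<epsilon> / 2"
    using \<epsilon> by (intro order_tendstoD(2)) auto
  with lin show ?thesis
  proof eventually_elim
    case (elim x)
    interpret design_mean: expectation_functional "design_mean (fst x) (snd x)" by (rule design_mean_functional)
    show ?case
    proof (intro allI impI)
      fix k assume k: "lip_coord A k \<and> (\<lambda>s. k (W s)) \<in> borel_measurable Q"
      have "\<bar>design_mean (fst x) (snd x) (\<lambda>s. k (hajek (fst x) (snd x) s)) - E x k\<bar> \<le>
        design_mean (fst x) (snd x) (\<lambda>s. \<Sum>f\<in>A. min 1 \<bar>hajek (fst x) (snd x) s f - incl_error (fst x) (snd x) (centred_val f) s\<bar>)"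
        unfolding E_def by (rule design_mean.abs_diff_le) (rule lip_coord_diff[OF A(1) conjunct1[OF k]])
      then have "\<bar>design_mean (fst x) (snd x) (\<lambda>s. k (hajek (fst x) (snd x) s)) - E x k\<bar> < \<epsilon> / 2"
        unfolding design_mean.sum using elim(2) by linarith
      moreover have "\<bar>E x k - (\<integral>s. k (W s) \<partial>Q)\<bar> \<le> \<epsilon> / 2" using elim(1) k by blast
      ultimately show "\<bar>design_mean (fst x) (snd x) (\<lambda>s. k (hajek (fst x) (snd x) s)) - (\<integral>s. k (W s) \<partial>Q)\<bar> \<le> \<epsilon>" by linarith
    qed
  qed
qed

end

subsection \<open>The Gaussian limit\<close>

text \<open>Used on both sides of the variance comparison: with r = 1 for the Gaussian process and
  with r = \<open>weight_cap / wt - 1\<close> under \<open>Pyx\<close>. Integrability of the squares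
  gives that of the products.\<close>

lemma integral_weighted_sum_square:
  fixes X :: "'f \<Rightarrow> 'a \<Rightarrow> real" and r :: "'a \<Rightarrow> real"
  assumes A: "finite A" and r: "r \<in> borel_measurable Q" "\<And>z. z \<in> space Q \<Longrightarrow> 0 \<le> r z"
    and X: "\<And>f. f \<in> A \<Longrightarrow> X f \<in> borel_measurable Q" "\<And>f. f \<in> A \<Longrightarrow> integrable Q (\<lambda>z. r z * (X f z)\<^sup>2)"
  shows "(\<integral>z. r z * (\<Sum>f\<in>A. t f * X f z)\<^sup>2 \<partial>Q) = (\<Sum>f\<in>A. \<Sum>g\<in>A. t f * t g * (\<integral>z. r z * (X f z * X g z) \<partial>Q))"
proof -
  have I: "integrable Q (\<lambda>z. r z * (X f z * X g z))" if "f \<in> A" "g \<in> A" for f g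
  proof (rule Bochner_Integration.integrable_bound)
    show "integrable Q (\<lambda>z. r z * (X f z)\<^sup>2 + r z * (X g z)\<^sup>2)" using X(2) that by auto
    show "(\<lambda>z. r z * (X f z * X g z)) \<in> borel_measurable Q" using r(1) X(1) that by measurable
    show "AE z in Q. norm (r z * (X f z * X g z)) \<le> norm (r z * (X f z)\<^sup>2 + r z * (X g z)\<^sup>2)"
    proof (rule AE_I2)
      fix z assume z: "z \<in> space Q"
      have "0 \<le> \<bar>X f z\<bar> * \<bar>X g z\<bar>" "2 * \<bar>X f z\<bar> * \<bar>X g z\<bar> \<le> (X f z)\<^sup>2 + (X g z)\<^sup>2"
        using sum_squares_bound[of "\<bar>X f z\<bar>" "\<bar>X g z\<bar>"] by simp_all
      then have "\<bar>X f z * X g z\<bar> \<le> (X f z)\<^sup>2 + (X g z)\<^sup>2" unfolding abs_mult by linarith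
      then have "r z * \<bar>X f z * X g z\<bar> \<le> r z * ((X f z)\<^sup>2 + (X g z)\<^sup>2)"
        by (rule mult_left_mono) (rule r(2)[OF z])
      then show "norm (r z * (X f z * X g z)) \<le> norm (r z * (X f z)\<^sup>2 + r z * (X g z)\<^sup>2)"
        using r(2)[OF z] by (simp add: abs_mult distrib_left)
    qed
  qed
  have e: "r z * (\<Sum>f\<in>A. t f * X f z)\<^sup>2 = (\<Sum>f\<in>A. \<Sum>g\<in>A. t f * t g * (r z * (X f z * X g z)))" for z
  proof -
    have "(\<Sum>f\<in>A. t f * X f z)\<^sup>2 = (\<Sum>f\<in>A. \<Sum>g\<in>A. (t f * X f z) * (t g * X g z))"
      by (simp only: power2_eq_square sum_product)
    then show ?thesis by (simp only: sum_distrib_left mult.assoc mult.left_commute)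
  qed
  show ?thesis
    unfolding e using I A by (simp add: Bochner_Integration.integral_sum)
qed

lemma centered_gaussianD:
  assumes "centered_gaussian_process M F K G"
  shows "finite A \<Longrightarrow> A \<subseteq> F \<Longrightarrow> normal_rv M (\<lambda>s. \<Sum>f\<in>A. a f * G s f)"
    and "f \<in> F \<Longrightarrow> (\<integral>s. G s f \<partial>M) = 0"
    and "f \<in> F \<Longrightarrow> g \<in> F \<Longrightarrow> (\<integral>s. G s f * G s g \<partial>M) = K f g"
  using assms unfolding centered_gaussian_process_def by simp_all

lemma centered_gaussian_coordinate:
  assumes M: "prob_space M" and G: "centered_gaussian_process M F K G" and f: "f \<in> F"
  shows "(\<lambda>s. G s f) \<in> borel_measurable M" "integrable M (\<lambda>s. (G s f)\<^sup>2)" "integrable M (\<lambda>s. G s f)"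
proof -
  interpret prob_space M by fact
  have "normal_rv M (\<lambda>s. \<Sum>g\<in>{f}. (\<lambda>_. 1) g * G s g)"
    by (rule centered_gaussianD(1)[OF G]) (use f in simp_all)
  then have n: "normal_rv M (\<lambda>s. G s f)" by simp
  have m: "(\<integral>s. G s f \<partial>M) = 0" by (rule centered_gaussianD(2)[OF G f])
  show [measurable]: "(\<lambda>s. G s f) \<in> borel_measurable M" using n by (simp add: normal_rv_def)
  show I: "integrable M (\<lambda>s. (G s f)\<^sup>2)" by (rule normal_rv_moments(1)[OF M n m])
  show "integrable M (\<lambda>s. G s f)"
  proof (rule Bochner_Integration.integrable_bound)
    show "integrable M (\<lambda>s. 1 + (G s f)\<^sup>2)" using I by simp
    show "AE s in M. norm (G s f) \<le> norm (1 + (G s f)\<^sup>2)"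
      using abs_le_1_plus_sq by (intro AE_I2) simp
  qed measurable
qed

context poisson_model
begin

lemma Sigma_hajek_eq:
  "Sigma_hajek Pyx w \<theta> f g = (\<integral>z. (weight_cap / wt (snd z) - 1) * (centred_val f z * centred_val g z) \<partial>Pyx)"
proof -
  have "wt x * (weight_cap - wt x) * (a * b / (wt x)\<^sup>2) = (weight_cap / wt x - 1) * (a * b)" for x a b
    using wt_bounds(1)[of x] by (simp add: field_simps power2_eq_square)
  then show ?thesis unfolding Sigma_hajek_def Let_def centred_val_def weight_cap_def[symmetric] by simp
qed

text \<open>A centred normal law is determined by its variance, and the covariance function makes
  this variance equal to the limit of the design variances.\<close>

lemma gaussian_limit_char:
  assumes MG: "prob_space MG" and G: "centered_gaussian_process MG F (Sigma_hajek Pyx w \<theta>) G"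
    and A: "finite A" "A \<subseteq> F"
  shows "(\<integral>s. cos ((\<Sum>f\<in>A. t f * G s f) + b) \<partial>MG) =
       exp (- (\<integral>z. (weight_cap / wt (snd z) - 1) * (\<Sum>f\<in>A. t f * centred_val f z)\<^sup>2 \<partial>Pyx) / 2) * cos b"
proof -
  have AF: "f \<in> F" if "f \<in> A" for f using that A by blast
  note coord = centered_gaussian_coordinate[OF MG G AF]
  have n: "normal_rv MG (\<lambda>s. \<Sum>f\<in>A. t f * G s f)" by (rule centered_gaussianD(1)[OF G A])
  have G0: "(\<integral>s. G s f \<partial>MG) = 0" if "f \<in> A" for f
    by (rule centered_gaussianD(2)[OF G AF[OF that]])
  have GS: "(\<integral>s. G s f * G s g \<partial>MG) = Sigma_hajek Pyx w \<theta> f g" if "f \<in> A" "g \<in> A" for f g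
    by (rule centered_gaussianD(3)[OF G AF[OF that(1)] AF[OF that(2)]])
  have mean: "(\<integral>s. (\<Sum>f\<in>A. t f * G s f) \<partial>MG) = 0"
    using coord(3) G0 by (simp add: Bochner_Integration.integral_sum)
  have "(\<integral>s. (\<Sum>f\<in>A. t f * G s f)\<^sup>2 \<partial>MG) = (\<integral>s. 1 * (\<Sum>f\<in>A. t f * G s f)\<^sup>2 \<partial>MG)" by simp
  also have "\<dots> = (\<Sum>f\<in>A. \<Sum>g\<in>A. t f * t g * (\<integral>s. 1 * (G s f * G s g) \<partial>MG))"
    by (rule integral_weighted_sum_square[OF A(1)]) (use coord in simp_all)
  also have "\<dots> = (\<Sum>f\<in>A. \<Sum>g\<in>A. t f * t g * (\<integral>z. (weight_cap / wt (snd z) - 1) * (centred_val f z * centred_val g z) \<partial>Pyx))"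
    by (intro sum.cong refl) (simp add: GS Sigma_hajek_eq)
  also have "\<dots> = (\<integral>z. (weight_cap / wt (snd z) - 1) * (\<Sum>f\<in>A. t f * centred_val f z)\<^sup>2 \<partial>Pyx)"
  proof (rule integral_weighted_sum_square[OF A(1), symmetric])
    show "0 \<le> weight_cap / wt (snd z) - 1" for z :: "'y \<times> 'x" using wt_bounds[of "snd z"] by (simp add: le_divide_eq)
    show "centred_val f \<in> borel_measurable Pyx" if "f \<in> A" for f
      using sq_int_centred_val[OF AF[OF that]] by (simp add: sq_int_def)
    show "integrable Pyx (\<lambda>z. (weight_cap / wt (snd z) - 1) * (centred_val f z)\<^sup>2)" if "f \<in> A" for f
      by (rule sq_int_integrable(4)[OF sq_int_centred_val[OF AF[OF that]]])
  qed measurable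
  finally show ?thesis using normal_rv_moments(2)[OF MG n mean] by simp
qed

end

subsection \<open>Discretization of bounded Lipschitz functionals\<close>

lemma BL1_D:
  assumes "h \<in> BL1 F" "z \<in> mspace (linf F)"
  shows "0 \<le> h z" "h z \<le> 1" "z' \<in> mspace (linf F) \<Longrightarrow> \<bar>h z - h z'\<bar> \<le> mdist (linf F) z z'"
  using assms unfolding BL1_def by blast+

lemma linf_compose_mspace:
  assumes "z \<in> mspace (linf F)" "\<rho> ` F \<subseteq> F"
  shows "restrict (\<lambda>f. z (\<rho> f)) F \<in> mspace (linf F)"
proof -
  obtain B where "\<forall>f\<in>F. \<bar>z f\<bar> \<le> B" using assms(1) unfolding linf_mspace by blast
  then have "\<forall>f\<in>F. \<bar>restrict (\<lambda>f. z (\<rho> f)) F f\<bar> \<le> B" using assms(2) by auto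
  then show ?thesis unfolding linf_mspace by (intro conjI exI[of _ B]) auto
qed

lemma BL1_measurable:
  assumes h: "h \<in> BL1 F"
  shows "h \<in> borel_measurable (linf_borel F)"
proof (rule linf_continuous_measurable, rule linf_lipschitz_continuous)
  fix z z' assume z: "z \<in> mspace (linf F)" "z' \<in> mspace (linf F)"
  from BL1_D(3)[OF h z] show "\<bar>h z - h z'\<bar> \<le> 1 * mdist (linf F) z z'" by linarith
qed

lemma BL1_compose_measurable:
  assumes h: "h \<in> BL1 F" and \<rho>: "\<rho> ` F \<subseteq> F"
  shows "(\<lambda>z. h (restrict (\<lambda>f. z (\<rho> f)) F)) \<in> borel_measurable (linf_borel F)"
proof (rule linf_continuous_measurable, rule linf_lipschitz_continuous)
  fix z z' assume z: "z \<in> mspace (linf F)" "z' \<in> mspace (linf F)"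
  have "\<bar>restrict (\<lambda>f. z (\<rho> f)) F f - restrict (\<lambda>f. z' (\<rho> f)) F f\<bar> \<le> mdist (linf F) z z'" if "f \<in> F" for f
    using linf_dist_ge[OF z, of "\<rho> f"] that \<rho> by auto
  then have "mdist (linf F) (restrict (\<lambda>f. z (\<rho> f)) F) (restrict (\<lambda>f. z' (\<rho> f)) F) \<le> mdist (linf F) z z'"
    by (rule linf_dist_le[OF linf_compose_mspace[OF z(1) \<rho>] linf_compose_mspace[OF z(2) \<rho>]]) (assumption | rule mdist_nonneg)+
  with BL1_D(3)[OF h linf_compose_mspace[OF z(1) \<rho>] linf_compose_mspace[OF z(2) \<rho>]]
  show "\<bar>h (restrict (\<lambda>f. z (\<rho> f)) F) - h (restrict (\<lambda>f. z' (\<rho> f)) F)\<bar> \<le> 1 * mdist (linf F) z z'" by linarith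
qed

text \<open>Since \<open>\<rho>\<close> has finite range on \<open>F\<close>, the composition is
  bounded for every \<open>u\<close>, so \<open>h\<close> is evaluated only where it is
  constrained.\<close>

lemma BL1_lip_coord:
  fixes \<rho> :: "'f \<Rightarrow> 'f"
  assumes h: "h \<in> BL1 F" and \<rho>: "finite (\<rho> ` F)"
  shows "lip_coord (\<rho> ` F) (\<lambda>u. h (restrict (\<lambda>f. u (\<rho> f)) F))"
proof -
  have ms: "restrict (\<lambda>f. u (\<rho> f)) F \<in> mspace (linf F)" for u :: "'f \<Rightarrow> real"
  proof -
    have "\<forall>f\<in>F. \<bar>restrict (\<lambda>f. u (\<rho> f)) F f\<bar> \<le> (\<Sum>g\<in>\<rho> ` F. \<bar>u g\<bar>)"
      using \<rho> by (auto intro: member_le_sum)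
    then show ?thesis unfolding linf_mspace by (intro conjI exI[of _ "\<Sum>g\<in>\<rho> ` F. \<bar>u g\<bar>"]) auto
  qed
  show ?thesis
    unfolding lip_coord_def
  proof (intro conjI allI impI)
    fix u v :: "'f \<Rightarrow> real" and d assume d: "0 \<le> d \<and> (\<forall>f\<in>\<rho> ` F. \<bar>u f - v f\<bar> \<le> d)"
    have "mdist (linf F) (restrict (\<lambda>f. u (\<rho> f)) F) (restrict (\<lambda>f. v (\<rho> f)) F) \<le> d"
      by (rule linf_dist_le[OF ms ms]) (use d in simp_all)
    with BL1_D(3)[OF h ms ms]
    show "\<bar>h (restrict (\<lambda>f. u (\<rho> f)) F) - h (restrict (\<lambda>f. v (\<rho> f)) F)\<bar> \<le> d" by (rule order_trans)
  qed (rule BL1_D(1,2)[OF h ms])+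
qed

text \<open>On a compact set of large probability the paths are uniformly close to finitely many
  functions, so a \<open>\<rho>\<close> fine enough for these moves the paths little; off that set
  the range of \<open>h\<close> is used.\<close>

lemma tight_discretization:
  fixes G :: "'a \<Rightarrow> 'f \<Rightarrow> real"
  assumes M: "prob_space M" and G: "tight_borel_element M F G" and \<epsilon>: "\<epsilon> > 0"
  obtains W :: "('f \<Rightarrow> real) set" where "finite W" "\<And>v. v \<in> W \<Longrightarrow> \<exists>B. \<forall>f\<in>F. \<bar>v f\<bar> \<le> B"
    "\<And>\<rho> h. \<rho> ` F \<subseteq> F \<Longrightarrow> (\<And>v f. v \<in> W \<Longrightarrow> f \<in> F \<Longrightarrow> \<bar>v f - v (\<rho> f)\<bar> \<le> \<epsilon> / 8) \<Longrightarrow> h \<in> BL1 F \<Longrightarrow>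
      \<bar>(\<integral>s. h (G s) \<partial>M) - (\<integral>s. h (restrict (\<lambda>f. G s (\<rho> f)) F) \<partial>M)\<bar> \<le> \<epsilon>"
proof -
  interpret prob_space M by fact
  have G_meas: "G \<in> measurable M (linf_borel F)" using G by (simp add: tight_borel_element_def)
  have ms: "G s \<in> mspace (linf F)" if "s \<in> space M" for s
    using measurable_space[OF G_meas that] by (simp only: space_linf_borel)
  \<comment> \<open>The minimum with 1 keeps the probability of the compact event positive; as
    \<open>measure\<close> is 0 on nonmeasurable sets, this shows that \<open>B\<close> is
    measurable.\<close>
  have "min \<epsilon> 1 / 2 > 0" using \<epsilon> by simp
  then obtain K where K: "compactin (mtopology_of (linf F)) K" "measure M {s \<in> space M. G s \<in> K} \<ge> 1 - min \<epsilon> 1 / 2"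
    using G unfolding tight_borel_element_def by blast
  define B where "B = {s \<in> space M. G s \<in> K}"
  have Bm: "measure M B \<ge> 1 - min \<epsilon> 1 / 2" using K(2) by (simp add: B_def)
  then have "measure M B \<noteq> 0" by linarith
  then have B: "B \<in> sets M" using measure_notin_sets by blast
  have "\<epsilon> / 8 > 0" using \<epsilon> by simp
  then obtain W where W: "finite W" "W \<subseteq> mspace (linf F)" "\<And>z. z \<in> K \<Longrightarrow> \<exists>v\<in>W. \<forall>f\<in>F. \<bar>z f - v f\<bar> \<le> \<epsilon> / 8"
    using compactin_linf_finite_net[OF K(1)] by blast
  show ?thesis
  proof (rule that[OF W(1)])
    show "\<exists>B. \<forall>f\<in>F. \<bar>v f\<bar> \<le> B" if "v \<in> W" for v using W(2) that unfolding linf_mspace[symmetric] by (auto simp only: linf_mspace)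
    fix \<rho> h assume \<rho>: "\<rho> ` F \<subseteq> F" and near: "\<And>v f. v \<in> W \<Longrightarrow> f \<in> F \<Longrightarrow> \<bar>v f - v (\<rho> f)\<bar> \<le> \<epsilon> / 8" and h: "h \<in> BL1 F"
    let ?R = "\<lambda>s. restrict (\<lambda>f. G s (\<rho> f)) F"
    have msR: "?R s \<in> mspace (linf F)" if "s \<in> space M" for s by (rule linf_compose_mspace[OF ms[OF that] \<rho>])
    have m1: "(\<lambda>s. h (G s)) \<in> borel_measurable M" by (rule measurable_compose[OF G_meas BL1_measurable[OF h]])
    have m2: "(\<lambda>s. h (?R s)) \<in> borel_measurable M" by (rule measurable_compose[OF G_meas BL1_compose_measurable[OF h \<rho>]])
    have i1: "integrable M (\<lambda>s. h (G s))"
      by (rule integrable_const_bound[OF _ m1, of 1]) (use BL1_D(1,2)[OF h ms] in \<open>intro AE_I2, simp\<close>)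
    have i2: "integrable M (\<lambda>s. h (?R s))"
      by (rule integrable_const_bound[OF _ m2, of 1]) (use BL1_D(1,2)[OF h msR] in \<open>intro AE_I2, simp\<close>)
    have pt: "\<bar>h (G s) - h (?R s)\<bar> \<le> \<epsilon> / 2 + indicator (space M - B) s" if s: "s \<in> space M" for s
    proof (cases "s \<in> B")
      case True
      then have "G s \<in> K" by (simp add: B_def)
      from W(3)[OF this] obtain v where v: "v \<in> W" "\<forall>f\<in>F. \<bar>G s f - v f\<bar> \<le> \<epsilon> / 8" by blast
      have "\<bar>G s f - ?R s f\<bar> \<le> \<epsilon> / 2" if f: "f \<in> F" for f
      proof -
        have "\<rho> f \<in> F" using \<rho> f by blast
        then have "\<bar>G s (\<rho> f) - v (\<rho> f)\<bar> \<le> \<epsilon> / 8" using v(2) by blast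
        moreover have "\<bar>G s f - v f\<bar> \<le> \<epsilon> / 8" using v(2) f by blast
        ultimately have "\<bar>G s f - G s (\<rho> f)\<bar> \<le> \<epsilon> / 2" using near[OF v(1) f] \<epsilon> by linarith
        then show ?thesis using f by simp
      qed
      then have "mdist (linf F) (G s) (?R s) \<le> \<epsilon> / 2"
        by (rule linf_dist_le[OF ms[OF s] msR[OF s]]) (use \<epsilon> in simp_all)
      then show ?thesis using BL1_D(3)[OF h ms[OF s] msR[OF s]] True by simp
    next
      case False
      then show ?thesis using BL1_D(1,2)[OF h ms[OF s]] BL1_D(1,2)[OF h msR[OF s]] s \<epsilon> by simp
    qed
    have "\<bar>(\<integral>s. h (G s) \<partial>M) - (\<integral>s. h (?R s) \<partial>M)\<bar> = \<bar>\<integral>s. h (G s) - h (?R s) \<partial>M\<bar>"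
      using i1 i2 by simp
    also have "\<dots> \<le> (\<integral>s. \<bar>h (G s) - h (?R s)\<bar> \<partial>M)" by (rule integral_abs_bound)
    also have "\<dots> \<le> (\<integral>s. \<epsilon> / 2 + indicator (space M - B) s \<partial>M)"
      using i1 i2 B pt by (intro integral_mono) (auto intro!: integrable_add integrable_abs integrable_diff simp: emeasure_eq_measure)
    also have "\<dots> = \<epsilon> / 2 + measure M (space M - B)"
      using B by (subst Bochner_Integration.integral_add) (auto simp: prob_space emeasure_eq_measure)
    also have "measure M (space M - B) = 1 - measure M B" by (rule prob_compl[OF B])
    finally show "\<bar>(\<integral>s. h (G s) \<partial>M) - (\<integral>s. h (?R s) \<partial>M)\<bar> \<le> \<epsilon>"
      using Bm by linarith
  qed
qed

subsection \<open>Conditional weak convergence\<close>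

text \<open>One discretization \<open>\<rho>\<close> must be fine for the Donsker limit, for the
  Gaussian limit and for the means at once, so the finite families are merged. The error is 3
  \<epsilon>/8 for the oscillation, \<epsilon>/4 for the finite-dimensional approximation and
  \<epsilon>/4 for the limit.\<close>

theorem (in poisson_model) hajek_conditional_convergence:
  fixes G :: "'g \<Rightarrow> ('y \<Rightarrow> real) \<Rightarrow> real"
  assumes MG: "prob_space MG" and tight: "tight_borel_element MG F G"
    and gauss: "centered_gaussian_process MG F (Sigma_hajek Pyx w \<theta>) G" and \<epsilon>: "\<epsilon> > 0"
  shows "\<forall>\<^sub>F x in Fl. \<forall>h\<in>BL1 F.
    \<bar>design_mean (fst x) (snd x) (\<lambda>s. h (restrict (\<lambda>f. hajek (fst x) (snd x) s f) F)) - (\<integral>s. h (G s) \<partial>MG)\<bar> \<le> \<epsilon>"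
proof (rule eventually_outer_filterI)
  fix \<eta> :: real assume \<eta>: "\<eta> > 0"
  define D where "D = (\<integral>z. 1 / wt (snd z) \<partial>Pyx) + 1"
  have Iwt: "integrable Pyx (\<lambda>z. 1 / wt (snd z))" using sq_int_integrable(1)[OF sq_int_one] by simp
  have D0: "D \<ge> 0"
    unfolding D_def using wt_bounds(1) by (intro add_nonneg_nonneg integral_nonneg_AE AE_I2) (auto intro: less_imp_le)
  define C where "C = 2 * (16 * weight_cap + weight_cap * 6 * (1 + 2 * weight_cap * D))"
  define C' where "C' = 2 * ((1 + 2 * weight_cap\<^sup>2) + weight_cap * (1 + 2 * weight_cap * D))"
  have C: "C \<ge> 0" unfolding C_def using weight_cap_pos D0 by (intro mult_nonneg_nonneg add_nonneg_nonneg) auto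
  have C': "C' \<ge> 0" unfolding C'_def using weight_cap_pos D0 by (intro mult_nonneg_nonneg add_nonneg_nonneg) auto
  \<comment> \<open>\<open>C\<close> and \<open>C'\<close> collect the coefficients of the two mesh
    parameters in \<open>hajek_osc_bound\<close>; each parameter then costs at most an eighth of
    \<epsilon>.\<close>
  define e where "e = \<epsilon> / (8 * (C + 1))"
  define d where "d = \<epsilon> / (8 * (C' + 1))"
  have e: "e > 0" "C * e \<le> \<epsilon> / 8" and d: "d > 0" "C' * d \<le> \<epsilon> / 8"
    unfolding e_def d_def using \<epsilon> C C' by (auto simp: field_simps)
  \<comment> \<open>\<open>rad_tail\<close> multiplies the probability by 48, which uses half of
    \<eta>.\<close>
  have \<eta>': "\<eta> / 96 > 0" using \<eta> by simp
  obtain W1 where W1: "finite W1" "\<And>v. v \<in> W1 \<Longrightarrow> \<exists>B. \<forall>f\<in>F. \<bar>v f\<bar> \<le> B"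
    "\<And>\<rho>. \<rho> ` F \<subseteq> F \<Longrightarrow> (\<And>v f. v \<in> W1 \<Longrightarrow> f \<in> F \<Longrightarrow> \<bar>v f - v (\<rho> f)\<bar> \<le> e / 4) \<Longrightarrow>
      \<forall>\<^sub>F N in sequentially. outer_measure_of M {\<omega> \<in> space M. \<exists>f\<in>F. \<bar>\<Sum>i<N. centred_weighted f (\<omega> i) - centred_weighted (\<rho> f) (\<omega> i)\<bar> > e * sqrt (real N)} \<le> ennreal (\<eta> / 96)"
  proof (rule donsker_osc_tail[OF e(1) \<eta>'], goal_cases)
    case (1 W)
    show ?case by (rule 1(1)[OF 1(2-4)])
  qed
  have \<epsilon>4: "\<epsilon> / 4 > 0" using \<epsilon> by simp
  obtain W2 where W2: "finite W2" "\<And>v. v \<in> W2 \<Longrightarrow> \<exists>B. \<forall>f\<in>F. \<bar>v f\<bar> \<le> B"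
    "\<And>\<rho> h. \<rho> ` F \<subseteq> F \<Longrightarrow> (\<And>v f. v \<in> W2 \<Longrightarrow> f \<in> F \<Longrightarrow> \<bar>v f - v (\<rho> f)\<bar> \<le> \<epsilon> / 4 / 8) \<Longrightarrow> h \<in> BL1 F \<Longrightarrow>
      \<bar>(\<integral>s. h (G s) \<partial>MG) - (\<integral>s. h (restrict (\<lambda>f. G s (\<rho> f)) F) \<partial>MG)\<bar> \<le> \<epsilon> / 4"
  proof (rule tight_discretization[OF MG tight \<epsilon>4], goal_cases)
    case (1 W)
    show ?case by (rule 1(1)[OF 1(2-4)])
  qed
  define \<delta> where "\<delta> = min (e / 4) (min d (\<epsilon> / 4 / 8))"
  have \<delta>: "\<delta> > 0" "\<delta> \<le> e / 4" "\<delta> \<le> d" "\<delta> \<le> \<epsilon> / 4 / 8" unfolding \<delta>_def using e(1) d(1) \<epsilon> by auto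
  have "finite (insert weighted_mean (W1 \<union> W2))" using W1(1) W2(1) by simp
  moreover have "\<exists>B. \<forall>f\<in>F. \<bar>v f\<bar> \<le> B" if "v \<in> insert weighted_mean (W1 \<union> W2)" for v
    using that weighted_mean_bounded W1(2) W2(2) by (elim insertE UnE) simp_all
  ultimately obtain \<rho> where \<rho>: "\<rho> ` F \<subseteq> F" "finite (\<rho> ` F)"
    "\<And>v f. v \<in> insert weighted_mean (W1 \<union> W2) \<Longrightarrow> f \<in> F \<Longrightarrow> \<bar>v f - v (\<rho> f)\<bar> \<le> \<delta>"
    using finite_range_representatives[OF _ _ \<delta>(1)] by blast
  have \<rho>weighted_mean: "\<bar>weighted_mean f - weighted_mean (\<rho> f)\<bar> \<le> d" if "f \<in> F" for f using \<rho>(3)[of weighted_mean f] that \<delta>(3) by simp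
  have \<rho>1: "\<bar>v f - v (\<rho> f)\<bar> \<le> e / 4" if "v \<in> W1" "f \<in> F" for v f using \<rho>(3)[of v f] that \<delta>(2) by simp
  have \<rho>2: "\<bar>v f - v (\<rho> f)\<bar> \<le> \<epsilon> / 4 / 8" if "v \<in> W2" "f \<in> F" for v f using \<rho>(3)[of v f] that \<delta>(4) by simp
  have lim: "\<bar>(\<integral>s. h (G s) \<partial>MG) - (\<integral>s. h (restrict (\<lambda>f. G s (\<rho> f)) F) \<partial>MG)\<bar> \<le> \<epsilon> / 4" if "h \<in> BL1 F" for h
    by (rule W2(3)[OF \<rho>(1) _ that]) (rule \<rho>2)
  have W1': "\<forall>\<^sub>F N in sequentially. outer_measure_of M {\<omega> \<in> space M. \<exists>f\<in>F. \<bar>\<Sum>i<N. centred_weighted f (\<omega> i) - centred_weighted (\<rho> f) (\<omega> i)\<bar> > e * sqrt (real N)} \<le> ennreal (\<eta> / 96)"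
    by (rule W1(3)[OF \<rho>(1)]) (rule \<rho>1)
  obtain N0 where N0: "\<And>N. N \<ge> N0 \<Longrightarrow>
      outer_measure_of M {\<omega> \<in> space M. \<exists>f\<in>F. \<bar>\<Sum>i<N. centred_weighted f (\<omega> i) - centred_weighted (\<rho> f) (\<omega> i)\<bar> > e * sqrt (real N)} \<le> ennreal (\<eta> / 96)"
    using W1' unfolding eventually_sequentially by blast
  define Bad where "Bad N = {\<omega> \<in> space M.
     rad N (\<lambda>e'. of_bool (\<exists>f\<in>F. \<bar>\<Sum>i<N. e' i * (centred_weighted f (\<omega> i) - centred_weighted (\<rho> f) (\<omega> i))\<bar> > 4 * e * sqrt (real N))) (\<lambda>_. 0) \<ge> (1/12 :: real)}" for N
  have bad: "outer_measure_of M (Bad N) \<le> ennreal (48 * (\<eta> / 96))" if N: "2 * N0 \<le> N" for N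
    unfolding Bad_def
    by (rule rad_tail[where \<Delta>="\<lambda>f z. centred_weighted f z - centred_weighted (\<rho> f) z", OF N0 N]) (use e(1) \<eta> in simp_all)
  define P where "P x \<longleftrightarrow> scale_factor (fst x) (snd x) \<ge> 1 / (2 * weight_cap) \<and> (\<Sum>i<fst x. 1 / wt (snd (snd x i))) / real (fst x) \<le> D \<and>
     (\<forall>k. lip_coord (\<rho> ` F) k \<and> (\<lambda>s. k (G s)) \<in> borel_measurable MG \<longrightarrow>
     \<bar>design_mean (fst x) (snd x) (\<lambda>s. k (hajek (fst x) (snd x) s)) - (\<integral>s. k (G s) \<partial>MG)\<bar> \<le> \<epsilon> / 4)" for x
  have P: "\<forall>\<^sub>F x in Fl. P x"
    unfolding P_def
  proof (intro eventually_conj eventually_scale_factor)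
    have "((\<lambda>x. (\<Sum>i<fst x. 1 / wt (snd (snd x i))) / real (fst x)) \<longlongrightarrow> (\<integral>z. 1 / wt (snd z) \<partial>Pyx)) Fl"
      by (rule wlln[OF Iwt])
    then have "\<forall>\<^sub>F x in Fl. (\<Sum>i<fst x. 1 / wt (snd (snd x i))) / real (fst x) < D"
      by (rule order_tendstoD(2)) (simp add: D_def)
    then show "\<forall>\<^sub>F x in Fl. (\<Sum>i<fst x. 1 / wt (snd (snd x i))) / real (fst x) \<le> D"
      by (rule eventually_mono) (rule less_imp_le)
    have F': "f \<in> F" if "f \<in> \<rho> ` F" for f using that \<rho>(1) by blast
    show "\<forall>\<^sub>F x in Fl. \<forall>k. lip_coord (\<rho> ` F) k \<and> (\<lambda>s. k (G s)) \<in> borel_measurable MG \<longrightarrow>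
       \<bar>design_mean (fst x) (snd x) (\<lambda>s. k (hajek (fst x) (snd x) s)) - (\<integral>s. k (G s) \<partial>MG)\<bar> \<le> \<epsilon> / 4"
      by (rule hajek_finite_dim[OF \<rho>(2,1) MG centered_gaussian_coordinate(1,2)[OF MG gauss F']
            gaussian_limit_char[OF MG gauss \<rho>(2,1)] \<epsilon>4])
  qed
  have "\<eta> / 2 > 0" using \<eta> by simp
  from eventually_outer_filterD[OF P this]
  have Pn: "\<forall>\<^sub>F N in sequentially. outer_measure_of M {\<omega> \<in> space M. \<not> P (N, \<omega>)} \<le> ennreal (\<eta> / 2)" .
  have "((\<lambda>N. 8 * weight_cap * D / real N) \<longlongrightarrow> 0) sequentially"
    by (rule real_tendsto_divide_at_top[OF tendsto_const filterlim_real_sequentially])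
  then have small: "\<forall>\<^sub>F N in sequentially. 8 * weight_cap * D / real N < \<epsilon> / 8"
    by (rule order_tendstoD(2)) (use \<epsilon> in simp)
  show "\<forall>\<^sub>F N in sequentially. outer_measure_of M {\<omega> \<in> space M. \<not> (\<forall>h\<in>BL1 F.
      \<bar>design_mean (fst (N, \<omega>)) (snd (N, \<omega>)) (\<lambda>s. h (restrict (\<lambda>f. hajek (fst (N, \<omega>)) (snd (N, \<omega>)) s f) F)) - (\<integral>s. h (G s) \<partial>MG)\<bar> \<le> \<epsilon>)} \<le> ennreal \<eta>"
    using Pn small eventually_ge_at_top[of "2 * N0"] eventually_ge_at_top[of 1]
  proof eventually_elim
    case (elim N)
    have good: "\<bar>design_mean N \<omega> (\<lambda>s. h (restrict (\<lambda>f. hajek N \<omega> s f) F)) - (\<integral>s. h (G s) \<partial>MG)\<bar> \<le> \<epsilon>"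
      if \<omega>: "\<omega> \<in> space M" "\<omega> \<notin> Bad N" "P (N, \<omega>)" and h: "h \<in> BL1 F" for \<omega> h
    proof -
      from \<omega>(3) have a: "scale_factor N \<omega> \<ge> 1 / (2 * weight_cap)" and D: "(\<Sum>i<N. 1 / wt (snd (\<omega> i))) / real N \<le> D"
        and fd: "\<And>k. lip_coord (\<rho> ` F) k \<and> (\<lambda>s. k (G s)) \<in> borel_measurable MG \<longrightarrow>
          \<bar>design_mean N \<omega> (\<lambda>s. k (hajek N \<omega> s)) - (\<integral>s. k (G s) \<partial>MG)\<bar> \<le> \<epsilon> / 4"
        unfolding P_def fst_conv snd_conv by blast+
      have event: "rad N (\<lambda>e'. of_bool (\<exists>f\<in>F. \<bar>\<Sum>i<N. e' i * (centred_weighted f (\<omega> i) - centred_weighted (\<rho> f) (\<omega> i))\<bar> > 4 * e * sqrt (real N))) (\<lambda>_. 0) < (1/12 :: real)"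
        using \<omega>(1,2) unfolding Bad_def by (simp only: mem_Collect_eq not_le simp_thms)
      note osc = hajek_osc_bound[OF elim(4) a \<rho>(1) less_imp_le[OF d(1)] e(1) \<rho>weighted_mean event D h]
      have "2 * (16 * weight_cap * e + d * (1 + 2 * weight_cap\<^sup>2) + weight_cap * (6 * e + d) * (1 + 2 * weight_cap * D)) = C * e + C' * d"
        unfolding C_def C'_def by (simp add: algebra_simps)
      then have 1: "\<bar>design_mean N \<omega> (\<lambda>s. h (restrict (\<lambda>f. hajek N \<omega> s f) F)) - design_mean N \<omega> (\<lambda>s. h (restrict (\<lambda>f. hajek N \<omega> s (\<rho> f)) F))\<bar> \<le> 3 * \<epsilon> / 8"
        using osc elim(2) e(2) d(2) by linarith
      have km: "(\<lambda>s. h (restrict (\<lambda>f. G s (\<rho> f)) F)) \<in> borel_measurable MG"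
        using tight unfolding tight_borel_element_def
        by (intro measurable_compose[OF _ BL1_compose_measurable[OF h \<rho>(1)]]) (rule conjunct1)
      have 2: "\<bar>design_mean N \<omega> (\<lambda>s. h (restrict (\<lambda>f. hajek N \<omega> s (\<rho> f)) F)) - (\<integral>s. h (restrict (\<lambda>f. G s (\<rho> f)) F) \<partial>MG)\<bar> \<le> \<epsilon> / 4"
        using fd[of "\<lambda>u. h (restrict (\<lambda>f. u (\<rho> f)) F)"] BL1_lip_coord[OF h \<rho>(2)] km by blast
      from 1 2 lim[OF h] \<epsilon> show ?thesis by linarith
    qed
    have "{\<omega> \<in> space M. \<not> (\<forall>h\<in>BL1 F. \<bar>design_mean N \<omega> (\<lambda>s. h (restrict (\<lambda>f. hajek N \<omega> s f) F)) - (\<integral>s. h (G s) \<partial>MG)\<bar> \<le> \<epsilon>)}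
        \<subseteq> Bad N \<union> {\<omega> \<in> space M. \<not> P (N, \<omega>)}" (is "?S \<subseteq> _")
      using good by blast
    then have "outer_measure_of M ?S \<le> outer_measure_of M (Bad N \<union> {\<omega> \<in> space M. \<not> P (N, \<omega>)})"
      by (rule outer_measure_of_mono)
    also have "\<dots> \<le> outer_measure_of M (Bad N) + outer_measure_of M {\<omega> \<in> space M. \<not> P (N, \<omega>)}"
      by (rule outer_measure_of_Un_le) (auto simp: Bad_def)
    also have "\<dots> \<le> ennreal (48 * (\<eta> / 96)) + ennreal (\<eta> / 2)" by (intro add_mono bad elim)
    also have "\<dots> = ennreal \<eta>" using \<eta> by (simp add: ennreal_plus[symmetric] del: ennreal_plus)
    finally show ?case unfolding fst_conv snd_conv .
  qed
qed

subsection \<open>The product model\<close>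

lemma fst_model_space:
  assumes "prob_space Pd" "prob_space Pe"
  shows "fst \<in> measurable (model_space Pyx Pd Pe) (\<Pi>\<^sub>M i\<in>(UNIV :: nat set). Pyx)"
    and "distr (model_space Pyx Pd Pe) (\<Pi>\<^sub>M i\<in>(UNIV :: nat set). Pyx) fst = (\<Pi>\<^sub>M i\<in>(UNIV :: nat set). Pyx)"
proof -
  have "prob_space (\<Pi>\<^sub>M i\<in>(UNIV :: nat set). Pe)" by (intro prob_space_PiM assms)
  then have "prob_space (Pd \<Otimes>\<^sub>M (\<Pi>\<^sub>M i\<in>(UNIV :: nat set). Pe))" using assms(1) by (rule prob_space_pair[rotated])
  then show "distr (model_space Pyx Pd Pe) (\<Pi>\<^sub>M i\<in>(UNIV :: nat set). Pyx) fst = (\<Pi>\<^sub>M i\<in>(UNIV :: nat set). Pyx)"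
    unfolding model_space_def by (rule prob_space.distr_pair_fst)
  show "fst \<in> measurable (model_space Pyx Pd Pe) (\<Pi>\<^sub>M i\<in>(UNIV :: nat set). Pyx)"
    unfolding model_space_def by (rule measurable_fst)
qed

lemma Xvec_measurable:
  fixes Pyx :: "('y::{banach, second_countable_topology} \<times> 'x::{banach, second_countable_topology}) measure"
  assumes "sets Pyx = sets borel"
  shows "(\<lambda>\<omega>. \<lambda>i\<in>{..<N}. snd (\<omega> i)) \<in> measurable (\<Pi>\<^sub>M i\<in>(UNIV :: nat set). Pyx) (\<Pi>\<^sub>M i\<in>{..<N}. borel)"
proof (rule measurable_restrict)
  fix i
  have "(snd :: 'y \<times> 'x \<Rightarrow> 'x) \<in> measurable borel borel"
    by (intro borel_measurable_continuous_onI continuous_on_snd continuous_on_id)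
  then have s: "snd \<in> measurable Pyx borel" by (simp add: measurable_cong_sets[OF assms refl])
  show "(\<lambda>\<omega>. snd (\<omega> i)) \<in> measurable (\<Pi>\<^sub>M i\<in>(UNIV :: nat set). Pyx) borel"
    by (rule measurable_compose[OF _ s]) (rule measurable_component_singleton, simp)
qed

text \<open>\<open>n\<close> depends on the data alone, and its measurability makes the outer
  measure an ordinary one, so the hypothesis carries over as an equality of measures for N \<ge>
  1.\<close>

lemma outer_filter_of_model_space:
  fixes Pyx :: "('y::{banach, second_countable_topology} \<times> 'x::{banach, second_countable_topology}) measure"
  assumes Pyx: "prob_space Pyx" "sets Pyx = sets borel" and P: "prob_space Pd" "prob_space Pe"
    and n: "\<And>N. N \<ge> 1 \<Longrightarrow> n N \<in> borel_measurable (\<Pi>\<^sub>M i\<in>{..<N}. borel)"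
    and conv: "\<And>\<epsilon>. \<epsilon> > 0 \<Longrightarrow>
         (\<lambda>N. measure (model_space Pyx Pd Pe)
                {\<omega> \<in> space (model_space Pyx Pd Pe). \<bar>n N (Xvec N \<omega>) / real N - \<alpha>\<bar> > \<epsilon>}) \<longlonglongrightarrow> 0"
  shows "((\<lambda>x. n (fst x) (\<lambda>i\<in>{..<fst x}. snd (snd x i)) / real (fst x)) \<longlongrightarrow> \<alpha>) (outer_filter (\<Pi>\<^sub>M i\<in>(UNIV :: nat set). Pyx))"
proof -
  let ?M = "\<Pi>\<^sub>M i\<in>(UNIV :: nat set). Pyx"
  let ?X = "\<lambda>N \<omega>. \<lambda>i\<in>{..<N}. snd (\<omega> i)"
  interpret prob_space ?M by (intro prob_space_PiM Pyx)
  have eq: "outer_measure_of ?M {\<omega> \<in> space ?M. \<bar>n N (?X N \<omega>) / real N - \<alpha>\<bar> > \<epsilon>} =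
      ennreal (measure (model_space Pyx Pd Pe) {\<omega> \<in> space (model_space Pyx Pd Pe). \<bar>n N (Xvec N \<omega>) / real N - \<alpha>\<bar> > \<epsilon>})"
    if N: "N \<ge> 1" for N \<epsilon>
  proof -
    let ?A = "{\<omega> \<in> space ?M. \<bar>n N (?X N \<omega>) / real N - \<alpha>\<bar> > \<epsilon>}"
    have [measurable]: "(\<lambda>\<omega>. n N (?X N \<omega>)) \<in> borel_measurable ?M"
      by (rule measurable_compose[OF Xvec_measurable[OF Pyx(2)] n[OF N]])
    have A: "?A \<in> sets ?M" by measurable
    have "fst -` ?A \<inter> space (model_space Pyx Pd Pe) =
        {\<omega> \<in> space (model_space Pyx Pd Pe). \<bar>n N (Xvec N \<omega>) / real N - \<alpha>\<bar> > \<epsilon>}"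
      using measurable_space[OF fst_model_space(1)[OF P]] unfolding Xvec_def by auto
    moreover have "measure ?M ?A = measure (model_space Pyx Pd Pe) (fst -` ?A \<inter> space (model_space Pyx Pd Pe))"
      using measure_distr[OF fst_model_space(1)[OF P] A] unfolding fst_model_space(2)[OF P] .
    ultimately show ?thesis by (simp only: outer_measure_of_eq[OF A] emeasure_eq_measure)
  qed
  have "(\<lambda>N. outer_measure_of ?M {\<omega> \<in> space ?M. \<bar>n N (?X N \<omega>) / real N - \<alpha>\<bar> > \<epsilon>}) \<longlonglongrightarrow> 0" if "\<epsilon> > 0" for \<epsilon>
  proof (rule Lim_transform_eventually)
    show "(\<lambda>N. ennreal (measure (model_space Pyx Pd Pe)
        {\<omega> \<in> space (model_space Pyx Pd Pe). \<bar>n N (Xvec N \<omega>) / real N - \<alpha>\<bar> > \<epsilon>})) \<longlonglongrightarrow> 0"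
      using tendsto_ennrealI[OF conv[OF that]] by (simp only: ennreal_0)
    show "\<forall>\<^sub>F N in sequentially. ennreal (measure (model_space Pyx Pd Pe)
        {\<omega> \<in> space (model_space Pyx Pd Pe). \<bar>n N (Xvec N \<omega>) / real N - \<alpha>\<bar> > \<epsilon>}) =
        outer_measure_of ?M {\<omega> \<in> space ?M. \<bar>n N (?X N \<omega>) / real N - \<alpha>\<bar> > \<epsilon>}"
      using eventually_ge_at_top[of 1] by eventually_elim (rule eq[symmetric])
  qed
  then have "((\<lambda>x. n (fst x) (?X (fst x) (snd x)) / real (fst x) - \<alpha>) \<longlongrightarrow> 0) (outer_filter ?M)"
    using tendsto_zero_outer_prob_iff[of ?M "\<lambda>N \<omega>. n N (?X N \<omega>) / real N - \<alpha>"] by blast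
  then show ?thesis by (simp only: LIM_zero_iff)
qed

text \<open>At fixed data, integrating out the uniform variable gives the weighted average over
  samples, which is the Bernoulli recursion with samples padded by zeros.\<close>

lemma (in poisson_model) design_expectation_eq_design_mean:
  fixes \<omega> :: "('y, 'x, 'd, 'e) omega"
  assumes "prob_space Pd" and D: "D \<in> borel_measurable Pd" "distr Pd borel D = uniform_measure lborel {0..1}"
    and enum: "bij_betw (enum N) {..<2 ^ N} ({..<N} \<rightarrow>\<^sub>E {0, 1})"
  shows "design_expectation Pd (\<lambda>\<omega>'. h (hajek_process F (incl_prob w c) enum D N \<omega>')) \<omega> =
    design_mean N (fst \<omega>) (\<lambda>s. h (restrict (\<lambda>f. hajek N (fst \<omega>) s f) F))"
proof -
  define x where "x = Xvec N \<omega>"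
  have x: "x = (\<lambda>i\<in>{..<N}. snd (fst \<omega> i))" by (simp add: x_def Xvec_def)
  have p: "incl N (fst \<omega>) = incl_prob w c N x" unfolding incl_def x ..
  define g where "g s = h (hajek_stat F N (incl_prob w c N x) s (Yvec N \<omega>))" for s
  have "design_expectation Pd (\<lambda>\<omega>'. h (hajek_process F (incl_prob w c) enum D N \<omega>')) \<omega> =
     (\<integral>d. g (sample_select (incl_prob w c) enum N x (D d)) \<partial>Pd)"
    by (simp add: design_expectation_def hajek_process_def Svec_def Xvec_def Yvec_def g_def x)
  also have "\<dots> = (\<Sum>s\<in>{..<N} \<rightarrow>\<^sub>E {0, 1}. g s * poisson_prob (incl_prob w c) N x s)"
  proof (rule expectation_sample_select[where enum=enum and N=N and \<pi>="incl_prob w c", OF assms(1) D enum])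
    fix i assume "i < N"
    then show "0 \<le> incl_prob w c N x i \<and> incl_prob w c N x i \<le> 1"
      using incl_bounds[of i N "fst \<omega>"] unfolding p by simp
  qed
  also have "\<dots> = bern N (incl_prob w c N x) (\<lambda>s. h (restrict (\<lambda>f. hajek N (fst \<omega>) s f) F))"
  proof (rule sum_poisson_prob_bern)
    fix s :: "nat \<Rightarrow> nat"
    have 1: "(\<Sum>i<N. (if i < N then real (s i) else 0) / incl_prob w c N x i) = (\<Sum>i<N. real (s i) / incl_prob w c N x i)"
      by (rule sum.cong) simp_all
    have 2: "(\<Sum>i<N. (if i < N then real (s i) else 0) / incl_prob w c N x i * f (fst (fst \<omega> i))) =
        (\<Sum>i<N. real (s i) / incl_prob w c N x i * f (Yvec N \<omega> i))" for f :: "'y \<Rightarrow> real"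
      by (rule sum.cong) (simp_all add: Yvec_def)
    have 3: "(\<Sum>i<N. f (fst (fst \<omega> i))) = (\<Sum>i<N. f (Yvec N \<omega> i))" for f :: "'y \<Rightarrow> real"
      by (rule sum.cong) (simp_all add: Yvec_def)
    show "g s = h (restrict (\<lambda>f. hajek N (fst \<omega>) (\<lambda>i. if i < N then real (s i) else 0) f) F)"
      unfolding g_def hajek_stat_def hajek_def Let_def p 1 2 3 ..
  qed
  finally show ?thesis unfolding p .
qed

theorem theorem4p5:
  fixes Pyx :: "('y::{banach, second_countable_topology} \<times> 'x::{banach, second_countable_topology}) measure"
    and Pd :: "'d measure" and D :: "'d \<Rightarrow> real"
    and Pe :: "'e measure" and rademacher :: "'e \<Rightarrow> real"
    and enum :: "nat \<Rightarrow> nat \<Rightarrow> nat \<Rightarrow> nat"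
    and w :: "'x \<Rightarrow> real"
    and n c :: "nat \<Rightarrow> (nat \<Rightarrow> 'x) \<Rightarrow> real"
    and F :: "('y \<Rightarrow> real) set"
    and \<alpha> \<theta> :: real
    and MG :: "'g measure" and G :: "'g \<Rightarrow> ('y \<Rightarrow> real) \<Rightarrow> real"
  assumes Pyx: "prob_space Pyx" "sets Pyx = sets borel"
    and Pd: "prob_space Pd"
    and D: "D \<in> borel_measurable Pd" "distr Pd borel D = uniform_measure lborel {0..1}"
    and Pe: "prob_space Pe"
    and rademacher: "rademacher \<in> borel_measurable Pe"
      "measure Pe {e \<in> space Pe. rademacher e = 1} = 1 / 2"
      "measure Pe {e \<in> space Pe. rademacher e = - 1} = 1 / 2"
    and enum: "\<And>N. bij_betw (enum N) {..<2 ^ N} ({..<N} \<rightarrow>\<^sub>E {0, 1})"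
    and w_pos: "\<And>x. w x > 0"
    and c_pos: "\<And>N x. N \<ge> 1 \<Longrightarrow> x \<in> {..<N} \<rightarrow>\<^sub>E UNIV \<Longrightarrow> c N x > 0"
    and n_range: "\<And>N x. N \<ge> 1 \<Longrightarrow> x \<in> {..<N} \<rightarrow>\<^sub>E UNIV \<Longrightarrow> 0 \<le> n N x \<and> n N x \<le> real N"
    and sum_incl_prob: "\<And>N x. N \<ge> 1 \<Longrightarrow> x \<in> {..<N} \<rightarrow>\<^sub>E UNIV \<Longrightarrow>
           (\<Sum>i<N. incl_prob w c N x i) = n N x"
    and design: "measurable_design (incl_prob w c)"
    and F_measurable: "F \<subseteq> borel_measurable borel"
    and C1: "\<exists>f\<in>F. \<exists>C. C \<noteq> 0 \<and> (AE y in distr Pyx borel fst. f y = C)"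
    and B0: "\<And>N. N \<ge> 1 \<Longrightarrow> n N \<in> borel_measurable (\<Pi>\<^sub>M i\<in>{..<N}. borel)"
      "0 < \<alpha>" "\<alpha> < 1"
      "\<And>\<epsilon>. \<epsilon> > 0 \<Longrightarrow>
         (\<lambda>N. measure (model_space Pyx Pd Pe)
                {\<omega> \<in> space (model_space Pyx Pd Pe). \<bar>n N (Xvec N \<omega>) / real N - \<alpha>\<bar> > \<epsilon>}) \<longlonglongrightarrow> 0"
    and B1: "w \<in> borel_measurable borel" "integrable Pyx (\<lambda>z. w (snd z))"
    and \<theta>: "\<theta> > 0" "(\<integral>z. min (\<theta> * w (snd z) / mean_weight Pyx w) 1 \<partial>Pyx) = \<alpha>"
    and B2: "Donsker Pyx (weighted Pyx w \<theta> ` F)"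
    and B3: "bdd_above ((\<lambda>f. \<bar>integral\<^sup>L Pyx (weighted Pyx w \<theta> f)\<bar>) ` F)"
    and G: "prob_space MG" "tight_borel_element MG F G"
      "centered_gaussian_process MG F (Sigma_hajek Pyx w \<theta>) G"
  shows "tendsto_zero_outer_prob (model_space Pyx Pd Pe)
           (\<lambda>N \<omega>. SUP h \<in> BL1 F.
              \<bar>design_expectation Pd (\<lambda>\<omega>'. h (hajek_process F (incl_prob w c) enum D N \<omega>')) \<omega>
               - (\<integral>\<xi>. h (G \<xi>) \<partial>MG)\<bar>)"
proof -
  let ?M = "\<Pi>\<^sub>M i\<in>(UNIV :: nat set). Pyx"
  let ?S = "model_space Pyx Pd Pe"
  have conv: "((\<lambda>x. n (fst x) (\<lambda>i\<in>{..<fst x}. snd (snd x i)) / real (fst x)) \<longlongrightarrow> \<alpha>) (outer_filter ?M)"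
    by (rule outer_filter_of_model_space[OF Pyx Pd Pe]) (fact B0(1), fact B0(4))
  interpret poisson_model Pyx w n c F \<alpha> \<theta>
    by (rule poisson_model.intro)
      (fact Pyx w_pos sum_incl_prob c_pos F_measurable C1 B0(2,3) conv B1 \<theta> B2 B3)+
  let ?T = "\<lambda>N \<omega>. SUP h \<in> BL1 F. \<bar>design_expectation Pd (\<lambda>\<omega>'. h (hajek_process F (incl_prob w c) enum D N \<omega>')) \<omega>
     - (\<integral>\<xi>. h (G \<xi>) \<partial>MG)\<bar>"
  define good where "good N \<omega> \<epsilon> \<longleftrightarrow> (\<forall>h\<in>BL1 F.
      \<bar>design_mean N \<omega> (\<lambda>s. h (restrict (\<lambda>f. hajek N \<omega> s f) F)) - (\<integral>\<xi>. h (G \<xi>) \<partial>MG)\<bar> \<le> \<epsilon>)" for N \<omega> \<epsilon>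
  \<comment> \<open>A nonempty index set, without which the real supremum would be an uninformative
    default value.\<close>
  have zero: "(\<lambda>_. 0) \<in> BL1 F" by (simp add: BL1_def del: mspace_funspace mdist_funspace)
  show ?thesis
    unfolding tendsto_zero_outer_prob_def
  proof (intro allI impI)
    fix \<epsilon> :: real assume \<epsilon>: "\<epsilon> > 0"
    have le: "\<bar>?T N \<omega>\<bar> \<le> \<epsilon>" if g: "good N (fst \<omega>) \<epsilon>" for N \<omega>
    proof -
      have each: "\<bar>design_expectation Pd (\<lambda>\<omega>'. h (hajek_process F (incl_prob w c) enum D N \<omega>')) \<omega> - (\<integral>\<xi>. h (G \<xi>) \<partial>MG)\<bar> \<le> \<epsilon>"
        if "h \<in> BL1 F" for h
        unfolding design_expectation_eq_design_mean[where h=h and enum=enum and N=N, OF Pd D enum] by (rule bspec[OF g[unfolded good_def] that])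
      have "?T N \<omega> \<le> \<epsilon>" by (rule cSUP_least) (use zero each in auto)
      moreover have "0 \<le> ?T N \<omega>"
        by (rule cSUP_upper2[OF bdd_aboveI2[OF each] zero]) simp_all
      ultimately show ?thesis by linarith
    qed
    have bound: "outer_measure_of ?S {\<omega> \<in> space ?S. \<bar>?T N \<omega>\<bar> > \<epsilon>} \<le> outer_measure_of ?M {\<omega> \<in> space ?M. \<not> good N \<omega> \<epsilon>}" for N
    proof -
      \<comment> \<open>The failure event lies in the preimage, under the projection, of a set of
        data sequences, so the one-sided inequality for preimages points the right way.\<close>
      have "{\<omega> \<in> space ?S. \<bar>?T N \<omega>\<bar> > \<epsilon>} \<subseteq> fst -` {\<omega> \<in> space ?M. \<not> good N \<omega> \<epsilon>} \<inter> space ?S"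
      proof
        fix \<omega> assume \<omega>: "\<omega> \<in> {\<omega> \<in> space ?S. \<bar>?T N \<omega>\<bar> > \<epsilon>}"
        then have "\<not> good N (fst \<omega>) \<epsilon>" using le[of N \<omega>] by (simp only: mem_Collect_eq) linarith
        moreover have "\<omega> \<in> space ?S" using \<omega> by (simp only: mem_Collect_eq)
        ultimately show "\<omega> \<in> fst -` {\<omega> \<in> space ?M. \<not> good N \<omega> \<epsilon>} \<inter> space ?S"
          using measurable_space[OF fst_model_space(1)[OF Pd Pe]] by simp
      qed
      then have "outer_measure_of ?S {\<omega> \<in> space ?S. \<bar>?T N \<omega>\<bar> > \<epsilon>} \<le>
          outer_measure_of ?S (fst -` {\<omega> \<in> space ?M. \<not> good N \<omega> \<epsilon>} \<inter> space ?S)"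
        by (rule outer_measure_of_mono)
      also have "\<dots> \<le> outer_measure_of ?M {\<omega> \<in> space ?M. \<not> good N \<omega> \<epsilon>}"
        by (rule outer_measure_of_vimage_le[OF fst_model_space[OF Pd Pe]]) blast
      finally show ?thesis .
    qed
    have lim: "(\<lambda>N. outer_measure_of ?M {\<omega> \<in> space ?M. \<not> good N \<omega> \<epsilon>}) \<longlonglongrightarrow> 0"
      using hajek_conditional_convergence[OF G \<epsilon>] unfolding eventually_outer_filter fst_conv snd_conv good_def .
    show "(\<lambda>N. outer_measure_of ?S {\<omega> \<in> space ?S. \<bar>?T N \<omega>\<bar> > \<epsilon>}) \<longlonglongrightarrow> 0"
      by (rule tendsto_sandwich[OF _ always_eventually[OF allI[OF bound]] tendsto_const lim]) simp
  qed
qed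

end
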